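(* $$\mu^{sym}_{3,1}(57)\leq 234.$$ In particular there is a symmetric multiplication algorithm of length at most $234$ for $\mathbb{F}_{3^{57}}$ over $\mathbb{F}_3$, constructed from a curve of genus one over $\mathbb{F}_3$.
   Context: For a finite-dimensional commutative $\mathbb{F}_q$-algebra $\mathcal{A}$, a symmetric multiplication algorithm of length $m$ is a collection of linear forms $\phi_1,\dots,\phi_m:\mathcal{A}\to\mathbb{F}_q$ and elements $w_1,\dots,w_m\in\mathcal{A}$ with $xy=\sum_{i=1}^m\phi_i(x)\phi_i(y)w_i$ for all $x,y\in\mathcal{A}$; $\mu^{sym}(\mathcal{A}/\mathbb{F}_q)$ is the minimal such $m$. For $n,l\geq 1$ put $\mathcal{A}_q(n,l)=\mathbb{F}_{q^n}[t]/(t^l)$ and $\mu^{sym}_q(n,l)=\mu^{sym}(\mathcal{A}_q(n,l)/\mathbb{F}_q)$. Curves are smooth, projective and geometrically irreducible. For a closed point $P$ of a curve $\mathcal{C}$ and $u\geq 1$, $P^{[u]}$ is the closed subscheme defined by the $u$-th power of the ideal sheaf of $P$; $\mathcal{L}(D)=\Gamma(\mathcal{C},\mathcal{O}_{\mathcal{C}}(D))$. Symmetric Chudnovsky data for $(n,l)$ on $\mathcal{C}$ is a triple $(Q,D,G)$ with $Q$ a closed point of degree $n$, $D$ a divisor, and $G=u_1P_1+\cdots+u_NP_N$ an effective divisor (the $P_i$ pairwise distinct closed points, $\deg P_i=d_i$, $u_i\ge 1$), such that the natural evaluation map $\mathcal{L}(2D)\to\prod_{i=1}^N\mathcal{O}_{\mathcal{C}}(2D)|_{P_i^{[u_i]}}$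 is injective and the natural evaluation map $\mathcal{L}(D)\to\mathcal{O}_{\mathcal{C}}(D)|_{Q^{[l]}}$ is surjective. Such data gives a symmetric multiplication algorithm for $\mathcal{A}_q(n,l)$ of length $\sum_{i=1}^N\mu^{sym}_q(d_i,u_i)$. $\mu^{sym}_{q,\mathcal{C}}(n)$ denotes the minimum of $\sum_i\mu^{sym}_q(d_i,u_i)$ over all symmetric Chudnovsky data for $(n,1)$ on $\mathcal{C}$ ($+\infty$ if there is none), and $\mu^{sym}_{q,g}(n)$ is the minimum of $\mu^{sym}_{q,\mathcal{C}}(n)$ over all curves $\mathcal{C}$ of genus $g$ over $\mathbb{F}_q$. *)

theory Defs
  imports
    "HOL-Algebra.Algebra"
    "HOL-Library.Extended_Nat"
begin

section \<open>Symmetric multiplication algorithms\<close>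

text \<open>
  A commutative algebra over a field is a pair of records as in the library locale
  \<^locale>\<open>algebra\<close>: the ring of scalars and a \<open>module\<close> record.
  \<open>algebra_via B h\<close> is the ring \<open>B\<close> with the scalar multiplication induced by a
  structure map \<open>h\<close> from the scalars to \<open>B\<close>.
\<close>

definition algebra_via :: "('a, 'b) ring_scheme \<Rightarrow> ('k \<Rightarrow> 'a) \<Rightarrow> ('k, 'a) module" where
  "algebra_via B h =
     \<lparr> carrier = carrier B, monoid.mult = monoid.mult B, one = \<one>\<^bsub>B\<^esub>,
       ring.zero = \<zero>\<^bsub>B\<^esub>, add = ring.add B,
       smult = (\<lambda>k x. h k \<otimes>\<^bsub>B\<^esub> x) \<rparr>"

definition linear_map ::
  "('k, 'c) ring_scheme \<Rightarrow> ('k, 'a, 'd) module_scheme \<Rightarrow> ('k, 'b, 'e) module_scheme \<Rightarrow> ('a \<Rightarrow> 'b) \<Rightarrow> bool"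
  where
  "linear_map k M N f \<longleftrightarrow>
     f \<in> carrier M \<rightarrow> carrier N \<and>
     (\<forall>x\<in>carrier M. \<forall>y\<in>carrier M. f (x \<oplus>\<^bsub>M\<^esub> y) = f x \<oplus>\<^bsub>N\<^esub> f y) \<and>
     (\<forall>c\<in>carrier k. \<forall>x\<in>carrier M. f (c \<odot>\<^bsub>M\<^esub> x) = c \<odot>\<^bsub>N\<^esub> f x)"

text \<open>The length of an algorithm is the cardinality of its index set \<open>I\<close>.\<close>

definition sym_mult_algorithm ::
  "('k, 'c) ring_scheme \<Rightarrow> ('k, 'a, 'd) module_scheme \<Rightarrow> 'i set \<Rightarrow> ('i \<Rightarrow> 'a \<Rightarrow> 'k) \<Rightarrow> ('i \<Rightarrow> 'a) \<Rightarrow> bool"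
  where
  "sym_mult_algorithm k A I \<phi> w \<longleftrightarrow>
     finite I \<and>
     (\<forall>i\<in>I. linear_map k A (algebra_via k (\<lambda>c. c)) (\<phi> i) \<and> w i \<in> carrier A) \<and>
     (\<forall>x\<in>carrier A. \<forall>y\<in>carrier A.
        x \<otimes>\<^bsub>A\<^esub> y = (\<Oplus>\<^bsub>A\<^esub>i\<in>I. (\<phi> i x \<otimes>\<^bsub>k\<^esub> \<phi> i y) \<odot>\<^bsub>A\<^esub> w i))"

definition mu_sym :: "('k, 'c) ring_scheme \<Rightarrow> ('k, 'a, 'd) module_scheme \<Rightarrow> enat" where
  "mu_sym k A = Inf {enat m |m. \<exists>\<phi> w. sym_mult_algorithm k A {..<m} \<phi> w}"

text \<open>
  \<open>GF q n\<close> is a fixed model of the field with \<open>q ^ n\<close> elements (unique up to isomorphism).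
  For a prime power \<open>q\<close>, the elements fixed by \<open>x \<mapsto> x ^ q\<close> form its subfield with \<open>q\<close> elements.
\<close>

definition GF :: "nat \<Rightarrow> nat \<Rightarrow> nat ring" where
  "GF q n = (SOME L. field L \<and> card (carrier L) = q ^ n)"

definition base_field :: "nat \<Rightarrow> nat \<Rightarrow> nat ring" where
  "base_field q n = (GF q n)\<lparr>carrier := {x \<in> carrier (GF q n). x [^]\<^bsub>GF q n\<^esub> q = x}\<rparr>"

definition GF_algebra :: "nat \<Rightarrow> nat \<Rightarrow> (nat, nat) module" where
  "GF_algebra q n = algebra_via (GF q n) (\<lambda>c. c)"

definition trunc_ideal :: "nat \<Rightarrow> nat \<Rightarrow> nat \<Rightarrow> nat list set" where
  "trunc_ideal q n l =
     PIdl\<^bsub>poly_ring (GF q n)\<^esub> (X\<^bsub>GF q n\<^esub> [^]\<^bsub>poly_ring (GF q n)\<^esub> l)"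

definition trunc_algebra :: "nat \<Rightarrow> nat \<Rightarrow> nat \<Rightarrow> (nat, nat list set) module" where
  "trunc_algebra q n l =
     algebra_via (poly_ring (GF q n) Quot trunc_ideal q n l)
       (\<lambda>c. trunc_ideal q n l +>\<^bsub>poly_ring (GF q n)\<^esub> ring.poly_of_const (GF q n) c)"

definition mu_sym_q :: "nat \<Rightarrow> nat \<Rightarrow> nat \<Rightarrow> enat" where
  "mu_sym_q q n l = mu_sym (base_field q n) (trunc_algebra q n l)"


section \<open>Curves, closed points and divisors\<close>

text \<open>
  A smooth projective geometrically irreducible curve over a finite (hence perfect) field \<open>K\<close>
  is represented by its function field \<open>F\<close>: a finitely generated extension of \<open>K\<close> of
  transcendence degree one in which \<open>K\<close> is algebraically closed.
\<close>

definition curve :: "'a set \<Rightarrow> 'a ring \<Rightarrow> bool" where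
  "curve K F \<longleftrightarrow>
     field F \<and> subfield K F \<and>
     (\<exists>x\<in>carrier F. ring.transcendental F K x \<and>
        ring.finite_dimension F (generate_field F (insert x K)) (carrier F)) \<and>
     (\<forall>x\<in>carrier F. ring.transcendental F K x \<or> x \<in> K)"

definition uniformizer :: "'a ring \<Rightarrow> 'a set \<Rightarrow> 'a \<Rightarrow> bool" where
  "uniformizer F P t \<longleftrightarrow>
     t \<in> P \<and> t \<noteq> \<zero>\<^bsub>F\<^esub> \<and> t \<notin> Units (F\<lparr>carrier := P\<rparr>) \<and>
     (\<forall>f\<in>carrier F - {\<zero>\<^bsub>F\<^esub>}. \<exists>n::int. \<exists>u\<in>Units (F\<lparr>carrier := P\<rparr>). f = t [^]\<^bsub>F\<^esub> n \<otimes>\<^bsub>F\<^esub> u)"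

text \<open>
  A closed point is identified with its local ring; the local rings of closed points are the
  discrete valuation rings of \<open>F\<close> containing \<open>K\<close>.
\<close>

definition closed_points :: "'a set \<Rightarrow> 'a ring \<Rightarrow> 'a set set" where
  "closed_points K F = {P. subring P F \<and> K \<subseteq> P \<and> (\<exists>t. uniformizer F P t)}"

text \<open>Only meaningful for nonzero \<open>f\<close>.\<close>

definition valuation :: "'a ring \<Rightarrow> 'a set \<Rightarrow> 'a \<Rightarrow> int" where
  "valuation F P f =
     (THE n. \<exists>t u. uniformizer F P t \<and> u \<in> Units (F\<lparr>carrier := P\<rparr>) \<and> f = t [^]\<^bsub>F\<^esub> n \<otimes>\<^bsub>F\<^esub> u)"

text \<open>
  The \<open>n\<close>-th power, for \<open>n \<in> \<int>\<close>, of the maximal ideal of the local ring at \<open>P\<close>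
  as a fractional ideal of \<open>F\<close>.
\<close>

definition max_ideal_pow :: "'a ring \<Rightarrow> 'a set \<Rightarrow> int \<Rightarrow> 'a set" where
  "max_ideal_pow F P n = {f \<in> carrier F. f = \<zero>\<^bsub>F\<^esub> \<or> n \<le> valuation F P f}"

text \<open>The \<open>K\<close>-algebra of functions on the \<open>u\<close>-fold point at \<open>P\<close>.\<close>

definition local_algebra :: "'a ring \<Rightarrow> 'a set \<Rightarrow> nat \<Rightarrow> ('a, 'a set) module" where
  "local_algebra F P u =
     algebra_via (F\<lparr>carrier := P\<rparr> Quot max_ideal_pow F P (int u))
       (\<lambda>c. max_ideal_pow F P (int u) +>\<^bsub>F\<^esub> c)"

definition pt_degree :: "'a set \<Rightarrow> 'a ring \<Rightarrow> 'a set \<Rightarrow> nat" where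
  "pt_degree K F P =
     ring.dim (local_algebra F P 1)
       ((\<lambda>c. max_ideal_pow F P 1 +>\<^bsub>F\<^esub> c) ` K) (carrier (local_algebra F P 1))"

type_synonym 'a divisor = "'a set \<Rightarrow> int"

definition supp :: "'a divisor \<Rightarrow> 'a set set" where
  "supp D = {P. D P \<noteq> 0}"

definition divisors :: "'a set \<Rightarrow> 'a ring \<Rightarrow> 'a divisor set" where
  "divisors K F = {D. finite (supp D) \<and> supp D \<subseteq> closed_points K F}"

definition div_degree :: "'a set \<Rightarrow> 'a ring \<Rightarrow> 'a divisor \<Rightarrow> int" where
  "div_degree K F D = (\<Sum>P\<in>supp D. D P * int (pt_degree K F P))"

text \<open>
  The stalk at \<open>P\<close> of the sheaf attached to \<open>D\<close> is the fractional ideal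
  \<open>max_ideal_pow F P (- D P)\<close>; global sections are the elements lying in all the stalks.
\<close>

definition global_sections :: "'a set \<Rightarrow> 'a ring \<Rightarrow> 'a divisor \<Rightarrow> 'a set" where
  "global_sections K F D =
     {f \<in> carrier F. \<forall>P\<in>closed_points K F. f \<in> max_ideal_pow F P (- D P)}"

text \<open>Riemann's definition of the genus: the maximum of \<open>deg D + 1 - dim L(D)\<close> over all divisors.\<close>

definition has_genus :: "'a set \<Rightarrow> 'a ring \<Rightarrow> nat \<Rightarrow> bool" where
  "has_genus K F g \<longleftrightarrow>
     (\<exists>D\<in>divisors K F. div_degree K F D + 1 - int (ring.dim F K (global_sections K F D)) = int g) \<and>
     (\<forall>D\<in>divisors K F. div_degree K F D + 1 - int (ring.dim F K (global_sections K F D)) \<le> int g)"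


section \<open>Symmetric Chudnovsky data\<close>

text \<open>
  The restriction of the sheaf of \<open>D\<close> to the \<open>u\<close>-fold point at \<open>P\<close> is the stalk modulo
  the \<open>u\<close>-th power of the maximal ideal times the stalk.
\<close>

definition evaluation :: "'a ring \<Rightarrow> 'a divisor \<Rightarrow> 'a set \<Rightarrow> nat \<Rightarrow> 'a \<Rightarrow> 'a set" where
  "evaluation F D P u f = max_ideal_pow F P (int u - D P) +>\<^bsub>F\<^esub> f"

definition fibre :: "'a ring \<Rightarrow> 'a divisor \<Rightarrow> 'a set \<Rightarrow> nat \<Rightarrow> 'a set set" where
  "fibre F D P u = evaluation F D P u ` max_ideal_pow F P (- D P)"

text \<open>
  The points \<open>P\<^sub>i\<close> are the elements of \<open>supp G\<close>, and \<open>u\<^sub>i\<close> is the value of \<open>G\<close> at \<open>P\<^sub>i\<close>.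
\<close>

definition sym_chudnovsky_data ::
  "'a set \<Rightarrow> 'a ring \<Rightarrow> nat \<Rightarrow> nat \<Rightarrow> 'a set \<Rightarrow> 'a divisor \<Rightarrow> 'a divisor \<Rightarrow> bool" where
  "sym_chudnovsky_data K F n l Q D G \<longleftrightarrow>
     Q \<in> closed_points K F \<and> pt_degree K F Q = n \<and>
     D \<in> divisors K F \<and>
     G \<in> divisors K F \<and> (\<forall>P. 0 \<le> G P) \<and>
     inj_on (\<lambda>f. \<lambda>P\<in>supp G. evaluation F (\<lambda>P. 2 * D P) P (nat (G P)) f)
       (global_sections K F (\<lambda>P. 2 * D P)) \<and>
     evaluation F D Q l ` global_sections K F D = fibre F D Q l"

definition data_length :: "'a set \<Rightarrow> 'a ring \<Rightarrow> 'a divisor \<Rightarrow> enat" where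
  "data_length K F G = (\<Sum>P\<in>supp G. mu_sym_q (card K) (pt_degree K F P) (nat (G P)))"

definition mu_sym_curve :: "'a set \<Rightarrow> 'a ring \<Rightarrow> nat \<Rightarrow> enat" where
  "mu_sym_curve K F n = Inf {data_length K F G |Q D G. sym_chudnovsky_data K F n 1 Q D G}"

text \<open>
  Function fields over finite fields are countable, so every one of them is isomorphic to one
  whose carrier is a set of natural numbers.
\<close>

definition mu_sym_genus :: "nat \<Rightarrow> nat \<Rightarrow> nat \<Rightarrow> enat" where
  "mu_sym_genus q g n =
     Inf {mu_sym_curve K F n |K (F :: nat ring). curve K F \<and> card K = q \<and> has_genus K F g}"

text \<open>
  The algorithms for the algebra of the \<open>l\<close>-fold point at \<open>Q\<close> that are constructed from
  Chudnovsky data: the linear forms lift an element to a global section by a linear section \<open>s\<close>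
  of evaluation at \<open>Q\<close>, evaluate at the \<open>P\<^sub>i\<close>, and apply the linear forms
  of algorithms for the algebras of the \<open>u\<^sub>i\<close>-fold points at the \<open>P\<^sub>i\<close>.
  The \<open>e P\<close> are local generators of the sheaf of \<open>D\<close>; dividing by them
  identifies its restriction to a multiple point with the algebra of that point.
\<close>

definition chudnovsky_algorithm ::
  "'a set \<Rightarrow> 'a ring \<Rightarrow> nat \<Rightarrow> 'a set \<Rightarrow> 'a divisor \<Rightarrow> 'a divisor \<Rightarrow> ('a set \<Rightarrow> nat) \<Rightarrow>
   ('a set \<times> nat \<Rightarrow> 'a set \<Rightarrow> 'a) \<Rightarrow> ('a set \<times> nat \<Rightarrow> 'a set) \<Rightarrow> bool" where
  "chudnovsky_algorithm K F l Q D G m \<phi> w \<longleftrightarrow>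
     sym_mult_algorithm (F\<lparr>carrier := K\<rparr>) (local_algebra F Q l)
       (SIGMA P:supp G. {..<m P}) \<phi> w \<and>
     (\<exists>e s \<psi> v.
        (\<forall>P\<in>insert Q (supp G). e P \<in> carrier F - {\<zero>\<^bsub>F\<^esub>} \<and> valuation F P (e P) = - D P) \<and>
        linear_map (F\<lparr>carrier := K\<rparr>) (local_algebra F Q l)
          (algebra_via (F\<lparr>carrier := global_sections K F D\<rparr>) (\<lambda>c. c)) s \<and>
        (\<forall>x\<in>carrier (local_algebra F Q l).
           max_ideal_pow F Q (int l) +>\<^bsub>F\<^esub> (s x \<otimes>\<^bsub>F\<^esub> inv\<^bsub>F\<^esub> e Q) = x) \<and>
        (\<forall>P\<in>supp G.
           sym_mult_algorithm (F\<lparr>carrier := K\<rparr>) (local_algebra F P (nat (G P)))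
             {..<m P} (\<psi> P) (v P)) \<and>
        (\<forall>P\<in>supp G. \<forall>j<m P. \<forall>x\<in>carrier (local_algebra F Q l).
           \<phi> (P, j) x = \<psi> P j (max_ideal_pow F P (G P) +>\<^bsub>F\<^esub> (s x \<otimes>\<^bsub>F\<^esub> inv\<^bsub>F\<^esub> e P))))"

end

theory Submission
  imports Defs "HOL-Algebra.Algebraic_Closure_Type" "HOL-Computational_Algebra.Computational_Algebra"
begin

text \<open>
  Let \<open>E\<close> be the curve \<open>y\<^sup>2 = x\<^sup>3 + x\<^sup>2 - 1\<close> over the field with three elements; its rational points are
  \<open>\<infinity>\<close>, \<open>R = (1, 1)\<close> and \<open>R' = (1, -1)\<close>. The interpolation divisor \<open>G\<close> has degree 114: it contains the three
  rational points with multiplicity three and points of degrees two, three and four with multiplicity one.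
  Since the algebras at these points have algorithms of length 5, 3, 6 and 9, the total length is at most 234.
  For a point \<open>Q\<close> of degree 57 take \<open>D = 56\<infinity> + R\<close> or \<open>D = 56\<infinity> + R'\<close>. The divisors \<open>2D - G\<close> and \<open>D - Q\<close>
  have degree zero; the first one is never principal, and the second one is not principal for at least one of the two
  choices. So both evaluation maps are injective, hence bijective, because by Riemann's inequality their
  domains are at least as large as their codomains. Dimensions over the field with three elements are
  handled as cardinalities throughout.

  A point \<open>Q\<close> exists because \<open>y\<^sup>2 = x\<^sup>3 + x\<^sup>2 - 1\<close> can be solved for \<open>x\<close> in the field with \<open>3\<^bsup>57\<^esup>\<close> elements
  as soon as \<open>- (y\<^sup>2 + 1)\<close> is a square, which gives too many solutions for all of them to lie in proper subfields.
\<close>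

text \<open>Since 114 is exactly 2 * 57 there is no slack: the kernels L(2D - G) and L(D - Q) belong
  to divisors of degree zero, and each divisor has to be non-principal. Up to a multiple of
  infinity, \<open>G\<close> is the divisor of a single function, so \<open>G\<close> is equivalent
  to 114 times infinity and the obvious choice D = 57 infinity would make 2D - G principal.
  Replacing one infinity by \<open>R\<close> turns 2D - G into the class of 2 (R - infinity); the
  rational points form a group of order 3, where doubling kills no nonzero class. For D - Q the
  classes R - infinity and R' - infinity differ, so at most one of them equals Q - 57 infinity. Both
  facts are proved by exhibiting functions, without class groups. The points of \<open>G\<close> are
  three rational ones, six of degree 2, eleven of degree 3 and fifteen of degree 4: the degrees add
  up to 9 + 12 + 33 + 60 = 114 and the lengths to 15 + 18 + 66 + 135 = 234. The algorithm itself
  also calls for surjectivity of evaluation at \<open>G\<close>, since its elements are obtained by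
  prescribing values there.\<close>

hide_const (open) Polynomials.degree up_ring.coeff up_ring.monom Divisibility.prime Divisibility.irreducible

section \<open>Counting cosets\<close>

definition add_subgroup :: "'a::ab_group_add set \<Rightarrow> bool" where
  "add_subgroup V \<longleftrightarrow> 0 \<in> V \<and> (\<forall>x\<in>V. \<forall>y\<in>V. x - y \<in> V)"

definition translate :: "'a::ab_group_add set \<Rightarrow> 'a \<Rightarrow> 'a set" where
  "translate W u = (+) u ` W"

definition cosets :: "'a::ab_group_add set \<Rightarrow> 'a set \<Rightarrow> 'a set set" where
  "cosets U W = translate W ` U"

lemma add_subgroup_zero: "add_subgroup V \<Longrightarrow> 0 \<in> V"
  by (simp add: add_subgroup_def)

lemma add_subgroup_diff: "add_subgroup V \<Longrightarrow> x \<in> V \<Longrightarrow> y \<in> V \<Longrightarrow> x - y \<in> V"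
  by (simp add: add_subgroup_def)

lemma add_subgroup_uminus: "add_subgroup V \<Longrightarrow> x \<in> V \<Longrightarrow> - x \<in> V"
  using add_subgroup_diff[of V 0 x] add_subgroup_zero by fastforce

lemma add_subgroup_add: "add_subgroup V \<Longrightarrow> x \<in> V \<Longrightarrow> y \<in> V \<Longrightarrow> x + y \<in> V"
  using add_subgroup_diff[of V x "- y"] add_subgroup_uminus by fastforce

lemma add_subgroup_sum:
  "add_subgroup V \<Longrightarrow> (\<And>i. i \<in> I \<Longrightarrow> f i \<in> V) \<Longrightarrow> sum f I \<in> V"
  by (induction I rule: infinite_finite_induct) (auto intro: add_subgroup_zero add_subgroup_add)

lemma translate_eq_iff:
  assumes "add_subgroup W" shows "translate W u = translate W v \<longleftrightarrow> u - v \<in> W"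
proof
  assume eq: "translate W u = translate W v"
  have "u \<in> translate W u"
    using add_subgroup_zero[OF assms] by (force simp: translate_def)
  then show "u - v \<in> W" unfolding eq by (auto simp: translate_def)
next
  have sub: "translate W u \<subseteq> translate W v" if "u - v \<in> W" for u v
  proof
    fix z assume "z \<in> translate W u"
    then obtain w where w: "w \<in> W" "z = u + w" by (auto simp: translate_def)
    have "z = v + ((u - v) + w)" using w by simp
    then show "z \<in> translate W v"
      using add_subgroup_add[OF assms that w(1)] unfolding translate_def by blast
  qed
  assume "u - v \<in> W"
  moreover from this have "v - u \<in> W" using add_subgroup_uminus[OF assms] by fastforce
  ultimately show "translate W u = translate W v" using sub by blast
qed

text \<open>Each fibre of \<open>\<phi>\<close> is a translate of \<open>W\<close>. The target
  carries no group structure, so \<open>\<phi>\<close> may be a tuple of cosets, as it is in the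
  Riemann inequality.\<close>

lemma card_eq_kernel_times_image:
  assumes V: "add_subgroup V" "finite V" and W: "W \<subseteq> V"
    and \<phi>: "\<And>x y. x \<in> V \<Longrightarrow> y \<in> V \<Longrightarrow> \<phi> x = \<phi> y \<longleftrightarrow> x - y \<in> W"
  shows "card V = card W * card (\<phi> ` V)"
proof -
  have fib: "card {x \<in> V. \<phi> x = c} = card W" if c: "c \<in> \<phi> ` V" for c
  proof -
    obtain r where r: "r \<in> V" "c = \<phi> r" using c by blast
    have "{x \<in> V. \<phi> x = c} = (+) r ` W"
    proof (intro equalityI subsetI)
      fix x assume "x \<in> {x \<in> V. \<phi> x = c}"
      then have "x - r \<in> W" using r \<phi> by auto
      then show "x \<in> (+) r ` W" by (metis add.commute diff_add_cancel image_eqI)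
    next
      fix x assume "x \<in> (+) r ` W"
      then obtain w where w: "w \<in> W" "x = r + w" by auto
      then have "x \<in> V" using W r V add_subgroup_add by blast
      then show "x \<in> {x \<in> V. \<phi> x = c}" using w r \<phi>[of x r] by simp
    qed
    then show ?thesis by (simp add: card_image)
  qed
  have "card V = (\<Sum>c\<in>\<phi> ` V. \<Sum>x\<in>{x \<in> V. \<phi> x = c}. 1)"
    using sum.image_gen[OF V(2), of "\<lambda>_. 1::nat" \<phi>] by simp
  also have "\<dots> = (\<Sum>c\<in>\<phi> ` V. card W)" using fib by simp
  finally show ?thesis by simp
qed

text \<open>Index multiplicativity: with a representative fixed in each coset of \<open>V\<close>, a
  coset of \<open>W\<close> in \<open>U\<close> is uniquely a representative plus a coset of
  \<open>W\<close> in \<open>V\<close>.\<close>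

lemma cosets_tower:
  assumes V: "add_subgroup V" and W: "add_subgroup W" "W \<subseteq> V"
    and U: "add_subgroup U" "V \<subseteq> U"
    and fin: "finite (cosets U V)" "finite (cosets V W)"
  shows "finite (cosets U W)" "card (cosets U W) = card (cosets U V) * card (cosets V W)"
proof -
  define rep where "rep C = (SOME u. u \<in> U \<and> translate V u = C)" for C
  have rep: "rep C \<in> U \<and> translate V (rep C) = C" if "C \<in> cosets U V" for C
    unfolding rep_def by (rule someI_ex) (use that in \<open>auto simp: cosets_def\<close>)
  define h where "h = (\<lambda>(C, B). (+) (rep C) ` B)"
  have tr: "(+) a ` translate W v = translate W (a + v)" for a v :: 'a
    by (auto simp: translate_def image_image add.assoc)
  have bij: "bij_betw h (cosets U V \<times> cosets V W) (cosets U W)"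
    unfolding bij_betw_def
  proof
    show "inj_on h (cosets U V \<times> cosets V W)"
    proof (intro inj_onI, clarify)
      fix C B C' B' assume a: "C \<in> cosets U V" "B \<in> cosets V W" "C' \<in> cosets U V" "B' \<in> cosets V W"
        and eq: "h (C, B) = h (C', B')"
      obtain v v' where v: "v \<in> V" "B = translate W v" "v' \<in> V" "B' = translate W v'"
        using a by (auto simp: cosets_def)
      have d: "(rep C + v) - (rep C' + v') \<in> W"
        using eq v W by (simp add: h_def tr translate_eq_iff)
      then have "(rep C + v) - (rep C' + v') - (v - v') \<in> V"
        using V W v by (meson add_subgroup_diff subsetD)
      moreover have "(rep C + v) - (rep C' + v') - (v - v') = rep C - rep C'" by simp
      ultimately have "rep C - rep C' \<in> V" by simp
      then have CC: "C = C'" using rep a V by (metis translate_eq_iff)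
      then have "B = B'" using d v W by (simp add: translate_eq_iff)
      with CC show "C = C' \<and> B = B'" by simp
    qed
  next
    show "h ` (cosets U V \<times> cosets V W) = cosets U W"
    proof (intro equalityI subsetI)
      fix D assume "D \<in> h ` (cosets U V \<times> cosets V W)"
      then obtain C v where "C \<in> cosets U V" "v \<in> V" "D = (+) (rep C) ` translate W v"
        by (auto simp: h_def cosets_def)
      then have "D = translate W (rep C + v)" "rep C + v \<in> U"
        using rep tr U by (auto intro: add_subgroup_add)
      then show "D \<in> cosets U W" by (auto simp: cosets_def)
    next
      fix D assume "D \<in> cosets U W"
      then obtain u where u: "u \<in> U" "D = translate W u" by (auto simp: cosets_def)
      let ?C = "translate V u"
      have C: "?C \<in> cosets U V" using u by (auto simp: cosets_def)
      have "u - rep ?C \<in> V" using rep[OF C] V by (metis translate_eq_iff)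
      then have "translate W (u - rep ?C) \<in> cosets V W" by (auto simp: cosets_def)
      moreover have "D = h (?C, translate W (u - rep ?C))" by (simp add: h_def tr u)
      ultimately show "D \<in> h ` (cosets U V \<times> cosets V W)" using C by blast
    qed
  qed
  show "finite (cosets U W)" using bij fin by (metis bij_betw_finite finite_cartesian_product)
  show "card (cosets U W) = card (cosets U V) * card (cosets V W)"
    using bij by (metis bij_betw_same_card card_cartesian_product)
qed

text \<open>This is why all steps in the filtration by powers of a maximal ideal have the same
  size.\<close>

lemma cosets_scale:
  fixes c :: "'a::field"
  assumes "c \<noteq> 0"
  shows "bij_betw ((`) ((*) c)) (cosets U W) (cosets ((*) c ` U) ((*) c ` W))"
proof -
  have inj: "inj ((`) ((*) c))"
    using assms by (intro injI) (auto simp: inj_image_eq_iff inj_def)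
  have "(*) c ` translate W u = translate ((*) c ` W) (c * u)" for u
    by (auto simp: translate_def image_image ring_distribs)
  then have "((`) ((*) c)) ` cosets U W = cosets ((*) c ` U) ((*) c ` W)"
    by (simp add: cosets_def image_image)
  then show ?thesis using inj by (auto simp: bij_betw_def intro: inj_on_subset)
qed

section \<open>The field with three elements\<close>

text \<open>Constructors make the field operations computable by pattern matching, so the finite
  checks on explicit polynomials can be run by \<open>code_simp\<close>.\<close>

datatype f3 = F0 | F1 | F2

instantiation f3 :: field
begin
fun plus_f3 where
  "plus_f3 F0 y = y" | "plus_f3 x F0 = x" | "plus_f3 F1 F1 = F2" | "plus_f3 F1 F2 = F0"
| "plus_f3 F2 F1 = F0" | "plus_f3 F2 F2 = F1"
fun times_f3 where
  "times_f3 F0 y = F0" | "times_f3 x F0 = F0" | "times_f3 F1 y = y" | "times_f3 F2 F1 = F2"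
| "times_f3 F2 F2 = F1"
fun uminus_f3 where "uminus_f3 F0 = F0" | "uminus_f3 F1 = F2" | "uminus_f3 F2 = F1"
definition zero_f3 where "0 = F0"
definition one_f3 where "1 = F1"
definition minus_f3 where "x - y = x + - (y::f3)"
text \<open>Both nonzero elements are their own inverse, and zero goes to zero as the class
  demands.\<close>

definition inverse_f3 where "inverse x = (x::f3)"
definition divide_f3 where "x div y = x * inverse (y::f3)"
instance
proof
  fix a b c :: f3
  show "a + b + c = a + (b + c)" "a * b * c = a * (b * c)" "a + b = b + a" "a * b = b * a"
    "(a + b) * c = a * c + b * c" "0 + a = a" "1 * a = a" "- a + a = 0" "a - b = a + - b"
    "(0::f3) \<noteq> 1" "a \<noteq> 0 \<Longrightarrow> inverse a * a = 1" "a div b = a * inverse b" "inverse (0::f3) = 0"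
    by (cases a; cases b; cases c;
        simp add: zero_f3_def one_f3_def minus_f3_def inverse_f3_def divide_f3_def)+
qed
end

lemma UNIV_f3: "(UNIV :: f3 set) = {F0, F1, F2}"
  using f3.exhaust by auto

instance f3 :: finite_field
  by (intro finite_fieldI) (simp add: UNIV_f3)

lemma card_f3: "card (UNIV :: f3 set) = 3"
  by (simp add: UNIV_f3)

lemma f3_cases: obtains "(x::f3) = 0" | "x = 1" | "x = -1"
  by (cases x) (auto simp: zero_f3_def one_f3_def)

lemma f3_three [simp]: "(x::f3) + (x + x) = 0" "(3::f3) = 0"
proof -
  show "x + (x + x) = 0" by (cases x) (auto simp: zero_f3_def)
  have "(3::f3) = 1 + (1 + 1)" by simp
  then show "(3::f3) = 0" by (simp add: one_f3_def zero_f3_def)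
qed

lemma f3_two: "(2::f3) = - 1"
proof -
  have "(2::f3) = 1 + 1" by simp
  then show ?thesis by (simp add: one_f3_def)
qed

text \<open>The coefficients on \<open>{..<n}\<close> determine such a polynomial. The zero
  polynomial is listed separately because its degree is 0, which would exclude it for
  \<open>n = 0\<close>.\<close>

lemma card_poly_degree_less:
  "card {p :: 'a::{finite,comm_ring_1} poly. p = 0 \<or> degree p < n} = card (UNIV :: 'a set) ^ n"
  "finite {p :: 'a poly. p = 0 \<or> degree p < n}"
proof -
  have bij: "bij_betw (\<lambda>c. Poly (map c [0..<n])) (PiE {..<n} (\<lambda>_. UNIV :: 'a set))
     {p. p = 0 \<or> degree p < n}"
  proof (rule bij_betw_byWitness[where f' = "\<lambda>p. restrict (coeff p) {..<n}"])
    show "\<forall>c\<in>PiE {..<n} (\<lambda>_. UNIV). restrict (coeff (Poly (map c [0..<n]))) {..<n} = c"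
      by (auto simp: nth_default_def PiE_def extensional_def fun_eq_iff)
    show "\<forall>p\<in>{p. p = 0 \<or> degree p < n}. Poly (map (restrict (coeff p) {..<n}) [0..<n]) = p"
      by (auto simp: poly_eq_iff nth_default_def coeff_eq_0)
    have "degree (Poly (map c [0..<n])) < n" if "n > 0" for c :: "nat \<Rightarrow> 'a"
    proof -
      have "degree (Poly (map c [0..<n])) \<le> n - 1"
        by (rule degree_le) (auto simp: nth_default_def)
      then show ?thesis using that by simp
    qed
    then show "(\<lambda>c. Poly (map c [0..<n])) ` (PiE {..<n} (\<lambda>_. UNIV :: 'a set)) \<subseteq> {p. p = 0 \<or> degree p < n}"
      by (cases "n = 0") auto
    show "(\<lambda>p. restrict (coeff p) {..<n}) ` {p. p = 0 \<or> degree p < n} \<subseteq> PiE {..<n} (\<lambda>_. UNIV)"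
      by (intro image_subsetI) (simp add: restrict_PiE_iff)
  qed
  have "finite (PiE {..<n} (\<lambda>_. UNIV :: 'a set))" by (intro finite_PiE) auto
  with bij show "finite {p :: 'a poly. p = 0 \<or> degree p < n}" by (simp add: bij_betw_finite)
  show "card {p :: 'a poly. p = 0 \<or> degree p < n} = card (UNIV :: 'a set) ^ n"
    using bij_betw_same_card[OF bij] by (simp add: card_PiE)
qed

section \<open>The affine coordinate ring of the curve\<close>

definition cubic :: "f3 poly" where "cubic = [:-1, 0, 1, 1:]"

lemma degree_cubic: "degree cubic = 3" and cubic_nonzero: "cubic \<noteq> 0"
  by (simp_all add: cubic_def)

text \<open>\<open>Aff p q\<close> is the element p + q y of F_3[x, y] / (y^2 - cubic), which is
  free over F_3[x] with basis 1, y.\<close>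

datatype aff = Aff (re: "f3 poly") (im: "f3 poly")

instantiation aff :: comm_ring_1
begin
definition zero_aff where "0 = Aff 0 0"
definition one_aff where "1 = Aff 1 0"
definition plus_aff where "u + v = Aff (re u + re v) (im u + im v)"
definition minus_aff where "u - v = Aff (re u - re v) (im u - im v)"
definition uminus_aff where "- u = Aff (- re u) (- im u)"
definition times_aff where "u * v = Aff (re u * re v + cubic * im u * im v) (re u * im v + im u * re v)"
instance
  by standard (simp_all add: zero_aff_def one_aff_def plus_aff_def minus_aff_def uminus_aff_def
      times_aff_def algebra_simps)
end

lemma re_im_simps [simp]:
  "re 0 = 0" "im 0 = 0" "re 1 = 1" "im 1 = 0" "re (u + v) = re u + re v" "im (u + v) = im u + im v"
  "re (u - v) = re u - re v" "im (u - v) = im u - im v" "re (- u) = - re u" "im (- u) = - im u"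
  "re (u * v) = re u * re v + cubic * im u * im v" "im (u * v) = re u * im v + im u * re v"
  by (simp_all add: zero_aff_def one_aff_def plus_aff_def minus_aff_def uminus_aff_def times_aff_def)

lemma aff_eq_iff: "u = v \<longleftrightarrow> re u = re v \<and> im u = im v"
  by (auto intro: aff.expand)

text \<open>The automorphism y to -y over F_3[x]; on the curve it is negation and exchanges
  \<open>R\<close> and \<open>R'\<close>.\<close>

definition conj :: "aff \<Rightarrow> aff" where "conj u = Aff (re u) (- im u)"
definition pol :: "f3 poly \<Rightarrow> aff" where "pol p = Aff p 0"
definition ycoord :: aff where "ycoord = Aff 0 1"
text \<open>The norm down to F_3[x]; it turns questions on the curve into divisibility and degrees
  of polynomials.\<close>

definition anorm :: "aff \<Rightarrow> f3 poly" where "anorm u = re u ^ 2 - cubic * im u ^ 2"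

lemma conj_simps [simp]:
  "re (conj u) = re u" "im (conj u) = - im u" "conj (u * v) = conj u * conj v"
  "conj (pol p) = pol p" "conj (conj u) = u"
  by (simp_all add: conj_def pol_def aff_eq_iff)

lemma pol_simps [simp]:
  "re (pol p) = p" "im (pol p) = 0" "pol (p + q) = pol p + pol q" "pol (p * q) = pol p * pol q"
  "pol (p - q) = pol p - pol q" "pol (- p) = - pol p" "pol 0 = 0" "pol 1 = 1"
  "re ycoord = 0" "im ycoord = 1"
  by (simp_all add: pol_def aff_eq_iff ycoord_def)

lemma pol_eq_iff [simp]: "pol p = pol q \<longleftrightarrow> p = q" "pol p = 0 \<longleftrightarrow> p = 0"
  by (simp_all add: aff_eq_iff)

lemma pol_power [simp]: "pol (p ^ n) = pol p ^ n"
  by (induction n) simp_all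

lemma aff_decomp: "u = pol (re u) + pol (im u) * ycoord"
  by (simp add: aff_eq_iff)

lemma mult_conj: "u * conj u = pol (anorm u)"
  by (simp add: aff_eq_iff anorm_def power2_eq_square algebra_simps)

lemma ycoord_sq: "ycoord * ycoord = pol cubic"
  by (simp add: aff_eq_iff)

lemma anorm_mult: "anorm (u * v) = anorm u * anorm v"
  by (simp add: anorm_def power2_eq_square algebra_simps)

text \<open>The degree of the norm is the pole order at infinity (\<open>val_inf_aff\<close>): 2 for
  x and 3 for y.\<close>

definition dg :: "aff \<Rightarrow> nat" where "dg u = degree (anorm u)"

text \<open>The two summands of the norm have degrees \<open>2 * degree (re u)\<close> and
  \<open>2 * degree (im u) + 3\<close> of opposite parity, so leading terms cannot cancel. The same
  parity argument later determines the valuation at infinity.\<close>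

lemma anorm_degree:
  assumes "u \<noteq> 0"
  shows "anorm u \<noteq> 0" "im u = 0 \<Longrightarrow> dg u = 2 * degree (re u)"
    "im u \<noteq> 0 \<Longrightarrow> dg u = max (2 * degree (re u)) (2 * degree (im u) + 3)"
proof -
  have d1: "degree (re u ^ 2) = 2 * degree (re u)"
    by (cases "re u = 0") (simp_all add: degree_power_eq)
  have c2: "dg u = max (2 * degree (re u)) (2 * degree (im u) + 3)
      \<and> anorm u \<noteq> 0" if "im u \<noteq> 0"
  proof -
    have d2: "degree (cubic * im u ^ 2) = 2 * degree (im u) + 3"
      using that by (simp add: degree_mult_eq cubic_nonzero degree_cubic degree_power_eq)
    have "2 * degree (re u) \<noteq> 2 * degree (im u) + 3" by presburger
    then consider "2 * degree (re u) < 2 * degree (im u) + 3" | "2 * degree (re u) > 2 * degree (im u) + 3"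
      by linarith
    then show ?thesis
    proof cases
      case 1
      then have "degree (anorm u) = 2 * degree (im u) + 3"
        unfolding anorm_def by (metis d1 d2 degree_add_eq_right degree_minus diff_conv_add_uminus)
      with 1 show ?thesis unfolding dg_def by auto
    next
      case 2
      then have "degree (anorm u) = 2 * degree (re u)"
        unfolding anorm_def by (metis d1 d2 degree_add_eq_left degree_minus diff_conv_add_uminus)
      with 2 show ?thesis unfolding dg_def by auto
    qed
  qed
  have c1: "dg u = 2 * degree (re u) \<and> anorm u \<noteq> 0" if "im u = 0"
    using that assms d1 by (auto simp: dg_def anorm_def aff_eq_iff)
  show "anorm u \<noteq> 0" "im u = 0 \<Longrightarrow> dg u = 2 * degree (re u)"
    "im u \<noteq> 0 \<Longrightarrow> dg u = max (2 * degree (re u)) (2 * degree (im u) + 3)"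
    using c1 c2 by blast+
qed

instance aff :: idom
proof
  fix u v :: aff assume "u \<noteq> 0" "v \<noteq> 0"
  then have "anorm (u * v) \<noteq> 0" by (simp add: anorm_mult anorm_degree)
  then show "u * v \<noteq> 0" by (metis anorm_def re_im_simps(1,2) diff_zero mult_zero_right zero_power2)
qed

lemma dg_mult: "u \<noteq> 0 \<Longrightarrow> v \<noteq> 0 \<Longrightarrow> dg (u * v) = dg u + dg v"
  by (simp add: dg_def anorm_mult degree_mult_eq anorm_degree)

lemma dg_one [simp]: "dg 1 = 0"
  by (simp add: dg_def anorm_def)

lemma dg_uminus [simp]: "dg (- u) = dg u"
  by (simp add: dg_def anorm_def)

lemma dg_power: "u \<noteq> 0 \<Longrightarrow> dg (u ^ n) = n * dg u"
  by (induction n) (simp_all add: dg_mult)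

lemma dg_pol: "dg (pol p) = 2 * degree p"
  by (cases "p = 0") (simp_all add: dg_def anorm_def degree_power_eq)

lemma dg_ycoord: "dg ycoord = 3"
  by (subst anorm_degree(3)) (auto simp: aff_eq_iff)

lemma dg_conj: "dg (conj u) = dg u"
  by (simp add: dg_def anorm_def)

lemma dg_le_iff:
  assumes "u \<noteq> 0"
  shows "dg u \<le> N \<longleftrightarrow> 2 * degree (re u) \<le> N \<and> (im u = 0 \<or> 2 * degree (im u) + 3 \<le> N)"
  using anorm_degree[OF assms] by (cases "im u = 0") auto

text \<open>The space L(N infinity), as \<open>sections_at_infinity\<close> confirms.\<close>

definition aff_le :: "nat \<Rightarrow> aff set" where "aff_le N = {u. u = 0 \<or> dg u \<le> N}"

lemma aff_le_iff:
  "u \<in> aff_le N \<longleftrightarrow> 2 * degree (re u) \<le> N \<and> (im u = 0 \<or> 2 * degree (im u) + 3 \<le> N)"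
  by (cases "u = 0") (simp_all add: aff_le_def dg_le_iff)

lemma add_subgroup_aff_le: "add_subgroup (aff_le N)"
proof -
  have "2 * degree (p - q) \<le> N" if "2 * degree p \<le> N" "2 * degree q \<le> N" for p q :: "f3 poly" and N
  proof -
    have "2 * degree (p - q) \<le> max (2 * degree p) (2 * degree q)"
      using degree_diff_le_max[of p q] by auto
    then show ?thesis using that by linarith
  qed
  note a = this
  have "im (u - v) = 0 \<or> 2 * degree (im (u - v)) + 3 \<le> N"
    if "im u = 0 \<or> 2 * degree (im u) + 3 \<le> N" "im v = 0 \<or> 2 * degree (im v) + 3 \<le> N" for u v
  proof (cases "3 \<le> N")
    case True
    then have "2 * degree (im u) \<le> N - 3" "2 * degree (im v) \<le> N - 3" using that by auto
    then show ?thesis using a[of "im u" "N - 3" "im v"] True by (auto simp: le_diff_conv2)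
  qed (use that in auto)
  then show ?thesis using a by (auto simp: add_subgroup_def aff_le_iff)
qed

text \<open>The possible pole orders are 0, 2, 3, 4 and so on. The gap at 1 is how genus one shows
  up: the dimension is \<open>N\<close> from \<open>N = 1\<close> on, while \<open>N = 0\<close>
  still leaves the constants.\<close>

lemma card_aff_le:
  assumes "N \<ge> 1"
  shows "card (aff_le N) = 3 ^ N" "finite (aff_le N)"
proof -
  \<comment> \<open>\<open>m\<close> and \<open>k\<close> count the free coefficients of the part in
    y and of the part in 1; the part in y starts only at pole order 3.\<close>
  define m where "m = (if N \<ge> 3 then (N - 3) div 2 + 1 else 0)"
  define k where "k = N div 2 + 1"
  have km: "k + m = N" using assms unfolding k_def m_def by auto
  let ?S = "{p :: f3 poly. p = 0 \<or> degree p < k} \<times> {p :: f3 poly. p = 0 \<or> degree p < m}"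
  have bij: "bij_betw (\<lambda>(p, q). Aff p q) ?S (aff_le N)"
  proof (rule bij_betw_byWitness[where f' = "\<lambda>u. (re u, im u)"])
    show "(\<lambda>(p, q). Aff p q) ` ?S \<subseteq> aff_le N"
      unfolding aff_le_iff k_def m_def by (auto simp: aff_le_iff split: if_splits)
    show "(\<lambda>u. (re u, im u)) ` aff_le N \<subseteq> ?S"
      unfolding k_def m_def by (auto simp: aff_le_iff split: if_splits)
  qed auto
  show "finite (aff_le N)"
    using bij_betw_finite[OF bij] card_poly_degree_less(2)[where 'a=f3] by simp
  show "card (aff_le N) = 3 ^ N"
    using bij_betw_same_card[OF bij] km
    by (simp add: card_cartesian_product card_poly_degree_less card_f3 flip: power_add)
qed

lemma aff_le_0: "u \<in> aff_le 0 \<longleftrightarrow> (\<exists>c. u = pol [:c:])"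
  by (auto simp: aff_le_iff aff_eq_iff degree_eq_zeroE elim: degree_eq_zeroE)

lemma aff_le_2: "u \<in> aff_le 2 \<longleftrightarrow> (\<exists>a b. u = pol [:a, b:])"
proof
  assume "u \<in> aff_le 2"
  then have d: "degree (re u) \<le> 1" "im u = 0" by (auto simp: aff_le_iff)
  then obtain a b where "re u = [:a, b:]"
  proof -
    obtain a q where q: "re u = pCons a q" by (cases "re u")
    then have "degree q = 0" using d by (auto split: if_splits)
    then show ?thesis using that q by (elim degree_eq_zeroE) auto
  qed
  then show "\<exists>a b. u = pol [:a, b:]" using d by (auto simp: aff_eq_iff)
qed (auto simp: aff_le_iff)

text \<open>Division with remainder in both coordinates; with the count below, the quotient by
  \<open>pol h\<close> has at most \<open>9 ^ degree h\<close> elements.\<close>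

lemma mod_pol_rep:
  assumes "h \<noteq> 0"
  shows "\<exists>v\<in>{v. (re v = 0 \<or> degree (re v) < degree h) \<and> (im v = 0 \<or> degree (im v) < degree h)}.
           \<exists>w. u = v + pol h * w"
  by (intro bexI[of _ "Aff (re u mod h) (im u mod h)"] exI[of _ "Aff (re u div h) (im u div h)"])
     (use assms in \<open>auto simp: aff_eq_iff degree_mod_less\<close>)

lemma card_mod_pol_reps:
  fixes n :: nat
  defines "V \<equiv> {v. (re v = 0 \<or> degree (re v) < n) \<and> (im v = 0 \<or> degree (im v) < n)}"
  shows "card V = 9 ^ n" "finite V"
proof -
  let ?S = "{p :: f3 poly. p = 0 \<or> degree p < n}"
  have bij: "bij_betw (\<lambda>(p, q). Aff p q) (?S \<times> ?S) V"
    by (rule bij_betw_byWitness[where f' = "\<lambda>u. (re u, im u)"]) (auto simp: V_def)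
  show "finite V"
    using bij_betw_finite[OF bij] card_poly_degree_less(2)[where 'a=f3] by simp
  show "card V = 9 ^ n"
    using bij_betw_same_card[OF bij]
    by (simp add: card_cartesian_product card_poly_degree_less card_f3 flip: power_mult_distrib)
qed

section \<open>Discrete valuation rings of a field\<close>

text \<open>The notions of the record definitions restated for a field type, with \<open>P\<close>
  the local ring; the dictionary is \<open>uniformizer_FF\<close> and its neighbours.\<close>

definition unit_in :: "'a::field set \<Rightarrow> 'a \<Rightarrow> bool" where
  "unit_in P u \<longleftrightarrow> u \<in> P \<and> u \<noteq> 0 \<and> inverse u \<in> P"

definition unif :: "'a::field set \<Rightarrow> 'a \<Rightarrow> bool" where
  "unif P t \<longleftrightarrow> t \<in> P \<and> t \<noteq> 0 \<and> inverse t \<notin> P \<and>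
     (\<forall>f. f \<noteq> 0 \<longrightarrow> (\<exists>n::int. \<exists>u. unit_in P u \<and> f = t powi n * u))"

definition dvr :: "'a::field set \<Rightarrow> bool" where
  "dvr P \<longleftrightarrow> 1 \<in> P \<and> (\<forall>x\<in>P. \<forall>y\<in>P. x - y \<in> P \<and> x * y \<in> P) \<and> (\<exists>t. unif P t)"

definition val :: "'a::field set \<Rightarrow> 'a \<Rightarrow> int" where
  "val P f = (THE n. \<exists>t u. unif P t \<and> unit_in P u \<and> f = t powi n * u)"

definition mpow :: "'a::field set \<Rightarrow> int \<Rightarrow> 'a set" where
  "mpow P n = {f. f = 0 \<or> n \<le> val P f}"

context
  fixes P :: "'a::field set"
  assumes dvr: "dvr P"
begin

lemma dvr_one: "1 \<in> P" and dvr_diff: "x \<in> P \<Longrightarrow> y \<in> P \<Longrightarrow> x - y \<in> P"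
  and dvr_mult: "x \<in> P \<Longrightarrow> y \<in> P \<Longrightarrow> x * y \<in> P"
  using dvr by (auto simp: dvr_def)

lemma dvr_zero: "0 \<in> P"
  using dvr_diff[OF dvr_one dvr_one] by simp

lemma dvr_uminus: "x \<in> P \<Longrightarrow> - x \<in> P"
  using dvr_diff[OF dvr_zero] by fastforce

lemma dvr_add: "x \<in> P \<Longrightarrow> y \<in> P \<Longrightarrow> x + y \<in> P"
  using dvr_diff[of x "- y"] dvr_uminus by fastforce

lemma dvr_add_subgroup: "add_subgroup P"
  using dvr_zero dvr_diff by (auto simp: add_subgroup_def)

lemma dvr_power: "x \<in> P \<Longrightarrow> x ^ n \<in> P"
  by (induction n) (auto intro: dvr_one dvr_mult)

lemma dvr_obtain_unif: obtains t where "unif P t"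
  using dvr by (auto simp: dvr_def)

lemma unit_in_mult: "unit_in P u \<Longrightarrow> unit_in P v \<Longrightarrow> unit_in P (u * v)"
  by (auto simp: unit_in_def intro: dvr_mult)

lemma unit_in_inverse: "unit_in P u \<Longrightarrow> unit_in P (inverse u)"
  by (auto simp: unit_in_def)

lemma unit_in_one: "unit_in P 1"
  by (simp add: unit_in_def dvr_one)

lemma unit_in_powi: assumes "unit_in P u" shows "unit_in P (u powi n)"
proof -
  have "unit_in P (v ^ k)" if "unit_in P v" for v k
    by (induction k) (auto intro: unit_in_one unit_in_mult that)
  then show ?thesis using assms unit_in_inverse by (simp add: power_int_def)
qed

text \<open>A negative power of \<open>t\<close> times a unit, if it were in \<open>P\<close>, could
  be multiplied up to \<open>inverse t\<close>, which lies outside \<open>P\<close>.\<close>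

lemma unif_powi_mem_iff:
  assumes t: "unif P t" and u: "unit_in P u"
  shows "t powi n * u \<in> P \<longleftrightarrow> 0 \<le> n"
proof
  assume "0 \<le> n"
  then have "t powi n = t ^ nat n" by (simp add: power_int_def)
  then show "t powi n * u \<in> P" using t u by (auto simp: unif_def unit_in_def intro!: dvr_mult dvr_power)
next
  assume mem: "t powi n * u \<in> P"
  show "0 \<le> n"
  proof (rule ccontr)
    assume n: "\<not> 0 \<le> n"
    have t0: "t \<noteq> 0" and u0: "u \<noteq> 0" using t u by (auto simp: unif_def unit_in_def)
    have "t powi n * u * inverse u * t ^ nat (- n - 1) \<in> P"
      using mem t u by (auto simp: unif_def unit_in_def intro!: dvr_mult dvr_power)
    moreover have "t ^ nat (- n - 1) = t powi (- n - 1)" using n by (simp add: power_int_def)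
    moreover have "t powi n * t powi (- n - 1) = t powi (- 1)"
      using t0 by (subst power_int_add[symmetric]) auto
    ultimately have "inverse t \<in> P" using u0 by (simp add: mult.assoc power_int_minus)
    then show False using t by (simp add: unif_def)
  qed
qed

lemma unif_rep:
  assumes "unif P t" "f \<noteq> 0"
  obtains n u where "unit_in P u" "f = t powi n * u"
proof -
  from assms have "\<exists>n u. unit_in P u \<and> f = t powi n * u" unfolding unif_def by simp
  then show ?thesis using that by blast
qed

text \<open>Makes \<open>val\<close> independent of the uniformizer: two uniformizers are powers of
  each other up to units, with exponents \<open>k, l \<ge> 1\<close> and
  \<open>k * l = 1\<close>.\<close>

lemma unif_powi_unique:
  assumes "unif P t" "unif P t'" "unit_in P u" "unit_in P u'" "t powi n * u = t' powi m * u'"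
  shows "n = m"
proof -
  have nz: "t \<noteq> 0" "t' \<noteq> 0" "u \<noteq> 0" "u' \<noteq> 0" using assms by (auto simp: unif_def unit_in_def)
  have same: "a = b" if "t powi a * v = t powi b * w" "unit_in P v" "unit_in P w" for a b v w
  proof -
    have nz': "v \<noteq> 0" "w \<noteq> 0" using that by (auto simp: unit_in_def)
    have "t powi (a - b) * (v * inverse w) = 1" "t powi (b - a) * (w * inverse v) = 1"
      using that nz nz' by (simp_all add: power_int_diff field_simps)
    then have "0 \<le> a - b" "0 \<le> b - a"
      using unif_powi_mem_iff[OF assms(1)] that unit_in_mult unit_in_inverse dvr_one by metis+
    then show ?thesis by simp
  qed
  have pos: "k \<ge> 1" if "unif P s" "unif P s'" "s' = s powi k * w" "unit_in P w" for s s' k w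
  proof -
    have "s' \<in> P" "inverse s' \<notin> P" using that by (auto simp: unif_def)
    moreover have "inverse s' = s powi (- k) * inverse w"
      using that by (simp add: power_int_minus)
    ultimately show ?thesis
      using unif_powi_mem_iff[OF that(1), of _ k] unif_powi_mem_iff[OF that(1), of _ "-k"] that unit_in_inverse
      by fastforce
  qed
  obtain k w where w: "unit_in P w" "t' = t powi k * w" using unif_rep[OF assms(1) nz(2)] .
  obtain l w' where w': "unit_in P w'" "t = t' powi l * w'" using unif_rep[OF assms(2) nz(1)] .
  have k: "k \<ge> 1" and l: "l \<ge> 1" using pos assms w w' by blast+
  have "t powi 1 * 1 = t powi (k * l) * (w powi l * w')"
    using w'(2)[unfolded w(2)] by (simp add: power_int_mult power_int_mult_distrib mult.assoc)
  then have "1 = k * l"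
    using same w w' unit_in_one unit_in_mult unit_in_powi by metis
  then have "k = 1" using k l by (metis abs_of_pos abs_zmult_eq_1 less_le_trans zero_less_one)
  then have "t powi n * u = t powi m * (w powi m * u')"
    using assms(5) w by (simp add: power_int_mult_distrib mult.assoc)
  then show "n = m" using same assms w unit_in_mult unit_in_powi by metis
qed

lemma val_eqI: "unif P t \<Longrightarrow> unit_in P u \<Longrightarrow> f = t powi n * u \<Longrightarrow> val P f = n"
  unfolding val_def by (rule the_equality) (auto dest: unif_powi_unique)

lemma val_rep:
  assumes "unif P t" "f \<noteq> 0"
  obtains u where "unit_in P u" "f = t powi val P f * u"
proof -
  obtain n u where u: "unit_in P u" "f = t powi n * u" using unif_rep[OF assms] .
  with val_eqI[OF assms(1) u] show ?thesis using that by simp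
qed

lemma val_unif: "unif P t \<Longrightarrow> val P t = 1"
  using val_eqI[of t 1 t 1] unit_in_one by simp

lemma val_unit: "unit_in P u \<Longrightarrow> val P u = 0"
  using val_eqI[of _ u u 0] by (metis dvr_obtain_unif mult_1 power_int_0_right)

lemma val_one: "val P 1 = 0"
  using val_unit unit_in_one by blast

lemma val_mult:
  assumes "f \<noteq> 0" "g \<noteq> 0" shows "val P (f * g) = val P f + val P g"
proof -
  obtain t where t: "unif P t" by (rule dvr_obtain_unif)
  obtain u v where "unit_in P u" "f = t powi val P f * u" "unit_in P v" "g = t powi val P g * v"
    using val_rep[OF t] assms by metis
  moreover have "t \<noteq> 0" using t by (simp add: unif_def)
  ultimately have "f * g = t powi (val P f + val P g) * (u * v)"
    by (metis (no_types, lifting) mult.assoc mult.left_commute power_int_add)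
  then show ?thesis using val_eqI[OF t unit_in_mult] \<open>unit_in P u\<close> \<open>unit_in P v\<close> by blast
qed

lemma val_inverse: "f \<noteq> 0 \<Longrightarrow> val P (inverse f) = - val P f"
  using val_mult[of f "inverse f"] val_one by simp

lemma val_divide: "f \<noteq> 0 \<Longrightarrow> g \<noteq> 0 \<Longrightarrow> val P (f / g) = val P f - val P g"
  by (simp add: divide_inverse val_mult val_inverse)

lemma val_power: "f \<noteq> 0 \<Longrightarrow> val P (f ^ n) = int n * val P f"
  by (induction n) (simp_all add: val_one val_mult algebra_simps)

lemma mem_iff_val: assumes "f \<noteq> 0" shows "f \<in> P \<longleftrightarrow> 0 \<le> val P f"
  by (metis assms dvr_obtain_unif unif_powi_mem_iff val_rep)

lemma val_uminus: "val P (- f) = val P f"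
proof (cases "f = 0")
  case False
  have "unit_in P (- 1)" using dvr_one dvr_uminus by (auto simp: unit_in_def)
  then show ?thesis using val_mult[of "-1" f] False val_unit by simp
qed simp

lemma unit_in_iff: "unit_in P u \<longleftrightarrow> u \<noteq> 0 \<and> val P u = 0"
  by (cases "u = 0") (auto simp: unit_in_def mem_iff_val val_inverse)

lemma unif_iff: "unif P t \<longleftrightarrow> t \<noteq> 0 \<and> val P t = 1"
proof
  assume t: "t \<noteq> 0 \<and> val P t = 1"
  obtain s where s: "unif P s" by (rule dvr_obtain_unif)
  have s0: "s \<noteq> 0" "val P s = 1" using s val_unif by (auto simp: unif_def)
  have "\<exists>n::int. \<exists>u. unit_in P u \<and> f = t powi n * u" if "f \<noteq> 0" for f
  proof (intro exI[of _ "val P f"] exI[of _ "f / t powi val P f"] conjI)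
    have pw: "val P (t powi n) = n" for n
      using t by (auto simp: power_int_def val_power val_inverse simp flip: power_inverse)
    show "unit_in P (f / t powi val P f)"
      using that t by (simp add: unit_in_iff val_divide pw)
    show "f = t powi val P f * (f / t powi val P f)" using t by simp
  qed
  then show "unif P t" using t by (auto simp: unif_def mem_iff_val val_inverse)
qed (use val_unif in \<open>auto simp: unif_def\<close>)

text \<open>Factor out the summand of smaller valuation: f + g = f (1 + g / f) with g / f in
  \<open>P\<close>.\<close>

lemma val_add:
  assumes "f \<noteq> 0" "g \<noteq> 0" "f + g \<noteq> 0" shows "min (val P f) (val P g) \<le> val P (f + g)"
proof -
  have *: "val P f \<le> val P (f + g)" if "val P f \<le> val P g" "f \<noteq> 0" "g \<noteq> 0" "f + g \<noteq> 0" for f g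
  proof -
    have "g / f \<in> P" using that by (simp add: mem_iff_val val_divide)
    then have "1 + g / f \<in> P" by (intro dvr_add dvr_one)
    moreover have "f + g = f * (1 + g / f)" using that by (simp add: field_simps)
    moreover have "1 + g / f \<noteq> 0" using calculation that by auto
    ultimately show ?thesis using that by (simp add: mem_iff_val val_mult)
  qed
  show ?thesis using *[of f g] *[of g f] assms by (auto simp: add.commute min_def)
qed

lemma add_subgroup_mpow: "add_subgroup (mpow P n)"
proof -
  have "x - y \<in> mpow P n" if "x \<in> mpow P n" "y \<in> mpow P n" for x y
  proof (cases "x = 0 \<or> y = 0 \<or> x - y = 0")
    case False
    then show ?thesis
      using val_add[of x "- y"] val_uminus[of y] that by (auto simp: mpow_def)
  qed (use that in \<open>auto simp: mpow_def val_uminus\<close>)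
  then show ?thesis by (auto simp: add_subgroup_def mpow_def)
qed

text \<open>A larger valuation of the sum would contradict the ultrametric inequality for f = (f +
  g) - g.\<close>

lemma val_add_eq:
  assumes "f \<noteq> 0" "g = 0 \<or> val P f < val P g"
  shows "f + g \<noteq> 0" "val P (f + g) = val P f"
proof -
  show nz: "f + g \<noteq> 0" using assms val_uminus[of g] by (metis add.inverse_inverse eq_neg_iff_add_eq_0 add.right_neutral order_less_irrefl)
  show "val P (f + g) = val P f"
  proof (cases "g = 0")
    case False
    then have "val P f \<le> val P (f + g)" using val_add[of f g] assms nz by simp
    moreover have "min (val P (f + g)) (val P (- g)) \<le> val P f"
      using val_add[of "f + g" "- g"] assms nz False by simp
    ultimately show ?thesis using False assms by (simp add: val_uminus min_def split: if_splits)
  qed simp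
qed

lemma mpow_0: "mpow P 0 = P"
proof (rule Set.set_eqI)
  fix f show "f \<in> mpow P 0 \<longleftrightarrow> f \<in> P"
    by (cases "f = 0") (simp_all add: mpow_def dvr_zero mem_iff_val)
qed

lemma mpow_mult: "f \<in> mpow P a \<Longrightarrow> g \<in> mpow P b \<Longrightarrow> f * g \<in> mpow P (a + b)"
  by (cases "f = 0 \<or> g = 0") (auto simp: mpow_def val_mult)

lemma mpow_mono: "a \<le> b \<Longrightarrow> mpow P b \<subseteq> mpow P a"
  by (auto simp: mpow_def)

lemma mpow_scale:
  assumes "c \<noteq> 0" shows "(*) c ` mpow P n = mpow P (n + val P c)"
proof (intro equalityI subsetI)
  fix z assume "z \<in> mpow P (n + val P c)"
  then have "z / c \<in> mpow P n" using assms by (auto simp: mpow_def val_divide)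
  then show "z \<in> (*) c ` mpow P n" using assms by (intro image_eqI[of _ _ "z / c"]) auto
qed (use assms in \<open>auto simp: mpow_def val_mult\<close>)

lemma exists_val: "\<exists>c. c \<noteq> 0 \<and> val P c = n"
proof -
  obtain t where t: "unif P t" by (rule dvr_obtain_unif)
  then show ?thesis using val_eqI[OF t unit_in_one, of "t powi n"] by (auto simp: unif_def intro!: exI[of _ "t powi n"])
qed

lemma cosets_mpow_step:
  shows "card (cosets (mpow P a) (mpow P (a + 1))) = card (cosets P (mpow P 1))"
    and "finite (cosets P (mpow P 1)) \<Longrightarrow> finite (cosets (mpow P a) (mpow P (a + 1)))"
proof -
  obtain c where c: "c \<noteq> 0" "val P c = a" using exists_val by blast
  have b: "bij_betw ((`) ((*) c)) (cosets P (mpow P 1)) (cosets (mpow P a) (mpow P (a + 1)))"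
    using cosets_scale[OF c(1), of P "mpow P 1"] mpow_scale[OF c(1), of 0] mpow_scale[OF c(1), of 1] c
    by (simp add: mpow_0 add.commute)
  show "card (cosets (mpow P a) (mpow P (a + 1))) = card (cosets P (mpow P 1))"
    using bij_betw_same_card[OF b] by simp
  show "finite (cosets P (mpow P 1)) \<Longrightarrow> finite (cosets (mpow P a) (mpow P (a + 1)))"
    using bij_betw_finite[OF b] by simp
qed

text \<open>A filtration with \<open>n\<close> steps, each of which is scaled to the residue field
  by \<open>cosets_mpow_step\<close>.\<close>

lemma cosets_mpow:
  assumes "finite (cosets P (mpow P 1))"
  shows "finite (cosets (mpow P a) (mpow P (a + int n)))
    \<and> card (cosets (mpow P a) (mpow P (a + int n))) = card (cosets P (mpow P 1)) ^ n"
proof (induction n)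
  case 0
  have "cosets V V = {V}" if "add_subgroup V" for V :: "'a set"
  proof -
    have "translate V u = V" if "u \<in> V" for u
      using translate_eq_iff[OF \<open>add_subgroup V\<close>, of u 0] that by (simp add: translate_def)
    then show ?thesis using add_subgroup_zero[OF that] by (auto simp: cosets_def)
  qed
  then show ?case using add_subgroup_mpow by simp
next
  case (Suc n)
  have s: "mpow P (a + int n + 1) \<subseteq> mpow P (a + int n)" "mpow P (a + int n) \<subseteq> mpow P a"
    by (auto simp: mpow_def)
  note tower = cosets_tower[OF add_subgroup_mpow add_subgroup_mpow s(1) add_subgroup_mpow s(2)]
  show ?case using tower Suc cosets_mpow_step[of "a + int n"] assms by (simp add: ac_simps)
qed

end

text \<open>Maximality of discrete valuation rings: an element of \<open>Q\<close> with negative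
  valuation at \<open>P\<close> divides \<open>inverse t\<close> inside \<open>P\<close> and would
  force \<open>inverse t\<close> into \<open>Q\<close>.\<close>

lemma dvr_overring_eq:
  assumes P: "dvr P" and Q: "dvr Q" "P \<subseteq> Q" and t: "unif P t" "inverse t \<notin> Q"
  shows "Q = P"
proof (intro equalityI subsetI)
  fix z assume z: "z \<in> Q"
  show "z \<in> P"
  proof (rule ccontr)
    assume nz: "z \<notin> P"
    then have z0: "z \<noteq> 0" using dvr_zero[OF P] by auto
    then have neg: "val P z < 0" using nz mem_iff_val[OF P] by simp
    have t0: "t \<noteq> 0" using t by (simp add: unif_def)
    have "inverse t / z \<in> P"
      using neg z0 t0 val_unif[OF P t(1)] by (simp add: mem_iff_val[OF P] val_divide[OF P] val_inverse[OF P])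
    then have "inverse t / z * z \<in> Q" using Q z dvr_mult by blast
    then show False using t z0 by simp
  qed
qed (use Q in auto)

section \<open>Maximal ideals of the affine coordinate ring\<close>

definition aff_ideal :: "aff set \<Rightarrow> bool" where
  "aff_ideal I \<longleftrightarrow> add_subgroup I \<and> (\<forall>a. \<forall>b\<in>I. a * b \<in> I)"

text \<open>The last clause excludes the zero ideal. By \<open>aff_prime_inverse\<close> these
  primes are maximal; they are the finite points of the curve.\<close>

definition aff_prime :: "aff set \<Rightarrow> bool" where
  "aff_prime p \<longleftrightarrow> aff_ideal p \<and> 1 \<notin> p \<and> (\<forall>a b. a * b \<in> p \<longrightarrow> a \<in> p \<or> b \<in> p) \<and> (\<exists>a\<in>p. a \<noteq> 0)"

definition loc :: "aff set \<Rightarrow> aff fract set" where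
  "loc p = {to_fract a / to_fract s | a s. s \<notin> p}"

lemma aff_ideal_closed:
  assumes "aff_ideal I"
  shows "0 \<in> I" "u \<in> I \<Longrightarrow> v \<in> I \<Longrightarrow> u + v \<in> I" "u \<in> I \<Longrightarrow> v \<in> I \<Longrightarrow> u - v \<in> I"
    "u \<in> I \<Longrightarrow> - u \<in> I" "u \<in> I \<Longrightarrow> a * u \<in> I" "u \<in> I \<Longrightarrow> u * a \<in> I"
proof -
  have I: "add_subgroup I" "\<And>a b. b \<in> I \<Longrightarrow> a * b \<in> I" using assms by (auto simp: aff_ideal_def)
  show "0 \<in> I" "u \<in> I \<Longrightarrow> v \<in> I \<Longrightarrow> u + v \<in> I" "u \<in> I \<Longrightarrow> v \<in> I \<Longrightarrow> u - v \<in> I"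
    "u \<in> I \<Longrightarrow> - u \<in> I" "u \<in> I \<Longrightarrow> a * u \<in> I"
    by (simp_all add: add_subgroup_zero[OF I(1)] add_subgroup_add[OF I(1)] add_subgroup_diff[OF I(1)]
        add_subgroup_uminus[OF I(1)] I(2))
  show "u \<in> I \<Longrightarrow> u * a \<in> I" using I(2)[of u a] by (simp add: mult.commute)
qed

lemma aff_prime_ideal: "aff_prime p \<Longrightarrow> aff_ideal p"
  by (simp add: aff_prime_def)

lemmas aff_prime_closed = aff_ideal_closed[OF aff_prime_ideal]

lemma aff_prime_one: "aff_prime p \<Longrightarrow> 1 \<notin> p"
  by (simp add: aff_prime_def)

lemma aff_prime_mult: "aff_prime p \<Longrightarrow> a * b \<in> p \<longleftrightarrow> a \<in> p \<or> b \<in> p"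
  by (metis aff_prime_closed(5,6) aff_prime_def)

lemma aff_prime_power: "aff_prime p \<Longrightarrow> a ^ n \<in> p \<Longrightarrow> a \<in> p"
  by (induction n) (auto simp: aff_prime_mult aff_prime_one)

lemma aff_prime_pol_const:
  assumes "aff_prime p" "c \<noteq> 0" shows "pol [:c:] \<notin> p"
proof
  assume "pol [:c:] \<in> p"
  then have "pol [:inverse c:] * pol [:c:] \<in> p" by (rule aff_prime_closed(5)[OF assms(1)])
  moreover have "pol [:inverse c:] * pol [:c:] = 1" using assms by (simp add: aff_eq_iff one_pCons)
  ultimately show False using aff_prime_one assms by simp
qed

text \<open>The contraction to F_3[x] is nonzero because it contains the norm of any nonzero element
  of \<open>p\<close>; an element of least degree generates it.\<close>

lemma aff_prime_under:
  assumes p: "aff_prime p"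
  obtains \<pi> where "irreducible \<pi>" "lead_coeff \<pi> = 1" "\<And>q. pol q \<in> p \<longleftrightarrow> \<pi> dvd q"
proof -
  obtain u where u: "u \<in> p" "u \<noteq> 0" using p by (auto simp: aff_prime_def)
  define Q where "Q q \<longleftrightarrow> pol q \<in> p \<and> q \<noteq> 0" for q
  have "u * conj u \<in> p" using aff_prime_closed(6)[OF p] u by simp
  then have "Q (anorm u)" using u by (simp add: Q_def mult_conj anorm_degree)
  then obtain q0 where q0: "Q q0" "\<And>q. Q q \<Longrightarrow> degree q0 \<le> degree q"
    using ex_has_least_nat[of Q "anorm u" degree] by auto
  define \<pi> where "\<pi> = smult (inverse (lead_coeff q0)) q0"
  have nz: "q0 \<noteq> 0" "\<pi> \<noteq> 0" using q0 by (auto simp: Q_def \<pi>_def)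
  have "\<pi> = [:inverse (lead_coeff q0):] * q0" by (simp add: \<pi>_def)
  then have \<pi>p: "pol \<pi> \<in> p"
    using aff_prime_closed(5)[OF p, of "pol q0" "pol [:inverse (lead_coeff q0):]"] q0
    unfolding Q_def by (metis pol_simps(4))
  have deg: "degree \<pi> = degree q0" using nz by (simp add: \<pi>_def)
  have lead: "lead_coeff \<pi> = 1" using nz by (simp add: \<pi>_def)
  have dvd: "pol q \<in> p \<longleftrightarrow> \<pi> dvd q" for q
  proof
    assume q: "pol q \<in> p"
    have "q mod \<pi> = q - \<pi> * (q div \<pi>)" by (simp add: minus_mult_div_eq_mod)
    then have "pol (q mod \<pi>) \<in> p" using q aff_prime_closed(3)[OF p q aff_prime_closed(6)[OF p \<pi>p]] by simp
    then have "q mod \<pi> = 0"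
      using q0(2)[of "q mod \<pi>"] degree_mod_less[OF nz(2), of q] deg unfolding Q_def by linarith
    then show "\<pi> dvd q" by auto
  next
    assume "\<pi> dvd q"
    then show "pol q \<in> p" using aff_prime_closed(6)[OF p \<pi>p] by (auto elim!: dvdE)
  qed
  have "irreducible \<pi>"
  proof (rule Factorial_Ring.irreducibleI[OF nz(2)])
    show "\<not> \<pi> dvd 1" using dvd[of 1] aff_prime_one[OF p] by simp
    fix a b assume ab: "\<pi> = a * b"
    then have "pol a \<in> p \<or> pol b \<in> p" using \<pi>p aff_prime_mult[OF p] by simp
    then have "a * b dvd a \<or> a * b dvd b" using dvd ab by simp
    then show "a dvd 1 \<or> b dvd 1" using nz ab
      by (metis dvd_mult_cancel_left dvd_mult_cancel_right mult.right_neutral mult.left_neutral mult_eq_0_iff)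
  qed
  then show ?thesis using lead dvd that by blast
qed

text \<open>\<open>a\<close> divides its norm, and modulo a nonzero polynomial there are finitely
  many remainders.\<close>

lemma finite_cosets_principal:
  assumes "a \<noteq> 0" shows "finite (cosets UNIV ((*) a ` (UNIV :: aff set)))"
proof -
  let ?I = "(*) a ` (UNIV :: aff set)"
  have sub: "add_subgroup ?I"
  proof -
    have "0 \<in> ?I" by (rule image_eqI[of _ _ 0]) auto
    moreover have "a * x - a * y \<in> ?I" for x y
      by (rule image_eqI[of _ _ "x - y"]) (auto simp: algebra_simps)
    ultimately show ?thesis by (auto simp: add_subgroup_def)
  qed
  define h where "h = anorm a"
  have h: "h \<noteq> 0" "pol h = a * conj a" using assms by (simp_all add: h_def anorm_degree mult_conj)
  define V where "V = {v. (re v = 0 \<or> degree (re v) < degree h) \<and> (im v = 0 \<or> degree (im v) < degree h)}"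
  have "cosets UNIV ?I \<subseteq> translate ?I ` V"
  proof
    fix C assume "C \<in> cosets UNIV ?I"
    then obtain u where u: "C = translate ?I u" by (auto simp: cosets_def)
    obtain v w where v: "v \<in> V" "u = v + pol h * w" using mod_pol_rep[OF h(1), of u] by (auto simp: V_def)
    then have "u - v = a * (conj a * w)" by (simp add: h(2) mult.assoc)
    then have "u - v \<in> ?I" by blast
    then show "C \<in> translate ?I ` V" using u v translate_eq_iff[OF sub] by blast
  qed
  then show ?thesis using card_mod_pol_reps(2) unfolding V_def by (meson finite_surj)
qed

text \<open>Pigeonhole among the powers of \<open>t\<close> modulo \<open>a\<close>. This yields
  inverses modulo primes and bounds the order of divisibility by a local parameter.\<close>

lemma exists_power_congruence:
  fixes a :: aff
  assumes "a \<noteq> 0"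
  obtains n m :: nat and w where "n < m" "t ^ n - t ^ m = a * w"
proof -
  let ?I = "(*) a ` (UNIV :: aff set)"
  have sub: "add_subgroup ?I"
  proof -
    have "0 \<in> ?I" by (rule image_eqI[of _ _ 0]) auto
    moreover have "a * x - a * y \<in> ?I" for x y
      by (rule image_eqI[of _ _ "x - y"]) (auto simp: algebra_simps)
    ultimately show ?thesis by (auto simp: add_subgroup_def)
  qed
  have "range (\<lambda>n. translate ?I (t ^ n)) \<subseteq> cosets UNIV ?I" by (auto simp: cosets_def)
  then have "finite (range (\<lambda>n. translate ?I (t ^ n)))"
    using finite_cosets_principal[OF assms] finite_subset by blast
  then have "\<not> inj (\<lambda>n. translate ?I (t ^ n))" using finite_imageD infinite_UNIV_nat by blast
  then obtain n m :: nat where nm: "n \<noteq> m" "translate ?I (t ^ n) = translate ?I (t ^ m)"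
    by (auto simp: inj_def)
  then consider "n < m" "t ^ n - t ^ m \<in> ?I" | "m < n" "t ^ m - t ^ n \<in> ?I"
    using translate_eq_iff[OF sub] by (metis linorder_neqE_nat)
  then show ?thesis using that by cases blast+
qed

text \<open>Apply the power congruence modulo a nonzero element of \<open>p\<close> and cancel the
  common power of \<open>s\<close>: some power of \<open>s\<close> inverts \<open>s\<close> modulo
  \<open>p\<close>.\<close>

lemma aff_prime_inverse:
  assumes p: "aff_prime p" and s: "s \<notin> p"
  obtains k where "1 - s * s ^ k \<in> p"
proof -
  obtain a where a: "a \<in> p" "a \<noteq> 0" using p by (auto simp: aff_prime_def)
  obtain n m w where nm: "n < m" "s ^ n - s ^ m = a * w" using exists_power_congruence[OF a(2)] .
  have "s ^ m = s ^ n * s ^ (m - n)" using nm by (simp flip: power_add)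
  then have "s ^ n * (1 - s ^ (m - n)) = a * w" using nm by (simp add: algebra_simps)
  then have "s ^ n * (1 - s ^ (m - n)) \<in> p" using aff_prime_closed(6)[OF p a(1)] by simp
  then have "1 - s ^ (m - n) \<in> p" using aff_prime_mult aff_prime_power p s by blast
  moreover have "s ^ (m - n) = s * s ^ (m - n - 1)" using nm
    by (simp add: Suc_diff_Suc flip: power_Suc)
  ultimately show ?thesis using that by metis
qed

lemma f3_poly_two: "(2 :: f3 poly) = - 1"
proof -
  have "(2 :: f3 poly) = [:2:]" by (simp add: numeral_poly)
  also have "[:2::f3:] = - 1" by (simp add: f3_two one_pCons)
  finally show ?thesis .
qed

lemma aff_two: "(2 :: aff) = - 1"
  by (simp only: one_add_one[symmetric] aff_eq_iff re_im_simps) (simp add: f3_poly_two)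

lemma aff_prime_double:
  assumes p: "aff_prime p" and u: "u + u \<in> p" shows "u \<in> p"
proof -
  have "u + u = 2 * u" by (simp only: mult_2)
  then have "u + u = - u" by (simp only: aff_two mult_minus_left mult_1)
  then have "- (- u) \<in> p" using u aff_prime_closed(4)[OF p] by metis
  then show "u \<in> p" by simp
qed

section \<open>Local parameters at the finite points\<close>

lemma re_im_mem:
  assumes p: "aff_prime p" and u: "u \<in> p" "conj u \<in> p"
  shows "pol (re u) \<in> p" "pol (im u) * ycoord \<in> p"
proof -
  have "u + conj u = pol (re u) + pol (re u)" by (simp add: aff_eq_iff aff_two f3_poly_two)
  then show 1: "pol (re u) \<in> p" using aff_prime_double[OF p] aff_prime_closed(2)[OF p u] by simp
  have "pol (im u) * ycoord = u - pol (re u)" by (simp add: aff_eq_iff)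
  then show "pol (im u) * ycoord \<in> p" using aff_prime_closed(3)[OF p u(1) 1] by simp
qed

text \<open>At a maximal ideal not containing \<open>y\<close> the extension of \<open>\<F>\<^sub>3[x]\<close> is unramified, so a generator
  of its trace on \<open>\<F>\<^sub>3[x]\<close> is a local parameter; otherwise \<open>y\<close> is one because the cubic is irreducible.\<close>

definition local_parameter :: "aff set \<Rightarrow> aff \<Rightarrow> bool" where
  "local_parameter p t \<longleftrightarrow> t \<in> p \<and> t \<noteq> 0 \<and> (\<forall>a\<in>p. \<exists>s b. s \<notin> p \<and> s * a = t * b)"

text \<open>If the conjugate of \<open>a\<close> is outside \<open>p\<close>, it serves as
  denominator, since the norm is a multiple of \<open>\<pi>\<close>. Otherwise the sum of
  \<open>a\<close> and its conjugate shows that both coordinates are multiples of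
  \<open>\<pi>\<close>.\<close>

lemma local_parameter_unramified:
  assumes p: "aff_prime p" and y: "ycoord \<notin> p" and \<pi>: "\<pi> \<noteq> 0" "\<And>q. pol q \<in> p \<longleftrightarrow> \<pi> dvd q"
  shows "local_parameter p (pol \<pi>)"
proof -
  have "\<exists>s b. s \<notin> p \<and> s * a = pol \<pi> * b" if a: "a \<in> p" for a
  proof (cases "conj a \<in> p")
    case False
    have "conj a * a \<in> p" by (rule aff_prime_closed(5)[OF p a])
    then have "pol (anorm a) \<in> p" using mult_conj[of a] by (simp add: mult.commute)
    then obtain c where "anorm a = \<pi> * c" using \<pi> by (auto elim!: dvdE)
    then have "conj a * a = pol \<pi> * pol c" using mult_conj[of a] by (simp add: mult.commute)
    then show ?thesis using False by blast
  next
    case True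
    then have "pol (re a) \<in> p" "pol (im a) \<in> p"
      using re_im_mem[OF p a] y aff_prime_mult[OF p] by blast+
    then obtain c d where "re a = \<pi> * c" "im a = \<pi> * d" using \<pi> by (auto elim!: dvdE)
    then have "1 * a = pol \<pi> * Aff c d" by (simp add: aff_eq_iff)
    then show ?thesis using aff_prime_one[OF p] by blast
  qed
  then show ?thesis using \<pi> by (simp add: local_parameter_def)
qed

text \<open>The first coordinate of an element of \<open>p\<close> is a multiple of the cubic, that
  is of y^2, so y divides the element without any denominator.\<close>

lemma local_parameter_ramified:
  assumes p: "aff_prime p" and y: "ycoord \<in> p" and irr: "irreducible cubic"
  shows "local_parameter p ycoord" "pol q \<in> p \<longleftrightarrow> cubic dvd q"
proof -
  obtain \<pi> where \<pi>: "irreducible \<pi>" "lead_coeff \<pi> = 1" "\<And>q. pol q \<in> p \<longleftrightarrow> \<pi> dvd q"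
    by (rule aff_prime_under[OF p]) blast
  have "pol cubic \<in> p" using y aff_prime_closed(5)[OF p y, of ycoord] by (simp add: ycoord_sq)
  then have "\<pi> dvd cubic" using \<pi> by simp
  then have "cubic dvd \<pi>" using irr \<pi>(1) by (meson irreducibleD' irreducible_not_unit)
  then show dvd: "pol q \<in> p \<longleftrightarrow> cubic dvd q" for q using \<pi>(3) \<open>\<pi> dvd cubic\<close> by (meson dvd_trans)
  have "\<exists>s b. s \<notin> p \<and> s * a = ycoord * b" if a: "a \<in> p" for a
  proof -
    have "pol (re a) = a - pol (im a) * ycoord" by (simp add: aff_eq_iff)
    then have "pol (re a) \<in> p" using aff_prime_closed(3)[OF p a aff_prime_closed(5)[OF p y]] by simp
    then obtain c where "re a = cubic * c" using dvd by (auto elim!: dvdE)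
    then have "1 * a = ycoord * Aff (im a) c" by (simp add: aff_eq_iff)
    then show ?thesis using aff_prime_one[OF p] by blast
  qed
  moreover have "ycoord \<noteq> 0" by (simp add: aff_eq_iff)
  ultimately show "local_parameter p ycoord" using y by (simp add: local_parameter_def)
qed

text \<open>In a factorization the factor of smaller degree has degree 0, or 1, or, only when
  \<open>p\<close> has degree 4, degree 2.\<close>

lemma poly_irreducible_by_small_divisors:
  fixes p :: "'a::field poly"
  assumes deg: "0 < degree p" "degree p \<le> 4" and roots: "\<And>c. poly p c \<noteq> 0"
    and quad: "degree p = 4 \<Longrightarrow> (\<And>a b. \<not> [:a, b, 1:] dvd p)"
  shows "irreducible p"
proof (rule Factorial_Ring.irreducibleI)
  show p0: "p \<noteq> 0" using deg by auto
  show "\<not> p dvd 1" using deg p0 by (simp add: is_unit_iff_degree)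
  fix a b assume ab: "p = a * b"
  have *: "a dvd 1 \<or> b dvd 1" if ab: "p = a * b" and le: "degree a \<le> degree b" for a b
  proof -
    have nz: "a \<noteq> 0" "b \<noteq> 0" using ab p0 by auto
    have d: "degree a + degree b = degree p" using ab nz by (simp add: degree_mult_eq)
    then consider "degree a = 0" | "degree a = 1" | "degree a = 2" "degree p = 4" using le deg by linarith
    then show ?thesis
    proof cases
      case 1 then show ?thesis using nz by (simp add: is_unit_iff_degree)
    next
      case 2
      then obtain c d where "a = [:c, d:]" "d \<noteq> 0"
        by (metis degree_pCons_eq_if degree_0 lead_coeff_pCons(1) nz(1) One_nat_def pCons_cases
            Suc_inject degree_eq_zeroE lead_coeff_pCons(2) nat.distinct(1) pCons_0_0)
      then have "poly a (- c / d) = 0" by simp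
      then show ?thesis using roots[of "- c / d"] ab by simp
    next
      case 3
      \<comment> \<open>The hypothesis on quadratic factors speaks of monic ones, so the factor is
        normalized.\<close>
      define m where "m = smult (inverse (lead_coeff a)) a"
      have "coeff a 2 \<noteq> 0" using 3 nz leading_coeff_neq_0[of a] by simp
      then have "degree m = 2" "lead_coeff m = 1" using 3 nz by (simp_all add: m_def)
      then have "m = [:coeff m 0, coeff m 1, 1:]"
        by (auto simp: poly_eq_iff coeff_pCons coeff_eq_0 eval_nat_numeral split: nat.splits)
      moreover have "m dvd p" using ab nz by (simp add: m_def smult_dvd)
      ultimately show ?thesis using quad[OF 3(2)] by metis
    qed
  qed
  show "a dvd 1 \<or> b dvd 1"
    using *[OF ab] *[of b a] ab by (metis mult.commute nat_le_linear)
qed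

lemma f3_all: "(\<forall>c::f3. Q c) \<longleftrightarrow> Q 0 \<and> Q 1 \<and> Q (- 1)"
  by (metis f3_cases)

lemma irreducible_cubic: "irreducible cubic"
proof (rule poly_irreducible_by_small_divisors)
  have "\<forall>c. poly cubic c \<noteq> 0" unfolding f3_all by (simp add: cubic_def)
  then show "poly cubic c \<noteq> 0" for c by blast
qed (simp_all add: degree_cubic)

lemma exists_local_parameter:
  assumes "aff_prime p" obtains t where "local_parameter p t"
proof (cases "ycoord \<in> p")
  case True
  then show ?thesis using local_parameter_ramified(1)[OF assms True irreducible_cubic] that by blast
next
  case False
  obtain \<pi> where \<pi>: "irreducible \<pi>" "lead_coeff \<pi> = 1" "\<And>q. pol q \<in> p \<longleftrightarrow> \<pi> dvd q"
    by (rule aff_prime_under[OF assms]) blast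
  then have "\<pi> \<noteq> 0" by auto
  then show ?thesis using local_parameter_unramified[OF assms False _ \<pi>(3)] that by blast
qed

section \<open>The closed points of the curve\<close>

lemma to_fract_power: "to_fract (a ^ n) = to_fract a ^ n"
  by (induction n) simp_all

context
  fixes p assumes p: "aff_prime p"
begin

lemma loc_memI: "s \<notin> p \<Longrightarrow> to_fract a / to_fract s \<in> loc p"
  by (auto simp: loc_def)

lemma to_fract_in_loc: "to_fract a \<in> loc p"
  using loc_memI[of 1 a] aff_prime_one[OF p] by simp

lemma nonmember_nonzero: "s \<notin> p \<Longrightarrow> to_fract s \<noteq> 0"
  using aff_prime_closed(1)[OF p] by auto

lemma unit_in_loc: "b \<notin> p \<Longrightarrow> s \<notin> p \<Longrightarrow> unit_in (loc p) (to_fract b / to_fract s)"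
  using loc_memI nonmember_nonzero by (auto simp: unit_in_def)

text \<open>Take the largest power of \<open>t\<close> that divides \<open>a\<close> up to
  denominators. The congruence of t^n and t^m modulo \<open>a\<close> bounds it by \<open>n\<close>:
  otherwise 1 would lie in \<open>p\<close>. Maximality keeps the cofactor outside
  \<open>p\<close>.\<close>

lemma local_parameter_rep:
  assumes t: "local_parameter p t" and a: "a \<noteq> 0"
  obtains n s b where "s \<notin> p" "b \<notin> p" "s * a = t ^ n * b"
proof -
  obtain n m w where nm: "n < m" "t ^ n - t ^ m = a * w" using exists_power_congruence[OF a] .
  define k where "k = m - n - 1"
  have m: "m = n + Suc k" using nm by (simp add: k_def)
  have t: "t \<in> p" "t \<noteq> 0" "\<And>a. a \<in> p \<Longrightarrow> \<exists>s b. s \<notin> p \<and> s * a = t * b"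
    using t by (auto simp: local_parameter_def)
  define E where "E j \<longleftrightarrow> (\<exists>s b. s \<notin> p \<and> s * a = t ^ j * b)" for j
  have bound: "j \<le> n" if "E j" for j
  proof (rule ccontr)
    assume "\<not> j \<le> n"
    then obtain i where j: "j = n + Suc i" using less_imp_Suc_add[of n j] by auto
    obtain s b where s: "s \<notin> p" "s * a = t ^ j * b" using \<open>E j\<close> by (auto simp: E_def)
    have "t ^ n * (s * (1 - t * t ^ k)) = s * (a * w)"
      unfolding nm(2)[symmetric] m by (simp add: algebra_simps power_add)
    also have "\<dots> = t ^ n * (t * (t ^ i * b * w))"
      using s(2) unfolding j by (simp add: algebra_simps power_add)
    finally have "s * (1 - t * t ^ k) = t * (t ^ i * b * w)" using t by simp
    then have "s * (1 - t * t ^ k) \<in> p" using aff_prime_closed(6)[OF p t(1)] by simp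
    then have "1 - t * t ^ k \<in> p" using s aff_prime_mult[OF p] by blast
    then have "1 - t * t ^ k + t * t ^ k \<in> p" by (rule aff_prime_closed(2)[OF p _ aff_prime_closed(6)[OF p t(1)]])
    then show False using aff_prime_one[OF p] by simp
  qed
  have "E 0" unfolding E_def using aff_prime_one[OF p] by (intro exI[of _ 1] exI[of _ a]) auto
  then have max: "E (Greatest E)" "\<not> E (Suc (Greatest E))"
    using GreatestI_nat[of E 0 n] Greatest_le_nat[of E "Suc (Greatest E)" n] bound by auto
  then obtain s b where sb: "s \<notin> p" "s * a = t ^ Greatest E * b" by (auto simp: E_def)
  have "b \<notin> p"
  proof
    assume "b \<in> p"
    then obtain s' b' where s': "s' \<notin> p" "s' * b = t * b'" using t(3) by blast
    have "(s' * s) * a = t ^ Suc (Greatest E) * b'"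
    proof -
      have "(s' * s) * a = s' * (s * a)" by (simp add: mult.assoc)
      also have "\<dots> = t ^ Greatest E * (s' * b)" unfolding sb(2) by (simp add: mult.left_commute)
      also have "\<dots> = t ^ Suc (Greatest E) * b'" unfolding s'(2) by (simp add: ac_simps)
      finally show ?thesis .
    qed
    then have "E (Suc (Greatest E))" unfolding E_def using s' sb aff_prime_mult[OF p] by blast
    then show False using max by simp
  qed
  then show ?thesis using that sb by blast
qed

lemma loc_unif:
  assumes t: "local_parameter p t" shows "unif (loc p) (to_fract t)"
proof -
  have t': "t \<in> p" "t \<noteq> 0" using t by (auto simp: local_parameter_def)
  have "inverse (to_fract t) \<notin> loc p"
  proof
    assume "inverse (to_fract t) \<in> loc p"
    then obtain a s where as: "s \<notin> p" "inverse (to_fract t) = to_fract a / to_fract s"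
      by (auto simp: loc_def)
    then have "to_fract s = to_fract (a * t)" using nonmember_nonzero t' by (simp add: field_simps)
    then have "s = a * t" unfolding to_fract_eq_iff .
    then show False using as(1) aff_prime_closed(5)[OF p t'(1)] by simp
  qed
  moreover have "\<exists>n::int. \<exists>u. unit_in (loc p) u \<and> f = to_fract t powi n * u" if f: "f \<noteq> 0" for f
  proof -
    obtain a c where ac: "f = to_fract a / to_fract c" "c \<noteq> 0" "a \<noteq> 0"
    proof (cases f)
      case (Fract a c)
      then show ?thesis using that[of a c] f by (auto simp: to_fract_def Zero_fract_def eq_fract)
    qed
    obtain n s b where 1: "s \<notin> p" "b \<notin> p" "s * a = t ^ n * b" using local_parameter_rep[OF t ac(3)] .
    obtain m r d where 2: "r \<notin> p" "d \<notin> p" "r * c = t ^ m * d" using local_parameter_rep[OF t ac(2)] .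
    note nz = nonmember_nonzero[OF 1(1)] nonmember_nonzero[OF 1(2)] nonmember_nonzero[OF 2(1)] nonmember_nonzero[OF 2(2)]
    have "to_fract s * to_fract a = to_fract t ^ n * to_fract b" "to_fract r * to_fract c = to_fract t ^ m * to_fract d"
      using 1(3) 2(3) by (metis to_fract_mult to_fract_power)+
    then have eqs: "to_fract a = to_fract t ^ n * to_fract b / to_fract s" "to_fract c = to_fract t ^ m * to_fract d / to_fract r"
      using nz by (simp_all add: field_simps)
    then have "f = (to_fract t ^ n / to_fract t ^ m) * (to_fract (b * r) / to_fract (d * s))"
      unfolding ac(1) eqs using nz t' by (simp add: field_simps)
    also have "to_fract t ^ n / to_fract t ^ m = to_fract t powi (int n - int m)"
      using t' by (simp add: power_int_diff)
    finally have "f = to_fract t powi (int n - int m) * (to_fract (b * r) / to_fract (d * s))" .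
    moreover have "unit_in (loc p) (to_fract (b * r) / to_fract (d * s))"
      using 1 2 by (intro unit_in_loc) (auto simp: aff_prime_mult[OF p])
    ultimately show ?thesis by blast
  qed
  ultimately show ?thesis using t' to_fract_in_loc by (auto simp: unif_def)
qed

lemma loc_dvr: "dvr (loc p)"
proof -
  obtain t where "local_parameter p t" using exists_local_parameter[OF p] .
  then have "\<exists>t. unif (loc p) t" using loc_unif by blast
  moreover have "x - y \<in> loc p \<and> x * y \<in> loc p" if xy: "x \<in> loc p" "y \<in> loc p" for x y
  proof -
    obtain a s b r where 1: "x = to_fract a / to_fract s" "s \<notin> p" "y = to_fract b / to_fract r" "r \<notin> p"
      using xy by (auto simp: loc_def)
    have "x - y = to_fract (a * r - b * s) / to_fract (s * r)" "x * y = to_fract (a * b) / to_fract (s * r)"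
      unfolding 1(1) 1(3) using nonmember_nonzero[OF 1(2)] nonmember_nonzero[OF 1(4)]
      by (simp_all add: field_simps)
    moreover have "s * r \<notin> p" using 1 aff_prime_mult[OF p] by blast
    ultimately show ?thesis using loc_memI by metis
  qed
  ultimately show ?thesis using to_fract_in_loc[of 1] by (auto simp: dvr_def)
qed

lemma val_loc_nonmember: "s \<notin> p \<Longrightarrow> val (loc p) (to_fract s) = 0"
  using val_unit[OF loc_dvr, of "to_fract s"] unit_in_loc[of s 1] aff_prime_one[OF p] by simp

text \<open>The prime is recovered from its local ring, so distinct primes give distinct
  points.\<close>

lemma mem_iff_mpow: "a \<in> p \<longleftrightarrow> to_fract a \<in> mpow (loc p) 1"
proof (cases "a = 0")
  case True then show ?thesis using aff_prime_closed(1)[OF p] by (simp add: mpow_def)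
next
  case a: False
  show ?thesis
  proof
    assume ap: "a \<in> p"
    obtain t where t: "local_parameter p t" using exists_local_parameter[OF p] .
    then obtain s b where s: "s \<notin> p" "s * a = t * b" using ap by (auto simp: local_parameter_def)
    have nz: "s \<noteq> 0" "b \<noteq> 0" "t \<noteq> 0" using s a t aff_prime_closed(1)[OF p] by (auto simp: local_parameter_def)
    have eq: "to_fract s * to_fract a = to_fract t * to_fract b" using s(2) by (metis to_fract_mult)
    have "0 \<le> val (loc p) (to_fract b)"
      using to_fract_in_loc nz by (simp flip: mem_iff_val[OF loc_dvr])
    moreover have "val (loc p) (to_fract s * to_fract a) = val (loc p) (to_fract a)"
      using nz a s by (simp add: val_mult[OF loc_dvr] val_loc_nonmember)
    moreover have "val (loc p) (to_fract t * to_fract b) = 1 + val (loc p) (to_fract b)"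
      using nz by (simp add: val_mult[OF loc_dvr] val_unif[OF loc_dvr loc_unif[OF t]])
    ultimately show "to_fract a \<in> mpow (loc p) 1" using eq by (simp add: mpow_def)
  next
    assume "to_fract a \<in> mpow (loc p) 1"
    then show "a \<in> p" using val_loc_nonmember[of a] a by (auto simp: mpow_def)
  qed
qed

text \<open>Affine functions are dense in the local ring: modulo any power of the maximal ideal a
  denominator has an affine inverse.\<close>

lemma loc_approx:
  assumes z: "z \<in> loc p" obtains u where "z - to_fract u \<in> mpow (loc p) (int e)"
proof -
  obtain a s where as: "z = to_fract a / to_fract s" "s \<notin> p" using z by (auto simp: loc_def)
  obtain r where r: "1 - s * r \<in> p" using aff_prime_inverse[OF p as(2)] by metis
  \<comment> \<open>Powers of 1 - s r are again of the form 1 - s q, and the e-th power vanishes to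
    order at least \<open>e\<close>.\<close>
  have "\<exists>q. 1 - s * q = (1 - s * r) ^ e"
  proof (induction e)
    case 0 show ?case by (intro exI[of _ 0]) simp
  next
    case (Suc e)
    then obtain q where q: "1 - s * q = (1 - s * r) ^ e" ..
    have "(1 - s * r) ^ Suc e = (1 - s * r) * (1 - s * q)" unfolding q by simp
    also have "\<dots> = 1 - s * (r + q - s * r * q)" by (simp add: algebra_simps)
    finally show ?case by metis
  qed
  then obtain q where q: "1 - s * q = (1 - s * r) ^ e" ..
  have "z - to_fract (a * q) = to_fract a / to_fract s * to_fract (1 - s * q)"
    using as nonmember_nonzero by (simp add: field_simps)
  moreover have "to_fract (1 - s * q) \<in> mpow (loc p) (int e)"
  proof (cases "1 - s * r = 0")
    case False
    then have nz: "to_fract (1 - s * r) \<noteq> 0" by (simp only: to_fract_eq_0_iff) simp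
    then have "1 \<le> val (loc p) (to_fract (1 - s * r))"
      using mem_iff_mpow[of "1 - s * r"] r by (simp add: mpow_def)
    then have "int e * 1 \<le> int e * val (loc p) (to_fract (1 - s * r))" by (intro mult_left_mono) auto
    then show ?thesis unfolding q to_fract_power
      by (simp only: mpow_def mem_Collect_eq val_power[OF loc_dvr nz] mult_1_right simp_thms)
  next
    case True
    then show ?thesis unfolding q using mpow_0[OF loc_dvr] dvr_one[OF loc_dvr] by (cases e) (auto simp: mpow_def)
  qed
  ultimately have "z - to_fract (a * q) \<in> mpow (loc p) (0 + int e)"
    using as z mpow_mult[OF loc_dvr] mpow_0[OF loc_dvr] by metis
  then show ?thesis using that[of "a * q"] by simp
qed

end

lemma to_fract_mem_loc_inj:
  assumes "aff_prime p" "aff_prime q" "loc p = loc q" shows "p = q"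
  using mem_iff_mpow assms by (metis subsetI subset_antisym)

text \<open>Zorn's lemma yields an ideal maximal among those avoiding 1. It is prime: if
  \<open>a\<close> is outside, then 1 = m + a c, and multiplying by b puts b inside whenever a b
  is.\<close>

lemma exists_aff_prime_superset:
  assumes "aff_ideal I" "a \<in> I" "a \<noteq> 0" "1 \<notin> I"
  obtains p where "aff_prime p" "I \<subseteq> p"
proof -
  define S where "S = {J. aff_ideal J \<and> I \<subseteq> J \<and> 1 \<notin> J}"
  have "\<exists>M\<in>S. \<forall>Y\<in>S. M \<subseteq> Y \<longrightarrow> Y = M"
  proof (rule subset_Zorn_nonempty)
    show "S \<noteq> {}" using assms by (auto simp: S_def)
    fix C assume C: "C \<noteq> {}" "subset.chain S C"
    have "u - v \<in> \<Union> C" if uv: "u \<in> \<Union> C" "v \<in> \<Union> C" for u v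
    proof -
      obtain J J' where J: "J \<in> C" "u \<in> J" "J' \<in> C" "v \<in> J'" using uv by blast
      then have "J \<subseteq> J' \<or> J' \<subseteq> J" using C by (auto simp: subset.chain_def)
      then obtain J0 where "J0 \<in> C" "u \<in> J0" "v \<in> J0" using J by blast
      moreover have "aff_ideal J0" using C \<open>J0 \<in> C\<close> by (auto simp: subset.chain_def S_def)
      ultimately show ?thesis using aff_ideal_closed(3) by blast
    qed
    moreover have "a * b \<in> \<Union> C" if b: "b \<in> \<Union> C" for a b
    proof -
      obtain J where J: "J \<in> C" "b \<in> J" using b by blast
      then have "aff_ideal J" using C by (auto simp: subset.chain_def S_def)
      then show ?thesis using J aff_ideal_closed(5) by blast
    qed
    moreover have "0 \<in> \<Union> C" "I \<subseteq> \<Union> C" "1 \<notin> \<Union> C"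
    proof -
      obtain J where J: "J \<in> C" using C by blast
      then have "aff_ideal J" "I \<subseteq> J" using C by (auto simp: subset.chain_def S_def)
      then show "0 \<in> \<Union> C" "I \<subseteq> \<Union> C" using J aff_ideal_closed(1) by blast+
      show "1 \<notin> \<Union> C" using C by (auto simp: subset.chain_def S_def)
    qed
    ultimately show "\<Union> C \<in> S" by (auto simp: S_def aff_ideal_def add_subgroup_def)
  qed
  then obtain M where M: "aff_ideal M" "I \<subseteq> M" "1 \<notin> M"
    and max: "\<And>Y. aff_ideal Y \<Longrightarrow> 1 \<notin> Y \<Longrightarrow> M \<subseteq> Y \<Longrightarrow> Y = M"
    by (auto simp: S_def)
  have "b \<in> M" if ab: "a * b \<in> M" "a \<notin> M" for a b
  proof -
    define Y where "Y = {m + a * c | m c. m \<in> M}"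
    have "aff_ideal Y"
    proof -
      have "0 \<in> Y" unfolding Y_def using aff_ideal_closed(1)[OF M(1)] by (auto intro!: exI[of _ 0])
      moreover have "x - y \<in> Y" if xy: "x \<in> Y" "y \<in> Y" for x y
      proof -
        obtain m c m' c' where "m \<in> M" "m' \<in> M" "x = m + a * c" "y = m' + a * c'" using xy by (auto simp: Y_def)
        then have "x - y = (m - m') + a * (c - c')" "m - m' \<in> M" using aff_ideal_closed(3)[OF M(1)] by (simp_all add: algebra_simps)
        then show ?thesis unfolding Y_def by blast
      qed
      moreover have "d * x \<in> Y" if x: "x \<in> Y" for d x
      proof -
        obtain m c where "m \<in> M" "x = m + a * c" using x by (auto simp: Y_def)
        then have "d * x = d * m + a * (d * c)" "d * m \<in> M"
          using aff_ideal_closed(5)[OF M(1)] by (simp add: algebra_simps, blast)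
        then show ?thesis unfolding Y_def by blast
      qed
      ultimately show ?thesis by (auto simp: aff_ideal_def add_subgroup_def)
    qed
    moreover have "M \<subseteq> Y"
    proof
      fix m assume "m \<in> M"
      then have "m + a * 0 \<in> Y" unfolding Y_def by blast
      then show "m \<in> Y" by simp
    qed
    moreover have "0 + a * 1 \<in> Y" unfolding Y_def using aff_ideal_closed(1)[OF M(1)] by blast
    ultimately have "1 \<in> Y" using max ab by auto
    then obtain m c where mc: "m \<in> M" "1 = m + a * c" by (auto simp: Y_def)
    have "b = b * (m + a * c)" using mc(2) by simp
    also have "\<dots> = b * m + c * (a * b)" by (simp add: algebra_simps)
    also have "\<dots> \<in> M"
      by (rule aff_ideal_closed(2)[OF M(1) aff_ideal_closed(5)[OF M(1) mc(1)] aff_ideal_closed(5)[OF M(1) ab(1)]])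
    finally show ?thesis .
  qed
  then have "aff_prime M" unfolding aff_prime_def using M assms by blast
  then show ?thesis using that M by blast
qed

text \<open>The denominators of \<open>z\<close> form an ideal. Were it proper, a prime above it
  would contain the denominator that regularity provides outside that prime.\<close>

lemma regular_imp_aff:
  assumes reg: "\<And>p. aff_prime p \<Longrightarrow> z \<in> loc p"
  obtains u where "z = to_fract u"
proof -
  define I where "I = {s. \<exists>u. to_fract s * z = to_fract u}"
  have ideal: "aff_ideal I"
  proof -
    have "0 \<in> I" unfolding I_def by (auto intro!: exI[of _ 0])
    moreover have "x - y \<in> I" if "x \<in> I" "y \<in> I" for x y
    proof -
      obtain u v where "to_fract x * z = to_fract u" "to_fract y * z = to_fract v" using \<open>x \<in> I\<close> \<open>y \<in> I\<close> by (auto simp: I_def)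
      then have "to_fract (x - y) * z = to_fract (u - v)" by (simp add: algebra_simps)
      then show ?thesis unfolding I_def by blast
    qed
    moreover have "a * x \<in> I" if "x \<in> I" for a x
    proof -
      obtain u where "to_fract x * z = to_fract u" using \<open>x \<in> I\<close> by (auto simp: I_def)
      then have "to_fract (a * x) * z = to_fract (a * u)" by (simp add: algebra_simps)
      then show ?thesis unfolding I_def by blast
    qed
    ultimately show ?thesis by (auto simp: aff_ideal_def add_subgroup_def)
  qed
  obtain a b where ab: "z = to_fract a / to_fract b" "b \<noteq> 0"
    by (cases z) (auto simp: to_fract_def)
  then have b: "b \<in> I" unfolding I_def by (auto intro!: exI[of _ a])
  have "1 \<in> I"
  proof (rule ccontr)
    assume "1 \<notin> I"
    then obtain p where p: "aff_prime p" "I \<subseteq> p" using exists_aff_prime_superset[OF ideal b ab(2)] by blast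
    obtain c s where cs: "z = to_fract c / to_fract s" "s \<notin> p" using reg[OF p(1)] by (auto simp: loc_def)
    then have "to_fract s * z = to_fract c" using nonmember_nonzero[OF p(1)] by simp
    then have "s \<in> I" unfolding I_def by blast
    then show False using p cs by blast
  qed
  then show ?thesis using that by (auto simp: I_def)
qed

lemma aff_le_mult:
  assumes "u \<in> aff_le M" "v \<in> aff_le N" shows "u * v \<in> aff_le (M + N)"
  using assms by (cases "u = 0 \<or> v = 0") (auto simp: aff_le_def dg_mult)

text \<open>The order of the residue field, hence 3 to the degree of the point
  (\<open>rcard_pt_degree\<close>).\<close>

definition rcard :: "'a::field set \<Rightarrow> nat" where
  "rcard P = card (cosets P (mpow P 1))"

lemma dvr_mpow_one_proper: assumes "dvr P" shows "1 \<notin> mpow P 1"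
  by (simp add: mpow_def val_one[OF assms])

lemma rcard_ge_2:
  assumes P: "dvr P" and fin: "finite (cosets P (mpow P 1))" shows "2 \<le> rcard P"
proof -
  have "translate (mpow P 1) 0 \<noteq> translate (mpow P 1) 1"
    using translate_eq_iff[OF add_subgroup_mpow[OF P], of 1 1 0] dvr_mpow_one_proper[OF P] by simp
  then have "card {translate (mpow P 1) 0, translate (mpow P 1) 1} = 2" by simp
  moreover have "{translate (mpow P 1) 0, translate (mpow P 1) 1} \<subseteq> cosets P (mpow P 1)"
    using dvr_zero[OF P] dvr_one[OF P] by (auto simp: cosets_def)
  ultimately show ?thesis using card_mono[OF fin] unfolding rcard_def by metis
qed

text \<open>Approximation to first order shows that affine functions already fill the residue field,
  so representatives may be taken in the coordinate ring.\<close>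

lemma loc_residue_bij:
  assumes p: "aff_prime p" and sur: "\<And>u. \<exists>v\<in>V. u - v \<in> p"
    and inj: "\<And>v v'. v \<in> V \<Longrightarrow> v' \<in> V \<Longrightarrow> v - v' \<in> p \<Longrightarrow> v = v'"
  shows "bij_betw (\<lambda>v. translate (mpow (loc p) 1) (to_fract v)) V (cosets (loc p) (mpow (loc p) 1))"
proof -
  note sg = add_subgroup_mpow[OF loc_dvr[OF p], of 1]
  have eq: "translate (mpow (loc p) 1) (to_fract v) = translate (mpow (loc p) 1) (to_fract v') \<longleftrightarrow> v - v' \<in> p" for v v'
    using translate_eq_iff[OF sg] mem_iff_mpow[OF p, of "v - v'"] by simp
  show ?thesis unfolding bij_betw_def
  proof
    show "inj_on (\<lambda>v. translate (mpow (loc p) 1) (to_fract v)) V"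
      using inj eq by (auto intro!: inj_onI)
    show "(\<lambda>v. translate (mpow (loc p) 1) (to_fract v)) ` V = cosets (loc p) (mpow (loc p) 1)"
    proof (intro equalityI subsetI)
      fix C assume "C \<in> cosets (loc p) (mpow (loc p) 1)"
      then obtain z where z: "z \<in> loc p" "C = translate (mpow (loc p) 1) z" by (auto simp: cosets_def)
      obtain u where "z - to_fract u \<in> mpow (loc p) (int 1)" using loc_approx[OF p z(1)] by blast
      then have "C = translate (mpow (loc p) 1) (to_fract u)" using z translate_eq_iff[OF sg] by simp
      moreover obtain v where "v \<in> V" "u - v \<in> p" using sur by blast
      ultimately show "C \<in> (\<lambda>v. translate (mpow (loc p) 1) (to_fract v)) ` V" using eq by blast
    next
      fix C assume "C \<in> (\<lambda>v. translate (mpow (loc p) 1) (to_fract v)) ` V"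
      then show "C \<in> cosets (loc p) (mpow (loc p) 1)" using to_fract_in_loc[OF p] by (auto simp: cosets_def)
    qed
  qed
qed

lemma finite_residue_loc:
  assumes p: "aff_prime p" shows "finite (cosets (loc p) (mpow (loc p) 1))"
proof -
  note sg = add_subgroup_mpow[OF loc_dvr[OF p], of 1]
  obtain \<pi> where \<pi>: "irreducible \<pi>" "lead_coeff \<pi> = 1" "\<And>q. pol q \<in> p \<longleftrightarrow> \<pi> dvd q"
    by (rule aff_prime_under[OF p]) blast
  have \<pi>0: "\<pi> \<noteq> 0" using \<pi> by auto
  define V where "V = {v. (re v = 0 \<or> degree (re v) < degree \<pi>) \<and> (im v = 0 \<or> degree (im v) < degree \<pi>)}"
  have "cosets (loc p) (mpow (loc p) 1) \<subseteq> (\<lambda>v. translate (mpow (loc p) 1) (to_fract v)) ` V"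
  proof
    fix C assume "C \<in> cosets (loc p) (mpow (loc p) 1)"
    then obtain z where z: "z \<in> loc p" "C = translate (mpow (loc p) 1) z" by (auto simp: cosets_def)
    obtain u where u: "z - to_fract u \<in> mpow (loc p) (int 1)" using loc_approx[OF p z(1)] by blast
    obtain v w where v: "v \<in> V" "u = v + pol \<pi> * w" using mod_pol_rep[OF \<pi>0, of u] by (auto simp: V_def)
    have "pol \<pi> * w \<in> p" using aff_prime_closed(6)[OF p] \<pi> by simp
    then have "to_fract (pol \<pi> * w) \<in> mpow (loc p) 1" using mem_iff_mpow[OF p] by blast
    then have "z - to_fract u + to_fract (pol \<pi> * w) \<in> mpow (loc p) 1" using u add_subgroup_add[OF sg] by simp
    then have "z - to_fract v \<in> mpow (loc p) 1" using v by simp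
    then show "C \<in> (\<lambda>v. translate (mpow (loc p) 1) (to_fract v)) ` V" using v z translate_eq_iff[OF sg] by blast
  qed
  then show ?thesis using card_mod_pol_reps(2) unfolding V_def by (meson finite_surj)
qed

subsection \<open>Points with prescribed \<open>x\<close>-coordinate\<close>

text \<open>The kernel of the reduction to F_3[x] / (\<open>\<pi>\<close>) that sends y to
  \<open>g\<close>. With \<open>g = 0\<close> and the cubic it is the point where y
  vanishes.\<close>

definition split_prime :: "f3 poly \<Rightarrow> f3 poly \<Rightarrow> aff set" where
  "split_prime \<pi> g = {u. \<pi> dvd re u + im u * g}"

text \<open>The ideal generated by \<open>\<pi>\<close>, the only candidate over
  \<open>\<pi>\<close> when the cubic has no square root modulo it
  (\<open>prime_over\<close>).\<close>

definition inert_prime :: "f3 poly \<Rightarrow> aff set" where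
  "inert_prime \<pi> = {u. \<pi> dvd re u \<and> \<pi> dvd im u}"

lemma split_prime_pol: "pol q \<in> split_prime \<pi> g \<longleftrightarrow> \<pi> dvd q"
  by (simp add: split_prime_def)

text \<open>Sending y to \<open>g\<close> respects y^2 = cubic modulo \<open>\<pi>\<close>; the
  error term in \<open>e_mult\<close> is a multiple of g^2 - cubic.\<close>

lemma aff_prime_split:
  assumes irr: "irreducible \<pi>" and g: "\<pi> dvd g * g - cubic"
  shows "aff_prime (split_prime \<pi> g)"
proof -
  have pr: "prime_elem \<pi>" using irr by (rule field_poly_irreducible_imp_prime)
  define e where "e u = re u + im u * g" for u
  have e_mult: "e (u * v) = e u * e v - im u * im v * (g * g - cubic)" for u v
    by (simp add: e_def algebra_simps)
  have mult: "\<pi> dvd e (u * v) \<longleftrightarrow> \<pi> dvd e u \<or> \<pi> dvd e v" for u v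
  proof -
    have "\<pi> dvd im u * im v * (g * g - cubic)" using g by simp
    then have "\<pi> dvd e (u * v) \<longleftrightarrow> \<pi> dvd e u * e v"
      unfolding e_mult using dvd_diff[of \<pi>] by (metis diff_add_cancel dvd_add)
    then show ?thesis using pr by (simp add: prime_elem_dvd_mult_iff)
  qed
  have d: "e (u - v) = e u - e v" for u v by (simp add: e_def algebra_simps)
  have m: "u \<in> split_prime \<pi> g \<longleftrightarrow> \<pi> dvd e u" for u by (simp add: split_prime_def e_def)
  have "\<not> \<pi> dvd 1" using irr by (rule irreducible_not_unit)
  moreover have "pol \<pi> \<in> split_prime \<pi> g" "pol \<pi> \<noteq> 0" using irr by (auto simp: split_prime_pol)
  moreover have "e 0 = 0" "e 1 = 1" by (simp_all add: e_def)
  ultimately have 1: "1 \<notin> split_prime \<pi> g" "0 \<in> split_prime \<pi> g"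
    unfolding m by auto
  have ex: "\<exists>a\<in>split_prime \<pi> g. a \<noteq> 0"
    using irr by (intro bexI[of _ "pol \<pi>"]) (auto simp: split_prime_pol)
  have diff: "u - v \<in> split_prime \<pi> g" if "u \<in> split_prime \<pi> g" "v \<in> split_prime \<pi> g" for u v
    using that unfolding m d by (rule dvd_diff)
  have "u * v \<in> split_prime \<pi> g \<longleftrightarrow> u \<in> split_prime \<pi> g \<or> v \<in> split_prime \<pi> g" for u v
    using mult unfolding m .
  then show ?thesis
    unfolding aff_prime_def aff_ideal_def add_subgroup_def using 1 ex diff by simp
qed

text \<open>If some element of \<open>p\<close> has a second coordinate that is invertible modulo
  \<open>p\<close>, solving for y gives a square root of the cubic; otherwise every element of
  \<open>p\<close> is a multiple of \<open>\<pi>\<close>.\<close>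

lemma prime_over:
  assumes p: "aff_prime p" and irr: "irreducible \<pi>" and \<pi>p: "pol \<pi> \<in> p"
  shows "(\<exists>g. \<pi> dvd g * g - cubic \<and> p = split_prime \<pi> g) \<or> p = inert_prime \<pi>"
proof -
  obtain \<pi>' where \<pi>': "irreducible \<pi>'" "lead_coeff \<pi>' = 1" "\<And>q. pol q \<in> p \<longleftrightarrow> \<pi>' dvd q"
    by (rule aff_prime_under[OF p]) blast
  have "\<pi>' dvd \<pi>" using \<pi>p \<pi>' by simp
  then have "\<pi> dvd \<pi>'" using irr \<pi>'(1) by (meson irreducibleD' irreducible_not_unit)
  then have dvd: "pol q \<in> p \<longleftrightarrow> \<pi> dvd q" for q using \<pi>'(3) \<open>\<pi>' dvd \<pi>\<close> by (meson dvd_trans)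
  show ?thesis
  proof (cases "\<exists>u\<in>p. \<not> \<pi> dvd im u")
    case True
    then obtain u where u: "u \<in> p" "\<not> \<pi> dvd im u" by blast
    have "pol (im u) \<notin> p" using u dvd by blast
    then obtain k where k: "1 - pol (im u) * pol (im u) ^ k \<in> p" by (rule aff_prime_inverse[OF p])
    \<comment> \<open>\<open>g\<close> is - re u / im u modulo \<open>p\<close>, with
      \<open>im u ^ k\<close> as the inverse of \<open>im u\<close>.\<close>
    define g where "g = - (im u ^ k * re u)"
    have "pol (im u) * (ycoord - pol g) = u - (1 - pol (im u) * pol (im u) ^ k) * pol (re u)"
      unfolding pol_power[symmetric] by (simp add: aff_eq_iff g_def algebra_simps del: pol_power)
    moreover have "u - (1 - pol (im u) * pol (im u) ^ k) * pol (re u) \<in> p"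
      by (rule aff_prime_closed(3)[OF p u(1) aff_prime_closed(6)[OF p k]])
    ultimately have yg: "ycoord - pol g \<in> p"
      using \<open>pol (im u) \<notin> p\<close> aff_prime_mult[OF p] by metis
    have mem: "v \<in> p \<longleftrightarrow> \<pi> dvd re v + im v * g" for v
    proof -
      have in_p: "pol (im v) * (ycoord - pol g) \<in> p" by (rule aff_prime_closed(5)[OF p yg])
      have eqs: "pol (re v + im v * g) + pol (im v) * (ycoord - pol g) = v"
        "v - pol (im v) * (ycoord - pol g) = pol (re v + im v * g)"
        by (simp_all add: aff_eq_iff algebra_simps)
      have "v \<in> p \<longleftrightarrow> pol (re v + im v * g) \<in> p"
        using aff_prime_closed(2)[OF p _ in_p] aff_prime_closed(3)[OF p _ in_p] eqs by metis
      then show ?thesis unfolding dvd .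
    qed
    have "(ycoord - pol g) * (ycoord + pol g) \<in> p" by (rule aff_prime_closed(6)[OF p yg])
    moreover have "(ycoord - pol g) * (ycoord + pol g) = - pol (g * g - cubic)"
      by (simp add: aff_eq_iff algebra_simps)
    ultimately have "- (- pol (g * g - cubic)) \<in> p" using aff_prime_closed(4)[OF p] by metis
    then have "\<pi> dvd g * g - cubic" using dvd by (metis minus_minus)
    moreover have "p = split_prime \<pi> g" using mem by (auto simp: split_prime_def)
    ultimately show ?thesis by blast
  next
    case False
    have "\<pi> dvd re u \<and> \<pi> dvd im u" if u: "u \<in> p" for u
    proof
      show "\<pi> dvd im u" using False u by blast
      then have "pol (im u) * ycoord \<in> p" using dvd aff_prime_closed(6)[OF p] by blast
      then have "u - pol (im u) * ycoord \<in> p" using u aff_prime_closed(3)[OF p] by blast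
      moreover have "u - pol (im u) * ycoord = pol (re u)" by (simp add: aff_eq_iff)
      ultimately show "\<pi> dvd re u" using dvd by metis
    qed
    moreover have "u \<in> p" if "\<pi> dvd re u \<and> \<pi> dvd im u" for u
    proof -
      have "pol (re u) \<in> p" "pol (im u) * ycoord \<in> p" using that dvd aff_prime_closed(6)[OF p] by blast+
      then show ?thesis by (subst aff_decomp) (rule aff_prime_closed(2)[OF p])
    qed
    ultimately have "p = inert_prime \<pi>" unfolding inert_prime_def by blast
    then show ?thesis by blast
  qed
qed

text \<open>(y - g)(y + g) is a multiple of \<open>\<pi>\<close>, so one factor lies in
  \<open>p\<close> and fixes the residue of y up to sign.\<close>

lemma prime_over_split:
  assumes p: "aff_prime p" and irr: "irreducible \<pi>" and \<pi>p: "pol \<pi> \<in> p" and g: "\<pi> dvd g * g - cubic"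
  shows "p = split_prime \<pi> g \<or> p = split_prime \<pi> (- g)"
proof -
  have pr: "prime_elem \<pi>" using irr by (rule field_poly_irreducible_imp_prime)
  obtain c where c: "g * g - cubic = \<pi> * c" using g by (auto elim: dvdE)
  have "(ycoord - pol g) * (ycoord + pol g) = pol \<pi> * pol (- c)"
    using c by (simp add: aff_eq_iff algebra_simps)
  then have "(ycoord - pol g) * (ycoord + pol g) \<in> p" using aff_prime_closed(6)[OF p \<pi>p] by metis
  then have y: "ycoord - pol g \<in> p \<or> ycoord + pol g \<in> p" using aff_prime_mult[OF p] by blast
  have "p \<noteq> inert_prime \<pi>"
    using y irreducible_not_unit[OF irr] by (auto simp: inert_prime_def)
  then obtain g' where g': "p = split_prime \<pi> g'" using prime_over[OF p irr \<pi>p] by blast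
  have cong: "split_prime \<pi> g' = split_prime \<pi> h" if "\<pi> dvd g' - h" for h
  proof -
    have "\<pi> dvd re u + im u * g' \<longleftrightarrow> \<pi> dvd re u + im u * h" for u
    proof -
      have "\<pi> dvd im u * (g' - h)" using that by simp
      moreover have "re u + im u * g' = (re u + im u * h) + im u * (g' - h)" by (simp add: algebra_simps)
      ultimately show ?thesis by (metis dvd_add_left_iff)
    qed
    then show ?thesis by (simp add: split_prime_def)
  qed
  show ?thesis using y
  proof
    assume "ycoord - pol g \<in> p"
    then have "\<pi> dvd g' - g" unfolding g' by (simp add: split_prime_def)
    then show ?thesis using cong g' by blast
  next
    assume "ycoord + pol g \<in> p"
    then have "\<pi> dvd g' - (- g)" unfolding g' by (simp add: split_prime_def add.commute)
    then show ?thesis using cong g' by blast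
  qed
qed

lemma rcard_split:
  assumes irr: "irreducible \<pi>" and g: "\<pi> dvd g * g - cubic"
  shows "rcard (loc (split_prime \<pi> g)) = 3 ^ degree \<pi>"
proof -
  have \<pi>0: "\<pi> \<noteq> 0" using irr by auto
  let ?S = "{q :: f3 poly. q = 0 \<or> degree q < degree \<pi>}"
  have "bij_betw (\<lambda>v. translate (mpow (loc (split_prime \<pi> g)) 1) (to_fract v)) (pol ` ?S)
      (cosets (loc (split_prime \<pi> g)) (mpow (loc (split_prime \<pi> g)) 1))"
  proof (rule loc_residue_bij[OF aff_prime_split[OF irr g]])
    fix u
    define q where "q = (re u + im u * g) mod \<pi>"
    have "q \<in> ?S" using \<pi>0 degree_mod_less by (auto simp: q_def)
    moreover have "\<pi> dvd (re u + im u * g) - q" by (simp add: q_def dvd_minus_mod)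
    then have "u - pol q \<in> split_prime \<pi> g" by (simp add: split_prime_def algebra_simps)
    ultimately show "\<exists>v\<in>pol ` ?S. u - v \<in> split_prime \<pi> g" by blast
  next
    fix v v' assume "v \<in> pol ` ?S" "v' \<in> pol ` ?S" "v - v' \<in> split_prime \<pi> g"
    then obtain q q' where q: "v = pol q" "v' = pol q'" "q \<in> ?S" "q' \<in> ?S" "\<pi> dvd q - q'"
      by (auto simp: split_prime_def)
    have "q - q' = 0 \<or> degree (q - q') < degree \<pi>"
      using q by (cases "q = 0"; cases "q' = 0") (auto intro: degree_diff_less)
    then have "q - q' = 0" using dvd_imp_degree_le[OF q(5)] by (meson leD)
    then show "v = v'" using q by simp
  qed
  from bij_betw_same_card[OF this] have "rcard (loc (split_prime \<pi> g)) = card (pol ` ?S)"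
    unfolding rcard_def by simp
  also have "\<dots> = card ?S" by (rule card_image) (auto intro!: inj_onI)
  finally show ?thesis by (simp add: card_poly_degree_less card_f3)
qed

text \<open>Both coordinates are free modulo \<open>\<pi>\<close>, so the degree of the point is
  twice that of \<open>\<pi>\<close>.\<close>

lemma rcard_inert:
  assumes irr: "irreducible \<pi>" and p: "aff_prime (inert_prime \<pi>)"
  shows "rcard (loc (inert_prime \<pi>)) = 9 ^ degree \<pi>"
proof -
  have \<pi>0: "\<pi> \<noteq> 0" using irr by auto
  define V where "V = {v. (re v = 0 \<or> degree (re v) < degree \<pi>) \<and> (im v = 0 \<or> degree (im v) < degree \<pi>)}"
  have "bij_betw (\<lambda>v. translate (mpow (loc (inert_prime \<pi>)) 1) (to_fract v)) V
      (cosets (loc (inert_prime \<pi>)) (mpow (loc (inert_prime \<pi>)) 1))"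
  proof (rule loc_residue_bij[OF p])
    fix u
    obtain v w where v: "v \<in> V" "u = v + pol \<pi> * w" using mod_pol_rep[OF \<pi>0, of u] by (auto simp: V_def)
    then have "u - v \<in> inert_prime \<pi>" by (simp add: inert_prime_def)
    then show "\<exists>v\<in>V. u - v \<in> inert_prime \<pi>" using v by blast
  next
    fix v v' assume v: "v \<in> V" "v' \<in> V" "v - v' \<in> inert_prime \<pi>"
    have *: "q = q'" if "q = 0 \<or> degree q < degree \<pi>" "q' = 0 \<or> degree q' < degree \<pi>" "\<pi> dvd q - q'" for q q'
    proof -
      have "q - q' = 0 \<or> degree (q - q') < degree \<pi>"
        using that by (cases "q = 0"; cases "q' = 0") (auto intro: degree_diff_less)
      then have "q - q' = 0" using dvd_imp_degree_le[OF that(3)] by (meson leD)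
      then show ?thesis by simp
    qed
    then show "v = v'" using v by (auto simp: V_def inert_prime_def aff_eq_iff)
  qed
  from bij_betw_same_card[OF this] show ?thesis
    unfolding rcard_def V_def card_mod_pol_reps(1) by simp
qed

subsection \<open>The point at infinity\<close>

definition inf_ring :: "aff fract set" where
  "inf_ring = {to_fract a / to_fract b | a b. b \<noteq> 0 \<and> (a = 0 \<or> dg a \<le> dg b)}"

lemma fract_rep:
  fixes f :: "aff fract"
  obtains a b where "f = to_fract a / to_fract b" "b \<noteq> 0"
  by (cases f) (auto simp: to_fract_def)

lemma inf_ring_mem_iff:
  assumes "a \<noteq> 0" "b \<noteq> 0" shows "to_fract a / to_fract b \<in> inf_ring \<longleftrightarrow> dg a \<le> dg b"
proof
  assume "to_fract a / to_fract b \<in> inf_ring"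
  then obtain c d where cd: "to_fract a / to_fract b = to_fract c / to_fract d" "d \<noteq> 0" "c = 0 \<or> dg c \<le> dg d"
    by (auto simp: inf_ring_def)
  have "to_fract (a * d) = to_fract (c * b)" using cd assms by (simp add: field_simps)
  then have eq: "a * d = c * b" unfolding to_fract_eq_iff .
  then have "c \<noteq> 0" using assms cd by auto
  then have "dg a + dg d = dg c + dg b" using eq assms cd dg_mult by metis
  then show "dg a \<le> dg b" using cd \<open>c \<noteq> 0\<close> by simp
qed (use assms in \<open>auto simp: inf_ring_def\<close>)

text \<open>x / y has order 3 - 2 = 1 at infinity.\<close>

definition inf_param :: "aff fract" where
  "inf_param = to_fract (pol [:0, 1:]) / to_fract ycoord"

lemma ycoord_nonzero: "ycoord \<noteq> 0"
  by (simp add: aff_eq_iff)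

lemma unit_in_inf_ring: "a \<noteq> 0 \<Longrightarrow> b \<noteq> 0 \<Longrightarrow> dg a = dg b \<Longrightarrow> unit_in inf_ring (to_fract a / to_fract b)"
  by (simp add: unit_in_def inf_ring_mem_iff)

text \<open>A power of x / y absorbs the difference of the pole orders and leaves a quotient of
  functions of equal pole order, which is a unit.\<close>

lemma inf_rep:
  assumes ab: "a \<noteq> 0" "b \<noteq> 0"
  shows "\<exists>u. unit_in inf_ring u \<and> to_fract a / to_fract b = inf_param powi (int (dg b) - int (dg a)) * u"
proof -
  let ?x = "pol [:0, 1:]"
  have x: "?x \<noteq> 0" "dg ?x = 2" by (simp_all add: dg_pol)
  note y = ycoord_nonzero dg_ycoord
  show ?thesis
  proof (cases "dg a \<le> dg b")
    case True
    define n where "n = dg b - dg a"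
    have "inf_param powi (int (dg b) - int (dg a)) = to_fract (?x ^ n) / to_fract (ycoord ^ n)"
      using True by (simp add: n_def inf_param_def power_int_def nat_diff_distrib power_divide to_fract_power
          flip: of_nat_diff)
    then have "to_fract a / to_fract b = inf_param powi (int (dg b) - int (dg a)) *
        (to_fract (a * ycoord ^ n) / to_fract (b * ?x ^ n))"
      using ab x(1) y(1) by (simp add: to_fract_power field_simps)
    moreover have "unit_in inf_ring (to_fract (a * ycoord ^ n) / to_fract (b * ?x ^ n))"
      using ab x y True by (intro unit_in_inf_ring) (simp_all add: dg_mult dg_power n_def)
    ultimately show ?thesis by blast
  next
    case False
    define n where "n = dg a - dg b"
    have e: "int (dg b) - int (dg a) = - int n" using False by (simp add: n_def)
    have "inf_param powi (int (dg b) - int (dg a)) = to_fract (ycoord ^ n) / to_fract (?x ^ n)"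
      unfolding e by (simp add: inf_param_def power_int_minus power_divide to_fract_power)
    then have "to_fract a / to_fract b = inf_param powi (int (dg b) - int (dg a)) *
        (to_fract (a * ?x ^ n) / to_fract (b * ycoord ^ n))"
      using ab x(1) y(1) by (simp add: to_fract_power field_simps)
    moreover have "unit_in inf_ring (to_fract (a * ?x ^ n) / to_fract (b * ycoord ^ n))"
      using ab x y False by (intro unit_in_inf_ring) (simp_all add: dg_mult dg_power n_def)
    ultimately show ?thesis by blast
  qed
qed

lemma inf_unif: "unif inf_ring inf_param"
proof -
  have x: "pol [:0, 1:] \<noteq> 0" "dg (pol [:0, 1:]) = 2" by (simp_all add: dg_pol)
  have "inf_param \<in> inf_ring" "inverse inf_param \<notin> inf_ring" "inf_param \<noteq> 0"
    using x ycoord_nonzero by (simp_all add: inf_param_def inf_ring_mem_iff dg_ycoord)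
  moreover have "\<exists>n::int. \<exists>u. unit_in inf_ring u \<and> f = inf_param powi n * u" if "f \<noteq> 0" for f
  proof -
    obtain a b where "f = to_fract a / to_fract b" "b \<noteq> 0" by (rule fract_rep)
    then show ?thesis using inf_rep[of a b] that by auto
  qed
  ultimately show ?thesis by (simp add: unif_def)
qed

lemma inf_dvr: "dvr inf_ring"
proof -
  have "x - y \<in> inf_ring \<and> x * y \<in> inf_ring" if xy: "x \<in> inf_ring" "y \<in> inf_ring" for x y
  proof -
    obtain a b c d where 1: "x = to_fract a / to_fract b" "b \<noteq> 0" "a = 0 \<or> dg a \<le> dg b"
      "y = to_fract c / to_fract d" "d \<noteq> 0" "c = 0 \<or> dg c \<le> dg d"
      using xy by (auto simp: inf_ring_def)
    have eqs: "x - y = to_fract (a * d - c * b) / to_fract (b * d)" "x * y = to_fract (a * c) / to_fract (b * d)"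
      unfolding 1(1) 1(4) using 1(2) 1(5) by (simp_all add: field_simps)
    have bd: "b * d \<noteq> 0" "dg (b * d) = dg b + dg d" using 1 by (simp_all add: dg_mult)
    have "a * d \<in> aff_le (dg b + dg d)" "c * b \<in> aff_le (dg d + dg b)"
      using 1 aff_le_mult[of a "dg b" d "dg d"] aff_le_mult[of c "dg d" b "dg b"]
      by (simp_all add: aff_le_def)
    then have "a * d - c * b \<in> aff_le (dg b + dg d)" by (simp add: add.commute add_subgroup_diff[OF add_subgroup_aff_le])
    then have "a * d - c * b = 0 \<or> dg (a * d - c * b) \<le> dg (b * d)" by (simp add: aff_le_def bd(2))
    then have "x - y \<in> inf_ring" unfolding eqs inf_ring_def using bd(1) by blast
    moreover have "a * c = 0 \<or> dg (a * c) \<le> dg (b * d)"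
      using 1 bd by (cases "a = 0 \<or> c = 0") (auto simp: dg_mult)
    then have "x * y \<in> inf_ring" unfolding eqs inf_ring_def using bd by blast
    ultimately show ?thesis ..
  qed
  moreover have "1 \<in> inf_ring" using inf_ring_mem_iff[of 1 1] by simp
  ultimately show ?thesis using inf_unif by (auto simp: dvr_def)
qed

lemma val_inf: "a \<noteq> 0 \<Longrightarrow> b \<noteq> 0 \<Longrightarrow> val inf_ring (to_fract a / to_fract b) = int (dg b) - int (dg a)"
  using inf_rep val_eqI[OF inf_dvr inf_unif] by blast

lemma val_inf_aff: "a \<noteq> 0 \<Longrightarrow> val inf_ring (to_fract a) = - int (dg a)"
  using val_inf[of a 1] by simp

text \<open>Subtracting the right multiple of the denominator cancels the leading coefficient of the
  numerator. For even pole order that coefficient sits in the first coordinate, for odd order in the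
  second.\<close>

lemma inf_residue: 
  assumes z: "z \<in> inf_ring" shows "\<exists>c. z - to_fract (pol [:c:]) \<in> mpow inf_ring 1"
proof -
  obtain a b where ab: "z = to_fract a / to_fract b" "b \<noteq> 0" "a = 0 \<or> dg a \<le> dg b" using z by (auto simp: inf_ring_def)
  have "\<exists>c. a - pol [:c:] * b = 0 \<or> dg (a - pol [:c:] * b) < dg b"
  proof (cases "dg b")
    case 0
    then have "a \<in> aff_le 0" "b \<in> aff_le 0" using ab by (auto simp: aff_le_def)
    then obtain c d where cd: "a = pol [:c:]" "b = pol [:d:]" using aff_le_0 by blast
    then have "d \<noteq> 0" using ab by auto
    then have "a - pol [:c / d:] * b = 0" unfolding cd by (simp add: aff_eq_iff)
    then show ?thesis by blast
  next
    case (Suc N)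
    have a: "a \<in> aff_le (Suc N)" using ab Suc by (auto simp: aff_le_def)
    have bN: "b \<in> aff_le (Suc N)" "b \<notin> aff_le N" using ab Suc by (auto simp: aff_le_def)
    have "\<exists>c. a - pol [:c:] * b \<in> aff_le N"
    proof (cases "even (Suc N)")
      case True
      then obtain k where k: "Suc N = 2 * k" by (elim evenE)
      have iff: "v \<in> aff_le N \<longleftrightarrow> coeff (re v) k = 0" if "v \<in> aff_le (Suc N)" for v
      proof
        assume "v \<in> aff_le N"
        then have "degree (re v) < k" using k by (auto simp: aff_le_iff)
        then show "coeff (re v) k = 0" by (rule coeff_eq_0)
      next
        assume z: "coeff (re v) k = 0"
        have le: "degree (re v) \<le> k" "im v = 0 \<or> 2 * degree (im v) + 3 \<le> Suc N" using that k by (auto simp: aff_le_iff)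
        have k0: "k > 0" using k by simp
        have "degree (re v) < k"
          using le(1) z k0 by (metis degree_0 leading_coeff_0_iff le_neq_implies_less)
        moreover have "im v = 0 \<or> 2 * degree (im v) + 3 \<le> N" using le(2) k by (cases "im v = 0") (simp, presburger)
        ultimately show "v \<in> aff_le N" using k by (auto simp: aff_le_iff)
      qed
      define c where "c = coeff (re a) k / coeff (re b) k"
      have "coeff (re b) k \<noteq> 0" using bN iff by blast
      then have "coeff (re (a - pol [:c:] * b)) k = 0" by (simp add: c_def)
      moreover have "pol [:c:] * b \<in> aff_le (Suc N)" using bN(1) by (auto simp: aff_le_iff intro: le_trans)
      ultimately show ?thesis using iff add_subgroup_diff[OF add_subgroup_aff_le a] by blast
    next
      case False
      show ?thesis
      \<comment> \<open>No function has pole order one, so \<open>b\<close> cannot exist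
        here.\<close>
      proof (cases "Suc N = 1")
        case True
        then have "aff_le (Suc N) = aff_le N" by (auto simp: aff_le_iff)
        then show ?thesis using bN by simp
      next
        case N1: False
        from False obtain j where "Suc N = 2 * j + 1" by (elim oddE)
        then obtain k where k: "Suc N = 2 * k + 3" using that[of "j - 1"] N1 by (cases j) auto
        have iff: "v \<in> aff_le N \<longleftrightarrow> coeff (im v) k = 0" if "v \<in> aff_le (Suc N)" for v
        proof
          assume "v \<in> aff_le N"
          then have "im v = 0 \<or> degree (im v) < k" using k by (auto simp: aff_le_iff)
          then show "coeff (im v) k = 0" using coeff_eq_0 by auto
        next
          assume z: "coeff (im v) k = 0"
          have le: "2 * degree (re v) \<le> Suc N" "im v = 0 \<or> degree (im v) \<le> k" using that k by (auto simp: aff_le_iff)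
          have "im v = 0 \<or> degree (im v) < k"
            using le(2) z by (metis leading_coeff_0_iff le_neq_implies_less)
          moreover have "2 * degree (re v) \<le> N" using le(1) k by presburger
          ultimately show "v \<in> aff_le N" using k by (auto simp: aff_le_iff)
        qed
        define c where "c = coeff (im a) k / coeff (im b) k"
        have "coeff (im b) k \<noteq> 0" using bN iff by blast
        then have "coeff (im (a - pol [:c:] * b)) k = 0" by (simp add: c_def)
        moreover have "pol [:c:] * b \<in> aff_le (Suc N)" using bN(1) by (auto simp: aff_le_iff intro: le_trans)
        ultimately show ?thesis using iff add_subgroup_diff[OF add_subgroup_aff_le a] by blast
      qed
    qed
    then show ?thesis using Suc by (auto simp: aff_le_def less_Suc_eq_le)
  qed
  then obtain c where c: "a - pol [:c:] * b = 0 \<or> dg (a - pol [:c:] * b) < dg b" ..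
  have eq: "z - to_fract (pol [:c:]) = to_fract (a - pol [:c:] * b) / to_fract b"
    unfolding ab(1) using ab(2) by (simp add: field_simps)
  show ?thesis
  proof (cases "a - pol [:c:] * b = 0")
    case True
    then show ?thesis unfolding mpow_def by (intro exI[of _ c]) (simp add: eq del: to_fract_diff)
  next
    case False
    then have "val inf_ring (z - to_fract (pol [:c:])) \<ge> 1" unfolding eq using c ab(2) by (simp add: val_inf del: to_fract_diff)
    then show ?thesis unfolding mpow_def by blast
  qed
qed

lemma inf_cosets: "cosets inf_ring (mpow inf_ring 1) = (\<lambda>c. translate (mpow inf_ring 1) (to_fract (pol [:c:]))) ` UNIV"
proof -
  note sg = add_subgroup_mpow[OF inf_dvr, of 1]
  have "to_fract (pol [:c:]) \<in> inf_ring" for c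
    using inf_ring_mem_iff[of "pol [:c:]" 1] dvr_zero[OF inf_dvr] by (cases "c = 0") (auto simp: dg_pol)
  then show ?thesis using inf_residue translate_eq_iff[OF sg] by (auto simp: cosets_def image_iff)
qed

lemma finite_residue_inf: "finite (cosets inf_ring (mpow inf_ring 1))"
  unfolding inf_cosets by simp

lemma rcard_inf: "rcard inf_ring = 3"
proof -
  note sg = add_subgroup_mpow[OF inf_dvr, of 1]
  have "inj (\<lambda>c. translate (mpow inf_ring 1) (to_fract (pol [:c:])))"
  proof (rule injI)
    fix c d assume "translate (mpow inf_ring 1) (to_fract (pol [:c:])) = translate (mpow inf_ring 1) (to_fract (pol [:d:]))"
    then have m: "to_fract (pol [:c:]) - to_fract (pol [:d:]) \<in> mpow inf_ring 1" using translate_eq_iff[OF sg] by blast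
    have "to_fract (pol [:c:]) - to_fract (pol [:d:]) = to_fract (pol [:c - d:])"
      by (simp flip: to_fract_diff pol_simps(5))
    moreover have "to_fract (pol [:c - d:]) \<in> mpow inf_ring 1 \<longleftrightarrow> c = d"
      using val_inf_aff[of "pol [:c - d:]"] by (cases "c = d") (auto simp: mpow_def dg_pol)
    ultimately show "c = d" using m by simp
  qed
  then show ?thesis unfolding rcard_def inf_cosets by (simp add: card_image card_f3)
qed

subsection \<open>There are no further closed points\<close>

text \<open>The constants 0, 1 and -1 belong to every discrete valuation ring, so x generates all
  polynomials inside \<open>P\<close>.\<close>

lemma dvr_pol_mem:
  assumes P: "dvr P" and x: "to_fract (pol [:0, 1:]) \<in> P" shows "to_fract (pol q) \<in> P"
proof (induction q)
  case 0 show ?case using dvr_zero[OF P] by simp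
next
  case (pCons a q)
  have "to_fract (pol [:a:]) \<in> P"
  proof (cases a rule: f3_cases)
    case 3
    then have "pol [:a:] = - 1" by (simp add: aff_eq_iff one_pCons)
    then show ?thesis using dvr_uminus[OF P dvr_one[OF P]] by simp
  qed (use dvr_zero[OF P] dvr_one[OF P] in \<open>simp_all flip: one_pCons\<close>)
  moreover have "pol (pCons a q) = pol [:a:] + pol [:0, 1:] * pol q" by (simp add: aff_eq_iff)
  ultimately show ?case using pCons x dvr_mult[OF P] dvr_add[OF P] by (metis to_fract_add to_fract_mult)
qed

text \<open>Since y is integral over F_3[x], the coordinate ring lies in \<open>P\<close>. The
  centre of \<open>P\<close> on it is a nonzero prime \<open>p\<close>, and \<open>loc p\<close>
  agrees with \<open>P\<close> by maximality.\<close>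

lemma dvr_finite_classification:
  assumes P: "dvr P" and x: "to_fract (pol [:0, 1:]) \<in> P"
  shows "\<exists>p. aff_prime p \<and> P = loc p"
proof -
  \<comment> \<open>A pole of y would be a pole of y^2, which is a polynomial in x.\<close>
  have "to_fract ycoord \<in> P"
  proof (rule ccontr)
    assume "to_fract ycoord \<notin> P"
    moreover have nz: "to_fract ycoord \<noteq> 0" using ycoord_nonzero by simp
    ultimately have "val P (to_fract ycoord) < 0" using mem_iff_val[OF P] by fastforce
    then have "val P (to_fract ycoord * to_fract ycoord) < 0" by (simp only: val_mult[OF P nz nz])
    moreover have "to_fract ycoord * to_fract ycoord = to_fract (pol cubic)" by (metis to_fract_mult ycoord_sq)
    ultimately show False
      using dvr_pol_mem[OF P x, of cubic] mem_iff_val[OF P, of "to_fract (pol cubic)"] cubic_nonzero by simp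
  qed
  then have A: "to_fract u \<in> P" for u
    using dvr_pol_mem[OF P x] dvr_mult[OF P] dvr_add[OF P]
    by (subst aff_decomp) (simp del: pol_simps)
  define p where "p = {u. to_fract u \<in> mpow P 1}"
  note sg = add_subgroup_mpow[OF P, of 1]
  have v0: "val P (to_fract s) = 0" if "s \<notin> p" for s
  proof -
    have "s \<noteq> 0" "\<not> 1 \<le> val P (to_fract s)" using that by (auto simp: p_def mpow_def)
    then show ?thesis using A[of s] mem_iff_val[OF P, of "to_fract s"] by simp
  qed
  have nz: "s \<noteq> 0" if "s \<notin> p" for s using that by (auto simp: p_def mpow_def)
  have "0 \<in> p" by (simp add: p_def mpow_def)
  moreover have "u - v \<in> p" if "u \<in> p" "v \<in> p" for u v
    using that add_subgroup_diff[OF sg] by (simp add: p_def)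
  moreover have "a * b \<in> p" if "b \<in> p" for a b
    using that mpow_mult[OF P, of "to_fract a" 0 "to_fract b" 1] A by (simp add: p_def mpow_0[OF P])
  moreover have "1 \<notin> p" using dvr_mpow_one_proper[OF P] by (simp add: p_def)
  moreover have "a \<in> p \<or> b \<in> p" if "a * b \<in> p" for a b
  proof (rule ccontr)
    assume "\<not> (a \<in> p \<or> b \<in> p)"
    then have "a * b \<noteq> 0" "val P (to_fract a * to_fract b) = 0" using v0 nz by (simp_all add: val_mult[OF P])
    then show False using that by (simp add: p_def mpow_def)
  qed
  moreover have "\<exists>a\<in>p. a \<noteq> 0"
  proof -
    obtain t where t: "unif P t" by (rule dvr_obtain_unif[OF P])
    obtain a b where ab: "t = to_fract a / to_fract b" "b \<noteq> 0" by (rule fract_rep)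
    have "t \<noteq> 0" "val P t = 1" using t val_unif[OF P t] by (auto simp: unif_def)
    then have a: "a \<noteq> 0" using ab by auto
    have "val P (to_fract a) - val P (to_fract b) = 1"
      using \<open>val P t = 1\<close> a ab by (simp add: val_divide[OF P])
    moreover have "0 \<le> val P (to_fract b)" using A[of b] ab mem_iff_val[OF P, of "to_fract b"] by simp
    ultimately have "a \<in> p" by (simp add: p_def mpow_def)
    then show ?thesis using a by blast
  qed
  ultimately have p: "aff_prime p" unfolding aff_prime_def aff_ideal_def add_subgroup_def by simp
  have sub: "loc p \<subseteq> P"
  proof
    fix z assume "z \<in> loc p"
    then obtain a s where as: "z = to_fract a / to_fract s" "s \<notin> p" by (auto simp: loc_def)
    show "z \<in> P"
    proof (cases "a = 0")
      case False
      then have "0 \<le> val P z"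
        using as v0 nz A[of a] mem_iff_val[OF P, of "to_fract a"] by (simp add: val_divide[OF P])
      moreover have "z \<noteq> 0" using False as nz by simp
      ultimately show ?thesis using mem_iff_val[OF P] by blast
    qed (use as dvr_zero[OF P] in simp)
  qed
  obtain t where t: "local_parameter p t" by (rule exists_local_parameter[OF p])
  then have "t \<in> p" "t \<noteq> 0" by (auto simp: local_parameter_def)
  then have "1 \<le> val P (to_fract t)" by (auto simp: p_def mpow_def)
  then have "inverse (to_fract t) \<notin> P"
    using \<open>t \<noteq> 0\<close> by (simp add: mem_iff_val[OF P] val_inverse[OF P])
  then have "P = loc p" by (rule dvr_overring_eq[OF loc_dvr[OF p] P sub loc_unif[OF p t]])
  then show ?thesis using p by blast
qed

text \<open>A pole of x of order e forces 2 v(y) = 3 v(x), and by parity every affine function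
  \<open>u\<close> gets valuation -(e / 2) times \<open>dg u\<close>. So the ring at infinity lies
  in \<open>P\<close>, and maximality gives equality.\<close>

lemma dvr_infinite_classification:
  assumes P: "dvr P" and x: "to_fract (pol [:0, 1:]) \<notin> P"
  shows "P = inf_ring"
proof -
  define e where "e = - val P (to_fract (pol [:0, 1:]))"
  have xnz: "to_fract (pol [:0, 1:]) \<noteq> 0" by simp
  have e: "e > 0" using x mem_iff_val[OF P xnz] by (simp add: e_def)
  have cval: "val P (to_fract (pol [:a:])) = 0" if "a \<noteq> 0" for a
  proof (cases a rule: f3_cases)
    case 3
    then have "pol [:a:] = - 1" by (simp add: aff_eq_iff one_pCons)
    then show ?thesis using val_uminus[OF P, of 1] val_one[OF P] by simp
  qed (use that val_one[OF P] in \<open>simp_all flip: one_pCons\<close>)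
  have vpol: "val P (to_fract (pol q)) = - (int (degree q) * e)" if "q \<noteq> 0" for q
    using that
  proof (induction q)
    case (pCons a q)
    show ?case
    proof (cases "q = 0")
      case True
      then show ?thesis using cval pCons by simp
    next
      case False
      let ?f = "to_fract (pol [:0, 1:] * pol q)"
      have f: "?f \<noteq> 0" "val P ?f = - (int (Suc (degree q)) * e)"
        using False pCons xnz by (simp_all add: val_mult[OF P] e_def algebra_simps)
      have "0 < int (Suc (degree q)) * e" using e by (intro mult_pos_pos) auto
      then have "to_fract (pol [:a:]) = 0 \<or> val P ?f < val P (to_fract (pol [:a:]))"
        using cval[of a] f(2) by (cases "a = 0") auto
      then have "val P (?f + to_fract (pol [:a:])) = - (int (Suc (degree q)) * e)"
        using val_add_eq(2)[OF P f(1)] f(2) by simp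
      moreover have "pol (pCons a q) = pol [:0, 1:] * pol q + pol [:a:]" by (simp add: aff_eq_iff)
      ultimately show ?thesis using False by (metis degree_pCons_eq to_fract_add)
    qed
  qed simp
  have ynz: "to_fract ycoord \<noteq> 0" using ycoord_nonzero by simp
  have y: "2 * val P (to_fract ycoord) = - (3 * e)"
  proof -
    have "to_fract ycoord * to_fract ycoord = to_fract (pol cubic)" by (metis to_fract_mult ycoord_sq)
    then have "val P (to_fract ycoord) + val P (to_fract ycoord) = val P (to_fract (pol cubic))"
      using val_mult[OF P ynz ynz] by simp
    then show ?thesis using vpol[OF cubic_nonzero] by (simp add: degree_cubic)
  qed
  \<comment> \<open>The valuation is doubled because \<open>e\<close> is not known to be even at
    this stage.\<close>
  have vaff: "2 * val P (to_fract u) = - (int (dg u) * e)" if u: "u \<noteq> 0" for u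
  proof -
    let ?a = "to_fract (pol (re u))" and ?b = "to_fract (pol (im u) * ycoord)"
    have sum: "to_fract u = ?a + ?b" by (metis aff_decomp to_fract_add)
    have va: "2 * val P ?a = - (int (2 * degree (re u)) * e)" if "re u \<noteq> 0"
      using vpol[OF that] by simp
    have vb: "2 * val P ?b = - (int (2 * degree (im u) + 3) * e)" if "im u \<noteq> 0"
    proof -
      have "val P ?b = val P (to_fract (pol (im u))) + val P (to_fract ycoord)"
        using that ynz val_mult[OF P, of "to_fract (pol (im u))" "to_fract ycoord"] by simp
      then show ?thesis using vpol[OF that] y by (simp add: algebra_simps)
    qed
    have less: "int m * e < int n * e" if "m < n" for m n using that e by simp
    consider "im u = 0" "re u \<noteq> 0" | "im u \<noteq> 0" "re u = 0"
      | "im u \<noteq> 0" "re u \<noteq> 0" "2 * degree (re u) < 2 * degree (im u) + 3"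
      | "im u \<noteq> 0" "re u \<noteq> 0" "2 * degree (re u) > 2 * degree (im u) + 3"
    proof -
      have "2 * degree (re u) \<noteq> 2 * degree (im u) + 3" by presburger
      then show ?thesis using that u aff_eq_iff[of u 0] by (metis linorder_neqE_nat re_im_simps(1,2))
    qed
    then show ?thesis
    proof cases
      case 1
      have "val P (to_fract u) = val P ?a" by (subst sum) (simp add: 1)
      moreover have "dg u = 2 * degree (re u)" by (rule anorm_degree(2)[OF u 1(1)])
      ultimately show ?thesis using va[OF 1(2)] by (simp only:)
    next
      case 2
      have "val P (to_fract u) = val P ?b" by (subst sum) (simp add: 2)
      moreover have "dg u = 2 * degree (im u) + 3" using anorm_degree(3)[OF u 2(1)] 2 by simp
      ultimately show ?thesis using vb[OF 2(1)] by (simp only:)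
    next
      case 3
      have "val P ?b < val P ?a" using va[OF 3(2)] vb[OF 3(1)] less[OF 3(3)] by linarith
      moreover have "?b \<noteq> 0" using 3 ycoord_nonzero by simp
      ultimately have "val P (?b + ?a) = val P ?b" using val_add_eq(2)[OF P, of ?b ?a] by blast
      then have "val P (to_fract u) = val P ?b" unfolding sum by (simp only: add.commute)
      moreover have "dg u = 2 * degree (im u) + 3" using anorm_degree(3)[OF u 3(1)] 3 by simp
      ultimately show ?thesis using vb[OF 3(1)] by (simp only:)
    next
      case 4
      have "val P ?a < val P ?b" using va[OF 4(2)] vb[OF 4(1)] less[OF 4(3)] by linarith
      moreover have "?a \<noteq> 0" using 4 by simp
      ultimately have "val P (?a + ?b) = val P ?a" using val_add_eq(2)[OF P, of ?a ?b] by blast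
      then have "val P (to_fract u) = val P ?a" unfolding sum .
      moreover have "dg u = 2 * degree (re u)" using anorm_degree(3)[OF u 4(1)] 4 by simp
      ultimately show ?thesis using va[OF 4(2)] by (simp only:)
    qed
  qed
  have "inf_ring \<subseteq> P"
  proof
    fix z assume "z \<in> inf_ring"
    then obtain a b where ab: "z = to_fract a / to_fract b" "b \<noteq> 0" "a = 0 \<or> dg a \<le> dg b" by (auto simp: inf_ring_def)
    show "z \<in> P"
    proof (cases "a = 0")
      case False
      have "int (dg a) * e \<le> int (dg b) * e" using False ab e by simp
      then have "0 \<le> val P z" using vaff[OF False] vaff[OF ab(2)] False ab by (simp add: val_divide[OF P])
      moreover have "z \<noteq> 0" using False ab by simp
      ultimately show ?thesis using mem_iff_val[OF P] by blast
    qed (use ab dvr_zero[OF P] in simp)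
  qed
  \<comment> \<open>x / y also vanishes at \<open>P\<close>: twice its valuation is -2e + 3e =
    e.\<close>
  moreover have "inverse inf_param \<notin> P"
  proof -
    have "inf_param \<noteq> 0" using inf_unif by (simp add: unif_def)
    moreover have "2 * val P inf_param = e"
      using y xnz ynz unfolding inf_param_def by (simp only: val_divide[OF P xnz ynz]) (simp add: e_def algebra_simps)
    ultimately show ?thesis using e by (simp add: mem_iff_val[OF P] val_inverse[OF P])
  qed
  ultimately show ?thesis using dvr_overring_eq[OF inf_dvr P _ inf_unif] by blast
qed

theorem dvr_classification:
  "dvr P \<longleftrightarrow> P = inf_ring \<or> (\<exists>p. aff_prime p \<and> P = loc p)"
  using dvr_finite_classification dvr_infinite_classification inf_dvr loc_dvr by metis

lemma loc_neq_inf_ring: "aff_prime p \<Longrightarrow> loc p \<noteq> inf_ring"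
  using to_fract_in_loc[of p "pol [:0, 1:]"] inf_ring_mem_iff[of "pol [:0, 1:]" 1] by (auto simp: dg_pol)

lemma finite_residue: "dvr (P :: aff fract set) \<Longrightarrow> finite (cosets P (mpow P 1))"
  unfolding dvr_classification using finite_residue_inf finite_residue_loc by blast

section \<open>Approximation and the Riemann inequality\<close>

lemma aff_prime_subset_eq:
  assumes p: "aff_prime p" and q: "aff_prime q" and sub: "q \<subseteq> p" shows "q = p"
proof (rule ccontr)
  assume "q \<noteq> p"
  then obtain s where s: "s \<in> p" "s \<notin> q" using sub by blast
  obtain k where "1 - s * s ^ k \<in> q" by (rule aff_prime_inverse[OF q s(2)])
  then have "1 - s * s ^ k \<in> p" using sub by blast
  from aff_prime_closed(2)[OF p this aff_prime_closed(6)[OF p s(1), of "s ^ k"]] have "1 \<in> p" by simp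
  then show False using aff_prime_one[OF p] by blast
qed

lemma mpow_power:
  assumes p: "aff_prime p" and a: "a \<in> p" shows "to_fract (a ^ e) \<in> mpow (loc p) (int e)"
proof (induction e)
  case 0 show ?case using mpow_0[OF loc_dvr[OF p]] dvr_one[OF loc_dvr[OF p]] by simp
next
  case (Suc e)
  have "to_fract a \<in> mpow (loc p) 1" using a mem_iff_mpow[OF p] by blast
  from mpow_mult[OF loc_dvr[OF p] this Suc] show ?case by simp
qed

text \<open>A product of elements of the other primes that avoids \<open>p\<close>, raised to the
  power \<open>e\<close>, vanishes to order \<open>e\<close> at those primes; an approximate inverse
  at \<open>p\<close> then makes it close to 1 there.\<close>

lemma exists_idempotent:
  assumes S: "finite S" "\<And>q. q \<in> S \<Longrightarrow> aff_prime q" and p: "p \<in> S"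
  obtains w where "1 - to_fract w \<in> mpow (loc p) (int e)"
    "\<And>q. q \<in> S \<Longrightarrow> q \<noteq> p \<Longrightarrow> to_fract w \<in> mpow (loc q) (int e)"
proof -
  have pp: "aff_prime p" using S p by blast
  have "\<exists>a. a \<in> q \<and> a \<notin> p" if "q \<in> S - {p}" for q
    using aff_prime_subset_eq[OF pp] S that by blast
  then obtain a where a: "\<And>q. q \<in> S - {p} \<Longrightarrow> a q \<in> q \<and> a q \<notin> p" by metis
  define b where "b = (\<Prod>q\<in>S - {p}. a q) ^ e"
  have "(\<Prod>q\<in>T. a q) \<notin> p" if "finite T" "T \<subseteq> S - {p}" for T
    using that
  proof (induction T)
    case (insert x F)
    then have "a x \<notin> p" using a[of x] by blast
    then show ?case using insert by (simp add: aff_prime_mult[OF pp])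
  qed (simp add: aff_prime_one[OF pp])
  then have "(\<Prod>q\<in>S - {p}. a q) \<notin> p" using S by blast
  then have "b \<notin> p" using aff_prime_power[OF pp] by (auto simp: b_def)
  then have "to_fract 1 / to_fract b \<in> loc p" by (rule loc_memI[OF pp])
  then obtain u where u: "to_fract 1 / to_fract b - to_fract u \<in> mpow (loc p) (int e)"
    using loc_approx[OF pp] by blast
  have "to_fract b * (to_fract 1 / to_fract b - to_fract u) \<in> mpow (loc p) (0 + int e)"
    by (rule mpow_mult[OF loc_dvr[OF pp] _ u]) (simp add: mpow_0[OF loc_dvr[OF pp]] to_fract_in_loc[OF pp])
  moreover have "to_fract b * (to_fract 1 / to_fract b - to_fract u) = 1 - to_fract (b * u)"
    using nonmember_nonzero[OF pp \<open>b \<notin> p\<close>] by (simp add: field_simps)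
  ultimately have 1: "1 - to_fract (b * u) \<in> mpow (loc p) (int e)" by simp
  have "to_fract (b * u) \<in> mpow (loc q) (int e)" if q: "q \<in> S" "q \<noteq> p" for q
  proof -
    have qq: "aff_prime q" using S q by blast
    have "(\<Prod>q\<in>S - {p}. a q) = a q * (\<Prod>q\<in>S - {p} - {q}. a q)"
      using q S by (intro prod.remove) auto
    then have "(\<Prod>q\<in>S - {p}. a q) \<in> q" using a[of q] q aff_prime_closed(6)[OF qq] by simp
    then have "to_fract b \<in> mpow (loc q) (int e)" unfolding b_def by (rule mpow_power[OF qq])
    moreover have "to_fract u \<in> mpow (loc q) 0" by (simp add: mpow_0[OF loc_dvr[OF qq]] to_fract_in_loc[OF qq])
    ultimately have "to_fract b * to_fract u \<in> mpow (loc q) (int e + 0)" by (rule mpow_mult[OF loc_dvr[OF qq]])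
    then show ?thesis by simp
  qed
  then show ?thesis using 1 that by blast
qed

text \<open>The Chinese remainder theorem for powers of maximal ideals: the local approximations are
  glued with the idempotents.\<close>

lemma strong_approximation:
  assumes S: "finite S" "\<And>q. q \<in> S \<Longrightarrow> aff_prime q" and z: "\<And>q. q \<in> S \<Longrightarrow> z q \<in> loc q"
  obtains u where "\<And>q. q \<in> S \<Longrightarrow> z q - to_fract u \<in> mpow (loc q) (int e)"
proof -
  have "\<forall>q\<in>S. \<exists>u. z q - to_fract u \<in> mpow (loc q) (int e)"
    using loc_approx[OF S(2) z] by meson
  then obtain u where u: "\<And>q. q \<in> S \<Longrightarrow> z q - to_fract (u q) \<in> mpow (loc q) (int e)" by metis
  have "\<forall>p\<in>S. \<exists>w. 1 - to_fract w \<in> mpow (loc p) (int e) \<and>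
      (\<forall>q\<in>S. q \<noteq> p \<longrightarrow> to_fract w \<in> mpow (loc q) (int e))"
    using exists_idempotent[OF S] by metis
  then obtain w where w: "\<And>p. p \<in> S \<Longrightarrow> 1 - to_fract (w p) \<in> mpow (loc p) (int e)"
    "\<And>p q. p \<in> S \<Longrightarrow> q \<in> S \<Longrightarrow> q \<noteq> p \<Longrightarrow> to_fract (w p) \<in> mpow (loc q) (int e)" by metis
  have tf_sum: "to_fract (sum f T) = (\<Sum>i\<in>T. to_fract (f i))" if "finite T" for f :: "aff set \<Rightarrow> aff" and T
    using that by (induction T) simp_all
  have "z q - to_fract (\<Sum>p\<in>S. w p * u p) \<in> mpow (loc q) (int e)" if q: "q \<in> S" for q
  proof -
    note Q = S(2)[OF q]
    note D = loc_dvr[OF Q]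
    note sg = add_subgroup_mpow[OF D, of "int e"]
    have 0: "to_fract v \<in> mpow (loc q) 0" for v by (simp add: mpow_0[OF D] to_fract_in_loc[OF Q])
    have "(1 - to_fract (w q)) * to_fract (u q) \<in> mpow (loc q) (int e + 0)"
      by (rule mpow_mult[OF D w(1)[OF q] 0])
    then have 1: "z q - to_fract (u q) + (1 - to_fract (w q)) * to_fract (u q) \<in> mpow (loc q) (int e)"
      using add_subgroup_add[OF sg u[OF q]] by simp
    have "to_fract (w p * u p) \<in> mpow (loc q) (int e)" if "p \<in> S - {q}" for p
      using mpow_mult[OF D w(2)[of p q] 0[of "u p"]] that q by auto
    then have 2: "(\<Sum>p\<in>S - {q}. to_fract (w p * u p)) \<in> mpow (loc q) (int e)" by (rule add_subgroup_sum[OF sg])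
    have "to_fract (\<Sum>p\<in>S. w p * u p) = to_fract (w q * u q) + (\<Sum>p\<in>S - {q}. to_fract (w p * u p))"
      unfolding tf_sum[OF S(1)] by (rule sum.remove[OF S(1) q])
    then have "z q - to_fract (\<Sum>p\<in>S. w p * u p) =
        (z q - to_fract (u q) + (1 - to_fract (w q)) * to_fract (u q)) - (\<Sum>p\<in>S - {q}. to_fract (w p * u p))"
      by (simp add: algebra_simps)
    then show ?thesis using add_subgroup_diff[OF sg 1 2] by (simp only:)
  qed
  then show ?thesis using that by blast
qed

section \<open>Orders of affine functions and the number of their zeros\<close>

definition vp :: "aff set \<Rightarrow> aff \<Rightarrow> int" where "vp p u = val (loc p) (to_fract u)"

lemma vp_nonneg: "aff_prime p \<Longrightarrow> u \<noteq> 0 \<Longrightarrow> 0 \<le> vp p u"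
  using to_fract_in_loc[of p u] mem_iff_val[OF loc_dvr, of p "to_fract u"] by (simp add: vp_def)

lemma vp_pos_iff: "aff_prime p \<Longrightarrow> u \<noteq> 0 \<Longrightarrow> 1 \<le> vp p u \<longleftrightarrow> u \<in> p"
  using mem_iff_mpow[of p u] by (simp add: vp_def mpow_def)

lemma vp_zero_iff: "aff_prime p \<Longrightarrow> u \<noteq> 0 \<Longrightarrow> vp p u = 0 \<longleftrightarrow> u \<notin> p"
  using vp_pos_iff[of p u] vp_nonneg[of p u] by auto

lemma vp_mult: "aff_prime p \<Longrightarrow> u \<noteq> 0 \<Longrightarrow> v \<noteq> 0 \<Longrightarrow> vp p (u * v) = vp p u + vp p v"
  by (simp add: vp_def val_mult[OF loc_dvr])

lemma vp_power: "aff_prime p \<Longrightarrow> u \<noteq> 0 \<Longrightarrow> vp p (u ^ n) = int n * vp p u"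
  by (simp add: vp_def to_fract_power val_power[OF loc_dvr])

lemma cosets_loc_mpow:
  assumes p: "aff_prime p"
  shows "finite (cosets (loc p) (mpow (loc p) (int n)))" "card (cosets (loc p) (mpow (loc p) (int n))) = rcard (loc p) ^ n"
  using cosets_mpow[OF loc_dvr[OF p] finite_residue_loc[OF p], of 0 n]
  by (simp_all add: mpow_0[OF loc_dvr[OF p]] rcard_def)

text \<open>Reduction modulo \<open>h\<close> maps the \<open>9\<^bsup>deg h\<^esup>\<close> representatives onto the product of the local quotients.\<close>

lemma prod_rcard_le:
  assumes S: "finite S" "\<And>q. q \<in> S \<Longrightarrow> aff_prime q" and h: "h \<noteq> 0"
  shows "(\<Prod>q\<in>S. rcard (loc q) ^ nat (vp q (pol h))) \<le> 9 ^ degree h"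
proof -
  define k where "k q = nat (vp q (pol h))" for q
  define V where "V = {v. (re v = 0 \<or> degree (re v) < degree h) \<and> (im v = 0 \<or> degree (im v) < degree h)}"
  define \<Phi> where "\<Phi> u = (\<lambda>q\<in>S. translate (mpow (loc q) (int (k q))) (to_fract u))" for u
  have kv: "int (k q) = vp q (pol h)" if "q \<in> S" for q
    using vp_nonneg[OF S(2)[OF that], of "pol h"] h by (simp add: k_def)
  have sub: "PiE S (\<lambda>q. cosets (loc q) (mpow (loc q) (int (k q)))) \<subseteq> \<Phi> ` V"
  proof
    fix c assume c: "c \<in> PiE S (\<lambda>q. cosets (loc q) (mpow (loc q) (int (k q))))"
    then have "\<forall>q\<in>S. \<exists>z. z \<in> loc q \<and> c q = translate (mpow (loc q) (int (k q))) z"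
      by (fastforce simp: cosets_def PiE_iff)
    then obtain z where z: "\<And>q. q \<in> S \<Longrightarrow> z q \<in> loc q"
      "\<And>q. q \<in> S \<Longrightarrow> c q = translate (mpow (loc q) (int (k q))) (z q)" by metis
    \<comment> \<open>The sum of all exponents is a single precision that suffices at every
      point.\<close>
    obtain u where u: "\<And>q. q \<in> S \<Longrightarrow> z q - to_fract u \<in> mpow (loc q) (int (\<Sum>q\<in>S. k q))"
      using strong_approximation[OF S z(1), of "\<Sum>q\<in>S. k q"] by blast
    obtain v w where v: "v \<in> V" "u = v + pol h * w" using mod_pol_rep[OF h, of u] by (auto simp: V_def)
    have "c q = translate (mpow (loc q) (int (k q))) (to_fract v)" if q: "q \<in> S" for q
    proof -
      note D = loc_dvr[OF S(2)[OF q]]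
      note sg = add_subgroup_mpow[OF D, of "int (k q)"]
      have "k q \<le> (\<Sum>q\<in>S. k q)" using S(1) q by (intro member_le_sum) auto
      then have 1: "z q - to_fract u \<in> mpow (loc q) (int (k q))"
        using u[OF q] mpow_mono[OF D, of "int (k q)" "int (\<Sum>q\<in>S. k q)"] by (meson of_nat_mono subsetD)
      have "to_fract (pol h) \<in> mpow (loc q) (int (k q))" using kv[OF q] by (simp add: mpow_def vp_def)
      moreover have "to_fract w \<in> mpow (loc q) 0"
        by (simp add: mpow_0[OF D] to_fract_in_loc[OF S(2)[OF q]])
      ultimately have "to_fract (pol h) * to_fract w \<in> mpow (loc q) (int (k q) + 0)" by (rule mpow_mult[OF D])
      then have "z q - to_fract u + to_fract (pol h) * to_fract w \<in> mpow (loc q) (int (k q))"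
        using add_subgroup_add[OF sg 1] by simp
      then have "z q - to_fract v \<in> mpow (loc q) (int (k q))" using v(2) by simp
      then show ?thesis using z(2)[OF q] translate_eq_iff[OF sg] by simp
    qed
    then have "c = \<Phi> v" using PiE_arb[OF c] unfolding \<Phi>_def restrict_def by (intro ext) auto
    then show "c \<in> \<Phi> ` V" using v by blast
  qed
  have fin: "finite V" "card V = 9 ^ degree h" using card_mod_pol_reps[of "degree h"] by (simp_all add: V_def)
  have "card (PiE S (\<lambda>q. cosets (loc q) (mpow (loc q) (int (k q))))) \<le> card V"
    using card_mono[OF finite_imageI[OF fin(1)] sub] card_image_le[OF fin(1), of \<Phi>] by linarith
  moreover have "card (PiE S (\<lambda>q. cosets (loc q) (mpow (loc q) (int (k q))))) = (\<Prod>q\<in>S. rcard (loc q) ^ k q)"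
    unfolding card_PiE[OF S(1)] by (intro prod.cong refl cosets_loc_mpow(2) S(2))
  ultimately show ?thesis using fin(2) by (simp add: k_def)
qed

text \<open>Each zero contributes a factor of at least 2 to a product bounded by
  \<open>9 ^ degree h\<close>; having n = \<open>9 ^ degree h\<close> zeros would give 2^n \<le>
  n.\<close>

lemma finite_zeros:
  assumes h: "h \<noteq> 0" shows "finite {p. aff_prime p \<and> pol h \<in> p}"
proof (rule ccontr)
  assume "infinite {p. aff_prime p \<and> pol h \<in> p}"
  then obtain T where T: "finite T" "card T = 9 ^ degree h" "T \<subseteq> {p. aff_prime p \<and> pol h \<in> p}"
    by (meson infinite_arbitrarily_large)
  have "2 ^ 1 \<le> rcard (loc q) ^ nat (vp q (pol h))" if q: "q \<in> T" for q
  proof -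
    have q': "aff_prime q" "pol h \<in> q" using T q by auto
    have 2: "2 \<le> rcard (loc q)" by (rule rcard_ge_2[OF loc_dvr[OF q'(1)] finite_residue_loc[OF q'(1)]])
    have "1 \<le> nat (vp q (pol h))" using vp_pos_iff[OF q'(1), of "pol h"] q' h by simp
    then have "rcard (loc q) ^ 1 \<le> rcard (loc q) ^ nat (vp q (pol h))" using 2 by (intro power_increasing) auto
    then show ?thesis using 2 by simp
  qed
  then have "(\<Prod>q\<in>T. 2 ^ 1) \<le> (\<Prod>q\<in>T. rcard (loc q) ^ nat (vp q (pol h)))" by (intro prod_mono) auto
  also have "\<dots> \<le> 9 ^ degree h" using prod_rcard_le[OF T(1) _ h] T(3) by blast
  finally have "(2::nat) ^ card T \<le> card T" using T by simp
  moreover have "card T < 2 ^ card T" by (rule less_exp)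
  ultimately show False by linarith
qed

section \<open>Riemann-Roch spaces and the Riemann inequality\<close>

definition sections :: "(aff fract set \<Rightarrow> int) \<Rightarrow> aff fract set" where
  "sections D = {f. \<forall>P. dvr P \<longrightarrow> f \<in> mpow P (- D P)}"

lemma sections_iff:
  "f \<in> sections D \<longleftrightarrow> f \<in> mpow inf_ring (- D inf_ring) \<and> (\<forall>p. aff_prime p \<longrightarrow> f \<in> mpow (loc p) (- D (loc p)))"
  unfolding sections_def dvr_classification by auto

lemma add_subgroup_sections: "add_subgroup (sections D)"
  unfolding add_subgroup_def sections_def
  using add_subgroup_mpow add_subgroup_zero add_subgroup_diff by blast

lemma sections_mult:
  "f \<in> sections D \<Longrightarrow> g \<in> sections E \<Longrightarrow> f * g \<in> sections (\<lambda>P. D P + E P)"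
  using mpow_mult by (fastforce simp: sections_def)

text \<open>Regular at all finite points means affine, by \<open>regular_imp_aff\<close>; the order
  at infinity is then read off \<open>dg\<close>.\<close>

lemma sections_at_infinity:
  "sections (\<lambda>P. if P = inf_ring then int n else 0) = to_fract ` aff_le n"
proof (intro equalityI subsetI)
  fix f assume f: "f \<in> sections (\<lambda>P. if P = inf_ring then int n else 0)"
  have "f \<in> loc p" if p: "aff_prime p" for p
  proof -
    have "f \<in> mpow (loc p) (- (if loc p = inf_ring then int n else 0))"
      using f p unfolding sections_iff by blast
    then have "f \<in> mpow (loc p) 0" using loc_neq_inf_ring[OF p] by simp
    then show ?thesis unfolding mpow_0[OF loc_dvr[OF p]] .
  qed
  then obtain u where u: "f = to_fract u" by (rule regular_imp_aff)
  have "f \<in> mpow inf_ring (- int n)" using f by (force simp: sections_iff)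
  then have "u \<in> aff_le n" unfolding u using val_inf_aff[of u] by (cases "u = 0") (auto simp: mpow_def aff_le_def)
  then show "f \<in> to_fract ` aff_le n" using u by blast
next
  fix f assume "f \<in> to_fract ` aff_le n"
  then obtain u where u: "f = to_fract u" "u \<in> aff_le n" by blast
  have "f \<in> mpow inf_ring (- int n)" unfolding u(1) using val_inf_aff[of u] u(2) by (cases "u = 0") (auto simp: mpow_def aff_le_def)
  moreover have "f \<in> mpow (loc p) 0" if p: "aff_prime p" for p
    unfolding u(1) using mpow_0[OF loc_dvr[OF p]] to_fract_in_loc[OF p] by simp
  ultimately show "f \<in> sections (\<lambda>P. if P = inf_ring then int n else 0)"
    using loc_neq_inf_ring by (auto simp: sections_iff)
qed

text \<open>After multiplication by a polynomial \<open>h\<close> whose zeros dominate the divisor, its sections become the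
  functions with a pole of bounded order at infinity that satisfy local conditions at the zeros of \<open>h\<close>.\<close>

lemma riemann_inequality:
  assumes supp: "finite {P. D P \<noteq> 0}" "\<And>P. D P \<noteq> 0 \<Longrightarrow> dvr P"
    and deg: "\<And>P. dvr P \<Longrightarrow> rcard P = 3 ^ d P"
  shows "finite (sections D)" "3 ^ nat (\<Sum>P | D P \<noteq> 0. D P * int (d P)) \<le> card (sections D)"
proof -
  define S where "S = {p. aff_prime p \<and> D (loc p) \<noteq> 0}"
  have inj: "inj_on loc {p. aff_prime p}" using to_fract_mem_loc_inj by (auto intro!: inj_onI)
  have "loc ` S \<subseteq> {P. D P \<noteq> 0}" by (auto simp: S_def)
  then have "finite (loc ` S)" using supp(1) finite_subset by blast
  then have finS: "finite S" by (rule finite_imageD) (rule inj_on_subset[OF inj], auto simp: S_def)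
  have "\<exists>q. q \<noteq> 0 \<and> pol q \<in> p" if "aff_prime p" for p
  proof -
    obtain \<pi> where "irreducible \<pi>" "lead_coeff \<pi> = 1" "\<And>q. pol q \<in> p \<longleftrightarrow> \<pi> dvd q"
      by (rule aff_prime_under[OF \<open>aff_prime p\<close>]) blast
    then show ?thesis by (intro exI[of _ \<pi>]) auto
  qed
  then obtain q where q: "\<And>p. aff_prime p \<Longrightarrow> q p \<noteq> 0 \<and> pol (q p) \<in> p" by metis
  define n where "n = D inf_ring"
  \<comment> \<open>The powers of \<open>q p\<close> dominate \<open>D\<close> at every finite point
    of its support; the extra power of x pushes the pole bound \<open>N\<close> to at least 1, where
    \<open>card_aff_le\<close> applies.\<close>
  define h where "h = (\<Prod>p\<in>S. q p ^ nat \<bar>D (loc p)\<bar>) * [:0, 1:] ^ (nat \<bar>n\<bar> + 1)"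
  have h0: "h \<noteq> 0" using finS q by (auto simp: h_def S_def)
  have "degree ([:0, 1::f3:] ^ (nat \<bar>n\<bar> + 1)) = nat \<bar>n\<bar> + 1" by (simp add: degree_power_eq)
  then have "nat \<bar>n\<bar> + 1 \<le> degree h"
    using h0 unfolding h_def by (subst degree_mult_eq) auto
  then have "1 \<le> n + 2 * int (degree h)" by linarith
  \<comment> \<open>\<open>pol h\<close> has pole order \<open>2 * degree h\<close> at infinity,
    which is added to the order that \<open>D\<close> allows there.\<close>
  define N where "N = nat (n + 2 * int (degree h))"
  have N: "int N = n + 2 * int (degree h)" "1 \<le> N" using \<open>1 \<le> n + 2 * int (degree h)\<close> by (auto simp: N_def)
  have h_ge: "\<bar>D (loc p)\<bar> \<le> vp p (pol h)" if p: "p \<in> S" for p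
  proof -
    have pp: "aff_prime p" using p by (simp add: S_def)
    have "h = q p ^ nat \<bar>D (loc p)\<bar> * ((\<Prod>p\<in>S - {p}. q p ^ nat \<bar>D (loc p)\<bar>) * [:0, 1:] ^ (nat \<bar>n\<bar> + 1))"
      unfolding h_def by (subst prod.remove[OF finS p]) (simp add: mult.assoc)
    then obtain r where r: "h = q p ^ nat \<bar>D (loc p)\<bar> * r" by blast
    then have "r \<noteq> 0" using h0 by auto
    have "vp p (pol h) = int (nat \<bar>D (loc p)\<bar>) * vp p (pol (q p)) + vp p (pol r)"
      unfolding r pol_simps pol_power using q[OF pp] \<open>r \<noteq> 0\<close> by (simp add: vp_mult[OF pp] vp_power[OF pp])
    moreover have "0 \<le> vp p (pol r)" using vp_nonneg[OF pp] \<open>r \<noteq> 0\<close> by simp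
    moreover have "1 \<le> vp p (pol (q p))" using vp_pos_iff[OF pp] q[OF pp] by simp
    then have "int (nat \<bar>D (loc p)\<bar>) * 1 \<le> int (nat \<bar>D (loc p)\<bar>) * vp p (pol (q p))" by (intro mult_left_mono) auto
    ultimately show ?thesis by linarith
  qed
  define Z where "Z = {p. aff_prime p \<and> pol h \<in> p}"
  have finZ: "finite Z" unfolding Z_def by (rule finite_zeros[OF h0])
  have SZ: "S \<subseteq> Z"
  proof
    fix p assume p: "p \<in> S"
    then have "1 \<le> vp p (pol h)" using h_ge[OF p] by (auto simp: S_def)
    then show "p \<in> Z" using p vp_pos_iff[of p "pol h"] h0 by (auto simp: S_def Z_def)
  qed
  have outside: "D (loc p) = 0" "vp p (pol h) = 0" if "aff_prime p" "p \<notin> Z" for p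
    using that SZ vp_zero_iff[of p "pol h"] h0 by (auto simp: S_def Z_def)
  have ZP: "aff_prime p" if "p \<in> Z" for p using that by (simp add: Z_def)
  define k where "k p = nat (vp p (pol h) - D (loc p))" for p
  have k: "int (k p) = vp p (pol h) - D (loc p)" if "p \<in> Z" for p
    using h_ge[of p] vp_nonneg[OF ZP[OF that], of "pol h"] that h0 by (cases "p \<in> S") (auto simp: k_def S_def Z_def)
  \<comment> \<open>The sections of \<open>D\<close> multiplied by \<open>h\<close>, cut out of L(N
    infinity) by conditions at the zeros of \<open>h\<close>.\<close>
  define W where "W = {u \<in> aff_le N. \<forall>p\<in>Z. to_fract u \<in> mpow (loc p) (int (k p))}"
  have hnz: "to_fract (pol h) \<noteq> 0" using h0 by simp
  have bij: "bij_betw (\<lambda>u. to_fract u / to_fract (pol h)) W (sections D)"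
    unfolding bij_betw_def
  proof
    show "inj_on (\<lambda>u. to_fract u / to_fract (pol h)) W" using hnz by (auto intro!: inj_onI simp: field_simps)
    show "(\<lambda>u. to_fract u / to_fract (pol h)) ` W = sections D"
    proof (intro equalityI subsetI)
      fix f assume "f \<in> (\<lambda>u. to_fract u / to_fract (pol h)) ` W"
      then obtain u where u: "u \<in> W" "f = to_fract u / to_fract (pol h)" by blast
      show "f \<in> sections D"
      proof (cases "u = 0")
        case True
        then show ?thesis using u add_subgroup_zero[OF add_subgroup_sections] by simp
      next
        case False
        have "- n \<le> val inf_ring f" using u False h0 N
          by (simp add: val_inf dg_pol W_def aff_le_def)
        moreover have "- D (loc p) \<le> val (loc p) f" if p: "aff_prime p" for p
        proof -
          have v: "val (loc p) f = vp p u - vp p (pol h)"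
            using False hnz unfolding u(2) vp_def by (simp add: val_divide[OF loc_dvr[OF p]])
          show ?thesis
          proof (cases "p \<in> Z")
            case True
            then have "int (k p) \<le> vp p u" using u(1) False by (auto simp: W_def mpow_def vp_def)
            then show ?thesis using k[OF True] v by simp
          next
            case outZ: False
            then show ?thesis using outside[OF p outZ] vp_nonneg[OF p False] v by simp
          qed
        qed
        ultimately show ?thesis by (simp add: sections_iff mpow_def n_def)
      qed
    next
      fix f assume f: "f \<in> sections D"
      have fl: "f = 0 \<or> - D (loc p) \<le> val (loc p) f" if "aff_prime p" for p
        using f that by (simp add: sections_iff mpow_def)
      have v: "val (loc p) (f * to_fract (pol h)) = val (loc p) f + vp p (pol h)" if "aff_prime p" "f \<noteq> 0" for p
        using that hnz by (simp add: val_mult[OF loc_dvr] vp_def)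
      have "f * to_fract (pol h) \<in> loc p" if p: "aff_prime p" for p
      proof (cases "f = 0")
        case True then show ?thesis using dvr_zero[OF loc_dvr[OF p]] by simp
      next
        case False
        have "0 \<le> val (loc p) (f * to_fract (pol h))"
        proof (cases "p \<in> Z")
          case True
          then show ?thesis using fl[OF p] False v[OF p False] k[OF True] by simp
        next
          case outZ: False
          then show ?thesis using fl[OF p] False v[OF p False] outside[OF p outZ] by simp
        qed
        then show ?thesis using False hnz mem_iff_val[OF loc_dvr[OF p], of "f * to_fract (pol h)"] by simp
      qed
      then obtain u where u: "f * to_fract (pol h) = to_fract u" by (rule regular_imp_aff)
      have fu: "f = to_fract u / to_fract (pol h)" using hnz by (simp add: field_simps flip: u)
      have "u \<in> W"
      proof (cases "u = 0")
        case True
        then show ?thesis using add_subgroup_zero[OF add_subgroup_aff_le] by (simp add: W_def mpow_def)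
      next
        case False
        then have f0: "f \<noteq> 0" using u by auto
        have "- n \<le> val inf_ring f" using f f0 by (simp add: sections_iff mpow_def n_def)
        moreover have "val inf_ring f = 2 * int (degree h) - int (dg u)"
          unfolding fu using False h0 by (simp add: val_inf dg_pol)
        ultimately have "dg u \<le> N" using N by simp
        moreover have "int (k p) \<le> vp p u" if p: "p \<in> Z" for p
          using fl[OF ZP[OF p]] f0 v[OF ZP[OF p] f0] k[OF p] unfolding u vp_def by simp
        ultimately show ?thesis by (auto simp: W_def aff_le_def mpow_def vp_def)
      qed
      then show "f \<in> (\<lambda>u. to_fract u / to_fract (pol h)) ` W" using fu by blast
    qed
  qed
  have finW: "finite W" using card_aff_le(2)[OF N(2)] by (simp add: W_def)
  then show "finite (sections D)" using bij bij_betw_finite by blast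
  \<comment> \<open>\<open>W\<close> is the kernel of this map into the product of the local
    quotients, so the size of that product bounds the index of \<open>W\<close>.\<close>
  define \<Phi> where "\<Phi> u = (\<lambda>p\<in>Z. translate (mpow (loc p) (int (k p))) (to_fract u))" for u
  have "\<Phi> x = \<Phi> y \<longleftrightarrow> x - y \<in> W" if "x \<in> aff_le N" "y \<in> aff_le N" for x y
  proof -
    have "\<Phi> x = \<Phi> y \<longleftrightarrow> (\<forall>p\<in>Z. to_fract (x - y) \<in> mpow (loc p) (int (k p)))"
      unfolding \<Phi>_def to_fract_diff using translate_eq_iff[OF add_subgroup_mpow[OF loc_dvr[OF ZP]]]
      by (auto simp: restrict_def fun_eq_iff)
    then show ?thesis using add_subgroup_diff[OF add_subgroup_aff_le that] by (simp add: W_def)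
  qed
  then have cardV: "card (aff_le N) = card W * card (\<Phi> ` aff_le N)"
    by (intro card_eq_kernel_times_image add_subgroup_aff_le card_aff_le(2)[OF N(2)]) (auto simp: W_def)
  have sub: "\<Phi> ` aff_le N \<subseteq> PiE Z (\<lambda>p. cosets (loc p) (mpow (loc p) (int (k p))))"
    using to_fract_in_loc[OF ZP] by (auto simp: \<Phi>_def cosets_def)
  have fin_cod: "finite (PiE Z (\<lambda>p. cosets (loc p) (mpow (loc p) (int (k p)))))"
    using finZ cosets_loc_mpow(1)[OF ZP] by (intro finite_PiE) auto
  have "card (\<Phi> ` aff_le N) \<le> card (PiE Z (\<lambda>p. cosets (loc p) (mpow (loc p) (int (k p)))))"
    by (rule card_mono[OF fin_cod sub])
  also have "\<dots> = (\<Prod>p\<in>Z. rcard (loc p) ^ k p)"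
    unfolding card_PiE[OF finZ] by (intro prod.cong refl cosets_loc_mpow(2) ZP)
  also have "\<dots> = (\<Prod>p\<in>Z. 3 ^ (d (loc p) * k p))"
    by (intro prod.cong refl) (simp add: deg loc_dvr ZP power_mult)
  also have "\<dots> = 3 ^ (\<Sum>p\<in>Z. d (loc p) * k p)" by (simp add: power_sum)
  finally have img: "card (\<Phi> ` aff_le N) \<le> 3 ^ (\<Sum>p\<in>Z. d (loc p) * k p)" .
  \<comment> \<open>The same kind of count for \<open>h\<close> itself bounds the total degree of
    its zeros by its pole order \<open>2 * degree h\<close>.\<close>
  have "(\<Prod>p\<in>Z. rcard (loc p) ^ nat (vp p (pol h))) = (\<Prod>p\<in>Z. 3 ^ (d (loc p) * nat (vp p (pol h))))"
    by (intro prod.cong refl) (simp add: deg loc_dvr ZP power_mult)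
  then have "3 ^ (\<Sum>p\<in>Z. d (loc p) * nat (vp p (pol h))) \<le> (9::nat) ^ degree h"
    using prod_rcard_le[OF finZ ZP h0] by (simp add: power_sum)
  also have "(9::nat) ^ degree h = 3 ^ (2 * degree h)" by (simp add: power_mult)
  finally have "(\<Sum>p\<in>Z. d (loc p) * nat (vp p (pol h))) \<le> 2 * degree h"
    by (simp add: power_increasing_iff)
  then have "int (\<Sum>p\<in>Z. d (loc p) * nat (vp p (pol h))) \<le> int (2 * degree h)" by (rule of_nat_mono)
  moreover have "int (\<Sum>p\<in>Z. d (loc p) * nat (vp p (pol h))) = (\<Sum>p\<in>Z. int (d (loc p)) * vp p (pol h))"
    unfolding of_nat_sum using vp_nonneg[OF ZP] h0 by (intro sum.cong refl) simp
  ultimately have le: "(\<Sum>p\<in>Z. int (d (loc p)) * vp p (pol h)) \<le> 2 * int (degree h)" by simp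
  have "d inf_ring = 1"
  proof -
    have "(3::nat) ^ d inf_ring = 3 ^ 1" using deg[OF inf_dvr] rcard_inf by simp
    then show ?thesis by (subst (asm) power_inject_exp) auto
  qed
  have degD: "(\<Sum>P | D P \<noteq> 0. D P * int (d P)) = n + (\<Sum>p\<in>Z. D (loc p) * int (d (loc p)))"
  proof -
    have "(\<Sum>P | D P \<noteq> 0. D P * int (d P)) = (\<Sum>P\<in>insert inf_ring (loc ` Z). D P * int (d P))"
    proof (rule sum.mono_neutral_left)
      show "{P. D P \<noteq> 0} \<subseteq> insert inf_ring (loc ` Z)"
        using supp(2) SZ unfolding dvr_classification by (auto simp: S_def)
    qed (use finZ in auto)
    also have "\<dots> = D inf_ring * int (d inf_ring) + (\<Sum>P\<in>loc ` Z. D P * int (d P))"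
      using finZ loc_neq_inf_ring ZP by (subst sum.insert) auto
    also have "(\<Sum>P\<in>loc ` Z. D P * int (d P)) = (\<Sum>p\<in>Z. D (loc p) * int (d (loc p)))"
      using inj_on_subset[OF inj, of Z] ZP by (subst sum.reindex) auto
    finally show ?thesis using \<open>d inf_ring = 1\<close> by (simp add: n_def)
  qed
  have "int (\<Sum>p\<in>Z. d (loc p) * k p) = (\<Sum>p\<in>Z. int (d (loc p)) * vp p (pol h)) - (\<Sum>p\<in>Z. D (loc p) * int (d (loc p)))"
    unfolding of_nat_sum sum_subtractf[symmetric] by (intro sum.cong refl) (simp add: k algebra_simps)
  then have expo: "int (\<Sum>p\<in>Z. d (loc p) * k p) \<le> int N - (\<Sum>P | D P \<noteq> 0. D P * int (d P))"
    using le N degD by linarith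
  show "3 ^ nat (\<Sum>P | D P \<noteq> 0. D P * int (d P)) \<le> card (sections D)"
  \<comment> \<open>For degree at most zero \<open>nat\<close> makes the bound equal to 1, and the
    zero section meets it.\<close>
  proof (cases "(\<Sum>P | D P \<noteq> 0. D P * int (d P)) \<le> 0")
    case True
    have "sections D \<noteq> {}" using add_subgroup_zero[OF add_subgroup_sections] by blast
    then show ?thesis using True \<open>finite (sections D)\<close> by (simp add: Suc_le_eq card_gt_0_iff)
  next
    case False
    define m where "m = nat (\<Sum>P | D P \<noteq> 0. D P * int (d P))"
    define K where "K = (\<Sum>p\<in>Z. d (loc p) * k p)"
    have mK: "m + K \<le> N" using expo False unfolding m_def K_def by linarith
    have "(3::nat) ^ m * 3 ^ K \<le> 3 ^ N" using mK by (simp flip: power_add)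
    also have "\<dots> = card W * card (\<Phi> ` aff_le N)" using cardV card_aff_le(1)[OF N(2)] by simp
    also have "\<dots> \<le> card W * 3 ^ K" using img unfolding K_def by (rule mult_le_mono2)
    finally have "3 ^ m \<le> card W" by simp
    then show ?thesis using bij_betw_same_card[OF bij] by (simp add: m_def)
  qed
qed

section \<open>The interpolation divisor\<close>

text \<open>Irreducible polynomials \<open>\<pi>\<close> of degree at most four together with a square root of the cubic
  modulo \<open>\<pi>\<close>; two conjugate points of degree \<open>deg \<pi>\<close> lie over each of them.\<close>

definition split_data :: "(f3 poly \<times> f3 poly) list" where
  "split_data =
    [([:-1,1,1:], [:1,1:]), ([:-1,-1,1:], [:1:]),
     ([:1,0,-1,1:], [:1,-1,-1:]), ([:1,-1,0,1:], [:1,-1:]), ([:1,-1,1,1:], [:1,1,-1:]),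
     ([:-1,-1,0,1:], [:0,0,1:]), ([:-1,-1,-1,1:], [:0,1,1:]),
     ([:1,0,1,1,1:], [:1,1,0,1:]), ([:1,1,1,1,1:], [:1,0,1,1:]), ([:1,-1,0,1,1:], [:0,1,-1,-1:]),
     ([:-1,0,0,-1,1:], [:1,0,-1:]), ([:-1,0,-1,0,1:], [:1,1,-1,1:]), ([:-1,1,0,0,1:], [:1,0,-1,1:]),
     ([:-1,-1,-1,1,1:], [:1,1,1:])]"

text \<open>Modulo these the cubic is not a square, so a single point of twice the degree lies over
  each: two of degree 2 and one of degree 4.\<close>

definition inert_data :: "f3 poly list" where
  "inert_data = [[:0,1:], [:1,1:], [:1,0,1:]]"

definition other_factors :: "f3 poly list" where
  "other_factors = inert_data @ map fst split_data"

text \<open>x - 1 is the only monic linear polynomial modulo which the cubic is a square;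
  \<open>R\<close> and \<open>R'\<close> lie over it.\<close>

definition xm1 :: "f3 poly" where "xm1 = [:-1, 1:]"

lemma split_data_dvd: "(\<pi>, g) \<in> set split_data \<Longrightarrow> \<pi> dvd g * g - cubic"
proof -
  have "\<forall>(p, g)\<in>set split_data. (g * g - cubic) mod p = 0"
    unfolding split_data_def cubic_def by code_simp
  then show "(\<pi>, g) \<in> set split_data \<Longrightarrow> \<pi> dvd g * g - cubic" by auto
qed

lemma split_data_irreducible: "(\<pi>, g) \<in> set split_data \<Longrightarrow> irreducible \<pi>"
proof (rule poly_irreducible_by_small_divisors)
  assume mem: "(\<pi>, g) \<in> set split_data"
  have "\<forall>(p, g)\<in>set split_data. \<forall>c::f3. poly p c \<noteq> 0"
    unfolding split_data_def f3_all by (simp add: f3_two)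
  then show "poly \<pi> c \<noteq> 0" for c using mem by auto
  show "0 < degree \<pi>" "degree \<pi> \<le> 4" using mem by (auto simp: split_data_def)
  \<comment> \<open>The first seven entries have degree 2 or 3, where the absence of roots decides;
    the quartics are also tested against all monic quadratics.\<close>
  have "\<forall>p\<in>set (map fst (drop 7 split_data)). \<forall>a\<in>{0,1,-1}. \<forall>b\<in>{0,1,-1}. p mod [:a, b, 1:] \<noteq> 0"
    unfolding split_data_def by code_simp
  then have "\<forall>p\<in>set (map fst (drop 7 split_data)). \<forall>a b. \<not> [:a, b, 1:] dvd p"
    unfolding f3_all dvd_eq_mod_eq_0 by simp
  moreover assume "degree \<pi> = 4"
  then have "\<pi> \<in> set (map fst (drop 7 split_data))" using mem by (auto simp: split_data_def)
  ultimately show "\<not> [:a, b, 1:] dvd \<pi>" for a b by blast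
qed

lemma irreducible_linear: "irreducible [:a, 1::f3:]"
  by (rule irreducible_linear_field_poly) simp

lemma irreducible_xm1: "irreducible xm1"
  unfolding xm1_def by (rule irreducible_linear)

lemma inert_data_irreducible: "\<pi> \<in> set inert_data \<Longrightarrow> irreducible \<pi>"
proof -
  have "irreducible [:1, 0, 1::f3:]"
  proof (rule poly_irreducible_by_small_divisors)
    have "\<forall>c. poly [:1, 0, 1::f3:] c \<noteq> 0" unfolding f3_all by (simp add: f3_two)
    then show "poly [:1, 0, 1::f3:] c \<noteq> 0" for c by blast
  qed simp_all
  then show "\<pi> \<in> set inert_data \<Longrightarrow> irreducible \<pi>" using irreducible_linear by (auto simp: inert_data_def)
qed

lemma other_factors_irreducible: "\<pi> \<in> set other_factors \<Longrightarrow> irreducible \<pi>"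
  using split_data_irreducible inert_data_irreducible by (auto simp: other_factors_def)

lemma other_factors_monic: "\<pi> \<in> set other_factors \<Longrightarrow> lead_coeff \<pi> = 1"
proof -
  have "\<forall>\<pi>\<in>set other_factors. lead_coeff \<pi> = 1"
    by (simp add: other_factors_def inert_data_def split_data_def)
  then show "\<pi> \<in> set other_factors \<Longrightarrow> lead_coeff \<pi> = 1" by blast
qed

text \<open>Distinct monic irreducibles have disjoint zeros. The cubic is included because y
  contributes the point over it.\<close>

lemma other_factors_distinct: "distinct (xm1 # cubic # other_factors)"
  unfolding xm1_def cubic_def other_factors_def inert_data_def split_data_def by code_simp

definition hx :: "f3 poly" where "hx = xm1 ^ 3 * (\<Prod>\<pi>\<in>set other_factors. \<pi>)"

text \<open>Its divisor is \<open>G\<close> minus 114 times infinity: at finite points it has the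
  zeros prescribed by \<open>G\<close>, and its only pole has order 111.\<close>

definition interp_fun :: aff where "interp_fun = pol hx * ycoord"

lemma hx_nonzero: "hx \<noteq> 0" and degree_hx: "degree hx = 54"
proof -
  have nz: "\<pi> \<noteq> 0" if "\<pi> \<in> set other_factors" for \<pi> using other_factors_irreducible[OF that] by auto
  have x: "xm1 ^ 3 \<noteq> 0" "degree (xm1 ^ 3) = 3" by (simp_all add: xm1_def degree_power_eq)
  have prod: "(\<Prod>\<pi>\<in>set other_factors. \<pi>) \<noteq> 0" using nz by auto
  have "degree (\<Prod>\<pi>\<in>set other_factors. \<pi>) = (\<Sum>\<pi>\<in>set other_factors. degree \<pi>)"
    using nz by (intro degree_prod_eq_sum_degree) auto
  also have "\<dots> = sum_list (map degree other_factors)"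
    using other_factors_distinct by (simp add: sum_list_distinct_conv_sum_set)
  also have "\<dots> = 51" by (simp add: other_factors_def inert_data_def split_data_def)
  finally have "degree (\<Prod>\<pi>\<in>set other_factors. \<pi>) = 51" .
  then show "hx \<noteq> 0" "degree hx = 54" using x prod unfolding hx_def by (simp_all add: degree_mult_eq)
qed

lemma interp_fun_nonzero: "interp_fun \<noteq> 0"
  using hx_nonzero ycoord_nonzero by (simp add: interp_fun_def)

lemma dg_interp_fun: "dg interp_fun = 111"
  using hx_nonzero ycoord_nonzero by (simp add: interp_fun_def dg_mult dg_pol dg_ycoord degree_hx)

section \<open>Zeros and orders of the interpolation function\<close>

lemma monic_irreducible_unique:
  assumes p: "aff_prime p" and \<pi>: "irreducible \<pi>" "lead_coeff \<pi> = 1" "pol \<pi> \<in> p"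
  shows "pol q \<in> p \<longleftrightarrow> \<pi> dvd q"
proof -
  obtain \<pi>' where \<pi>': "irreducible \<pi>'" "lead_coeff \<pi>' = 1" "\<And>q. pol q \<in> p \<longleftrightarrow> \<pi>' dvd q"
    by (rule aff_prime_under[OF p]) blast
  have "\<pi>' dvd \<pi>" using \<pi> \<pi>' by simp
  then have "\<pi> dvd \<pi>'" using \<pi>(1) \<pi>'(1) by (meson irreducibleD' irreducible_not_unit)
  then show ?thesis using \<pi>'(3) \<open>\<pi>' dvd \<pi>\<close> by (meson dvd_trans)
qed

lemma monic_irreducible_eq:
  assumes "aff_prime p" "irreducible \<pi>" "lead_coeff \<pi> = 1" "pol \<pi> \<in> p"
    and "irreducible \<pi>'" "lead_coeff \<pi>' = 1" "pol \<pi>' \<in> p"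
  shows "\<pi> = \<pi>'"
proof -
  have d: "\<pi> dvd \<pi>'" "\<pi>' dvd \<pi>" using monic_irreducible_unique assms by blast+
  then obtain c where c: "\<pi>' = \<pi> * c" by (elim dvdE)
  have nz: "\<pi> \<noteq> 0" "\<pi>' \<noteq> 0" using assms by auto
  then have "c \<noteq> 0" "degree c = 0"
    using c d(2) dvd_imp_degree_le[OF d(2)] by (auto simp: degree_mult_eq)
  then obtain a where a: "c = [:a:]" by (auto elim: degree_eq_zeroE)
  then have "lead_coeff \<pi>' = lead_coeff \<pi> * a" using c by (simp add: lead_coeff_mult mult.commute)
  then have "a = 1" using assms by simp
  then show ?thesis using c a by simp
qed

text \<open>y vanishes only over the cubic, so elsewhere the monic irreducible below
  \<open>p\<close> is itself a local parameter.\<close>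

lemma vp_pol_unramified:
  assumes p: "aff_prime p" and \<pi>: "irreducible \<pi>" "lead_coeff \<pi> = 1" "pol \<pi> \<in> p" and y: "\<pi> \<noteq> cubic"
  shows "vp p (pol \<pi>) = 1" "ycoord \<notin> p"
proof -
  show yp: "ycoord \<notin> p"
  proof
    assume "ycoord \<in> p"
    then have "pol cubic \<in> p" using aff_prime_closed(5)[OF p, of ycoord ycoord] by (simp add: ycoord_sq)
    then show False using monic_irreducible_eq[OF p \<pi> irreducible_cubic] y by (simp add: cubic_def)
  qed
  have "local_parameter p (pol \<pi>)"
    using monic_irreducible_unique[OF p \<pi>] \<pi> by (intro local_parameter_unramified[OF p yp]) auto
  then show "vp p (pol \<pi>) = 1" unfolding vp_def using val_unif[OF loc_dvr[OF p]] loc_unif[OF p] by blast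
qed

text \<open>At most one of the distinct monic irreducible factors vanishes at a point, and its
  exponent in \<open>hx\<close> is the order there.\<close>

lemma vp_hx:
  assumes p: "aff_prime p"
  shows "pol xm1 \<in> p \<Longrightarrow> vp p (pol hx) = 3"
    "\<pi> \<in> set other_factors \<Longrightarrow> pol \<pi> \<in> p \<Longrightarrow> vp p (pol hx) = 1"
    "pol hx \<in> p \<longleftrightarrow> (\<exists>\<pi>\<in>insert xm1 (set other_factors). pol \<pi> \<in> p)"
proof -
  have nz: "\<pi> \<noteq> 0" if "\<pi> \<in> set other_factors" for \<pi> using other_factors_irreducible[OF that] by auto
  have x: "xm1 \<noteq> 0" "lead_coeff xm1 = 1" by (simp_all add: xm1_def)
  have pol_prod: "pol (\<Prod>\<pi>\<in>T. \<pi>) = (\<Prod>\<pi>\<in>T. pol \<pi>)" for T by (induction T rule: infinite_finite_induct) auto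
  have vprod: "vp p (\<Prod>\<pi>\<in>T. pol \<pi>) = (\<Sum>\<pi>\<in>T. vp p (pol \<pi>))" if "finite T" "T \<subseteq> set other_factors" for T
    using that
  proof (induction T)
    case empty show ?case by (simp add: vp_def val_one[OF loc_dvr[OF p]])
  next
    case (insert a T)
    then have "(\<Prod>\<pi>\<in>T. pol \<pi>) \<noteq> 0" "pol a \<noteq> 0" using nz by auto
    then show ?case using insert by (simp add: vp_mult[OF p])
  qed
  have "pol (\<Prod>\<pi>\<in>set other_factors. \<pi>) \<noteq> 0" using nz by auto
  then have v: "vp p (pol hx) = 3 * vp p (pol xm1) + (\<Sum>\<pi>\<in>set other_factors. vp p (pol \<pi>))"
    unfolding hx_def pol_simps pol_power using x(1)
    by (simp add: vp_mult[OF p] vp_power[OF p] pol_prod vprod)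
  note irr = other_factors_irreducible and mon = other_factors_monic
  have dist: "xm1 \<notin> set other_factors" "cubic \<notin> set other_factors" "xm1 \<noteq> cubic"
    using other_factors_distinct by auto
  {
    assume xp: "pol xm1 \<in> p"
    have "vp p (pol \<pi>) = 0" if "\<pi> \<in> set other_factors" for \<pi>
      using monic_irreducible_eq[OF p irreducible_xm1 x(2) xp irr[OF that] mon[OF that]] that dist nz[OF that]
        vp_zero_iff[OF p, of "pol \<pi>"] by auto
    then show "vp p (pol hx) = 3"
      using v vp_pol_unramified(1)[OF p irreducible_xm1 x(2) xp dist(3)] by simp
  }
  {
    assume \<pi>: "\<pi> \<in> set other_factors" "pol \<pi> \<in> p"
    have "vp p (pol xm1) = 0"
      using monic_irreducible_eq[OF p irreducible_xm1 x(2) _ irr[OF \<pi>(1)] mon[OF \<pi>(1)] \<pi>(2)] \<pi>(1) dist x(1)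
        vp_zero_iff[OF p, of "pol xm1"] by auto
    moreover have "vp p (pol \<pi>') = 0" if "\<pi>' \<in> set other_factors - {\<pi>}" for \<pi>'
      using monic_irreducible_eq[OF p irr[OF \<pi>(1)] mon[OF \<pi>(1)] \<pi>(2) irr[of \<pi>'] mon[of \<pi>']] that nz[of \<pi>']
        vp_zero_iff[OF p, of "pol \<pi>'"] by auto
    moreover have "vp p (pol \<pi>) = 1" using vp_pol_unramified(1)[OF p irr[OF \<pi>(1)] mon[OF \<pi>(1)] \<pi>(2)] dist \<pi>(1) by auto
    ultimately show "vp p (pol hx) = 1" using v sum.remove[of "set other_factors" \<pi> "\<lambda>\<pi>. vp p (pol \<pi>)"] \<pi>(1) by simp
  }
  have "(\<Prod>\<pi>\<in>T. pol \<pi>) \<in> p \<longleftrightarrow> (\<exists>\<pi>\<in>T. pol \<pi> \<in> p)" if "finite T" for T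
    using that by (induction T) (auto simp: aff_prime_one[OF p] aff_prime_mult[OF p])
  moreover have "pol xm1 ^ 3 \<in> p \<longleftrightarrow> pol xm1 \<in> p"
    using aff_prime_power[OF p] aff_prime_closed(6)[OF p] by (metis power3_eq_cube)
  ultimately show "pol hx \<in> p \<longleftrightarrow> (\<exists>\<pi>\<in>insert xm1 (set other_factors). pol \<pi> \<in> p)"
    unfolding hx_def by (simp add: aff_prime_mult[OF p] pol_prod)
qed

text \<open>The cubic is irreducible, so the three geometric points with y = 0 form a single point
  of degree 3.\<close>

definition y_prime :: "aff set" where "y_prime = split_prime cubic 0"

lemma aff_prime_y: "aff_prime y_prime"
  unfolding y_prime_def by (rule aff_prime_split[OF irreducible_cubic]) simp

lemma rcard_y: "rcard (loc y_prime) = 3 ^ 3"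
  unfolding y_prime_def using rcard_split[OF irreducible_cubic, of 0] by (simp add: degree_cubic)

lemma ycoord_mem_iff: assumes p: "aff_prime p" shows "ycoord \<in> p \<longleftrightarrow> p = y_prime"
proof
  assume "ycoord \<in> p"
  then have "pol cubic \<in> p" using aff_prime_closed(5)[OF p, of ycoord ycoord] by (simp add: ycoord_sq)
  then show "p = y_prime" using prime_over_split[OF p irreducible_cubic, of 0] by (simp add: y_prime_def)
qed (simp add: y_prime_def split_prime_def)

lemma vp_interp:
  assumes p: "aff_prime p"
  shows "p = y_prime \<Longrightarrow> vp p interp_fun = 1" "p \<noteq> y_prime \<Longrightarrow> vp p interp_fun = vp p (pol hx)"
    "interp_fun \<in> p \<longleftrightarrow> p = y_prime \<or> pol hx \<in> p"
proof -
  have v: "vp p interp_fun = vp p (pol hx) + vp p ycoord"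
    unfolding interp_fun_def using hx_nonzero ycoord_nonzero by (simp add: vp_mult[OF p])
  show "p \<noteq> y_prime \<Longrightarrow> vp p interp_fun = vp p (pol hx)"
    using v vp_zero_iff[OF p ycoord_nonzero] ycoord_mem_iff[OF p] by simp
  show "interp_fun \<in> p \<longleftrightarrow> p = y_prime \<or> pol hx \<in> p"
    unfolding interp_fun_def using aff_prime_mult[OF p] ycoord_mem_iff[OF p] by blast
  assume py: "p = y_prime"
  then have yp: "ycoord \<in> p" using ycoord_mem_iff[OF p] by blast
  have "pol \<pi> \<notin> p" if "\<pi> \<in> insert xm1 (set other_factors)" for \<pi>
  proof
    assume mem: "pol \<pi> \<in> p"
    have "irreducible \<pi>" "lead_coeff \<pi> = 1" "\<pi> \<noteq> cubic"
      using that irreducible_xm1 other_factors_irreducible other_factors_monic other_factors_distinct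
      by (auto simp: xm1_def[THEN arg_cong[of _ _ lead_coeff]] simp del: irreducible_xm1) (simp_all add: xm1_def)?
    then show False using vp_pol_unramified(2)[OF p _ _ mem] yp by blast
  qed
  then have "vp p (pol hx) = 0" using vp_hx(3)[OF p] vp_zero_iff[OF p, of "pol hx"] hx_nonzero by simp
  moreover have "vp p ycoord = 1"
    unfolding vp_def using val_unif[OF loc_dvr[OF p] loc_unif[OF p local_parameter_ramified(1)[OF p yp irreducible_cubic]]] .
  ultimately show "vp p interp_fun = 1" using v by simp
qed

text \<open>At infinity the pole of \<open>interp_fun\<close> is replaced by the multiplicity three
  that \<open>G\<close> has at rational points. Sets that are no points get 0, as
  \<open>divisors\<close> requires.\<close>

definition Gdiv :: "aff fract set \<Rightarrow> int" where
  "Gdiv P = (if P = inf_ring then 3 else if dvr P then val P (to_fract interp_fun) else 0)"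

lemma Gdiv_inf: "Gdiv inf_ring = 3" by (simp add: Gdiv_def)

lemma Gdiv_loc: "aff_prime p \<Longrightarrow> Gdiv (loc p) = vp p interp_fun"
  by (simp add: Gdiv_def loc_neq_inf_ring loc_dvr vp_def)

lemma Gdiv_nonneg: "0 \<le> Gdiv P"
proof (cases "dvr P")
  case True
  then show ?thesis unfolding dvr_classification
    using Gdiv_loc vp_nonneg[OF _ interp_fun_nonzero] by (auto simp: Gdiv_inf)
qed (use inf_dvr in \<open>auto simp: Gdiv_def\<close>)

definition zeros :: "f3 poly \<Rightarrow> aff set set" where "zeros h = {p. aff_prime p \<and> pol h \<in> p}"

lemma zeros_hx: "zeros hx = (\<Union>\<pi>\<in>insert xm1 (set other_factors). zeros \<pi>)"
  using vp_hx(3) by (auto simp: zeros_def)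

lemma Gdiv_supp: "{P. Gdiv P \<noteq> 0} = insert inf_ring (loc ` insert y_prime (zeros hx))"
proof -
  have A: "Gdiv (loc p) \<noteq> 0 \<longleftrightarrow> p \<in> insert y_prime (zeros hx)" if "aff_prime p" for p
    using that vp_zero_iff[OF that interp_fun_nonzero] vp_interp(3)[OF that] by (simp add: Gdiv_loc zeros_def)
  have C: "aff_prime p" if "p \<in> insert y_prime (zeros hx)" for p using that aff_prime_y by (auto simp: zeros_def)
  show ?thesis
  proof (intro equalityI subsetI)
    fix P assume P: "P \<in> {P. Gdiv P \<noteq> 0}"
    then have "dvr P" using inf_dvr by (auto simp: Gdiv_def split: if_splits)
    then consider "P = inf_ring" | p where "aff_prime p" "P = loc p" unfolding dvr_classification by blast
    then show "P \<in> insert inf_ring (loc ` insert y_prime (zeros hx))"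
    proof cases
      case 2 then show ?thesis using P A[OF 2(1)] by blast
    qed simp
  next
    fix P assume "P \<in> insert inf_ring (loc ` insert y_prime (zeros hx))"
    then consider "P = inf_ring" | p where "p \<in> insert y_prime (zeros hx)" "P = loc p" by blast
    then show "P \<in> {P. Gdiv P \<noteq> 0}"
    proof cases
      case 1 then show ?thesis by (simp add: Gdiv_inf)
    next
      case 2 then show ?thesis using A[OF C[OF 2(1)]] by blast
    qed
  qed
qed

lemma finite_Gdiv_supp: "finite {P. Gdiv P \<noteq> 0}"
  unfolding Gdiv_supp using finite_zeros[OF hx_nonzero] by (simp add: zeros_def)

lemma Gdiv_supp_dvr: "Gdiv P \<noteq> 0 \<Longrightarrow> dvr P"
  using inf_dvr by (auto simp: Gdiv_def split: if_splits)

lemma y_not_zero_hx: "y_prime \<notin> zeros hx"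
proof
  assume "y_prime \<in> zeros hx"
  then obtain \<pi> where \<pi>: "\<pi> \<in> insert xm1 (set other_factors)" "pol \<pi> \<in> y_prime" unfolding zeros_hx by (auto simp: zeros_def)
  then have "irreducible \<pi> \<and> lead_coeff \<pi> = 1 \<and> \<pi> \<noteq> cubic"
    using irreducible_xm1 other_factors_irreducible other_factors_monic other_factors_distinct
    by (auto simp: xm1_def)
  then show False using vp_pol_unramified(2)[OF aff_prime_y _ _ \<pi>(2)] ycoord_mem_iff[OF aff_prime_y] by blast
qed

text \<open>Factors 27 at infinity and 27 at the point with y = 0, and at most 9^54 for the zeros of
  \<open>hx\<close>. The product is the size of the target of evaluation at
  \<open>G\<close>.\<close>

lemma rcard_interp: "(\<Prod>P | Gdiv P \<noteq> 0. rcard P ^ nat (Gdiv P)) \<le> 3 ^ 114"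
proof -
  have fin: "finite (zeros hx)" using finite_zeros[OF hx_nonzero] by (simp add: zeros_def)
  have pr: "aff_prime p" if "p \<in> zeros hx" for p using that by (simp add: zeros_def)
  have inj: "inj_on loc (insert y_prime (zeros hx))"
    using to_fract_mem_loc_inj aff_prime_y by (auto intro!: inj_onI simp: zeros_def)
  have "(\<Prod>P | Gdiv P \<noteq> 0. rcard P ^ nat (Gdiv P)) = 27 * (\<Prod>P\<in>loc ` insert y_prime (zeros hx). rcard P ^ nat (Gdiv P))"
    unfolding Gdiv_supp using fin pr aff_prime_y loc_neq_inf_ring
    by (subst prod.insert) (auto simp: Gdiv_inf rcard_inf)
  also have "(\<Prod>P\<in>loc ` insert y_prime (zeros hx). rcard P ^ nat (Gdiv P)) = (\<Prod>p\<in>insert y_prime (zeros hx). rcard (loc p) ^ nat (Gdiv (loc p)))"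
    by (subst prod.reindex[OF inj]) simp
  also have "\<dots> = 27 * (\<Prod>p\<in>zeros hx. rcard (loc p) ^ nat (Gdiv (loc p)))"
    using fin y_not_zero_hx by (simp add: Gdiv_loc[OF aff_prime_y] vp_interp(1)[OF aff_prime_y] rcard_y)
  also have "(\<Prod>p\<in>zeros hx. rcard (loc p) ^ nat (Gdiv (loc p))) = (\<Prod>p\<in>zeros hx. rcard (loc p) ^ nat (vp p (pol hx)))"
    using y_not_zero_hx by (intro prod.cong refl) (metis Gdiv_loc pr vp_interp(2))
  also have "\<dots> \<le> 9 ^ 54" using prod_rcard_le[OF fin pr hx_nonzero] by (simp add: degree_hx)
  finally show ?thesis by simp
qed

section \<open>The cost of the interpolation divisor\<close>

text \<open>The values 5, 3, 6, 9 belong to multiplicity three at a rational point and to simple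
  points of degree 2, 3, 4; by \<open>known_types\<close> no other case arises on the
  support.\<close>

definition cost :: "aff fract set \<Rightarrow> nat" where
  "cost P = (if Gdiv P = 3 then 5 else if rcard P = 3 ^ 2 then 3 else if rcard P = 3 ^ 3 then 6 else 9)"

definition known_type :: "aff fract set \<Rightarrow> bool" where
  "known_type P \<longleftrightarrow> (Gdiv P = 3 \<and> rcard P = 3) \<or> (Gdiv P = 1 \<and> rcard P \<in> {3 ^ 2, 3 ^ 3, 3 ^ 4})"

lemma zeros_split:
  assumes "irreducible \<pi>" "\<pi> dvd g * g - cubic"
  shows "zeros \<pi> \<subseteq> {split_prime \<pi> g, split_prime \<pi> (- g)}"
  using prime_over_split[OF _ assms(1) _ assms(2)] by (auto simp: zeros_def)

lemma rcard_zeros_split: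
  assumes "irreducible \<pi>" "\<pi> dvd g * g - cubic" "p \<in> zeros \<pi>"
  shows "rcard (loc p) = 3 ^ degree \<pi>"
  using zeros_split[OF assms(1,2)] rcard_split[OF assms(1)] assms(2,3) by fastforce

lemma sum_zeros_split_le:
  assumes "irreducible \<pi>" "\<pi> dvd g * g - cubic" "\<And>p. p \<in> zeros \<pi> \<Longrightarrow> f p \<le> c"
  shows "(\<Sum>p\<in>zeros \<pi>. f p) \<le> 2 * (c::nat)"
proof -
  have "card (zeros \<pi>) \<le> card {split_prime \<pi> g, split_prime \<pi> (- g)}"
    by (rule card_mono[OF _ zeros_split[OF assms(1,2)]]) simp
  also have "\<dots> \<le> 2" by (simp add: card_insert_if)
  finally have "card (zeros \<pi>) \<le> 2" .
  have "(\<Sum>p\<in>zeros \<pi>. f p) \<le> card (zeros \<pi>) * c" using sum_bounded_above[of "zeros \<pi>" f c] assms(3) by simp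
  also have "\<dots> \<le> 2 * c" using \<open>card (zeros \<pi>) \<le> 2\<close> by (rule mult_le_mono1)
  finally show ?thesis .
qed

text \<open>At x = 0 and x = -1 the cubic takes the value -1, a nonsquare in F_3; modulo x^2 + 1 all
  nine remainders are tried.\<close>

lemma inert_data_inert:
  assumes \<pi>: "\<pi> \<in> set inert_data" shows "\<not> \<pi> dvd g * g - cubic"
proof
  assume d: "\<pi> dvd g * g - cubic"
  have nsq: "c * c + 1 \<noteq> 0" for c :: f3 by (cases c rule: f3_cases) (auto simp: f3_two)
  consider "\<pi> = [:0,1:]" | "\<pi> = [:1,1:]" | "\<pi> = [:1,0,1:]" using \<pi> by (auto simp: inert_data_def)
  then show False
  proof cases
    case 1
    then have "poly (g * g - cubic) 0 = 0" using d poly_eq_0_iff_dvd[of "g * g - cubic" 0] by simp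
    then show False using nsq[of "poly g 0"] by (simp add: cubic_def)
  next
    case 2
    then have "poly (g * g - cubic) (- 1) = 0" using d poly_eq_0_iff_dvd[of "g * g - cubic" "- 1"] by simp
    then show False using nsq[of "poly g (- 1)"] by (simp add: cubic_def)
  next
    case 3
    define r where "r = g mod \<pi>"
    have "\<pi> dvd (g - r) * (g + r)" unfolding r_def by (intro dvd_mult2 dvd_minus_mod)
    then have "\<pi> dvd (g * g - cubic) - (g - r) * (g + r)" by (rule dvd_diff[OF d])
    then have "\<pi> dvd r * r - cubic" by (simp add: algebra_simps)
    then have r0: "(r * r - cubic) mod [:1,0,1:] = 0" using 3 by auto
    have "r = 0 \<or> degree r < 2" using 3 degree_mod_less[of \<pi> g] by (auto simp: r_def)
    then obtain a b where "r = [:a, b:]"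
    proof -
      obtain a q where q: "r = pCons a q" by (cases r)
      then have "degree q = 0" using \<open>r = 0 \<or> degree r < 2\<close> by (auto split: if_splits)
      then show ?thesis using that q by (elim degree_eq_zeroE) auto
    qed
    have chk: "\<forall>a\<in>{0,1,-1}. \<forall>b\<in>{0,1,-1}. ([:a,b:] * [:a,b:] - cubic) mod [:1,0,1:] \<noteq> (0 :: f3 poly)"
      unfolding cubic_def by code_simp
    have mem: "x \<in> {0,1,-1}" for x :: f3 by (cases x rule: f3_cases) auto
    have "([:a,b:] * [:a,b:] - cubic) mod [:1,0,1:] \<noteq> 0"
      using chk[THEN bspec, OF mem[of a], THEN bspec, OF mem[of b]] .
    then show False using r0 \<open>r = [:a, b:]\<close> by simp
  qed
qed

lemma zeros_inert:
  assumes \<pi>: "\<pi> \<in> set inert_data" and p: "p \<in> zeros \<pi>"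
  shows "p = inert_prime \<pi>" "rcard (loc p) = 9 ^ degree \<pi>"
proof -
  have pr: "aff_prime p" "pol \<pi> \<in> p" using p by (auto simp: zeros_def)
  show eq: "p = inert_prime \<pi>"
    using prime_over[OF pr(1) inert_data_irreducible[OF \<pi>] pr(2)] inert_data_inert[OF \<pi>] by blast
  show "rcard (loc p) = 9 ^ degree \<pi>"
    using rcard_inert[OF inert_data_irreducible[OF \<pi>]] pr(1) unfolding eq by blast
qed

lemma Gdiv_zeros:
  shows "p \<in> zeros xm1 \<Longrightarrow> Gdiv (loc p) = 3"
    "\<pi> \<in> set other_factors \<Longrightarrow> p \<in> zeros \<pi> \<Longrightarrow> Gdiv (loc p) = 1"
proof -
  have *: "Gdiv (loc p) = vp p (pol hx)" if "p \<in> zeros hx" for p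
    using that y_not_zero_hx Gdiv_loc[of p] vp_interp(2)[of p] by (auto simp: zeros_def)
  show "p \<in> zeros xm1 \<Longrightarrow> Gdiv (loc p) = 3" using *[of p] vp_hx(1)[of p] zeros_hx by (auto simp: zeros_def)
  assume "\<pi> \<in> set other_factors" "p \<in> zeros \<pi>"
  then show "Gdiv (loc p) = 1" using *[of p] vp_hx(2)[of p \<pi>] zeros_hx by (auto simp: zeros_def)
qed

lemma xm1_dvd: "xm1 dvd 1 * 1 - cubic"
proof -
  have "(1 * 1 - cubic) mod xm1 = 0" unfolding xm1_def cubic_def by code_simp
  then show ?thesis by auto
qed

lemma degree_split_data: "(\<pi>, g) \<in> set split_data \<Longrightarrow> degree \<pi> \<in> {2, 3, 4}"
  by (auto simp: split_data_def)

lemma known_types: assumes "Gdiv P \<noteq> 0" shows "known_type P"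
proof -
  consider "P = inf_ring" | "P = loc y_prime" | p where "p \<in> zeros xm1" "P = loc p"
    | \<pi> g p where "(\<pi>, g) \<in> set split_data" "p \<in> zeros \<pi>" "P = loc p"
    | \<pi> p where "\<pi> \<in> set inert_data" "p \<in> zeros \<pi>" "P = loc p"
  proof -
    have "P = inf_ring \<or> (\<exists>p. P = loc p \<and> (p = y_prime \<or> p \<in> zeros hx))" using assms Gdiv_supp by blast
    moreover have "p \<in> zeros xm1 \<or> (\<exists>\<pi>\<in>set inert_data. p \<in> zeros \<pi>) \<or> (\<exists>\<pi> g. (\<pi>, g) \<in> set split_data \<and> p \<in> zeros \<pi>)"
      if "p \<in> zeros hx" for p using that unfolding zeros_hx other_factors_def by fastforce
    ultimately show ?thesis using that by blast
  qed
  then show ?thesis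
  proof cases
    case 1 then show ?thesis by (simp add: known_type_def Gdiv_inf rcard_inf)
  next
    case 2 then show ?thesis using Gdiv_loc[OF aff_prime_y] vp_interp(1)[OF aff_prime_y] rcard_y by (simp add: known_type_def)
  next
    case 3
    then show ?thesis using Gdiv_zeros(1) rcard_zeros_split[OF irreducible_xm1 xm1_dvd]
      by (simp add: known_type_def xm1_def)
  next
    case 4
    have "\<pi> \<in> set other_factors" using 4(1) by (force simp: other_factors_def)
    then have "Gdiv P = 1" using Gdiv_zeros(2)[OF _ 4(2)] 4(3) by simp
    then show ?thesis
      using rcard_zeros_split[OF split_data_irreducible[OF 4(1)] split_data_dvd[OF 4(1)] 4(2)] degree_split_data[OF 4(1)] 4(3)
      by (auto simp: known_type_def)
  next
    case 5
    have "\<pi> \<in> set other_factors" using 5(1) by (simp add: other_factors_def)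
    then have "Gdiv P = 1" using Gdiv_zeros(2)[OF _ 5(2)] 5(3) by simp
    moreover have "degree \<pi> \<in> {1, 2}" using 5 by (auto simp: inert_data_def)
    ultimately show ?thesis using zeros_inert(2)[OF 5(1,2)] 5(3) by (auto simp: known_type_def)
  qed
qed

text \<open>Twice the cost of one point, for the conjugate pair over a split polynomial of degree
  \<open>d\<close>.\<close>

definition factor_cost :: "nat \<Rightarrow> nat" where
  "factor_cost d = (if d = 2 then 6 else if d = 3 then 12 else 18)"

lemma sum_UNION_le:
  fixes f :: "'b \<Rightarrow> nat"
  assumes "finite I" "\<And>i. i \<in> I \<Longrightarrow> finite (A i)"
  shows "sum f (\<Union>i\<in>I. A i) \<le> (\<Sum>i\<in>I. sum f (A i))"
  using assms
proof (induction I)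
  case (insert x F)
  have "sum f (A x \<union> (\<Union>i\<in>F. A i)) \<le> sum f (A x) + sum f (\<Union>i\<in>F. A i)"
    using insert by (subst sum.union_inter[symmetric]) auto
  then show ?case using insert by simp
qed simp

text \<open>5 at infinity, 6 at the point with y = 0, 10 over x - 1, 15 over
  \<open>inert_data\<close> and 198 over \<open>split_data\<close>.\<close>

lemma sum_cost: "(\<Sum>P | Gdiv P \<noteq> 0. cost P) \<le> 234"
proof -
  have fin: "finite (zeros \<pi>)" if "irreducible \<pi>" for \<pi>
  proof -
    have "\<pi> \<noteq> 0" using that by auto
    then show ?thesis using finite_zeros[of \<pi>] by (simp add: zeros_def)
  qed
  have finx: "finite (zeros hx)" using finite_zeros[OF hx_nonzero] by (simp add: zeros_def)
  define f where "f p = cost (loc p)" for p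
  have x: "(\<Sum>p\<in>zeros xm1. f p) \<le> 2 * 5"
    using Gdiv_zeros(1) by (intro sum_zeros_split_le[OF irreducible_xm1 xm1_dvd]) (simp add: f_def cost_def)
  have split: "(\<Sum>p\<in>zeros \<pi>. f p) \<le> factor_cost (degree \<pi>)" if "(\<pi>, g) \<in> set split_data" for \<pi> g
  proof -
    note irr = split_data_irreducible[OF that] and dvd = split_data_dvd[OF that]
    have "\<pi> \<in> set other_factors" using that by (force simp: other_factors_def)
    have "f p \<le> factor_cost (degree \<pi>) div 2" if p: "p \<in> zeros \<pi>" for p
      using Gdiv_zeros(2)[OF \<open>\<pi> \<in> set other_factors\<close> p] rcard_zeros_split[OF irr dvd p] degree_split_data[OF \<open>(\<pi>, g) \<in> set split_data\<close>]
      by (auto simp: f_def cost_def factor_cost_def)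
    then have "(\<Sum>p\<in>zeros \<pi>. f p) \<le> 2 * (factor_cost (degree \<pi>) div 2)" by (rule sum_zeros_split_le[OF irr dvd])
    then show ?thesis by (simp add: factor_cost_def split: if_splits)
  qed
  have inert: "(\<Sum>p\<in>zeros \<pi>. f p) \<le> (if degree \<pi> = 1 then 3 else 9)" if \<pi>: "\<pi> \<in> set inert_data" for \<pi>
  proof -
    have "\<pi> \<in> set other_factors" using \<pi> by (simp add: other_factors_def)
    have "zeros \<pi> \<subseteq> {inert_prime \<pi>}" using zeros_inert(1)[OF \<pi>] by blast
    then have "card (zeros \<pi>) \<le> 1" using card_mono[of "{inert_prime \<pi>}" "zeros \<pi>"] by simp
    moreover have "f p \<le> (if degree \<pi> = 1 then 3 else 9)" if p: "p \<in> zeros \<pi>" for p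
      using Gdiv_zeros(2)[OF \<open>\<pi> \<in> set other_factors\<close> p] zeros_inert(2)[OF \<pi> p] by (auto simp: f_def cost_def)
    then have "(\<Sum>p\<in>zeros \<pi>. f p) \<le> card (zeros \<pi>) * (if degree \<pi> = 1 then 3 else 9)"
      using sum_bounded_above[of "zeros \<pi>" f] by simp
    ultimately show ?thesis by (smt (verit) mult_le_mono1 nat_mult_1 le_trans)
  qed
  define I where "I = map fst split_data"
  have dI: "distinct I" "distinct inert_data" using other_factors_distinct by (simp_all add: I_def other_factors_def)
  have "(\<Sum>p\<in>(\<Union>\<pi>\<in>set I. zeros \<pi>). f p) \<le> (\<Sum>\<pi>\<in>set I. \<Sum>p\<in>zeros \<pi>. f p)"
    by (rule sum_UNION_le) (auto simp: I_def intro!: fin intro: split_data_irreducible)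
  also have "\<dots> \<le> (\<Sum>\<pi>\<in>set I. factor_cost (degree \<pi>))" by (rule sum_mono) (use split in \<open>auto simp: I_def\<close>)
  also have "\<dots> = sum_list (map (\<lambda>\<pi>. factor_cost (degree \<pi>)) I)"
    by (rule sum_list_distinct_conv_sum_set[OF dI(1), symmetric])
  also have "\<dots> = 198" by (simp add: I_def split_data_def factor_cost_def)
  finally have 1: "(\<Sum>p\<in>(\<Union>\<pi>\<in>set I. zeros \<pi>). f p) \<le> 198" .
  have "(\<Sum>p\<in>(\<Union>\<pi>\<in>set inert_data. zeros \<pi>). f p) \<le> (\<Sum>\<pi>\<in>set inert_data. \<Sum>p\<in>zeros \<pi>. f p)"
    by (rule sum_UNION_le) (auto intro: fin inert_data_irreducible)
  also have "\<dots> \<le> (\<Sum>\<pi>\<in>set inert_data. if degree \<pi> = 1 then 3 else 9)" by (rule sum_mono) (use inert in auto)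
  also have "\<dots> = sum_list (map (\<lambda>\<pi>. if degree \<pi> = 1 then 3 else 9) inert_data)"
    by (rule sum_list_distinct_conv_sum_set[OF dI(2), symmetric])
  also have "\<dots> = 15" by (simp add: inert_data_def)
  finally have 2: "(\<Sum>p\<in>(\<Union>\<pi>\<in>set inert_data. zeros \<pi>). f p) \<le> 15" .
  have zx: "zeros hx = zeros xm1 \<union> ((\<Union>\<pi>\<in>set inert_data. zeros \<pi>) \<union> (\<Union>\<pi>\<in>set I. zeros \<pi>))"
    unfolding zeros_hx other_factors_def I_def by auto
  have un: "sum f (A \<union> B) \<le> sum f A + sum f B" if "finite A" "finite B" for A B
    using that by (subst sum.union_inter[symmetric]) auto
  have sub: "finite (zeros xm1)" "finite (\<Union>\<pi>\<in>set inert_data. zeros \<pi>)" "finite (\<Union>\<pi>\<in>set I. zeros \<pi>)"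
    using finx unfolding zx by auto
  have hxs: "sum f (zeros hx) \<le> 223"
    unfolding zx using un[OF sub(1) finite_UnI[OF sub(2,3)]] un[OF sub(2,3)] x 1 2 by linarith
  have inj: "inj_on loc (insert y_prime (zeros hx))"
    using to_fract_mem_loc_inj aff_prime_y by (auto intro!: inj_onI simp: zeros_def)
  have "(\<Sum>P | Gdiv P \<noteq> 0. cost P) = cost inf_ring + (\<Sum>P\<in>loc ` insert y_prime (zeros hx). cost P)"
    unfolding Gdiv_supp using finx aff_prime_y loc_neq_inf_ring
    by (subst sum.insert) (auto simp: zeros_def)
  also have "(\<Sum>P\<in>loc ` insert y_prime (zeros hx). cost P) = (\<Sum>p\<in>insert y_prime (zeros hx). f p)"
    by (subst sum.reindex[OF inj]) (simp add: f_def)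
  also have "\<dots> = 6 + sum f (zeros hx)"
    using finx y_not_zero_hx Gdiv_loc[OF aff_prime_y] vp_interp(1)[OF aff_prime_y] rcard_y
    by (simp add: f_def cost_def)
  also have "cost inf_ring = 5" by (simp add: cost_def Gdiv_inf)
  finally show ?thesis using hxs by linarith
qed

section \<open>The two evaluation maps\<close>

text \<open>Such a function is a + b x, and x - 1 has order one at the points over it, so a nonzero
  constant multiple of x - 1 cannot vanish twice. This encodes that 2 (R - infinity) is not
  principal.\<close>

lemma linear_order_two:
  assumes p: "aff_prime p" and xp: "pol xm1 \<in> p" and w: "w \<in> aff_le 2" and v: "w = 0 \<or> 2 \<le> vp p w"
  shows "w = 0"
proof (rule ccontr)
  assume w0: "w \<noteq> 0"
  have x: "lead_coeff xm1 = 1" "xm1 \<noteq> cubic" by (simp_all add: xm1_def cubic_def)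
  obtain a b where ab: "w = pol [:a, b:]" using w aff_le_2 by blast
  have "w \<in> p" using v w0 vp_pos_iff[OF p w0] by simp
  then have "xm1 dvd [:a, b:]" unfolding ab using monic_irreducible_unique[OF p irreducible_xm1 x(1) xp] by blast
  then obtain c where c: "[:a, b:] = xm1 * c" by (elim dvdE)
  then have "c \<noteq> 0" using w0 ab by auto
  moreover have "degree [:a, b:] \<le> 1" by simp
  moreover have "xm1 \<noteq> 0" "degree xm1 = 1" by (simp_all add: xm1_def)
  ultimately have "degree c = 0" unfolding c by (subst (asm) degree_mult_eq) auto
  then obtain d where d: "c = [:d:]" by (auto elim: degree_eq_zeroE)
  then have "pol [:d:] \<noteq> 0" "pol [:d:] \<notin> p" using \<open>c \<noteq> 0\<close> aff_prime_pol_const[OF p, of d] by auto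
  moreover have "pol xm1 \<noteq> 0" by (simp add: xm1_def)
  ultimately have "vp p w = 1"
    unfolding ab c d pol_simps using vp_pol_unramified(1)[OF p irreducible_xm1 x(1) xp x(2)] vp_zero_iff[OF p, of "pol [:d:]"]
    by (simp add: vp_mult[OF p])
  then show False using v w0 by simp
qed

text \<open>For \<open>e\<close> equal to 1 and -1 these are \<open>R\<close> and
  \<open>R'\<close>.\<close>

definition rat_prime :: "f3 \<Rightarrow> aff set" where "rat_prime e = split_prime xm1 [:e:]"

definition sgn3 :: "f3 \<Rightarrow> bool" where "sgn3 e \<longleftrightarrow> e = 1 \<or> e = - 1"

lemma sgn3_minus: "sgn3 e \<Longrightarrow> sgn3 (- e)" by (auto simp: sgn3_def)

lemma rat_dvd: "sgn3 e \<Longrightarrow> xm1 dvd [:e:] * [:e:] - cubic"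
  using xm1_dvd by (auto simp: sgn3_def one_pCons)

lemma aff_prime_rat: "sgn3 e \<Longrightarrow> aff_prime (rat_prime e)"
  unfolding rat_prime_def by (rule aff_prime_split[OF irreducible_xm1 rat_dvd])

lemma xm1_mem_rat: "pol xm1 \<in> rat_prime e"
  by (simp add: rat_prime_def split_prime_pol)

lemma rat_neq: assumes "sgn3 e" shows "rat_prime e \<noteq> rat_prime (- e)"
proof
  assume eq: "rat_prime e = rat_prime (- e)"
  have "ycoord - pol [:e:] \<in> rat_prime e" by (simp add: rat_prime_def split_prime_def)
  then have "xm1 dvd [:- e:] + [:- e:]" unfolding eq by (simp add: rat_prime_def split_prime_def)
  moreover have "[:- e:] + [:- e:] = [:e:]" using assms by (auto simp: sgn3_def)
  ultimately have "xm1 dvd [:e:]" by (simp add: f3_two)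
  then show False using dvd_imp_degree_le[of xm1 "[:e:]"] assms by (auto simp: xm1_def sgn3_def)
qed

lemma vp_xm1:
  assumes "aff_prime p" shows "vp p (pol xm1) = (if pol xm1 \<in> p then 1 else 0)"
proof -
  have "lead_coeff xm1 = 1" "xm1 \<noteq> cubic" "pol xm1 \<noteq> 0" by (simp_all add: xm1_def cubic_def)
  then show ?thesis using vp_pol_unramified(1)[OF assms irreducible_xm1] vp_zero_iff[OF assms] by simp
qed

definition Ddiv :: "f3 \<Rightarrow> aff fract set \<Rightarrow> int" where
  "Ddiv e P = (if P = inf_ring then 56 else if P = loc (rat_prime e) then 1 else 0)"

lemma Ddiv_inf: "Ddiv e inf_ring = 56" by (simp add: Ddiv_def)

lemma Ddiv_loc: "aff_prime p \<Longrightarrow> sgn3 e \<Longrightarrow> Ddiv e (loc p) = (if p = rat_prime e then 1 else 0)"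
  using loc_neq_inf_ring to_fract_mem_loc_inj aff_prime_rat by (auto simp: Ddiv_def)

lemma Ddiv_supp: "sgn3 e \<Longrightarrow> {P. Ddiv e P \<noteq> 0} = {inf_ring, loc (rat_prime e)}"
  by (auto simp: Ddiv_def)

lemma val_loc_mult:
  assumes "aff_prime p" "f \<noteq> 0" "u \<noteq> 0" shows "val (loc p) (f * to_fract u) = val (loc p) f + vp p u"
  using assms by (simp add: val_mult[OF loc_dvr] vp_def)

text \<open>Dividing by \<open>interp_fun\<close> moves a section of \<open>2D - G\<close> to one of \<open>2R - 2\<infinity>\<close>, and \<open>2(R - \<infinity>)\<close> is not principal.\<close>

lemma sections_twice_minus_G:
  assumes e: "sgn3 e" and f: "f \<in> sections (\<lambda>P. 2 * Ddiv e P - Gdiv P)"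
  shows "f = 0"
proof (rule ccontr)
  assume f0: "f \<noteq> 0"
  \<comment> \<open>The factor (x - 1)^2 clears the possible double pole at the point of sign
    \<open>e\<close> and creates a double zero at its conjugate.\<close>
  define g where "g = f / to_fract interp_fun * to_fract (pol xm1 * pol xm1)"
  have x0: "xm1 \<noteq> 0" "dg (pol xm1) = 2" "degree xm1 = 1" by (simp_all add: xm1_def dg_pol)
  have H0: "to_fract interp_fun \<noteq> 0" using interp_fun_nonzero by simp
  have g0: "g \<noteq> 0" using f0 H0 x0 by (simp add: g_def)
  have vg: "val (loc p) g = val (loc p) f - vp p interp_fun + 2 * vp p (pol xm1)" if p: "aff_prime p" for p
  proof -
    have "pol xm1 \<noteq> 0" using x0 by simp
    then have "vp p (pol xm1 * pol xm1) = 2 * vp p (pol xm1)" by (simp add: vp_mult[OF p])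
    moreover have "val (loc p) g = val (loc p) (f / to_fract interp_fun) + vp p (pol xm1 * pol xm1)"
      unfolding g_def using f0 H0 x0 by (intro val_loc_mult[OF p]) auto
    ultimately show ?thesis using f0 H0 by (simp add: val_divide[OF loc_dvr[OF p]] vp_def)
  qed
  have vf: "Gdiv (loc p) - 2 * Ddiv e (loc p) \<le> val (loc p) f" if "aff_prime p" for p
    using f f0 that by (simp add: sections_iff mpow_def)
  have ge: "- 2 * (if p = rat_prime e then 1 else 0) + 2 * (if pol xm1 \<in> p then 1 else 0) \<le> val (loc p) g"
    if p: "aff_prime p" for p
    using vf[OF p] vg[OF p] by (simp add: Gdiv_loc[OF p] Ddiv_loc[OF p e] vp_xm1[OF p])
  have "g \<in> loc p" if p: "aff_prime p" for p
  proof -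
    have "0 \<le> val (loc p) g" using ge[OF p] xm1_mem_rat[of e] by (auto split: if_splits)
    then show ?thesis using g0 mem_iff_val[OF loc_dvr[OF p]] by blast
  qed
  then obtain u where u: "g = to_fract u" by (rule regular_imp_aff)
  then have u0: "u \<noteq> 0" using g0 by auto
  have "Gdiv inf_ring - 2 * Ddiv e inf_ring \<le> val inf_ring f" using f f0 by (simp add: sections_iff mpow_def)
  \<comment> \<open>3 - 2 * 56 = -109, and -109 + 111 - 4 = -2, so the pole of \<open>g\<close> at
    infinity has order at most 2.\<close>
  then have "- 109 \<le> val inf_ring f" by (simp add: Gdiv_inf Ddiv_inf)
  moreover have "val inf_ring g = val inf_ring f + 111 - 4"
    unfolding g_def using f0 H0 x0 interp_fun_nonzero
    by (simp add: val_mult[OF inf_dvr] val_divide[OF inf_dvr] val_inf_aff dg_interp_fun)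
  ultimately have "dg u \<le> 2" using val_inf_aff[OF u0] u by simp
  then have le: "u \<in> aff_le 2" by (simp add: aff_le_def)
  have pr: "aff_prime (rat_prime (- e))" by (rule aff_prime_rat[OF sgn3_minus[OF e]])
  have "2 \<le> vp (rat_prime (- e)) u"
    using ge[OF pr] rat_neq[OF e] xm1_mem_rat[of "- e"] u by (simp add: vp_def)
  then have "u = 0" using linear_order_two[OF pr xm1_mem_rat le] by blast
  then show False using u0 by blast
qed

section \<open>Sections of \<open>D\<close> that vanish at the point of degree 57\<close>

context
  fixes \<pi> g :: "f3 poly"
  assumes \<pi>: "irreducible \<pi>" "degree \<pi> = 57" and g: "\<pi> dvd g * g - cubic"
begin

definition "Qp = split_prime \<pi> g"

lemma Qp_prime: "aff_prime Qp"
  unfolding Qp_def by (rule aff_prime_split[OF \<pi>(1) g])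

lemma Qp_neq_rat: "Qp \<noteq> rat_prime e"
proof
  assume "Qp = rat_prime e"
  then have "\<pi> dvd xm1" using xm1_mem_rat[of e] by (simp add: Qp_def split_prime_pol flip: \<open>Qp = rat_prime e\<close>)
  then show False using dvd_imp_degree_le[of \<pi> xm1] \<pi> by (simp add: xm1_def)
qed

text \<open>This is L(D - Q), because \<open>D\<close> does not involve \<open>Q\<close>
  (\<open>Qp_neq_rat\<close>).\<close>

definition sections_at_Q :: "f3 \<Rightarrow> aff fract set" where
  "sections_at_Q e = {f \<in> sections (Ddiv e). f \<in> mpow (loc Qp) 1}"

text \<open>Multiplying by x - 1 clears the pole at the rational point of sign \<open>e\<close> and
  adds a zero at the opposite one; the pole bound at infinity becomes 56 + 2.\<close>

lemma sections_at_Q_aff: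
  assumes e: "sgn3 e" and f: "f \<in> sections_at_Q e" "f \<noteq> 0"
  obtains u where "u \<noteq> 0" "dg u \<le> 58" "u \<in> Qp" "u \<in> rat_prime (- e)"
proof -
  have x0: "xm1 \<noteq> 0" "dg (pol xm1) = 2" by (simp_all add: xm1_def dg_pol)
  define h where "h = f * to_fract (pol xm1)"
  have h0: "h \<noteq> 0" using f x0 by (simp add: h_def)
  have vh: "val (loc p) h = val (loc p) f + (if pol xm1 \<in> p then 1 else 0)" if p: "aff_prime p" for p
    unfolding h_def using f x0 by (subst val_loc_mult[OF p]) (simp_all add: vp_xm1[OF p])
  have vf: "- Ddiv e (loc p) \<le> val (loc p) f" if "aff_prime p" for p
    using f that by (simp add: sections_at_Q_def sections_iff mpow_def)
  have vQ: "1 \<le> val (loc Qp) f" using f by (simp add: sections_at_Q_def mpow_def)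
  have ge: "- (if p = rat_prime e then 1 else 0) + (if pol xm1 \<in> p then 1 else 0) \<le> val (loc p) h"
    if p: "aff_prime p" for p
    using vf[OF p] vh[OF p] by (simp add: Ddiv_loc[OF p e])
  have "h \<in> loc p" if p: "aff_prime p" for p
  proof -
    have "0 \<le> val (loc p) h" using ge[OF p] xm1_mem_rat[of e] by (auto split: if_splits)
    then show ?thesis using h0 mem_iff_val[OF loc_dvr[OF p]] by blast
  qed
  then obtain u where u: "h = to_fract u" by (rule regular_imp_aff)
  then have u0: "u \<noteq> 0" using h0 by auto
  have "- 56 \<le> val inf_ring f" using f by (simp add: sections_at_Q_def sections_iff mpow_def Ddiv_inf)
  moreover have "val inf_ring h = val inf_ring f - 2"
    unfolding h_def using f x0 by (simp add: val_mult[OF inf_dvr] val_inf_aff)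
  ultimately have "dg u \<le> 58" using val_inf_aff[OF u0] u by simp
  moreover have "u \<in> Qp" using vQ vh[OF Qp_prime] vp_pos_iff[OF Qp_prime u0] u by (auto simp: vp_def split: if_splits)
  moreover have pr: "aff_prime (rat_prime (- e))" by (rule aff_prime_rat[OF sgn3_minus[OF e]])
  have "u \<in> rat_prime (- e)"
    using ge[OF pr] rat_neq[OF e] xm1_mem_rat[of "- e"] vp_pos_iff[OF pr u0] u by (simp add: vp_def)
  ultimately show ?thesis using that u0 by blast
qed

text \<open>If both classes failed, the product of one function with the conjugate of the other would be
  \<open>\<pi>\<close> times a function with poles of order at most two that vanishes doubly at a rational point.\<close>

lemma exists_good_sign: "\<exists>e. sgn3 e \<and> sections_at_Q e = {0}"
proof (rule ccontr)
  assume contra: "\<not> (\<exists>e. sgn3 e \<and> sections_at_Q e = {0})"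
  have zero: "0 \<in> sections_at_Q e" for e
    using add_subgroup_zero[OF add_subgroup_sections] by (simp add: sections_at_Q_def mpow_def)
  have ex: "\<exists>f. f \<in> sections_at_Q e \<and> f \<noteq> 0" if "sgn3 e" for e using contra zero[of e] that by blast
  have s: "sgn3 1" "sgn3 (- 1)" by (simp_all add: sgn3_def)
  \<comment> \<open>\<open>u\<close> comes from sign 1 and \<open>v\<close> from sign -1, so
    \<open>u\<close> and the conjugate of \<open>v\<close> vanish at the same rational
    point.\<close>
  obtain u where u: "u \<noteq> 0" "dg u \<le> 58" "u \<in> Qp" "u \<in> rat_prime (- 1)"
    using ex[OF s(1)] sections_at_Q_aff[OF s(1)] by metis
  obtain v where v: "v \<noteq> 0" "dg v \<le> 58" "v \<in> Qp" "v \<in> rat_prime (- (- 1))"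
    using ex[OF s(2)] sections_at_Q_aff[OF s(2)] by metis
  obtain a where a: "re u + im u * g = \<pi> * a" using u(3) by (auto simp: Qp_def split_prime_def elim: dvdE)
  obtain b where b: "re v + im v * g = \<pi> * b" using v(3) by (auto simp: Qp_def split_prime_def elim: dvdE)
  obtain c where c: "g * g - cubic = \<pi> * c" using g by (elim dvdE)
  have re: "re u = \<pi> * a - im u * g" "re v = \<pi> * b - im v * g" "cubic = g * g - \<pi> * c"
    using a b c by (simp_all add: algebra_simps)
  \<comment> \<open>The quotient of \<open>u * conj v\<close> by \<open>\<pi>\<close>, written out.
    It exists because \<open>u\<close> vanishes at \<open>Q\<close> and \<open>conj v\<close> at the
    conjugate of \<open>Q\<close>, the two points over \<open>\<pi>\<close>.\<close>
  define w where "w = Aff (\<pi> * a * b - a * im v * g - im u * g * b + im u * im v * c) (im u * b - a * im v)"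
  have prod: "u * conj v = pol \<pi> * w"
    unfolding w_def aff_eq_iff re_im_simps conj_simps pol_simps aff.sel re(1,2)
    by (subst re(3)) (simp add: algebra_simps)
  have cv: "conj v \<noteq> 0" using v(1) by (metis conj_simps(5) conj_simps(4) pol_simps(7))
  have nz: "w \<noteq> 0" "pol \<pi> \<noteq> 0" using prod u(1) cv by auto
  have "dg (u * conj v) = dg u + dg v" using u(1) cv by (simp add: dg_mult dg_conj)
  \<comment> \<open>114 is twice the degree of \<open>\<pi>\<close>, and 58 + 58 - 114 = 2.\<close>
  moreover have "dg (u * conj v) = 114 + dg w" unfolding prod using nz by (simp add: dg_mult dg_pol \<pi>)
  ultimately have "dg w \<le> 2" using u v by simp
  then have le: "w \<in> aff_le 2" by (simp add: aff_le_def)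
  have pr: "aff_prime (rat_prime (- 1))" by (rule aff_prime_rat[OF s(2)])
  have "conj v \<in> rat_prime (- 1)" using v(4) by (simp add: rat_prime_def split_prime_def)
  then have "2 \<le> vp (rat_prime (- 1)) (u * conj v)"
    using vp_pos_iff[OF pr u(1)] vp_pos_iff[OF pr cv] u(4) by (simp add: vp_mult[OF pr u(1) cv])
  moreover have "pol \<pi> \<notin> rat_prime (- 1)"
  proof
    assume "pol \<pi> \<in> rat_prime (- 1)"
    then have "xm1 dvd \<pi>" by (simp add: rat_prime_def split_prime_pol)
    then have "\<pi> dvd xm1" using \<pi>(1) irreducible_xm1 by (meson irreducibleD' irreducible_not_unit)
    then show False using dvd_imp_degree_le[of \<pi> xm1] \<pi> by (simp add: xm1_def)
  qed
  then have "vp (rat_prime (- 1)) (pol \<pi>) = 0" using vp_zero_iff[OF pr nz(2)] by blast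
  ultimately have "2 \<le> vp (rat_prime (- 1)) w" unfolding prod by (simp add: vp_mult[OF pr nz(2,1)])
  then have "w = 0" using linear_order_two[OF pr xm1_mem_rat le] by blast
  then show False using nz by blast
qed

end

section \<open>Dimensions over finite fields\<close>

text \<open>A base identifies \<open>E\<close> with the lists of \<open>n\<close> coordinates in
  \<open>K\<close>.\<close>

lemma (in ring) card_of_dimension:
  assumes K: "subfield K R" "finite K" and dim: "dimension n K E"
  shows "card E = card K ^ n" "finite E"
proof -
  obtain Us where Us: "set Us \<subseteq> carrier R" "independent K Us" "length Us = n" "Span K Us = E"
    using exists_base[OF K(1) dim] by blast
  let ?L = "{Ks. set Ks \<subseteq> K \<and> length Ks = n}"
  have "bij_betw (\<lambda>Ks. combine Ks Us) ?L E"
    unfolding bij_betw_def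
  proof
    show "(\<lambda>Ks. combine Ks Us) ` ?L = E"
      using Span_eq_combine_set_length_version[OF K(1) Us(1)] Us by auto
    then show "inj_on (\<lambda>Ks. combine Ks Us) ?L"
      using unique_decomposition[OF K(1) Us(2)] Us(3,4)
      by (intro inj_onI) (metis (mono_tags, lifting) imageI mem_Collect_eq)
  qed
  then show "card E = card K ^ n" "finite E"
    using card_lists_length_eq[OF K(2), of n] finite_lists_length_eq[OF K(2), of n]
    by (auto simp: bij_betw_finite dest: bij_betw_same_card)
qed

text \<open>A longest independent list inside the finite set \<open>E\<close> spans it, since
  otherwise it could be extended.\<close>

lemma (in ring) exists_dimension:
  assumes K: "subfield K R" and E: "subgroup E (add_monoid R)" "finite E"
    and scale: "\<And>k x. k \<in> K \<Longrightarrow> x \<in> E \<Longrightarrow> k \<otimes> x \<in> E"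
  shows "\<exists>n. dimension n K E"
proof -
  define S where "S = {Us. independent K Us \<and> set Us \<subseteq> E}"
  have EC: "E \<subseteq> carrier R" using subgroup.subset[OF E(1)] by simp
  have bound: "length Us \<le> card E" if "Us \<in> S" for Us
  proof -
    have "cycle Us" using that independent_distinct[OF K] by (auto simp: S_def)
    then have "length Us = card (set Us)" by (simp add: distinct_card)
    then show ?thesis using that card_mono[OF E(2), of "set Us"] by (auto simp: S_def)
  qed
  have "[] \<in> S" by (simp add: S_def)
  then obtain Us where Us: "Us \<in> S" "\<And>Vs. Vs \<in> S \<Longrightarrow> length Vs \<le> length Us"
    using ex_has_greatest_nat[of "\<lambda>Us. Us \<in> S" "[]" length "Suc (card E)"] bound le_imp_less_Suc by blast
  have ind: "independent K Us" "set Us \<subseteq> E" using Us by (auto simp: S_def)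
  have "Span K Us \<subseteq> E"
  proof (rule Span_min[OF K _ E(1)])
    show "set Us \<subseteq> carrier R" using ind EC by blast
    show "K <#> set Us \<subseteq> E" using scale ind(2) unfolding set_mult_def by auto
  qed
  moreover have "v \<in> Span K Us" if v: "v \<in> E" for v
  proof (rule ccontr)
    assume "v \<notin> Span K Us"
    then have "independent K (v # Us)" using v EC ind(1) by (intro li_Cons) auto
    then have "v # Us \<in> S" using v ind by (simp add: S_def)
    then show False using Us(2) by fastforce
  qed
  ultimately have "Span K Us = E" by blast
  then show ?thesis using dimension_independent[OF ind(1)] by auto
qed

lemma (in ring) card_eq_dim:
  assumes "subfield K R" "card K = 3" "subgroup E (add_monoid R)" "finite E"
    "\<And>k x. k \<in> K \<Longrightarrow> x \<in> E \<Longrightarrow> k \<otimes> x \<in> E"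
  shows "card E = 3 ^ dim K E"
proof -
  obtain n where n: "dimension n K E" using exists_dimension assms by blast
  have "finite K" using assms(2) card.infinite by fastforce
  then show ?thesis using card_of_dimension[OF assms(1) _ n] dimI[OF assms(1) n] assms(2) by (simp add: over_def)
qed

section \<open>Copies of fields\<close>

text \<open>An injective encoding \<open>e\<close> of a subfield \<open>T\<close> carries a
  type-class field over to a record on natural numbers. It serves both for the function field and
  for the finite fields.\<close>

definition copy_field :: "('b::field \<Rightarrow> nat) \<Rightarrow> 'b set \<Rightarrow> nat ring" where
  "copy_field e T = \<lparr> carrier = e ` T, monoid.mult = (\<lambda>a b. e (inv_into T e a * inv_into T e b)),
     one = e 1, ring.zero = e 0, add = (\<lambda>a b. e (inv_into T e a + inv_into T e b)) \<rparr>"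

lemma copy_field_field:
  assumes e: "inj_on e T" and T: "0 \<in> T" "1 \<in> T" "\<And>x y. x \<in> T \<Longrightarrow> y \<in> T \<Longrightarrow> x + y \<in> T"
    "\<And>x y. x \<in> T \<Longrightarrow> y \<in> T \<Longrightarrow> x * y \<in> T" "\<And>x. x \<in> T \<Longrightarrow> - x \<in> T" "\<And>x. x \<in> T \<Longrightarrow> inverse x \<in> T"
  shows "Ring.field (copy_field e T)"
proof -
  have inv [simp]: "inv_into T e (e x) = x" if "x \<in> T" for x using e that by simp
  have "cring (copy_field e T)"
  proof (rule cringI)
    show "abelian_group (copy_field e T)"
    proof (rule abelian_groupI)
      fix x assume "x \<in> carrier (copy_field e T)"
      then obtain a where a: "a \<in> T" "x = e a" by (auto simp: copy_field_def)
      then show "\<exists>y\<in>carrier (copy_field e T). y \<oplus>\<^bsub>copy_field e T\<^esub> x = \<zero>\<^bsub>copy_field e T\<^esub>"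
        using T by (intro bexI[of _ "e (- a)"]) (auto simp: copy_field_def)
    qed (use T in \<open>auto simp: copy_field_def ac_simps\<close>)
    show "comm_monoid (copy_field e T)"
      by (rule comm_monoidI) (use T in \<open>auto simp: copy_field_def ac_simps\<close>)
  qed (use T in \<open>auto simp: copy_field_def algebra_simps\<close>)
  then show ?thesis
  proof (rule cring.cring_fieldI2)
    show "\<zero>\<^bsub>copy_field e T\<^esub> \<noteq> \<one>\<^bsub>copy_field e T\<^esub>"
      using inj_onD[OF e _ T(1,2)] by (auto simp: copy_field_def)
    fix a assume a: "a \<in> carrier (copy_field e T)" "a \<noteq> \<zero>\<^bsub>copy_field e T\<^esub>"
    then obtain x where x: "x \<in> T" "a = e x" "x \<noteq> 0" by (auto simp: copy_field_def)
    then show "\<exists>b\<in>carrier (copy_field e T). a \<otimes>\<^bsub>copy_field e T\<^esub> b = \<one>\<^bsub>copy_field e T\<^esub>"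
      using T by (intro bexI[of _ "e (inverse x)"]) (auto simp: copy_field_def)
  qed
qed

section \<open>The function field on the natural numbers\<close>

text \<open>Transporting the function field along a bijection with \<open>nat\<close> yields the record over natural numbers
  that the definition of \<open>mu_sym_genus\<close> asks for.\<close>

lemma countable_fract: "countable (UNIV :: aff fract set)"
proof -
  have "countable (UNIV :: f3 set)" using countable_finite[OF finite] by blast
  then have "countable (lists (UNIV :: f3 set))" by (rule countable_lists)
  then have "countable (range (coeffs :: f3 poly \<Rightarrow> _))" by (rule countable_subset[rotated]) auto
  then have p: "countable (UNIV :: f3 poly set)"
    by (rule countable_image_inj_on) (auto intro: injI simp: coeffs_eq_iff)
  have pair: "countable (UNIV :: ('a \<times> 'b) set)" if "countable (UNIV :: 'a set)" "countable (UNIV :: 'b set)"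
    using countable_SIGMA[OF that(1), of "\<lambda>_. UNIV :: 'b set"] that(2) by (simp add: UNIV_Times_UNIV)
  have "range (\<lambda>(a, b). Aff a b) = UNIV" by (rule surjI[of _ "\<lambda>u. (re u, im u)"]) simp
  then have a: "countable (UNIV :: aff set)" using countable_image[OF pair[OF p p]] by metis
  have "z \<in> range (\<lambda>(a, b). to_fract a / to_fract b)" for z :: "aff fract"
  proof -
    obtain a b where "z = to_fract a / to_fract b" by (rule fract_rep)
    then show ?thesis by (intro image_eqI[of _ _ "(a, b)"]) auto
  qed
  then have "range (\<lambda>(a, b). to_fract a / to_fract b) = (UNIV :: aff fract set)" by blast
  then show ?thesis using countable_image[OF pair[OF a a]] by metis
qed

lemma infinite_fract: "infinite (UNIV :: aff fract set)"
proof
  assume "finite (UNIV :: aff fract set)"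
  then have "finite (range (\<lambda>n. to_fract (pol (monom (1::f3) n))))" by (rule finite_subset[OF subset_UNIV])
  moreover have "inj (\<lambda>n. to_fract (pol (monom (1::f3) n)))" by (rule injI) (simp add: monom_eq_iff')
  ultimately show False using finite_imageD[of _ UNIV] infinite_UNIV_nat by metis
qed

text \<open>\<open>fr\<close> decodes and \<open>cd\<close> encodes; equations in the record are
  proved by applying \<open>fr\<close>.\<close>

definition fr :: "nat \<Rightarrow> aff fract" where "fr = from_nat_into UNIV"
definition cd :: "aff fract \<Rightarrow> nat" where "cd = inv_into UNIV fr"

lemma bij_fr: "bij fr"
  unfolding fr_def by (rule bij_betw_from_nat_into[OF countable_fract infinite_fract])

lemma fr_cd [simp]: "fr (cd z) = z" and cd_fr [simp]: "cd (fr a) = a"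
  using bij_fr by (simp_all add: cd_def bij_is_surj surj_f_inv_f bij_is_inj)

lemma fr_eq_iff [simp]: "fr a = fr b \<longleftrightarrow> a = b"
  by (metis cd_fr)

lemma inj_cd: "inj cd" by (metis fr_cd injI)

definition FF :: "nat ring" where "FF = copy_field cd UNIV"

lemma inv_into_cd: "inv_into UNIV cd = fr"
  by (rule inv_equality) auto

lemma FF_simps [simp]:
  "carrier FF = UNIV" "fr (a \<otimes>\<^bsub>FF\<^esub> b) = fr a * fr b" "fr (a \<oplus>\<^bsub>FF\<^esub> b) = fr a + fr b"
  "fr \<one>\<^bsub>FF\<^esub> = 1" "fr \<zero>\<^bsub>FF\<^esub> = 0"
proof -
  have "range cd = UNIV" by (rule surjI[of _ fr]) simp
  then show "carrier FF = UNIV" by (simp add: FF_def copy_field_def)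
qed (simp_all add: FF_def copy_field_def inv_into_cd)

lemma field_FF: "Ring.field FF"
  unfolding FF_def by (rule copy_field_field) (use inj_cd in auto)

interpretation FF: cring FF
  using field_FF by (simp add: Ring.field_def domain_def)

lemma FF_eq_iff: "a = b \<longleftrightarrow> fr a = fr b" by simp

lemma FF_eqI: "fr a = fr b \<Longrightarrow> a = b" by simp

lemma fr_uminus [simp]: "fr (\<ominus>\<^bsub>FF\<^esub> a) = - fr a"
proof -
  have "fr (a \<oplus>\<^bsub>FF\<^esub> \<ominus>\<^bsub>FF\<^esub> a) = fr \<zero>\<^bsub>FF\<^esub>" by (subst FF.r_neg) auto
  then have "fr a + fr (\<ominus>\<^bsub>FF\<^esub> a) = 0" by simp
  then show ?thesis by (simp add: add_eq_0_iff)
qed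

lemma fr_minus [simp]: "fr (a \<ominus>\<^bsub>FF\<^esub> b) = fr a - fr b"
  by (simp add: a_minus_def)

lemma fr_zero_iff [simp]: "fr a = 0 \<longleftrightarrow> a = \<zero>\<^bsub>FF\<^esub>"
  using fr_eq_iff[of a "\<zero>\<^bsub>FF\<^esub>"] by simp

lemma fr_inv [simp]: assumes "a \<noteq> \<zero>\<^bsub>FF\<^esub>" shows "fr (inv\<^bsub>FF\<^esub> a) = inverse (fr a)"
proof -
  have "a \<in> Units FF" using assms field.field_Units[OF field_FF] by simp
  then have "fr (a \<otimes>\<^bsub>FF\<^esub> inv\<^bsub>FF\<^esub> a) = fr \<one>\<^bsub>FF\<^esub>" by simp
  then have "fr a * fr (inv\<^bsub>FF\<^esub> a) = 1" by simp
  then show ?thesis by (simp add: inverse_unique)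
qed

lemma fr_pow_nat [simp]: "fr (a [^]\<^bsub>FF\<^esub> (n::nat)) = fr a ^ n"
  by (induction n) (simp_all add: mult.commute)

lemma fr_pow_int [simp]: assumes "a \<noteq> \<zero>\<^bsub>FF\<^esub>" shows "fr (a [^]\<^bsub>FF\<^esub> (n::int)) = fr a powi n"
proof -
  have nz: "a [^]\<^bsub>FF\<^esub> k \<noteq> \<zero>\<^bsub>FF\<^esub>" for k :: nat
    using assms by (metis fr_pow_nat fr_zero_iff power_eq_0_iff)
  show ?thesis
  proof (cases "n < 0")
    case True
    then have "fr (a [^]\<^bsub>FF\<^esub> n) = fr (inv\<^bsub>FF\<^esub> (a [^]\<^bsub>FF\<^esub> nat (- n)))" unfolding int_pow_def2 by simp
    also have "\<dots> = inverse (fr a ^ nat (- n))" unfolding fr_inv[OF nz] fr_pow_nat ..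
    also have "\<dots> = inverse (fr a) ^ nat (- n)" by (rule power_inverse[symmetric])
    finally show ?thesis using True by (simp only: power_int_def if_not_P linorder_not_le)
  next
    case False
    then have "a [^]\<^bsub>FF\<^esub> n = a [^]\<^bsub>FF\<^esub> nat n" using pow_nat[of n FF a] by simp
    then have "fr (a [^]\<^bsub>FF\<^esub> n) = fr a ^ nat n" by (simp only: fr_pow_nat)
    then show ?thesis using False by (simp add: power_int_def)
  qed
qed

definition KK :: "nat set" where "KK = (\<lambda>c. cd (to_fract (pol [:c:]))) ` UNIV"

lemma mem_KK_iff: "a \<in> KK \<longleftrightarrow> (\<exists>c. fr a = to_fract (pol [:c:]))"
  by (auto simp: KK_def image_iff FF_eq_iff simp del: fr_eq_iff)

lemma card_KK: "card KK = 3"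
proof -
  have "inj (\<lambda>c. cd (to_fract (pol [:c:])))" by (rule injI) (simp add: inj_eq[OF inj_cd])
  then show ?thesis by (simp add: KK_def card_image card_f3)
qed

lemma const_pol_simps:
  "to_fract (pol [:c:]) + to_fract (pol [:d:]) = to_fract (pol [:c + d:])"
  "to_fract (pol [:c:]) * to_fract (pol [:d:]) = to_fract (pol [:c * d:])"
  "- to_fract (pol [:c:]) = to_fract (pol [:- c:])"
  by (simp_all flip: to_fract_add to_fract_mult to_fract_uminus pol_simps(3,4,6))

lemma const_pol_inverse: "c \<noteq> 0 \<Longrightarrow> inverse (to_fract (pol [:c:])) = to_fract (pol [:inverse c:])"
  by (rule inverse_unique) (simp add: const_pol_simps flip: one_pCons)

lemma subfield_KK: "subfield KK FF"
proof (rule field.subfieldI'[OF field_FF])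
  show "subring KK FF"
  proof (rule FF.subringI)
    show "\<one>\<^bsub>FF\<^esub> \<in> KK" unfolding mem_KK_iff by (rule exI[of _ 1]) (simp flip: one_pCons)
  qed (auto simp: mem_KK_iff const_pol_simps)
  fix k assume "k \<in> KK - {\<zero>\<^bsub>FF\<^esub>}"
  then obtain c where c: "fr k = to_fract (pol [:c:])" "k \<noteq> \<zero>\<^bsub>FF\<^esub>" by (auto simp: mem_KK_iff)
  then have "c \<noteq> 0" using fr_zero_iff[of k] by auto
  then show "inv\<^bsub>FF\<^esub> k \<in> KK" using c by (auto simp: mem_KK_iff const_pol_inverse)
qed

subsection \<open>Closed points, valuations and sections\<close>

lemma Units_FF: "a \<in> Units (FF\<lparr>carrier := P\<rparr>) \<longleftrightarrow> unit_in (fr ` P) (fr a)"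
proof
  assume "a \<in> Units (FF\<lparr>carrier := P\<rparr>)"
  then obtain b where b: "a \<in> P" "b \<in> P" "a \<otimes>\<^bsub>FF\<^esub> b = \<one>\<^bsub>FF\<^esub>" by (auto simp: Units_def)
  then have 1: "fr a * fr b = 1" by (metis FF_simps(2,4))
  then have "inverse (fr a) = fr b" by (rule inverse_unique)
  moreover have "fr a \<noteq> 0" using 1 by (metis mult_zero_left zero_neq_one)
  ultimately show "unit_in (fr ` P) (fr a)" using b(1,2) unfolding unit_in_def by (metis imageI)
next
  assume "unit_in (fr ` P) (fr a)"
  then obtain b where b: "a \<in> P" "b \<in> P" "inverse (fr a) = fr b" "fr a \<noteq> 0" by (auto simp: unit_in_def)
  then have "fr (a \<otimes>\<^bsub>FF\<^esub> b) = 1" "fr (b \<otimes>\<^bsub>FF\<^esub> a) = 1" by (simp_all flip: b(3))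
  then have "a \<otimes>\<^bsub>FF\<^esub> b = \<one>\<^bsub>FF\<^esub>" "b \<otimes>\<^bsub>FF\<^esub> a = \<one>\<^bsub>FF\<^esub>" by (metis FF_simps(4) fr_eq_iff)+
  then show "a \<in> Units (FF\<lparr>carrier := P\<rparr>)" using b by (auto simp: Units_def)
qed

lemma fr_image_mem: "fr a \<in> fr ` P \<longleftrightarrow> a \<in> P" by auto

lemma uniformizer_FF: "uniformizer FF P t \<longleftrightarrow> unif (fr ` P) (fr t)"
proof -
  have "(\<forall>f\<in>carrier FF - {\<zero>\<^bsub>FF\<^esub>}. \<exists>n::int. \<exists>u\<in>Units (FF\<lparr>carrier := P\<rparr>). f = t [^]\<^bsub>FF\<^esub> n \<otimes>\<^bsub>FF\<^esub> u)
     \<longleftrightarrow> (\<forall>f. f \<noteq> 0 \<longrightarrow> (\<exists>n::int. \<exists>u. unit_in (fr ` P) u \<and> f = fr t powi n * u))" (is "?L \<longleftrightarrow> ?R")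
    if t: "t \<noteq> \<zero>\<^bsub>FF\<^esub>"
  proof
    assume L: ?L
    show ?R
    proof (intro allI impI)
      fix f :: "aff fract" assume "f \<noteq> 0"
      then have "cd f \<in> carrier FF - {\<zero>\<^bsub>FF\<^esub>}" using fr_zero_iff[of "cd f"] by simp
      then obtain n :: int and u where u: "u \<in> Units (FF\<lparr>carrier := P\<rparr>)" "cd f = t [^]\<^bsub>FF\<^esub> n \<otimes>\<^bsub>FF\<^esub> u" using L by blast
      then have "f = fr t powi n * fr u" using t by (metis FF_simps(2) fr_cd fr_pow_int)
      then show "\<exists>n::int. \<exists>u. unit_in (fr ` P) u \<and> f = fr t powi n * u" using u(1) Units_FF by blast
    qed
  next
    assume R: ?R
    show ?L
    proof
      fix f assume "f \<in> carrier FF - {\<zero>\<^bsub>FF\<^esub>}"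
      then have "fr f \<noteq> 0" by simp
      then obtain n :: int and u where u: "unit_in (fr ` P) u" "fr f = fr t powi n * u" using R by blast
      have "cd u \<in> Units (FF\<lparr>carrier := P\<rparr>)" by (simp add: Units_FF u(1))
      moreover have "f = t [^]\<^bsub>FF\<^esub> n \<otimes>\<^bsub>FF\<^esub> cd u" by (rule FF_eqI) (simp add: u(2) t)
      ultimately show "\<exists>n::int. \<exists>u\<in>Units (FF\<lparr>carrier := P\<rparr>). f = t [^]\<^bsub>FF\<^esub> n \<otimes>\<^bsub>FF\<^esub> u" by blast
    qed
  qed
  then show ?thesis unfolding uniformizer_def unif_def
    by (cases "t = \<zero>\<^bsub>FF\<^esub>") (auto simp: Units_FF unit_in_def fr_image_mem)
qed

lemma valuation_FF: "valuation FF P f = val (fr ` P) (fr f)"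
proof -
  have "(\<exists>t u. uniformizer FF P t \<and> u \<in> Units (FF\<lparr>carrier := P\<rparr>) \<and> f = t [^]\<^bsub>FF\<^esub> n \<otimes>\<^bsub>FF\<^esub> u) \<longleftrightarrow>
      (\<exists>t u. unif (fr ` P) t \<and> unit_in (fr ` P) u \<and> fr f = t powi n * u)" for n :: int
  proof
    assume "\<exists>t u. uniformizer FF P t \<and> u \<in> Units (FF\<lparr>carrier := P\<rparr>) \<and> f = t [^]\<^bsub>FF\<^esub> n \<otimes>\<^bsub>FF\<^esub> u"
    then obtain t u where tu: "uniformizer FF P t" "u \<in> Units (FF\<lparr>carrier := P\<rparr>)" "f = t [^]\<^bsub>FF\<^esub> n \<otimes>\<^bsub>FF\<^esub> u" by blast
    then have "t \<noteq> \<zero>\<^bsub>FF\<^esub>" by (simp add: uniformizer_def)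
    then show "\<exists>t u. unif (fr ` P) t \<and> unit_in (fr ` P) u \<and> fr f = t powi n * u"
      using tu by (intro exI[of _ "fr t"] exI[of _ "fr u"]) (simp add: uniformizer_FF Units_FF)
  next
    assume "\<exists>t u. unif (fr ` P) t \<and> unit_in (fr ` P) u \<and> fr f = t powi n * u"
    then obtain t u where tu: "unif (fr ` P) t" "unit_in (fr ` P) u" "fr f = t powi n * u" by blast
    then have t: "cd t \<noteq> \<zero>\<^bsub>FF\<^esub>" using fr_zero_iff[of "cd t"] by (simp add: unif_def)
    have "f = cd t [^]\<^bsub>FF\<^esub> n \<otimes>\<^bsub>FF\<^esub> cd u" by (rule FF_eqI) (simp add: tu(3) t)
    then show "\<exists>t u. uniformizer FF P t \<and> u \<in> Units (FF\<lparr>carrier := P\<rparr>) \<and> f = t [^]\<^bsub>FF\<^esub> n \<otimes>\<^bsub>FF\<^esub> u"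
      using tu(1,2) by (intro exI[of _ "cd t"] exI[of _ "cd u"]) (simp add: uniformizer_FF Units_FF)
  qed
  then show ?thesis unfolding valuation_def val_def by simp
qed

lemma max_ideal_pow_FF: "max_ideal_pow FF P n = fr -` mpow (fr ` P) n"
  by (auto simp: max_ideal_pow_def mpow_def valuation_FF)

lemma subring_FF:
  "subring P FF \<longleftrightarrow> 1 \<in> fr ` P \<and> (\<forall>x\<in>fr ` P. \<forall>y\<in>fr ` P. x - y \<in> fr ` P \<and> x * y \<in> fr ` P)"
proof
  assume P: "subring P FF"
  have one: "fr \<one>\<^bsub>FF\<^esub> \<in> fr ` P" using subringE(3)[OF P] by blast
  have "fr (a \<oplus>\<^bsub>FF\<^esub> \<ominus>\<^bsub>FF\<^esub> b) \<in> fr ` P" "fr (a \<otimes>\<^bsub>FF\<^esub> b) \<in> fr ` P" if "a \<in> P" "b \<in> P" for a b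
    using subringE(5,6,7)[OF P] that by blast+
  then show "1 \<in> fr ` P \<and> (\<forall>x\<in>fr ` P. \<forall>y\<in>fr ` P. x - y \<in> fr ` P \<and> x * y \<in> fr ` P)"
    using one by auto
next
  assume R: "1 \<in> fr ` P \<and> (\<forall>x\<in>fr ` P. \<forall>y\<in>fr ` P. x - y \<in> fr ` P \<and> x * y \<in> fr ` P)"
  then have zero: "0 \<in> fr ` P" by (metis diff_self)
  then have um: "- x \<in> fr ` P" if "x \<in> fr ` P" for x using R that by (metis diff_0)
  have add: "x + y \<in> fr ` P" if "x \<in> fr ` P" "y \<in> fr ` P" for x y using R um that by (metis diff_minus_eq_add)
  show "subring P FF"
  proof (rule FF.subringI)
    fix a b assume ab: "a \<in> P" "b \<in> P"
    show "\<ominus>\<^bsub>FF\<^esub> a \<in> P" using um[of "fr a"] ab by (simp add: fr_image_mem flip: fr_uminus)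
    show "a \<otimes>\<^bsub>FF\<^esub> b \<in> P" using R ab by (auto simp: fr_image_mem simp flip: FF_simps(2))
    show "a \<oplus>\<^bsub>FF\<^esub> b \<in> P" using add[of "fr a" "fr b"] ab by (simp add: fr_image_mem flip: FF_simps(3))
  next
    show "\<one>\<^bsub>FF\<^esub> \<in> P" using R by (metis FF_simps(4) fr_image_mem)
  qed simp_all
qed

lemma const_in_dvr:
  assumes P: "dvr P" shows "to_fract (pol [:c:]) \<in> P"
proof (cases c rule: f3_cases)
  case 3
  then have "pol [:c:] = - 1" by (simp add: aff_eq_iff one_pCons)
  then show ?thesis using dvr_uminus[OF P dvr_one[OF P]] by simp
qed (use dvr_zero[OF P] dvr_one[OF P] in \<open>simp_all flip: one_pCons\<close>)

lemma closed_points_FF: "P \<in> closed_points KK FF \<longleftrightarrow> dvr (fr ` P)"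
proof -
  have "(\<exists>t. uniformizer FF P t) \<longleftrightarrow> (\<exists>t. unif (fr ` P) t)"
    unfolding uniformizer_FF by (metis fr_cd)
  moreover have "KK \<subseteq> P" if d: "dvr (fr ` P)"
  proof
    fix a assume "a \<in> KK"
    then obtain c where "fr a = to_fract (pol [:c:])" by (auto simp: mem_KK_iff)
    then have "fr a \<in> fr ` P" using const_in_dvr[OF d] by simp
    then show "a \<in> P" by auto
  qed
  ultimately show ?thesis by (auto simp: closed_points_def subring_FF dvr_def)
qed

text \<open>\<open>pt\<close> and the image under \<open>fr\<close> translate between local rings in
  the field type and closed points of the record.\<close>

definition pt :: "aff fract set \<Rightarrow> nat set" where "pt Q = fr -` Q"

lemma fr_image_pt [simp]: "fr ` pt Q = Q"
  unfolding pt_def using fr_cd by (auto simp: image_iff) (metis fr_cd)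

lemma pt_fr_image [simp]: "pt (fr ` P) = P"
  by (auto simp: pt_def)

lemma pt_eq_iff [simp]: "pt Q = pt Q' \<longleftrightarrow> Q = Q'" by (metis fr_image_pt)

lemma pt_closed_point [simp]: "pt Q \<in> closed_points KK FF \<longleftrightarrow> dvr Q"
  by (simp add: closed_points_FF)

lemma global_sections_FF: "global_sections KK FF D = fr -` sections (\<lambda>Q. D (pt Q))"
proof -
  have "(\<forall>P\<in>closed_points KK FF. f \<in> max_ideal_pow FF P (- D P)) \<longleftrightarrow> fr f \<in> sections (\<lambda>Q. D (pt Q))" for f
    unfolding sections_def max_ideal_pow_FF by (auto simp: closed_points_FF) (metis fr_image_pt pt_closed_point closed_points_FF)
  then show ?thesis by (auto simp: global_sections_def)
qed

lemma coset_FF: "(fr -` W) +>\<^bsub>FF\<^esub> f = fr -` translate W (fr f)"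
proof -
  have "x \<in> (fr -` W) +>\<^bsub>FF\<^esub> f \<longleftrightarrow> fr x \<in> translate W (fr f)" for x
  proof
    assume "x \<in> (fr -` W) +>\<^bsub>FF\<^esub> f"
    then obtain w where "w \<in> fr -` W" "x = w \<oplus>\<^bsub>FF\<^esub> f" by (auto simp: a_r_coset_def' )
    then show "fr x \<in> translate W (fr f)" by (auto simp: translate_def add.commute)
  next
    assume "fr x \<in> translate W (fr f)"
    then obtain w where w: "w \<in> W" "fr x = fr f + w" by (auto simp: translate_def)
    then have "x = cd w \<oplus>\<^bsub>FF\<^esub> f" by (simp add: FF_eq_iff add.commute del: fr_eq_iff)
    then show "x \<in> (fr -` W) +>\<^bsub>FF\<^esub> f" using w by (auto simp: a_r_coset_def')
  qed
  then show ?thesis by auto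
qed

lemma vimage_fr_eq_iff [simp]: "fr -` A = fr -` B \<longleftrightarrow> A = B"
  by (metis fr_image_pt pt_def)

section \<open>The algebra of functions on a multiple point\<close>

lemma cring_algebra_via:
  assumes "cring B" shows "cring (algebra_via B h)"
proof -
  interpret B: cring B by (rule assms)
  show ?thesis
  proof (rule cringI)
    show "abelian_group (algebra_via B h)"
    proof (rule abelian_groupI)
      fix x assume "x \<in> carrier (algebra_via B h)"
      then show "\<exists>y\<in>carrier (algebra_via B h). y \<oplus>\<^bsub>algebra_via B h\<^esub> x = \<zero>\<^bsub>algebra_via B h\<^esub>"
        using B.l_neg by (intro bexI[of _ "\<ominus>\<^bsub>B\<^esub> x"]) (simp_all add: algebra_via_def)
    qed (auto simp: algebra_via_def B.a_assoc B.a_comm B.a_lcomm)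
    show "comm_monoid (algebra_via B h)"
      by (rule comm_monoidI) (auto simp: algebra_via_def B.m_assoc B.m_comm B.m_lcomm)
  qed (auto simp: algebra_via_def B.l_distr)
qed

definition cls :: "nat set \<Rightarrow> nat \<Rightarrow> nat \<Rightarrow> nat set" where
  "cls P u x = max_ideal_pow FF P (int u) +>\<^bsub>FF\<^esub> x"

lemma cls_eq: "cls P u x = fr -` translate (mpow (fr ` P) (int u)) (fr x)"
  by (simp add: cls_def max_ideal_pow_FF coset_FF)

context
  fixes P assumes P: "P \<in> closed_points KK FF"
begin

lemma dvr_P: "dvr (fr ` P)" using P by (simp add: closed_points_FF)

lemma cring_P: "cring (FF\<lparr>carrier := P\<rparr>)"
  using P FF.subcring_iff FF.subcringI' by (auto simp: closed_points_def)

lemma P_closed: "a \<in> P \<Longrightarrow> b \<in> P \<Longrightarrow> a \<oplus>\<^bsub>FF\<^esub> b \<in> P" "a \<in> P \<Longrightarrow> b \<in> P \<Longrightarrow> a \<otimes>\<^bsub>FF\<^esub> b \<in> P"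
  "\<one>\<^bsub>FF\<^esub> \<in> P" "\<zero>\<^bsub>FF\<^esub> \<in> P" "a \<in> P \<Longrightarrow> \<ominus>\<^bsub>FF\<^esub> a \<in> P" "KK \<subseteq> P"
  using P subringE[of P FF] by (auto simp: closed_points_def)

lemma mem_P: "x \<in> P \<longleftrightarrow> fr x \<in> mpow (fr ` P) 0"
  by (simp add: mpow_0[OF dvr_P] fr_image_mem)

lemma ideal_P: "ideal (max_ideal_pow FF P (int u)) (FF\<lparr>carrier := P\<rparr>)"
proof -
  let ?R = "FF\<lparr>carrier := P\<rparr>" and ?M = "max_ideal_pow FF P (int u)"
  interpret R: cring ?R by (rule cring_P)
  have MP: "x \<in> P" if "x \<in> ?M" for x
  proof -
    have "fr x \<in> mpow (fr ` P) (int u)" using that by (simp add: max_ideal_pow_FF)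
    with mpow_mono[OF dvr_P, of 0 "int u"] have "fr x \<in> mpow (fr ` P) 0" by auto
    then show ?thesis by (rule mem_P[THEN iffD2])
  qed
  show ?thesis
  proof (rule idealI)
    show "ring ?R" by (rule R.ring_axioms)
    show "subgroup ?M (add_monoid ?R)"
    proof (rule R.add.subgroupI)
      show "?M \<subseteq> carrier ?R" using MP by auto
      have "\<zero>\<^bsub>FF\<^esub> \<in> ?M" using add_subgroup_zero[OF add_subgroup_mpow[OF dvr_P]] by (simp add: max_ideal_pow_FF)
      then show "?M \<noteq> {}" by blast
      fix x assume x: "x \<in> ?M"
      have "\<ominus>\<^bsub>?R\<^esub> x = \<ominus>\<^bsub>FF\<^esub> x"
        using MP[OF x] P_closed(5) FF.l_neg by (intro R.minus_equality) auto
      then show "\<ominus>\<^bsub>?R\<^esub> x \<in> ?M" using x add_subgroup_uminus[OF add_subgroup_mpow[OF dvr_P]] by (simp add: max_ideal_pow_FF)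
      fix y assume "y \<in> ?M"
      then show "x \<oplus>\<^bsub>?R\<^esub> y \<in> ?M" using x add_subgroup_add[OF add_subgroup_mpow[OF dvr_P]] by (simp add: max_ideal_pow_FF)
    qed
    fix a x assume "a \<in> ?M" "x \<in> carrier ?R"
    then have "fr x \<in> mpow (fr ` P) 0" "fr a \<in> mpow (fr ` P) (int u)"
      using mem_P[of x] by (simp_all add: max_ideal_pow_FF)
    then have "fr x * fr a \<in> mpow (fr ` P) (0 + int u)" by (rule mpow_mult[OF dvr_P])
    then show "x \<otimes>\<^bsub>?R\<^esub> a \<in> ?M" "a \<otimes>\<^bsub>?R\<^esub> x \<in> ?M" by (simp_all add: max_ideal_pow_FF mult.commute)
  qed
qed

lemma cls_R: "max_ideal_pow FF P (int u) +>\<^bsub>FF\<lparr>carrier := P\<rparr>\<^esub> x = cls P u x"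
  by (simp add: cls_def a_r_coset_def')

lemma cring_LA: "cring (local_algebra FF P u)"
proof -
  have "cring ((FF\<lparr>carrier := P\<rparr>) Quot max_ideal_pow FF P (int u))"
    by (rule ideal.quotient_is_cring[OF ideal_P cring_P])
  then show ?thesis unfolding local_algebra_def by (rule cring_algebra_via)
qed

lemma carrier_LA: "carrier (local_algebra FF P u) = cls P u ` P"
  by (auto simp: local_algebra_def algebra_via_def FactRing_def A_RCOSETS_def' cls_R)

lemma cls_in_LA: "x \<in> P \<Longrightarrow> cls P u x \<in> carrier (local_algebra FF P u)"
  by (simp add: carrier_LA)

lemma cls_hom:
  "x \<in> P \<Longrightarrow> y \<in> P \<Longrightarrow> cls P u x \<oplus>\<^bsub>local_algebra FF P u\<^esub> cls P u y = cls P u (x \<oplus>\<^bsub>FF\<^esub> y)"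
  "x \<in> P \<Longrightarrow> y \<in> P \<Longrightarrow> cls P u x \<otimes>\<^bsub>local_algebra FF P u\<^esub> cls P u y = cls P u (x \<otimes>\<^bsub>FF\<^esub> y)"
  "\<one>\<^bsub>local_algebra FF P u\<^esub> = cls P u \<one>\<^bsub>FF\<^esub>"
  "\<zero>\<^bsub>local_algebra FF P u\<^esub> = cls P u \<zero>\<^bsub>FF\<^esub>"
proof -
  have h: "(+>\<^bsub>FF\<lparr>carrier := P\<rparr>\<^esub>) (max_ideal_pow FF P (int u)) \<in>
      ring_hom (FF\<lparr>carrier := P\<rparr>) ((FF\<lparr>carrier := P\<rparr>) Quot max_ideal_pow FF P (int u))"
    by (rule ideal.rcos_ring_hom[OF ideal_P])
  show "x \<in> P \<Longrightarrow> y \<in> P \<Longrightarrow> cls P u x \<oplus>\<^bsub>local_algebra FF P u\<^esub> cls P u y = cls P u (x \<oplus>\<^bsub>FF\<^esub> y)"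
    "x \<in> P \<Longrightarrow> y \<in> P \<Longrightarrow> cls P u x \<otimes>\<^bsub>local_algebra FF P u\<^esub> cls P u y = cls P u (x \<otimes>\<^bsub>FF\<^esub> y)"
    "\<one>\<^bsub>local_algebra FF P u\<^esub> = cls P u \<one>\<^bsub>FF\<^esub>"
    using ring_hom_add[OF h, of x y] ring_hom_mult[OF h, of x y] ring_hom_one[OF h]
    by (simp_all add: local_algebra_def algebra_via_def cls_R)
  have "\<zero>\<^bsub>local_algebra FF P u\<^esub> = max_ideal_pow FF P (int u)"
    by (simp add: local_algebra_def algebra_via_def FactRing_def)
  then show "\<zero>\<^bsub>local_algebra FF P u\<^esub> = cls P u \<zero>\<^bsub>FF\<^esub>"
    by (simp add: cls_eq max_ideal_pow_FF translate_def)
qed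

lemma cls_eq_iff: "cls P u x = cls P u y \<longleftrightarrow> fr x - fr y \<in> mpow (fr ` P) (int u)"
  by (simp add: cls_eq translate_eq_iff[OF add_subgroup_mpow[OF dvr_P]])

lemma smult_LA: "c \<odot>\<^bsub>local_algebra FF P u\<^esub> z = cls P u c \<otimes>\<^bsub>local_algebra FF P u\<^esub> z"
  by (simp add: local_algebra_def algebra_via_def cls_def)

lemma card_LA: "card (carrier (local_algebra FF P u)) = rcard (fr ` P) ^ u" "finite (carrier (local_algebra FF P u))"
proof -
  have "carrier (local_algebra FF P u) = (-`) fr ` cosets (fr ` P) (mpow (fr ` P) (int u))"
    by (auto simp: carrier_LA cls_eq cosets_def image_image)
  moreover have "inj_on ((-`) fr) S" for S by (rule inj_onI) simp
  moreover have "finite (cosets (fr ` P) (mpow (fr ` P) (int u)))"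
    "card (cosets (fr ` P) (mpow (fr ` P) (int u))) = rcard (fr ` P) ^ u"
    using cosets_mpow[OF dvr_P finite_residue[OF dvr_P], of 0 u] by (simp_all add: mpow_0[OF dvr_P] rcard_def)
  ultimately show "card (carrier (local_algebra FF P u)) = rcard (fr ` P) ^ u" "finite (carrier (local_algebra FF P u))"
    by (simp_all add: card_image)
qed

lemma one_neq_zero_LA: "u \<ge> 1 \<Longrightarrow> \<one>\<^bsub>local_algebra FF P u\<^esub> \<noteq> \<zero>\<^bsub>local_algebra FF P u\<^esub>"
  by (simp add: cls_hom cls_eq_iff mpow_def val_one[OF dvr_P])

lemma hom_KK_LA: "cls P u \<in> ring_hom (FF\<lparr>carrier := KK\<rparr>) (local_algebra FF P u)"
proof (rule ring_hom_memI)
  fix x assume "x \<in> carrier (FF\<lparr>carrier := KK\<rparr>)"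
  then have x: "x \<in> P" using P_closed(6) by auto
  then show "cls P u x \<in> carrier (local_algebra FF P u)" by (rule cls_in_LA)
  fix y assume "y \<in> carrier (FF\<lparr>carrier := KK\<rparr>)"
  then have y: "y \<in> P" using P_closed(6) by auto
  show "cls P u (x \<otimes>\<^bsub>FF\<lparr>carrier := KK\<rparr>\<^esub> y) = cls P u x \<otimes>\<^bsub>local_algebra FF P u\<^esub> cls P u y"
    "cls P u (x \<oplus>\<^bsub>FF\<lparr>carrier := KK\<rparr>\<^esub> y) = cls P u x \<oplus>\<^bsub>local_algebra FF P u\<^esub> cls P u y"
    by (simp_all add: cls_hom x y)
next
  show "cls P u \<one>\<^bsub>FF\<lparr>carrier := KK\<rparr>\<^esub> = \<one>\<^bsub>local_algebra FF P u\<^esub>" by (simp add: cls_hom)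
qed

text \<open>The residue field is a vector space over the embedded constants; counting its elements
  links the dimension in \<open>pt_degree\<close> with \<open>rcard\<close>.\<close>

lemma rcard_pt_degree: "rcard (fr ` P) = 3 ^ pt_degree KK FF P"
proof -
  let ?A = "local_algebra FF P 1"
  interpret A: cring ?A by (rule cring_LA)
  have fK: "Ring.field (FF\<lparr>carrier := KK\<rparr>)" by (rule FF.subfield_iff(2)[OF subfield_KK])
  interpret h: ring_hom_ring "FF\<lparr>carrier := KK\<rparr>" ?A "cls P 1"
    using fK hom_KK_LA by (intro ring_hom_ringI2 A.ring_axioms) (auto simp: Ring.field_def domain_def cring_def)
  have "subfield KK (FF\<lparr>carrier := KK\<rparr>)" using field.carrier_is_subfield[OF fK] by simp
  then have inj: "inj_on (cls P 1) KK" and sub: "subfield (cls P 1 ` KK) ?A"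
    using h.img_is_subfield[of KK] one_neq_zero_LA by auto
  have "card (carrier ?A) = 3 ^ ring.dim ?A (cls P 1 ` KK) (carrier ?A)"
  proof (rule A.card_eq_dim[OF sub])
    show "card (cls P 1 ` KK) = 3" using card_image[OF inj] card_KK by simp
    show "subgroup (carrier ?A) (add_monoid ?A)" by (rule A.add.subgroup_self)
    show "finite (carrier ?A)" by (rule card_LA)
    show "k \<otimes>\<^bsub>?A\<^esub> x \<in> carrier ?A" if k: "k \<in> cls P 1 ` KK" and x: "x \<in> carrier ?A" for k x
    proof (rule A.m_closed[OF _ x])
      obtain c where "c \<in> KK" "k = cls P 1 c" using k by blast
      then show "k \<in> carrier ?A" using P_closed(6) cls_in_LA by blast
    qed
  qed
  moreover have "cls P 1 ` KK = (\<lambda>c. max_ideal_pow FF P 1 +>\<^bsub>FF\<^esub> c) ` KK" by (simp add: cls_def)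
  ultimately show ?thesis using card_LA(1)[of 1] by (simp add: pt_degree_def)
qed

end

lemma rcard_pt: "dvr Q \<Longrightarrow> rcard Q = 3 ^ pt_degree KK FF (pt Q)"
  using rcard_pt_degree[of "pt Q"] by simp

lemma pt_degree_eqI: "dvr Q \<Longrightarrow> rcard Q = 3 ^ n \<Longrightarrow> pt_degree KK FF (pt Q) = n"
  using rcard_pt[of Q] power_inject_exp[of "3::nat"] by simp

section \<open>The curve has genus one\<close>

lemma divisors_FF:
  assumes "D \<in> divisors KK FF"
  shows "finite {Q. D (pt Q) \<noteq> 0}" "\<And>Q. D (pt Q) \<noteq> 0 \<Longrightarrow> dvr Q" "supp D = pt ` {Q. D (pt Q) \<noteq> 0}"
proof -
  show s: "supp D = pt ` {Q. D (pt Q) \<noteq> 0}"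
    unfolding supp_def by (auto simp: image_iff) (metis pt_fr_image)
  have "finite (pt ` {Q. D (pt Q) \<noteq> 0})" using assms s by (simp add: divisors_def)
  then show "finite {Q. D (pt Q) \<noteq> 0}" by (rule finite_imageD) (auto intro: inj_onI)
  show "dvr Q" if "D (pt Q) \<noteq> 0" for Q
    using assms that by (auto simp: divisors_def supp_def simp flip: pt_closed_point)
qed

lemma div_degree_FF:
  assumes "D \<in> divisors KK FF"
  shows "div_degree KK FF D = (\<Sum>Q | D (pt Q) \<noteq> 0. D (pt Q) * int (pt_degree KK FF (pt Q)))"
  unfolding div_degree_def divisors_FF(3)[OF assms] by (subst sum.reindex) (auto intro: inj_onI)

lemma finite_card_sections:
  assumes D: "D \<in> divisors KK FF"
  shows "finite (sections (\<lambda>Q. D (pt Q)))" "3 ^ nat (div_degree KK FF D) \<le> card (sections (\<lambda>Q. D (pt Q)))"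
  using riemann_inequality[OF divisors_FF(1,2)[OF D], of "\<lambda>Q. pt_degree KK FF (pt Q)"] rcard_pt div_degree_FF[OF D] by auto

lemma card_vimage_fr: "card (fr -` A) = card A"
  using bij_fr by (metis card_vimage_inj bij_is_inj bij_is_surj subset_UNIV)

lemma finite_vimage_fr: "finite A \<Longrightarrow> finite (fr -` A)"
  using bij_fr by (intro finite_vimageI) (auto simp: bij_is_inj)

lemma card_global_sections:
  assumes D: "D \<in> divisors KK FF"
  shows "card (sections (\<lambda>Q. D (pt Q))) = 3 ^ ring.dim FF KK (global_sections KK FF D)"
proof -
  let ?S = "sections (\<lambda>Q. D (pt Q))"
  note sg = add_subgroup_sections[of "\<lambda>Q. D (pt Q)"]
  have "card (global_sections KK FF D) = 3 ^ ring.dim FF KK (global_sections KK FF D)"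
  proof (rule FF.card_eq_dim[OF subfield_KK card_KK])
    show "subgroup (global_sections KK FF D) (add_monoid FF)"
    proof (rule FF.add.subgroupI)
      have "\<zero>\<^bsub>FF\<^esub> \<in> global_sections KK FF D" using add_subgroup_zero[OF sg] by (simp add: global_sections_FF)
      then show "global_sections KK FF D \<noteq> {}" by blast
    qed (use add_subgroup_add[OF sg] add_subgroup_uminus[OF sg] in \<open>auto simp: global_sections_FF\<close>)
    show "finite (global_sections KK FF D)"
      unfolding global_sections_FF by (rule finite_vimage_fr[OF finite_card_sections(1)[OF D]])
    fix k x assume k: "k \<in> KK" and x: "x \<in> global_sections KK FF D"
    obtain c where c: "fr k = to_fract (pol [:c:])" using k by (auto simp: mem_KK_iff)
    have "fr k * fr x \<in> mpow P (0 + - D (pt P))" if "dvr P" for P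
      using x that c const_in_dvr[OF that] by (intro mpow_mult[OF that]) (auto simp: global_sections_FF sections_def mpow_0[OF that])
    then show "k \<otimes>\<^bsub>FF\<^esub> x \<in> global_sections KK FF D" by (simp add: global_sections_FF sections_def)
  qed
  then show ?thesis by (simp add: global_sections_FF card_vimage_fr)
qed

lemma dim_ge_degree:
  assumes D: "D \<in> divisors KK FF"
  shows "div_degree KK FF D \<le> int (ring.dim FF KK (global_sections KK FF D))"
proof -
  have "(3::nat) ^ nat (div_degree KK FF D) \<le> 3 ^ ring.dim FF KK (global_sections KK FF D)"
    using finite_card_sections(2)[OF D] card_global_sections[OF D] by simp
  then have "nat (div_degree KK FF D) \<le> ring.dim FF KK (global_sections KK FF D)"
    by (simp add: power_increasing_iff)
  then show ?thesis by linarith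
qed

lemma pt_degree_inf: "pt_degree KK FF (pt inf_ring) = 1"
  by (rule pt_degree_eqI[OF inf_dvr]) (simp add: rcard_inf)

text \<open>Riemann's inequality in the form dim L(D) \<ge> deg D bounds the expression by 1. The
  divisor of infinity attains the bound, because no function has pole order one.\<close>

theorem genus_one: "has_genus KK FF 1"
proof -
  define D where "D P = (if P = pt inf_ring then 1 else 0 :: int)" for P
  have supp: "supp D = {pt inf_ring}" by (auto simp: supp_def D_def)
  have D: "D \<in> divisors KK FF" using inf_dvr by (simp add: divisors_def supp)
  have deg: "div_degree KK FF D = 1" by (simp add: div_degree_def supp D_def pt_degree_inf)
  have "(\<lambda>Q. D (pt Q)) = (\<lambda>P. if P = inf_ring then int 1 else 0)" by (intro ext) (simp add: D_def)
  then have "card (sections (\<lambda>Q. D (pt Q))) = card (to_fract ` aff_le 1)" using sections_at_infinity[of 1] by simp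
  also have "\<dots> = 3" using card_aff_le(1)[of 1] by (subst card_image) (auto intro: inj_onI)
  finally have "(3::nat) ^ ring.dim FF KK (global_sections KK FF D) = 3 ^ 1" using card_global_sections[OF D] by simp
  then have "ring.dim FF KK (global_sections KK FF D) = 1" by (subst (asm) power_inject_exp) auto
  then have "\<exists>D\<in>divisors KK FF. div_degree KK FF D + 1 - int (ring.dim FF KK (global_sections KK FF D)) = int 1"
    using D deg by (intro bexI[of _ D]) auto
  moreover have "div_degree KK FF D + 1 - int (ring.dim FF KK (global_sections KK FF D)) \<le> int 1"
    if "D \<in> divisors KK FF" for D
    using dim_ge_degree[OF that] by simp
  ultimately show ?thesis by (simp add: has_genus_def)
qed

text \<open>Coefficient lists start with the leading coefficient, and nonzero constants have
  valuation 0, so at a pole of \<open>z\<close> the leading term dominates all later ones.\<close>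

lemma eval_bound:
  assumes Q: "dvr Q" and z: "z \<noteq> \<zero>\<^bsub>FF\<^esub>" "val Q (fr z) < 0" and p: "set p \<subseteq> KK"
  shows "ring.eval FF p z = \<zero>\<^bsub>FF\<^esub> \<or> (int (length p) - 1) * val Q (fr z) \<le> val Q (fr (ring.eval FF p z))"
    and "p \<noteq> [] \<Longrightarrow> hd p \<noteq> \<zero>\<^bsub>FF\<^esub> \<Longrightarrow> ring.eval FF p z \<noteq> \<zero>\<^bsub>FF\<^esub>"
proof -
  have K0: "val Q (fr a) = 0" if a: "a \<in> KK" "a \<noteq> \<zero>\<^bsub>FF\<^esub>" for a
  proof -
    obtain c where c: "fr a = to_fract (pol [:c:])" using a by (auto simp: mem_KK_iff)
    then have c0: "c \<noteq> 0" using a fr_zero_iff[of a] by auto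
    have "unit_in Q (fr a)" unfolding unit_in_def c using c0 const_in_dvr[OF Q] by (simp add: const_pol_inverse)
    then show ?thesis by (rule val_unit[OF Q])
  qed
  define B where "B p \<longleftrightarrow> (ring.eval FF p z = \<zero>\<^bsub>FF\<^esub> \<or> (int (length p) - 1) * val Q (fr z) \<le> val Q (fr (ring.eval FF p z)))
      \<and> (p \<noteq> [] \<longrightarrow> hd p \<noteq> \<zero>\<^bsub>FF\<^esub> \<longrightarrow> ring.eval FF p z \<noteq> \<zero>\<^bsub>FF\<^esub>)" for p
  have "B p" using p
  proof (induction p)
    case Nil then show ?case by (simp add: B_def FF.eval.simps)
  next
    case (Cons a p)
    let ?r = "fr (ring.eval FF p z)" and ?t = "fr a * fr z ^ length p"
    have ev: "fr (ring.eval FF (a # p) z) = ?t + ?r" by (simp add: FF.eval.simps)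
    have IH: "?r = 0 \<or> (int (length p) - 1) * val Q (fr z) \<le> val Q ?r" using Cons by (simp add: B_def)
    have r: "?r = 0 \<or> int (length p) * val Q (fr z) < val Q ?r" using IH z(2) by (auto simp: algebra_simps)
    show ?case
    proof (cases "a = \<zero>\<^bsub>FF\<^esub>")
      case True
      then have "fr (ring.eval FF (a # p) z) = ?r" using ev by simp
      then show ?thesis using r True unfolding B_def by auto
    next
      case False
      then have t: "?t \<noteq> 0" "val Q ?t = int (length p) * val Q (fr z)"
        using z(1) K0[of a] Cons(2) by (simp_all add: val_mult[OF Q] val_power[OF Q])
      then have "?t + ?r \<noteq> 0" "val Q (?t + ?r) = int (length p) * val Q (fr z)"
        using val_add_eq[OF Q t(1), of ?r] r by simp_all
      then have "fr (ring.eval FF (a # p) z) \<noteq> 0" "val Q (fr (ring.eval FF (a # p) z)) = int (length p) * val Q (fr z)"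
        unfolding ev by blast+
      then have "ring.eval FF (a # p) z \<noteq> \<zero>\<^bsub>FF\<^esub>"
        "val Q (fr (ring.eval FF (a # p) z)) = (int (length (a # p)) - 1) * val Q (fr z)" by (metis fr_zero_iff, simp del: FF.eval.simps)
      then show ?thesis unfolding B_def by simp
    qed
  qed
  then show "ring.eval FF p z = \<zero>\<^bsub>FF\<^esub> \<or> (int (length p) - 1) * val Q (fr z) \<le> val Q (fr (ring.eval FF p z))"
    "p \<noteq> [] \<Longrightarrow> hd p \<noteq> \<zero>\<^bsub>FF\<^esub> \<Longrightarrow> ring.eval FF p z \<noteq> \<zero>\<^bsub>FF\<^esub>" by (auto simp: B_def)
qed

lemma transcendental_if_pole:
  assumes Q: "dvr Q" and z: "fr z \<notin> Q" shows "ring.transcendental FF KK z"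
proof (rule ccontr)
  assume "\<not> ring.transcendental FF KK z"
  then have "(ring.algebraic FF over KK) z" by (simp add: over_def)
  then obtain p where p: "p \<in> carrier (KK[X]\<^bsub>FF\<^esub>)" "p \<noteq> []" "ring.eval FF p z = \<zero>\<^bsub>FF\<^esub>"
    using domain.algebraicE[of FF KK z] field_FF subfieldE(1)[OF subfield_KK] by (auto simp: Ring.field_def)
  have "set p \<subseteq> KK" "hd p \<noteq> \<zero>\<^bsub>FF\<^esub>" using p by (auto simp: univ_poly_def polynomial_def)
  moreover have z0: "z \<noteq> \<zero>\<^bsub>FF\<^esub>" using z dvr_zero[OF Q] by auto
  moreover have "val Q (fr z) < 0" using z z0 mem_iff_val[OF Q, of "fr z"] by simp
  ultimately show False using eval_bound(2)[OF Q] p by blast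
qed

text \<open>An element that is not transcendental has no poles, hence lies in L(0), which consists
  of the constants. Over K(x) the field is spanned by y and 1.\<close>

theorem curve_FF: "curve KK FF"
proof -
  define x where "x = cd (to_fract (pol [:0, 1:]))"
  have tx: "ring.transcendental FF KK x"
  proof (rule transcendental_if_pole[OF inf_dvr])
    show "fr x \<notin> inf_ring" using inf_ring_mem_iff[of "pol [:0, 1:]" 1] by (simp add: x_def dg_pol)
  qed
  have tr: "ring.transcendental FF KK z \<or> z \<in> KK" for z
  proof (rule ccontr)
    assume a: "\<not> (ring.transcendental FF KK z \<or> z \<in> KK)"
    then have "fr z \<in> Q" if "dvr Q" for Q using transcendental_if_pole[OF that] by blast
    then have "fr z \<in> sections (\<lambda>P. if P = inf_ring then int 0 else 0)" by (auto simp: sections_def mpow_0)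
    then obtain u where "fr z = to_fract u" "u \<in> aff_le 0" unfolding sections_at_infinity by blast
    then have "z \<in> KK" using aff_le_0[of u] by (auto simp: mem_KK_iff)
    then show False using a by blast
  qed
  let ?L = "generate_field FF (insert x KK)"
  have sL: "subfield ?L FF" by (rule field.generate_field_is_subfield[OF field_FF]) simp
  have pL: "cd (to_fract (pol p)) \<in> ?L" for p
  proof (induction p)
    case 0
    have "cd (to_fract (pol 0)) = \<zero>\<^bsub>FF\<^esub>" by (rule FF_eqI) simp
    then show ?case using field.zero_in_generate[OF field_FF] by simp
  next
    case (pCons a p)
    have a: "cd (to_fract (pol [:a:])) \<in> ?L" by (rule generate_field.incl) (auto simp: KK_def)
    have x: "x \<in> ?L" by (rule generate_field.incl) simp
    have "pol (pCons a p) = pol [:a:] + pol [:0, 1:] * pol p" by (simp add: aff_eq_iff)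
    then have "to_fract (pol (pCons a p)) = to_fract (pol [:a:]) + to_fract (pol [:0, 1:]) * to_fract (pol p)"
      by (simp only: to_fract_add to_fract_mult)
    then have "cd (to_fract (pol (pCons a p))) = cd (to_fract (pol [:a:])) \<oplus>\<^bsub>FF\<^esub> (x \<otimes>\<^bsub>FF\<^esub> cd (to_fract (pol p)))"
      by (intro FF_eqI) (simp only: x_def FF_simps fr_cd)
    then show ?case using a x pCons by (metis generate_field.eng_add generate_field.eng_mult)
  qed
  have qL: "cd (to_fract (pol p) / to_fract (pol q)) \<in> ?L" if q: "q \<noteq> 0" for p q
  proof -
    have nz: "cd (to_fract (pol q)) \<noteq> \<zero>\<^bsub>FF\<^esub>" using q fr_zero_iff[of "cd (to_fract (pol q))"] by simp
    have "cd (to_fract (pol p) / to_fract (pol q)) = cd (to_fract (pol p)) \<otimes>\<^bsub>FF\<^esub> inv\<^bsub>FF\<^esub> cd (to_fract (pol q))"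
      by (intro FF_eqI) (simp only: FF_simps fr_cd fr_inv[OF nz] divide_inverse)
    then show ?thesis using pL nz by (metis generate_field.eng_mult generate_field.m_inv)
  qed
  define y where "y = cd (to_fract ycoord)"
  have "carrier FF \<subseteq> ring.Span FF ?L [y, \<one>\<^bsub>FF\<^esub>]"
  proof
    fix z assume "z \<in> carrier FF"
    obtain a b where ab: "fr z = to_fract a / to_fract b" "b \<noteq> 0" by (rule fract_rep)
    \<comment> \<open>The norm clears the denominator: a / b = a conj(b) / norm(b), with a
      polynomial below.\<close>
    define n where "n = anorm b"
    have n: "n \<noteq> 0" "pol n = b * conj b" using ab by (simp_all add: n_def anorm_degree mult_conj)
    then have cb: "to_fract (conj b) \<noteq> 0" by auto
    define v where "v = a * conj b"
    have "fr z = to_fract v / to_fract (pol n)" unfolding ab(1) n(2) v_def using ab(2) cb by simp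
    also have "to_fract v = to_fract (pol (re v)) + to_fract (pol (im v)) * to_fract ycoord"
      by (metis aff_decomp to_fract_add to_fract_mult)
    finally have z: "fr z = to_fract (pol (im v)) / to_fract (pol n) * to_fract ycoord + to_fract (pol (re v)) / to_fract (pol n)"
      by (simp add: add_divide_distrib)
    let ?k = "cd (to_fract (pol (im v)) / to_fract (pol n))" and ?l = "cd (to_fract (pol (re v)) / to_fract (pol n))"
    have eq: "z = ?k \<otimes>\<^bsub>FF\<^esub> y \<oplus>\<^bsub>FF\<^esub> (?l \<otimes>\<^bsub>FF\<^esub> \<one>\<^bsub>FF\<^esub> \<oplus>\<^bsub>FF\<^esub> \<zero>\<^bsub>FF\<^esub>)"
      using z by (intro FF_eqI) (simp only: y_def FF_simps fr_cd mult_1_right add_0_right)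
    have l: "?l \<otimes>\<^bsub>FF\<^esub> \<one>\<^bsub>FF\<^esub> \<oplus>\<^bsub>FF\<^esub> \<zero>\<^bsub>FF\<^esub> \<in> ring.Span FF ?L [\<one>\<^bsub>FF\<^esub>]"
      using qL[OF n(1)] by (auto simp: FF.line_extension_mem_iff)
    have sp: "ring.Span FF ?L [y, \<one>\<^bsub>FF\<^esub>] = ring.line_extension FF ?L y (ring.Span FF ?L [\<one>\<^bsub>FF\<^esub>])"
      by simp
    show "z \<in> ring.Span FF ?L [y, \<one>\<^bsub>FF\<^esub>]"
      unfolding sp FF.line_extension_mem_iff
      by (rule bexI[of _ ?k], rule bexI[of _ "?l \<otimes>\<^bsub>FF\<^esub> \<one>\<^bsub>FF\<^esub> \<oplus>\<^bsub>FF\<^esub> \<zero>\<^bsub>FF\<^esub>"], rule eq, rule l, rule qL[OF n(1)])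
  qed
  then have "UNIV \<subseteq> ring.Span FF ?L [y, \<one>\<^bsub>FF\<^esub>]" by (simp only: FF_simps(1))
  then have span: "ring.Span FF ?L [y, \<one>\<^bsub>FF\<^esub>] = carrier FF"
    unfolding FF_simps(1) by (rule top.extremum_uniqueI)
  have "set [y, \<one>\<^bsub>FF\<^esub>] \<subseteq> carrier FF" by simp
  from FF.Span_finite_dimension[OF sL this] have "ring.finite_dimension FF ?L (carrier FF)"
    unfolding span .
  then show ?thesis unfolding curve_def using field_FF subfield_KK tx tr by (intro conjI bexI[of _ x]) auto
qed

section \<open>Symmetric algorithms for small algebras\<close>

text \<open>A right-nested sum that unfolds for explicit algorithms; \<open>finsum_nth\<close> turns
  it into the indexed sum of \<open>sym_mult_algorithm\<close>.\<close>

primrec (in ring) list_sum :: "'a list \<Rightarrow> 'a" where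
  "list_sum [] = \<zero>"
| "list_sum (z # zs) = z \<oplus> list_sum zs"

lemma (in ring) list_sum_closed: "set zs \<subseteq> carrier R \<Longrightarrow> list_sum zs \<in> carrier R"
  by (induction zs) auto

lemma (in ring) list_sum_snoc:
  "set zs \<subseteq> carrier R \<Longrightarrow> z \<in> carrier R \<Longrightarrow> list_sum (zs @ [z]) = z \<oplus> list_sum zs"
  by (induction zs) (auto simp: list_sum_closed add.m_lcomm)

lemma (in ring) finsum_nth:
  "set zs \<subseteq> carrier R \<Longrightarrow> (\<Oplus>i\<in>{..<length zs}. zs ! i) = list_sum zs"
proof (induction zs rule: rev_induct)
  case (snoc z zs)
  have "(\<Oplus>i\<in>{..<length (zs @ [z])}. (zs @ [z]) ! i) = (\<Oplus>i\<in>insert (length zs) {..<length zs}. (zs @ [z]) ! i)"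
    by (simp add: lessThan_Suc)
  also have "\<dots> = z \<oplus> (\<Oplus>i\<in>{..<length zs}. (zs @ [z]) ! i)"
    using snoc(2) by (subst finsum_insert) (auto simp: nth_append dest: nth_mem)
  also have "(\<Oplus>i\<in>{..<length zs}. (zs @ [z]) ! i) = (\<Oplus>i\<in>{..<length zs}. zs ! i)"
    using snoc(2) by (intro add.finprod_cong) (auto simp: nth_append simp_implies_def dest: nth_mem)
  finally show ?case using snoc by (simp add: list_sum_snoc)
qed (simp)

text \<open>Abstracts over the two kinds of algebras in play: the truncated polynomial algebras
  behind \<open>mu_sym_q\<close> and the local algebras at the points.\<close>

locale scalar_algebra = cring A
  for k :: "('k, 'c) ring_scheme" and A :: "('k, 'a, 'd) module_scheme" (structure) and h :: "'k \<Rightarrow> 'a" +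
  assumes field_k: "Ring.field k" and card_k: "card (carrier k) = 3"
    and h: "h \<in> ring_hom k A" and one_neq_zero: "\<one> \<noteq> \<zero>"
    and smult: "\<And>r x. r \<in> carrier k \<Longrightarrow> x \<in> carrier A \<Longrightarrow> r \<odot> x = h r \<otimes> x"
begin

definition K where "K = h ` carrier k"

lemma h_closed: "r \<in> carrier k \<Longrightarrow> h r \<in> carrier A"
  using ring_hom_closed[OF h] .

lemma h_hom: "ring_hom_ring k A h"
  using field_k h ring_axioms by (intro ring_hom_ringI2) (auto simp: Ring.field_def domain_def cring_def)

lemma K_facts: "inj_on h (carrier k)" "subfield K A" "card K = 3" "finite K" "K \<subseteq> carrier A"
proof -
  interpret H: ring_hom_ring k A h by (rule h_hom)
  note sub = field.carrier_is_subfield[OF field_k]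
  show inj: "inj_on h (carrier k)" and "subfield K A"
    using H.img_is_subfield[OF sub one_neq_zero] by (simp_all add: K_def)
  show c: "card K = 3" using card_image[OF inj] card_k by (simp add: K_def)
  show "finite K" using c card.infinite by fastforce
  show "K \<subseteq> carrier A" using h_closed by (auto simp: K_def)
qed

definition g where "g = inv_into (carrier k) h"

lemma g: "c \<in> K \<Longrightarrow> g c \<in> carrier k" "c \<in> K \<Longrightarrow> h (g c) = c" "r \<in> carrier k \<Longrightarrow> g (h r) = r"
  using K_facts(1) by (auto simp: g_def K_def inv_into_into f_inv_into_f)

lemma g_hom:
  assumes "c \<in> K" "d \<in> K"
  shows "g (c \<oplus> d) = g c \<oplus>\<^bsub>k\<^esub> g d" "g (c \<otimes> d) = g c \<otimes>\<^bsub>k\<^esub> g d"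
proof -
  interpret k: Ring.field k by (rule field_k)
  have "c \<oplus> d = h (g c \<oplus>\<^bsub>k\<^esub> g d)" "c \<otimes> d = h (g c \<otimes>\<^bsub>k\<^esub> g d)"
    using g assms ring_hom_add[OF h, of "g c" "g d"] ring_hom_mult[OF h, of "g c" "g d"] by simp_all
  then show "g (c \<oplus> d) = g c \<oplus>\<^bsub>k\<^esub> g d" "g (c \<otimes> d) = g c \<otimes>\<^bsub>k\<^esub> g d"
    using g assms by (metis k.add.m_closed, metis k.m_closed)
qed

abbreviation form :: "('a \<Rightarrow> 'k) \<Rightarrow> bool" where
  "form \<equiv> linear_map k A (algebra_via k (\<lambda>c. c))"

lemma form_closed: "form \<phi> \<Longrightarrow> x \<in> carrier A \<Longrightarrow> \<phi> x \<in> carrier k"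
  by (auto simp: linear_map_def algebra_via_def)

lemma form_add: assumes "form \<phi>" "form \<psi>" shows "form (\<lambda>x. \<phi> x \<oplus>\<^bsub>k\<^esub> \<psi> x)"
proof -
  interpret k: Ring.field k by (rule field_k)
  have smult_closed: "c \<odot> x \<in> carrier A" if "c \<in> carrier k" "x \<in> carrier A" for c x
    using that smult h_closed by simp
  show ?thesis using assms unfolding linear_map_def algebra_via_def
    by (auto simp: Pi_iff k.r_distr k.add.m_ac)
qed

lemma algorithm_of_list:
  assumes L: "\<And>\<phi> w. (\<phi>, w) \<in> set L \<Longrightarrow> form \<phi> \<and> w \<in> carrier A"
    and eq: "\<And>x y. x \<in> carrier A \<Longrightarrow> y \<in> carrier A \<Longrightarrow>
      x \<otimes> y = list_sum (map (\<lambda>(\<phi>, w). (h (\<phi> x) \<otimes> h (\<phi> y)) \<otimes> w) L)"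
  shows "\<exists>\<phi> w. sym_mult_algorithm k A {..<length L} \<phi> w"
proof (intro exI)
  interpret k: Ring.field k by (rule field_k)
  have nth: "form (fst (L ! i))" "snd (L ! i) \<in> carrier A" if "i < length L" for i
    using L[of "fst (L ! i)" "snd (L ! i)"] that nth_mem[OF that] by simp_all
  have "x \<otimes> y = (\<Oplus>i\<in>{..<length L}. (fst (L ! i) x \<otimes>\<^bsub>k\<^esub> fst (L ! i) y) \<odot> snd (L ! i))"
    if xy: "x \<in> carrier A" "y \<in> carrier A" for x y
  proof -
    let ?zs = "map (\<lambda>(\<phi>, w). (h (\<phi> x) \<otimes> h (\<phi> y)) \<otimes> w) L"
    have cl: "set ?zs \<subseteq> carrier A" using L xy form_closed h_closed by fastforce
    have "(\<Oplus>i\<in>{..<length L}. (fst (L ! i) x \<otimes>\<^bsub>k\<^esub> fst (L ! i) y) \<odot> snd (L ! i)) = (\<Oplus>i\<in>{..<length ?zs}. ?zs ! i)"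
    proof (rule add.finprod_cong')
      show "{..<length L} = {..<length ?zs}" by simp
      show "(\<lambda>i. ?zs ! i) \<in> {..<length ?zs} \<rightarrow> carrier A" using cl nth_mem by blast
      fix i assume "i \<in> {..<length ?zs}"
      then have i: "i < length L" by simp
      show "(fst (L ! i) x \<otimes>\<^bsub>k\<^esub> fst (L ! i) y) \<odot> snd (L ! i) = ?zs ! i"
        using nth[OF i] i xy form_closed[of "fst (L ! i)"] ring_hom_mult[OF h]
        by (simp add: smult case_prod_beta)
    qed
    then show ?thesis using finsum_nth[OF cl] eq[OF xy] by simp
  qed
  then show "sym_mult_algorithm k A {..<length L} (\<lambda>i. fst (L ! i)) (\<lambda>i. snd (L ! i))"
    unfolding sym_mult_algorithm_def using nth by auto
qed

text \<open>Uniqueness of coordinates makes them additive and homogeneous; pulled back along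
  \<open>h\<close> they become linear forms with values in \<open>k\<close>.\<close>

lemma base_coordinates:
  assumes ind: "independent K Vs" and sp: "Span K Vs = carrier A"
  obtains \<phi> where "\<And>i. i < length Vs \<Longrightarrow> form (\<phi> i)"
    "\<And>x. x \<in> carrier A \<Longrightarrow> x = combine (map (\<lambda>i. h (\<phi> i x)) [0..<length Vs]) Vs"
proof -
  interpret k: Ring.field k by (rule field_k)
  note sub = K_facts(2)
  note Kc = K_facts(5)
  have Vs: "set Vs \<subseteq> carrier A" by (rule independent_in_carrier[OF ind])
  have uniq: "\<exists>!Ks. set Ks \<subseteq> K \<and> length Ks = length Vs \<and> x = combine Ks Vs" if "x \<in> carrier A" for x
    using unique_decomposition[OF sub ind] that sp by simp
  define co where "co x = (THE Ks. set Ks \<subseteq> K \<and> length Ks = length Vs \<and> x = combine Ks Vs)" for x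
  have co: "set (co x) \<subseteq> K \<and> length (co x) = length Vs \<and> x = combine (co x) Vs" if "x \<in> carrier A" for x
    unfolding co_def by (rule theI'[OF uniq[OF that]])
  have co_eq: "co x = Ks" if "x \<in> carrier A" "set Ks \<subseteq> K" "length Ks = length Vs" "x = combine Ks Vs" for x Ks
    using uniq[OF that(1)] co[OF that(1)] that(2-4) by blast
  have Kadd: "c \<oplus> d \<in> K" "c \<otimes> d \<in> K" if "c \<in> K" "d \<in> K" for c d
    using subringE(6,7)[OF subfieldE(1)[OF sub]] that by blast+
  have add: "co (x \<oplus> y) = map2 (\<oplus>) (co x) (co y)" if xy: "x \<in> carrier A" "y \<in> carrier A" for x y
  proof (rule co_eq)
    show "x \<oplus> y = combine (map2 (\<oplus>) (co x) (co y)) Vs"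
      using combine_add[of "co x" Vs "co y"] co[OF xy(1)] co[OF xy(2)] Kc Vs by (metis subset_trans)
    show "set (map2 (\<oplus>) (co x) (co y)) \<subseteq> K"
    proof
      fix c assume "c \<in> set (map2 (\<oplus>) (co x) (co y))"
      then obtain a b where ab: "(a, b) \<in> set (zip (co x) (co y))" "c = a \<oplus> b" by auto
      then have "a \<in> set (co x)" "b \<in> set (co y)" by (auto dest: set_zip_leftD set_zip_rightD)
      then have "a \<in> K" "b \<in> K" using co[OF xy(1)] co[OF xy(2)] by blast+
      then show "c \<in> K" using ab(2) Kadd(1) by simp
    qed
  qed (use xy co in auto)
  have scale: "co (c \<otimes> x) = map ((\<otimes>) c) (co x)" if c: "c \<in> K" and x: "x \<in> carrier A" for c x
  proof (rule co_eq)
    show "c \<otimes> x = combine (map ((\<otimes>) c) (co x)) Vs"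
      using combine_r_distr[of "co x" Vs c] co[OF x] Kc Vs c by (metis subset_trans subsetD)
    show "set (map ((\<otimes>) c) (co x)) \<subseteq> K" using co[OF x] Kadd(2)[OF c] by auto
  qed (use c x co Kc in auto)
  define \<phi> where "\<phi> i x = g (co x ! i)" for i x
  have mem: "co x ! i \<in> K" if "x \<in> carrier A" "i < length Vs" for x i
    using co[OF that(1)] that(2) by (metis nth_mem subsetD)
  have "form (\<phi> i)" if i: "i < length Vs" for i
    unfolding linear_map_def
  proof (intro conjI ballI)
    show "\<phi> i \<in> carrier A \<rightarrow> carrier (algebra_via k (\<lambda>c. c))"
      using mem[OF _ i] g(1) by (auto simp: \<phi>_def algebra_via_def)
    fix x assume x: "x \<in> carrier A"
    show "\<phi> i (x \<oplus> y) = \<phi> i x \<oplus>\<^bsub>algebra_via k (\<lambda>c. c)\<^esub> \<phi> i y" if y: "y \<in> carrier A" for y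
      using add[OF x y] mem[OF x i] mem[OF y i] co[OF x] co[OF y] i g_hom(1)
      by (simp add: \<phi>_def algebra_via_def)
    show "\<phi> i (c \<odot> x) = c \<odot>\<^bsub>algebra_via k (\<lambda>c. c)\<^esub> \<phi> i x" if c: "c \<in> carrier k" for c
    proof -
      have hc: "h c \<in> K" using c by (simp add: K_def)
      then show ?thesis using scale[OF hc x] mem[OF x i] co[OF x] i g_hom(2)[OF hc] g(3)[OF c] smult[OF c x]
        by (simp add: \<phi>_def algebra_via_def)
    qed
  qed
  moreover have "x = combine (map (\<lambda>i. h (\<phi> i x)) [0..<length Vs]) Vs" if x: "x \<in> carrier A" for x
  proof -
    have "map (\<lambda>i. h (\<phi> i x)) [0..<length Vs] = co x"
      using co[OF x] mem[OF x] g(2) by (intro nth_equalityI) (auto simp: \<phi>_def)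
    then show ?thesis using co[OF x] by simp
  qed
  ultimately show ?thesis using that by blast
qed

text \<open>The mixed terms are recovered from the product of the sums, and each of the three
  products has the symmetric shape of one linear form applied to both factors.\<close>

lemma karatsuba:
  assumes "X0 \<in> carrier A" "X1 \<in> carrier A" "Y0 \<in> carrier A" "Y1 \<in> carrier A" "b \<in> carrier A" "c \<in> carrier A"
  shows "(X0 \<otimes> b \<oplus> X1 \<otimes> c) \<otimes> (Y0 \<otimes> b \<oplus> Y1 \<otimes> c) =
    (X0 \<otimes> Y0) \<otimes> (b \<otimes> b \<ominus> b \<otimes> c) \<oplus> ((X1 \<otimes> Y1) \<otimes> (c \<otimes> c \<ominus> b \<otimes> c)
      \<oplus> ((X0 \<oplus> X1) \<otimes> (Y0 \<oplus> Y1)) \<otimes> (b \<otimes> c))"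
  using assms by algebra

text \<open>One product for each basis element and one for each pair of them, six in all.\<close>

lemma karatsuba3:
  assumes "X0 \<in> carrier A" "X1 \<in> carrier A" "X2 \<in> carrier A" "Y0 \<in> carrier A" "Y1 \<in> carrier A" "Y2 \<in> carrier A"
    "b \<in> carrier A" "c \<in> carrier A" "d \<in> carrier A"
  shows "(X0 \<otimes> b \<oplus> (X1 \<otimes> c \<oplus> X2 \<otimes> d)) \<otimes> (Y0 \<otimes> b \<oplus> (Y1 \<otimes> c \<oplus> Y2 \<otimes> d)) =
    (X0 \<otimes> Y0) \<otimes> (b \<otimes> b \<ominus> b \<otimes> c \<ominus> b \<otimes> d) \<oplus> ((X1 \<otimes> Y1) \<otimes> (c \<otimes> c \<ominus> b \<otimes> c \<ominus> c \<otimes> d)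
      \<oplus> ((X2 \<otimes> Y2) \<otimes> (d \<otimes> d \<ominus> b \<otimes> d \<ominus> c \<otimes> d) \<oplus> (((X0 \<oplus> X1) \<otimes> (Y0 \<oplus> Y1)) \<otimes> (b \<otimes> c)
      \<oplus> (((X0 \<oplus> X2) \<otimes> (Y0 \<oplus> Y2)) \<otimes> (b \<otimes> d) \<oplus> ((X1 \<oplus> X2) \<otimes> (Y1 \<oplus> Y2)) \<otimes> (c \<otimes> d)))))"
proof -
  have cross: "((Z \<oplus> Z') \<otimes> (W \<oplus> W')) \<otimes> m = (Z \<otimes> W) \<otimes> m \<oplus> ((Z' \<otimes> W') \<otimes> m \<oplus> (Z \<otimes> W' \<oplus> Z' \<otimes> W) \<otimes> m)"
    if "Z \<in> carrier A" "Z' \<in> carrier A" "W \<in> carrier A" "W' \<in> carrier A" "m \<in> carrier A" for Z Z' W W' m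
    using that by algebra
  have sq: "(Z \<otimes> e \<oplus> U) \<otimes> (W \<otimes> e \<oplus> V) = (Z \<otimes> W) \<otimes> (e \<otimes> e) \<oplus> (Z \<otimes> (e \<otimes> V) \<oplus> W \<otimes> (e \<otimes> U) \<oplus> U \<otimes> V)"
    if "Z \<in> carrier A" "e \<in> carrier A" "U \<in> carrier A" "W \<in> carrier A" "V \<in> carrier A" for Z e U W V
    using that by algebra
  have mixed: "X0 \<otimes> (b \<otimes> (Y1 \<otimes> c \<oplus> Y2 \<otimes> d)) \<oplus> Y0 \<otimes> (b \<otimes> (X1 \<otimes> c \<oplus> X2 \<otimes> d)) =
      (X0 \<otimes> Y1 \<oplus> X1 \<otimes> Y0) \<otimes> (b \<otimes> c) \<oplus> (X0 \<otimes> Y2 \<oplus> X2 \<otimes> Y0) \<otimes> (b \<otimes> d)"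
    using assms by algebra
  have two: "(X1 \<otimes> c \<oplus> X2 \<otimes> d) \<otimes> (Y1 \<otimes> c \<oplus> Y2 \<otimes> d) =
      (X1 \<otimes> Y1) \<otimes> (c \<otimes> c) \<oplus> ((X2 \<otimes> Y2) \<otimes> (d \<otimes> d) \<oplus> (X1 \<otimes> Y2 \<oplus> X2 \<otimes> Y1) \<otimes> (c \<otimes> d))"
    using assms by algebra
  have split: "p \<otimes> (e \<ominus> m \<ominus> n) = p \<otimes> e \<ominus> p \<otimes> m \<ominus> p \<otimes> n"
    if "p \<in> carrier A" "e \<in> carrier A" "m \<in> carrier A" "n \<in> carrier A" for p e m n
    using that by algebra
  have collect: "p0 \<ominus> p1 \<ominus> p2 \<oplus> (q0 \<ominus> q1 \<ominus> q2 \<oplus> (r0 \<ominus> r1 \<ominus> r2 \<oplus> (p1 \<oplus> (q1 \<oplus> s1) \<oplus> (p2 \<oplus> (r1 \<oplus> s2) \<oplus> (q2 \<oplus> (r2 \<oplus> s3))))))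
      = p0 \<oplus> (s1 \<oplus> s2 \<oplus> (q0 \<oplus> (r0 \<oplus> s3)))"
    if "p0 \<in> carrier A" "p1 \<in> carrier A" "p2 \<in> carrier A" "q0 \<in> carrier A" "q1 \<in> carrier A" "q2 \<in> carrier A"
      "r0 \<in> carrier A" "r1 \<in> carrier A" "r2 \<in> carrier A" "s1 \<in> carrier A" "s2 \<in> carrier A" "s3 \<in> carrier A"
    for p0 p1 p2 q0 q1 q2 r0 r1 r2 s1 s2 s3
    using that by algebra
  show ?thesis
    using assms by (simp add: sq mixed two cross split collect)
qed

lemma form_h_add:
  assumes "form \<phi>" "form \<psi>" "x \<in> carrier A"
  shows "h (\<phi> x \<oplus>\<^bsub>k\<^esub> \<psi> x) = h (\<phi> x) \<oplus> h (\<psi> x)"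
  using ring_hom_add[OF h] form_closed assms by blast

lemma algorithm_dim2:
  assumes ind: "independent K [b, c]" and sp: "Span K [b, c] = carrier A"
  shows "\<exists>\<phi> w. sym_mult_algorithm k A {..<3::nat} \<phi> w"
proof -
  obtain \<phi> where f: "\<And>i. i < length [b, c] \<Longrightarrow> form (\<phi> i)"
    "\<And>x. x \<in> carrier A \<Longrightarrow> x = combine (map (\<lambda>i. h (\<phi> i x)) [0..<length [b, c]]) [b, c]"
    using base_coordinates[OF ind sp] by metis
  have bc: "b \<in> carrier A" "c \<in> carrier A" using independent_in_carrier[OF ind] by auto
  have F: "form (\<phi> 0)" "form (\<phi> 1)" using f(1)[of 0] f(1)[of 1] by simp_all
  have hc: "h (\<phi> 0 x) \<in> carrier A" "h (\<phi> 1 x) \<in> carrier A" if "x \<in> carrier A" for x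
    using that F form_closed h_closed by blast+
  have x: "x = h (\<phi> 0 x) \<otimes> b \<oplus> h (\<phi> 1 x) \<otimes> c" if "x \<in> carrier A" for x
    using f(2)[OF that] hc[OF that] bc by simp
  let ?L = "[(\<phi> 0, b \<otimes> b \<ominus> b \<otimes> c), (\<phi> 1, c \<otimes> c \<ominus> b \<otimes> c), (\<lambda>x. \<phi> 0 x \<oplus>\<^bsub>k\<^esub> \<phi> 1 x, b \<otimes> c)]"
  have "\<exists>\<phi> w. sym_mult_algorithm k A {..<length ?L} \<phi> w"
  proof (rule algorithm_of_list)
    fix \<psi> w assume "(\<psi>, w) \<in> set ?L"
    then show "form \<psi> \<and> w \<in> carrier A" using F form_add[OF F] bc by auto
  next
    fix u v assume uv: "u \<in> carrier A" "v \<in> carrier A"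
    have "u \<otimes> v = (h (\<phi> 0 u) \<otimes> b \<oplus> h (\<phi> 1 u) \<otimes> c) \<otimes> (h (\<phi> 0 v) \<otimes> b \<oplus> h (\<phi> 1 v) \<otimes> c)"
      using x[OF uv(1)] x[OF uv(2)] by simp
    then show "u \<otimes> v = list_sum (map (\<lambda>(\<phi>, w). (h (\<phi> u) \<otimes> h (\<phi> v)) \<otimes> w) ?L)"
      using karatsuba[OF hc[OF uv(1)] hc[OF uv(2)] bc] hc[OF uv(1)] hc[OF uv(2)] bc
        form_h_add[OF F uv(1)] form_h_add[OF F uv(2)] by simp
  qed
  then show ?thesis by (simp add: eval_nat_numeral)
qed

text \<open>If two basis elements multiply to zero, the product belonging to that pair drops out and
  five remain.\<close>

lemma algorithm_dim3:
  assumes ind: "independent K [b, c, d]" and sp: "Span K [b, c, d] = carrier A"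
  shows "\<exists>\<phi> w. sym_mult_algorithm k A {..<6::nat} \<phi> w"
    "b \<otimes> c = \<zero> \<Longrightarrow> \<exists>\<phi> w. sym_mult_algorithm k A {..<5::nat} \<phi> w"
proof -
  obtain \<phi> where f: "\<And>i. i < length [b, c, d] \<Longrightarrow> form (\<phi> i)"
    "\<And>x. x \<in> carrier A \<Longrightarrow> x = combine (map (\<lambda>i. h (\<phi> i x)) [0..<length [b, c, d]]) [b, c, d]"
    using base_coordinates[OF ind sp] by metis
  have bc: "b \<in> carrier A" "c \<in> carrier A" "d \<in> carrier A" using independent_in_carrier[OF ind] by auto
  have F: "form (\<phi> 0)" "form (\<phi> 1)" "form (\<phi> 2)" using f(1)[of 0] f(1)[of 1] f(1)[of 2] by simp_all
  have hc: "h (\<phi> 0 x) \<in> carrier A" "h (\<phi> 1 x) \<in> carrier A" "h (\<phi> 2 x) \<in> carrier A" if "x \<in> carrier A" for x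
    using that F form_closed h_closed by blast+
  have x: "x = h (\<phi> 0 x) \<otimes> b \<oplus> (h (\<phi> 1 x) \<otimes> c \<oplus> h (\<phi> 2 x) \<otimes> d)" if "x \<in> carrier A" for x
    using f(2)[OF that] hc[OF that] bc by (simp add: numeral_2_eq_2)
  have fh: "h (\<phi> 0 u \<oplus>\<^bsub>k\<^esub> \<phi> 1 u) = h (\<phi> 0 u) \<oplus> h (\<phi> 1 u)" "h (\<phi> 0 u \<oplus>\<^bsub>k\<^esub> \<phi> 2 u) = h (\<phi> 0 u) \<oplus> h (\<phi> 2 u)"
    "h (\<phi> 1 u \<oplus>\<^bsub>k\<^esub> \<phi> 2 u) = h (\<phi> 1 u) \<oplus> h (\<phi> 2 u)" if "u \<in> carrier A" for u
    using form_h_add F that by blast+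
  have prod: "u \<otimes> v = (h (\<phi> 0 u) \<otimes> b \<oplus> (h (\<phi> 1 u) \<otimes> c \<oplus> h (\<phi> 2 u) \<otimes> d)) \<otimes>
      (h (\<phi> 0 v) \<otimes> b \<oplus> (h (\<phi> 1 v) \<otimes> c \<oplus> h (\<phi> 2 v) \<otimes> d))" if "u \<in> carrier A" "v \<in> carrier A" for u v
    using x[OF that(1)] x[OF that(2)] by simp
  let ?L = "[(\<phi> 0, b \<otimes> b \<ominus> b \<otimes> c \<ominus> b \<otimes> d), (\<phi> 1, c \<otimes> c \<ominus> b \<otimes> c \<ominus> c \<otimes> d), (\<phi> 2, d \<otimes> d \<ominus> b \<otimes> d \<ominus> c \<otimes> d),
      (\<lambda>x. \<phi> 0 x \<oplus>\<^bsub>k\<^esub> \<phi> 1 x, b \<otimes> c), (\<lambda>x. \<phi> 0 x \<oplus>\<^bsub>k\<^esub> \<phi> 2 x, b \<otimes> d), (\<lambda>x. \<phi> 1 x \<oplus>\<^bsub>k\<^esub> \<phi> 2 x, c \<otimes> d)]"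
  have "\<exists>\<phi> w. sym_mult_algorithm k A {..<length ?L} \<phi> w"
  proof (rule algorithm_of_list)
    fix \<psi> w assume "(\<psi>, w) \<in> set ?L"
    then show "form \<psi> \<and> w \<in> carrier A"
      using F form_add[OF F(1,2)] form_add[OF F(1,3)] form_add[OF F(2,3)] bc by auto
  next
    fix u v assume uv: "u \<in> carrier A" "v \<in> carrier A"
    show "u \<otimes> v = list_sum (map (\<lambda>(\<phi>, w). (h (\<phi> u) \<otimes> h (\<phi> v)) \<otimes> w) ?L)"
      using prod[OF uv] karatsuba3[OF hc[OF uv(1)] hc[OF uv(2)] bc] hc[OF uv(1)] hc[OF uv(2)] bc
        fh[OF uv(1)] fh[OF uv(2)] by simp
  qed
  then show "\<exists>\<phi> w. sym_mult_algorithm k A {..<6::nat} \<phi> w" by (simp add: eval_nat_numeral)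
  assume n: "b \<otimes> c = \<zero>"
  let ?L = "[(\<phi> 0, b \<otimes> b \<ominus> b \<otimes> c \<ominus> b \<otimes> d), (\<phi> 1, c \<otimes> c \<ominus> b \<otimes> c \<ominus> c \<otimes> d), (\<phi> 2, d \<otimes> d \<ominus> b \<otimes> d \<ominus> c \<otimes> d),
      (\<lambda>x. \<phi> 0 x \<oplus>\<^bsub>k\<^esub> \<phi> 2 x, b \<otimes> d), (\<lambda>x. \<phi> 1 x \<oplus>\<^bsub>k\<^esub> \<phi> 2 x, c \<otimes> d)]"
  have "\<exists>\<phi> w. sym_mult_algorithm k A {..<length ?L} \<phi> w"
  proof (rule algorithm_of_list)
    fix \<psi> w assume "(\<psi>, w) \<in> set ?L"
    then show "form \<psi> \<and> w \<in> carrier A"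
      using F form_add[OF F(1,3)] form_add[OF F(2,3)] bc by auto
  next
    fix u v assume uv: "u \<in> carrier A" "v \<in> carrier A"
    show "u \<otimes> v = list_sum (map (\<lambda>(\<phi>, w). (h (\<phi> u) \<otimes> h (\<phi> v)) \<otimes> w) ?L)"
      using prod[OF uv] karatsuba3[OF hc[OF uv(1)] hc[OF uv(2)] bc] hc[OF uv(1)] hc[OF uv(2)] bc
        fh[OF uv(1)] fh[OF uv(2)] by (simp add: n)
  qed
  then show "\<exists>\<phi> w. sym_mult_algorithm k A {..<5::nat} \<phi> w" by (simp add: eval_nat_numeral)
qed

text \<open>Karatsuba applied twice: every element is U c + V with U and V in the span of b and 1,
  so 3 * 3 products suffice.\<close>

lemma algorithm_dim4:
  assumes ind: "independent K [b \<otimes> c, c, b, \<one>]" and sp: "Span K [b \<otimes> c, c, b, \<one>] = carrier A"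
    and bc: "b \<in> carrier A" "c \<in> carrier A"
  shows "\<exists>\<phi> w. sym_mult_algorithm k A {..<9::nat} \<phi> w"
proof -
  obtain \<phi> where f: "\<And>i. i < length [b \<otimes> c, c, b, \<one>] \<Longrightarrow> form (\<phi> i)"
    "\<And>x. x \<in> carrier A \<Longrightarrow> x = combine (map (\<lambda>i. h (\<phi> i x)) [0..<length [b \<otimes> c, c, b, \<one>]]) [b \<otimes> c, c, b, \<one>]"
    using base_coordinates[OF ind sp] by metis
  have F: "form (\<phi> 0)" "form (\<phi> 1)" "form (\<phi> 2)" "form (\<phi> 3)"
    using f(1)[of 0] f(1)[of 1] f(1)[of 2] f(1)[of 3] by simp_all
  have hc: "h (\<phi> 0 x) \<in> carrier A" "h (\<phi> 1 x) \<in> carrier A" "h (\<phi> 2 x) \<in> carrier A" "h (\<phi> 3 x) \<in> carrier A"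
    if "x \<in> carrier A" for x using that F form_closed h_closed by blast+
  define U where "U x = h (\<phi> 0 x) \<otimes> b \<oplus> h (\<phi> 1 x) \<otimes> \<one>" for x
  define V where "V x = h (\<phi> 2 x) \<otimes> b \<oplus> h (\<phi> 3 x) \<otimes> \<one>" for x
  have UV: "U x \<in> carrier A" "V x \<in> carrier A" if "x \<in> carrier A" for x
    using hc[OF that] bc by (simp_all add: U_def V_def)
  have x: "x = U x \<otimes> c \<oplus> V x \<otimes> \<one>" if "x \<in> carrier A" for x
  proof -
    have "x = h (\<phi> 0 x) \<otimes> (b \<otimes> c) \<oplus> (h (\<phi> 1 x) \<otimes> c \<oplus> (h (\<phi> 2 x) \<otimes> b \<oplus> h (\<phi> 3 x) \<otimes> \<one>))"
      using f(2)[OF that] hc[OF that] bc by (simp add: numeral_2_eq_2 numeral_3_eq_3)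
    also have "\<dots> = U x \<otimes> c \<oplus> V x \<otimes> \<one>"
      using hc[OF that] bc unfolding U_def V_def by algebra
    finally show ?thesis .
  qed
  define p where "p \<equiv> \<lambda>i x. \<phi> i x"
  define S where "S i j x = \<phi> i x \<oplus>\<^bsub>k\<^esub> \<phi> j x" for i j x
  have FS: "form (S i j)" if "i \<in> {0,1,2,3}" "j \<in> {0,1,2,3}" for i j
  proof -
    have "S i j = (\<lambda>x. \<phi> i x \<oplus>\<^bsub>k\<^esub> \<phi> j x)" by (intro ext) (simp add: S_def)
    moreover have "form (\<phi> i)" "form (\<phi> j)" using that F by auto
    ultimately show ?thesis using form_add by simp
  qed
  have hS: "h (S i j x) = h (\<phi> i x) \<oplus> h (\<phi> j x)" if "i \<in> {0,1,2,3}" "j \<in> {0,1,2,3}" "x \<in> carrier A" for i j x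
    using form_h_add[of "\<phi> i" "\<phi> j" x] that F by (auto simp: S_def)
  define T where "T x = S 0 2 x \<oplus>\<^bsub>k\<^esub> S 1 3 x" for x
  have FT: "form T" using form_add[OF FS[of 0 2] FS[of 1 3]] by (simp add: T_def[abs_def])
  have hT: "h (T x) = (h (\<phi> 0 x) \<oplus> h (\<phi> 2 x)) \<oplus> (h (\<phi> 1 x) \<oplus> h (\<phi> 3 x))" if "x \<in> carrier A" for x
    using form_h_add[OF FS FS that, of 0 2 1 3] hS[OF _ _ that] by (simp add: T_def)
  define w0 where "w0 = b \<otimes> b \<ominus> b \<otimes> \<one>"
  define w1 where "w1 = \<one> \<otimes> \<one> \<ominus> b \<otimes> \<one>"
  define w2 where "w2 = b \<otimes> \<one>"
  define v0 where "v0 = c \<otimes> c \<ominus> c \<otimes> \<one>"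
  define v1 where "v1 = \<one> \<otimes> \<one> \<ominus> c \<otimes> \<one>"
  define v2 where "v2 = c \<otimes> \<one>"
  have w: "w0 \<in> carrier A" "w1 \<in> carrier A" "w2 \<in> carrier A" "v0 \<in> carrier A" "v1 \<in> carrier A" "v2 \<in> carrier A"
    using bc by (simp_all add: w0_def w1_def w2_def v0_def v1_def v2_def)
  let ?L = "[(\<phi> 0, w0 \<otimes> v0), (\<phi> 1, w1 \<otimes> v0), (S 0 1, w2 \<otimes> v0), (\<phi> 2, w0 \<otimes> v1), (\<phi> 3, w1 \<otimes> v1), (S 2 3, w2 \<otimes> v1),
     (S 0 2, w0 \<otimes> v2), (S 1 3, w1 \<otimes> v2), (T, w2 \<otimes> v2)]"
  have "\<exists>\<phi> w. sym_mult_algorithm k A {..<length ?L} \<phi> w"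
  proof (rule algorithm_of_list)
    fix \<psi> w assume "(\<psi>, w) \<in> set ?L"
    then show "form \<psi> \<and> w \<in> carrier A" using F FS FT w by auto
  next
    fix u v assume uv: "u \<in> carrier A" "v \<in> carrier A"
    note hu = hc[OF uv(1)] and hv = hc[OF uv(2)]
    have "u \<otimes> v = (U u \<otimes> c \<oplus> V u \<otimes> \<one>) \<otimes> (U v \<otimes> c \<oplus> V v \<otimes> \<one>)" using x[OF uv(1)] x[OF uv(2)] by simp
    also have "\<dots> = (U u \<otimes> U v) \<otimes> v0 \<oplus> ((V u \<otimes> V v) \<otimes> v1 \<oplus> ((U u \<oplus> V u) \<otimes> (U v \<oplus> V v)) \<otimes> v2)"
      unfolding v0_def v1_def v2_def by (rule karatsuba) (use UV uv bc in auto)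
    also have "U u \<otimes> U v = (h (\<phi> 0 u) \<otimes> h (\<phi> 0 v)) \<otimes> w0 \<oplus> ((h (\<phi> 1 u) \<otimes> h (\<phi> 1 v)) \<otimes> w1
        \<oplus> (h (S 0 1 u) \<otimes> h (S 0 1 v)) \<otimes> w2)"
      using karatsuba[of "h (\<phi> 0 u)" "h (\<phi> 1 u)" "h (\<phi> 0 v)" "h (\<phi> 1 v)" b \<one>] hu hv bc hS[OF _ _ uv(1)] hS[OF _ _ uv(2)]
      by (simp only: U_def w0_def w1_def w2_def one_closed insertI1 insertI2)
    also have "V u \<otimes> V v = (h (\<phi> 2 u) \<otimes> h (\<phi> 2 v)) \<otimes> w0 \<oplus> ((h (\<phi> 3 u) \<otimes> h (\<phi> 3 v)) \<otimes> w1
        \<oplus> (h (S 2 3 u) \<otimes> h (S 2 3 v)) \<otimes> w2)"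
      using karatsuba[of "h (\<phi> 2 u)" "h (\<phi> 3 u)" "h (\<phi> 2 v)" "h (\<phi> 3 v)" b \<one>] hu hv bc hS[OF _ _ uv(1)] hS[OF _ _ uv(2)]
      by (simp only: V_def w0_def w1_def w2_def one_closed insertI1 insertI2)
    also have "U u \<oplus> V u = h (S 0 2 u) \<otimes> b \<oplus> h (S 1 3 u) \<otimes> \<one>"
    proof -
      have "U u \<oplus> V u = (h (\<phi> 0 u) \<oplus> h (\<phi> 2 u)) \<otimes> b \<oplus> (h (\<phi> 1 u) \<oplus> h (\<phi> 3 u)) \<otimes> \<one>"
        unfolding U_def V_def using hu bc by algebra
      then show ?thesis using hS[OF _ _ uv(1)] by simp
    qed
    also have "U v \<oplus> V v = h (S 0 2 v) \<otimes> b \<oplus> h (S 1 3 v) \<otimes> \<one>"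
    proof -
      have "U v \<oplus> V v = (h (\<phi> 0 v) \<oplus> h (\<phi> 2 v)) \<otimes> b \<oplus> (h (\<phi> 1 v) \<oplus> h (\<phi> 3 v)) \<otimes> \<one>"
        unfolding U_def V_def using hv bc by algebra
      then show ?thesis using hS[OF _ _ uv(2)] by simp
    qed
    also have "(h (S 0 2 u) \<otimes> b \<oplus> h (S 1 3 u) \<otimes> \<one>) \<otimes> (h (S 0 2 v) \<otimes> b \<oplus> h (S 1 3 v) \<otimes> \<one>) =
       (h (S 0 2 u) \<otimes> h (S 0 2 v)) \<otimes> w0 \<oplus> ((h (S 1 3 u) \<otimes> h (S 1 3 v)) \<otimes> w1 \<oplus> (h (T u) \<otimes> h (T v)) \<otimes> w2)"
      using karatsuba[of "h (S 0 2 u)" "h (S 1 3 u)" "h (S 0 2 v)" "h (S 1 3 v)" b \<one>] hu hv bc hS[OF _ _ uv(1)] hS[OF _ _ uv(2)] hT[OF uv(1)] hT[OF uv(2)]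
      by (simp add: w0_def w1_def w2_def)
    finally have *: "u \<otimes> v =
       ((h (\<phi> 0 u) \<otimes> h (\<phi> 0 v)) \<otimes> w0 \<oplus> ((h (\<phi> 1 u) \<otimes> h (\<phi> 1 v)) \<otimes> w1 \<oplus> (h (S 0 1 u) \<otimes> h (S 0 1 v)) \<otimes> w2)) \<otimes> v0 \<oplus>
       (((h (\<phi> 2 u) \<otimes> h (\<phi> 2 v)) \<otimes> w0 \<oplus> ((h (\<phi> 3 u) \<otimes> h (\<phi> 3 v)) \<otimes> w1 \<oplus> (h (S 2 3 u) \<otimes> h (S 2 3 v)) \<otimes> w2)) \<otimes> v1 \<oplus>
       ((h (S 0 2 u) \<otimes> h (S 0 2 v)) \<otimes> w0 \<oplus> ((h (S 1 3 u) \<otimes> h (S 1 3 v)) \<otimes> w1 \<oplus> (h (T u) \<otimes> h (T v)) \<otimes> w2)) \<otimes> v2)" .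
    have hcl: "h (\<psi> z) \<in> carrier A" if "form \<psi>" "z \<in> carrier A" for \<psi> z using that form_closed h_closed by blast
    have dist: "(a1 \<otimes> w0 \<oplus> (a2 \<otimes> w1 \<oplus> a3 \<otimes> w2)) \<otimes> r = a1 \<otimes> (w0 \<otimes> r) \<oplus> (a2 \<otimes> (w1 \<otimes> r) \<oplus> a3 \<otimes> (w2 \<otimes> r))"
      if "a1 \<in> carrier A" "a2 \<in> carrier A" "a3 \<in> carrier A" "r \<in> carrier A" for a1 a2 a3 r
      using that w by (simp add: l_distr m_assoc)
    have cl: "h (\<psi> u) \<otimes> h (\<psi> v) \<in> carrier A" if "form \<psi>" for \<psi> using hcl[OF that] uv by simp
    note fs = F FT FS[of 0 1, simplified] FS[of 2 3, simplified] FS[of 0 2, simplified] FS[of 1 3, simplified]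
    show "u \<otimes> v = list_sum (map (\<lambda>(\<phi>, w). (h (\<phi> u) \<otimes> h (\<phi> v)) \<otimes> w) ?L)"
      unfolding * using fs[THEN cl] w by (simp add: dist a_assoc)
  qed
  then show ?thesis by (simp add: eval_nat_numeral)
qed

end

section \<open>Bases adapted to fields and to nilpotent algebras\<close>

context scalar_algebra
begin

lemma exists_base_of_card:
  assumes "card (carrier A) = 3 ^ n"
  obtains Vs where "independent K Vs" "length Vs = n" "Span K Vs = carrier A"
proof -
  have fin: "finite (carrier A)" using assms card.infinite by fastforce
  obtain m where m: "dimension m K (carrier A)"
    using exists_dimension[OF K_facts(2) add.subgroup_self fin] K_facts(5) by auto
  then have "(3::nat) ^ m = 3 ^ n" using card_of_dimension[OF K_facts(2,4) m] K_facts(3) assms by simp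
  then have "m = n" by (subst (asm) power_inject_exp) auto
  then show ?thesis using exists_base[OF K_facts(2) m] that by blast
qed

lemma K_closed: "c \<in> K \<Longrightarrow> c \<in> carrier A" using K_facts(5) by blast

lemma Span_one: "Span K [\<one>] = K"
proof -
  have "k \<otimes> \<one> \<oplus> \<zero> = k" if "k \<in> K" for k using K_closed[OF that] by simp
  then show ?thesis by (auto simp: line_extension_mem_iff)
qed

lemma independent_one: "independent K [\<one>]"
  by (rule li_Cons) (simp_all add: one_neq_zero)

lemma Span_mem: "x \<in> Span K (u # Us) \<longleftrightarrow> (\<exists>k\<in>K. \<exists>v\<in>Span K Us. x = k \<otimes> u \<oplus> v)"
  by (simp add: line_extension_mem_iff)

text \<open>In degrees 2 and 3 any basis serves. In degree 4 a basis of products is wanted, so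
  \<open>b\<close> is taken outside \<open>K\<close> and \<open>c\<close> outside a set too small to
  cover the field.\<close>

lemma field_algorithm:
  assumes A: "Ring.field A"
  shows "card (carrier A) = 3 ^ 2 \<Longrightarrow> \<exists>\<phi> w. sym_mult_algorithm k A {..<3::nat} \<phi> w"
    "card (carrier A) = 3 ^ 3 \<Longrightarrow> \<exists>\<phi> w. sym_mult_algorithm k A {..<6::nat} \<phi> w"
    "card (carrier A) = 3 ^ 4 \<Longrightarrow> \<exists>\<phi> w. sym_mult_algorithm k A {..<9::nat} \<phi> w"
proof -
  interpret F: Ring.field A by (rule A)
  {
    assume "card (carrier A) = 3 ^ 2"
    then obtain Vs where Vs: "independent K Vs" "length Vs = 2" "Span K Vs = carrier A" by (rule exists_base_of_card)
    then obtain b c where "Vs = [b, c]" by (auto simp: length_Suc_conv numeral_2_eq_2)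
    then show "\<exists>\<phi> w. sym_mult_algorithm k A {..<3::nat} \<phi> w" using algorithm_dim2 Vs by blast
  }
  {
    assume "card (carrier A) = 3 ^ 3"
    then obtain Vs where Vs: "independent K Vs" "length Vs = 3" "Span K Vs = carrier A" by (rule exists_base_of_card)
    then obtain b c d where "Vs = [b, c, d]" by (auto simp: length_Suc_conv numeral_3_eq_3)
    then show "\<exists>\<phi> w. sym_mult_algorithm k A {..<6::nat} \<phi> w" using algorithm_dim3(1) Vs by blast
  }
  assume card: "card (carrier A) = 3 ^ 4"
  have fin: "finite (carrier A)" using card card.infinite by fastforce
  have "\<not> carrier A \<subseteq> K" using card_mono[OF K_facts(4), of "carrier A"] K_facts(3) card by auto
  then obtain b where b: "b \<in> carrier A" "b \<notin> K" by blast
  have ind2: "independent K [b, \<one>]" using b Span_one independent_one by (intro li_Cons) auto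
  define S where "S = Span K [b, \<one>]"
  have cS: "card S = 9" "finite S" "S \<subseteq> carrier A"
  proof -
    have "dimension (length [b, \<one>]) K S" unfolding S_def by (rule dimension_independent[OF ind2])
    then show "card S = 9" "finite S" "S \<subseteq> carrier A"
      using card_of_dimension[OF K_facts(2,4)] K_facts(3) space_subgroup_props(1)[OF K_facts(2)] by fastforce+
  qed
  \<comment> \<open>Outside \<open>B\<close>, the element \<open>b \<otimes> c\<close> is not in the span of \<open>c\<close>, \<open>b\<close>, \<open>\<one>\<close>.\<close>
  define B where "B = S \<union> (\<Union>e\<in>K. (\<lambda>v. inv (b \<ominus> e) \<otimes> v) ` S)"
  have "card (\<Union>e\<in>K. (\<lambda>v. inv (b \<ominus> e) \<otimes> v) ` S) \<le> (\<Sum>e\<in>K. card ((\<lambda>v. inv (b \<ominus> e) \<otimes> v) ` S))"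
    by (rule card_UN_le[OF K_facts(4)])
  also have "\<dots> \<le> (\<Sum>e\<in>K. 9)" by (intro sum_mono order.trans[OF card_image_le[OF cS(2)]]) (simp add: cS(1))
  finally have "card (\<Union>e\<in>K. (\<lambda>v. inv (b \<ominus> e) \<otimes> v) ` S) \<le> 27" using K_facts(3) by simp
  \<comment> \<open>9 + 3 * 9 = 36 elements are excluded, out of 81.\<close>
  then have "card B \<le> 36"
    using card_Un_le[of S "\<Union>e\<in>K. (\<lambda>v. inv (b \<ominus> e) \<otimes> v) ` S"] cS(1) unfolding B_def by linarith
  moreover have "finite B" unfolding B_def using cS(2) K_facts(4) by blast
  ultimately have "\<not> carrier A \<subseteq> B" using card_mono[of B "carrier A"] card by auto
  then obtain c where c: "c \<in> carrier A" "c \<notin> B" by blast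
  have "c \<notin> Span K [b, \<one>]" using c by (simp only: B_def S_def) blast
  then have ind3: "independent K [c, b, \<one>]" by (rule li_Cons[OF c(1) _ ind2])
  have "b \<otimes> c \<notin> Span K [c, b, \<one>]"
  proof
    assume "b \<otimes> c \<in> Span K [c, b, \<one>]"
    then obtain e v where ev: "e \<in> K" "v \<in> S" "b \<otimes> c = e \<otimes> c \<oplus> v" unfolding Span_mem[of _ c] S_def by blast
    have cl: "e \<in> carrier A" "v \<in> carrier A" using ev K_closed cS by auto
    have "b \<ominus> e \<noteq> \<zero>" using b ev cl by auto
    then have u: "b \<ominus> e \<in> Units A" using b cl F.field_Units by simp
    have "(b \<ominus> e) \<otimes> c = b \<otimes> c \<ominus> e \<otimes> c" using b c cl by algebra
    also have "\<dots> = v" unfolding ev(3) using c cl by algebra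
    finally have "inv (b \<ominus> e) \<otimes> v = c" using u c b cl by (metis Units_closed Units_inv_closed Units_l_inv l_one m_assoc)
    then have "c \<in> B" unfolding B_def using ev by blast
    then show False using c by blast
  qed
  then have ind4: "independent K [b \<otimes> c, c, b, \<one>]" by (rule li_Cons[OF _ _ ind3, rotated]) (use b c in simp)
  obtain Vs where Vs: "independent K Vs" "length Vs = 4" "Span K Vs = carrier A" using card by (rule exists_base_of_card)
  then have dim: "dimension 4 K (carrier A)" using dimensionI[OF K_facts(2) Vs(1,3)] by simp
  have "Span K [b \<otimes> c, c, b, \<one>] = carrier A"
    using independent_length_eq_dimension[OF K_facts(2) dim ind4] b c by simp
  then show "\<exists>\<phi> w. sym_mult_algorithm k A {..<9::nat} \<phi> w" using algorithm_dim4[OF ind4] b c by blast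
qed

text \<open>The basis t^2, t, 1 has t^2 t = 0, which triggers the five-term case of
  \<open>algorithm_dim3\<close>. The hypothesis \<open>step\<close>, applied three times, expands
  every element in powers of \<open>t\<close>.\<close>

lemma nilpotent_algorithm:
  assumes t: "t \<in> carrier A" "t \<otimes> (t \<otimes> t) = \<zero>" "t \<otimes> t \<noteq> \<zero>"
    and step: "\<And>x. x \<in> carrier A \<Longrightarrow> \<exists>y\<in>carrier A. \<exists>c\<in>K. x = t \<otimes> y \<oplus> c"
  shows "\<exists>\<phi> w. sym_mult_algorithm k A {..<5::nat} \<phi> w"
proof -
  have t2: "(t \<otimes> t) \<otimes> t = \<zero>" "(t \<otimes> t) \<otimes> (t \<otimes> t) = \<zero>" using t by (simp_all add: m_assoc)
  \<comment> \<open>A nonzero scalar is invertible, so it cannot kill t^2.\<close>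
  have unit: "c = \<zero>" if c: "c \<in> K" "c \<otimes> (t \<otimes> t) = \<zero>" for c
  proof (rule ccontr)
    assume "c \<noteq> \<zero>"
    then have "c \<in> Units (A\<lparr>carrier := K\<rparr>)" using subfield.subfield_Units[OF K_facts(2)] c by simp
    then obtain d where d: "d \<in> K" "d \<otimes> c = \<one>" by (auto simp: Units_def)
    have "d \<otimes> (c \<otimes> (t \<otimes> t)) = t \<otimes> t"
      using d c(1) K_closed t by (simp add: m_assoc[symmetric])
    then show False using c(2) t K_closed[OF d(1)] by simp
  qed
  have "t \<notin> Span K [\<one>]"
  proof
    assume "t \<in> Span K [\<one>]"
    then have "t \<in> K" unfolding Span_one .
    then have "t = \<zero>" using unit t by blast
    then show False using t by simp
  qed
  then have ind2: "independent K [t, \<one>]" by (rule li_Cons[OF t(1) _ independent_one])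
  have "t \<otimes> t \<notin> Span K [t, \<one>]"
  proof
    assume "t \<otimes> t \<in> Span K [t, \<one>]"
    then obtain b a where ba: "b \<in> K" "a \<in> K" "t \<otimes> t = b \<otimes> t \<oplus> a" unfolding Span_mem[of _ t] Span_one by blast
    note cl = K_closed[OF ba(1)] K_closed[OF ba(2)] t(1)
    have "(t \<otimes> t) \<otimes> (t \<otimes> t) = b \<otimes> (t \<otimes> (t \<otimes> t)) \<oplus> a \<otimes> (t \<otimes> t)"
      by (subst ba(3)) (use cl in \<open>simp add: l_distr m_assoc\<close>)
    then have "a \<otimes> (t \<otimes> t) = \<zero>" using t2 t cl by simp
    then have a: "a = \<zero>" by (rule unit[OF ba(2)])
    then have "t \<otimes> t = b \<otimes> t" using ba(3) cl by simp
    then have "(t \<otimes> t) \<otimes> t = b \<otimes> (t \<otimes> t)" using cl by (simp add: m_assoc)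
    then have "b = \<zero>" using unit[OF ba(1)] t2 by simp
    then show False using \<open>t \<otimes> t = b \<otimes> t\<close> t by simp
  qed
  then have ind3: "independent K [t \<otimes> t, t, \<one>]" by (rule li_Cons[OF _ _ ind2, rotated]) (use t in simp)
  have "x \<in> Span K [t \<otimes> t, t, \<one>]" if x: "x \<in> carrier A" for x
  proof -
    obtain y c where 1: "y \<in> carrier A" "c \<in> K" "x = t \<otimes> y \<oplus> c" using step[OF x] by blast
    obtain z b where 2: "z \<in> carrier A" "b \<in> K" "y = t \<otimes> z \<oplus> b" using step[OF 1(1)] by blast
    obtain v a where 3: "v \<in> carrier A" "a \<in> K" "z = t \<otimes> v \<oplus> a" using step[OF 2(1)] by blast
    note cl = 3(1) t(1) K_closed[OF 1(2)] K_closed[OF 2(2)] K_closed[OF 3(2)]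
    have "x = (t \<otimes> (t \<otimes> t)) \<otimes> v \<oplus> (a \<otimes> (t \<otimes> t) \<oplus> (b \<otimes> t \<oplus> c))"
      unfolding 1(3) 2(3) 3(3) using cl by algebra
    then have "x = a \<otimes> (t \<otimes> t) \<oplus> (b \<otimes> t \<oplus> c)" unfolding t(2) using cl by simp
    moreover have "b \<otimes> t \<oplus> c \<in> Span K [t, \<one>]" unfolding Span_mem[of _ t] Span_one using 1(2) 2(2) by blast
    ultimately show ?thesis unfolding Span_mem[of _ "t \<otimes> t"] using 3(2) by blast
  qed
  moreover have "Span K [t \<otimes> t, t, \<one>] \<subseteq> carrier A"
    using Span_in_carrier[OF K_facts(5), of "[t \<otimes> t, t, \<one>]"] t by simp
  ultimately have "Span K [t \<otimes> t, t, \<one>] = carrier A" by blast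
  then show ?thesis using algorithm_dim3(2)[OF ind3] t2 by blast
qed

end

section \<open>Finite fields of characteristic three\<close>

lemma CHAR_f3: "CHAR(f3) = 3"
proof (rule CHAR_eq_posI)
  fix n :: nat assume "0 < n" "n < 3"
  then consider "n = 1" | "n = 2" by linarith
  then show "of_nat n \<noteq> (0::f3)" by cases (simp_all add: f3_two)
qed simp_all

text \<open>X^N - X splits in the algebraic closure and has derivative -1, so its \<open>N\<close>
  roots are distinct.\<close>

lemma card_roots_frobenius:
  assumes n: "n \<ge> 1" and N_def: "N = 3 ^ n"
  shows "card {x :: f3 alg_closure. x ^ N = x} = N" "finite {x :: f3 alg_closure. x ^ N = x}"
proof -
  define p :: "f3 alg_closure poly" where "p = monom 1 N - [:0, 1:]"
  have N: "N > 1" using one_less_power[of "3::nat" n] n by (simp add: N_def)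
  have char: "CHAR(f3 alg_closure) = 3" by (simp add: CHAR_f3)
  have N0: "(of_nat N :: f3 alg_closure) = 0"
    unfolding of_nat_eq_0_iff_char_dvd char using n by (simp add: N_def)
  have degp: "degree p = N" "lead_coeff p = 1"
  proof -
    have "degree [:0, 1 :: f3 alg_closure:] < degree (monom (1 :: f3 alg_closure) N)" using N by (simp add: degree_monom_eq)
    then have d: "degree p = degree (monom (1 :: f3 alg_closure) N)"
      unfolding p_def diff_conv_add_uminus by (intro degree_add_eq_left) simp
    then show "degree p = N" by (simp add: degree_monom_eq)
    then show "lead_coeff p = 1" using N by (simp add: p_def coeff_pCons split: nat.split)
  qed
  have p0: "p \<noteq> 0" using degp N by auto
  obtain A where A: "size A = degree p" "p = smult (lead_coeff p) (\<Prod>x\<in>#A. [:-x, 1:])"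
    using alg_closed_imp_factorization[OF p0] by blast
  have pA: "p = (\<Prod>x\<in>#A. [:-x, 1:])" using A(2) degp by simp
  have roots: "{x. x ^ N = x} = set_mset A"
  proof -
    have "poly p x = 0 \<longleftrightarrow> x \<in># A" for x
      unfolding pA poly_prod_mset by (auto simp: prod_mset_zero_iff image_iff)
    moreover have "poly p x = 0 \<longleftrightarrow> x ^ N = x" for x by (simp add: p_def poly_monom)
    ultimately show ?thesis by auto
  qed
  have "count A x \<le> 1" for x
  proof (rule ccontr)
    assume "\<not> count A x \<le> 1"
    then have "{#x, x#} \<subseteq># A" by (auto simp: subseteq_mset_def)
    then obtain B where B: "A = {#x, x#} + B" by (metis subset_mset.add_diff_inverse)
    define q where "q = [:-x, 1:] * (\<Prod>x\<in>#B. [:-x, 1:])"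
    have q: "p = [:-x, 1:] * q" unfolding pA B q_def by (simp add: mult.assoc)
    have "poly (pderiv p) x = 0" unfolding q pderiv_mult by (simp add: q_def)
    moreover have "pderiv p = - 1"
      unfolding p_def pderiv_diff pderiv_monom using N0 by (simp add: pderiv_pCons one_pCons)
    ultimately show False by simp
  qed
  then have "count A x = 1" if "x \<in># A" for x
    using that by (meson count_greater_eq_one_iff le_antisym)
  then have "size A = card (set_mset A)"
    by (simp add: size_multiset_overloaded_eq)
  then show "card {x :: f3 alg_closure. x ^ N = x} = N" "finite {x :: f3 alg_closure. x ^ N = x}"
    unfolding roots using A(1) degp by simp_all
qed

text \<open>\<open>GF\<close> is a choice among records on natural numbers, so a witness has to be
  supplied: the fixed field of x to x^(3^n) in the algebraic closure, encoded in the
  naturals.\<close>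

lemma GF_exists:
  assumes n: "n \<ge> 1" shows "Ring.field (GF 3 n) \<and> card (carrier (GF 3 n)) = 3 ^ n"
proof -
  define T where "T = {x :: f3 alg_closure. x ^ (3 ^ n) = x}"
  have T: "card T = 3 ^ n" "finite T" unfolding T_def using card_roots_frobenius[OF n refl] by simp_all
  obtain e :: "f3 alg_closure \<Rightarrow> nat" where e: "inj_on e T" using finite_imp_inj_to_nat_seg[OF T(2)] by blast
  have char: "CHAR(f3 alg_closure) = 3" by (simp add: CHAR_f3)
  have add: "(x + y) ^ (3 ^ n) = x ^ (3 ^ n) + y ^ (3 ^ n)" for x y :: "f3 alg_closure"
    using freshmans_dream'[of "3 ^ n" n x y] char by simp
  have minus: "(- x) ^ (3 ^ n) = - (x ^ (3 ^ n))" for x :: "f3 alg_closure" by (rule power_minus_odd) simp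
  have "Ring.field (copy_field e T)"
    by (rule copy_field_field[OF e])
      (auto simp: T_def add minus power_mult_distrib power_inverse)
  moreover have "card (carrier (copy_field e T)) = 3 ^ n" using T e by (simp add: copy_field_def card_image)
  ultimately have "Ring.field (copy_field e T) \<and> card (carrier (copy_field e T)) = 3 ^ n" ..
  then show ?thesis unfolding GF_def by (rule someI)
qed

text \<open>The order 3^n of the additive group kills 1, and 3^n times 1 is the n-th power of 1 + 1
  + 1 in a field.\<close>

lemma (in field) char_three:
  assumes card: "card (carrier R) = 3 ^ n" shows "\<one> \<oplus> \<one> \<oplus> \<one> = \<zero>"
proof -
  let ?s = "\<one> \<oplus> \<one> \<oplus> \<one>"
  have fin: "finite (carrier R)" using card card.infinite by fastforce
  have "[(3 ^ m :: nat)] \<cdot> \<one> = ?s [^] m" for m :: nat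
  proof (induction m)
    case (Suc m)
    have "[(3 ^ Suc m :: nat)] \<cdot> \<one> = [(3::nat)] \<cdot> ([(3 ^ m :: nat)] \<cdot> \<one>)"
      by (subst add.nat_pow_pow) (simp_all add: mult.commute)
    also have "\<dots> = (?s [^] m \<oplus> ?s [^] m) \<oplus> ?s [^] m" unfolding Suc by (simp add: numeral_3_eq_3)
    also have "\<dots> = ?s [^] m \<otimes> ?s" by (simp add: r_distr)
    finally show ?case by simp
  qed simp
  moreover have "[(3 ^ n :: nat)] \<cdot> \<one> = \<zero>"
    using add.pow_order_eq_1[of \<one>] card by (simp add: Coset.order_def)
  ultimately have "?s [^] n = \<zero>" by simp
  then show ?thesis
  proof (rule contrapos_pp)
    assume "?s \<noteq> \<zero>"
    have "?s [^] m \<noteq> \<zero>" for m :: nat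
    proof (induction m)
      case (Suc m) then show ?case using \<open>?s \<noteq> \<zero>\<close> integral by fastforce
    qed simp
    then show "?s [^] n \<noteq> \<zero>" .
  qed
qed

text \<open>The fixed points of cubing are the roots of x (x - 1) (x + 1).\<close>

lemma (in field) prime_field:
  assumes three: "\<one> \<oplus> \<one> \<oplus> \<one> = \<zero>"
  shows "{x \<in> carrier R. x [^] (3::nat) = x} = {\<zero>, \<one>, \<ominus> \<one>}" "subfield {\<zero>, \<one>, \<ominus> \<one>} R" "card {\<zero>, \<one>, \<ominus> \<one>} = 3"
proof -
  have two: "\<one> \<oplus> \<one> = \<ominus> \<one>" using three by (metis add.m_closed minus_equality one_closed)
  have ne: "\<one> \<noteq> \<ominus> \<one>"
  proof
    assume "\<one> = \<ominus> \<one>"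
    then have "\<one> \<oplus> \<one> = \<one>" using two by simp
    then show False using one_not_zero by (metis add.l_cancel_one' one_closed)
  qed
  have nz: "\<ominus> \<one> \<noteq> \<zero>" using one_not_zero by (metis minus_minus minus_zero one_closed)
  show "card {\<zero>, \<one>, \<ominus> \<one>} = 3" using ne nz one_not_zero nz[symmetric] one_not_zero[symmetric] by (simp add: card_insert_if del: add.inv_eq_1_iff)
  have mm: "\<ominus> \<one> \<otimes> \<ominus> \<one> = \<one>" by (simp add: l_minus r_minus)
  have mp: "\<ominus> \<one> \<oplus> \<ominus> \<one> = \<one>" by (metis two minus_add minus_minus one_closed)
  show "{x \<in> carrier R. x [^] (3::nat) = x} = {\<zero>, \<one>, \<ominus> \<one>}"
  proof (intro equalityI subsetI)
    fix x assume "x \<in> {x \<in> carrier R. x [^] (3::nat) = x}"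
    then have xc: "x \<in> carrier R" and x3: "x [^] (3::nat) = x" by simp_all
    have x: "x \<in> carrier R" "x \<otimes> x \<otimes> x = x" using xc x3 by (simp_all add: numeral_3_eq_3)
    have "x \<otimes> ((x \<ominus> \<one>) \<otimes> (x \<oplus> \<one>)) = x \<otimes> x \<otimes> x \<ominus> x" using x(1) by algebra
    also have "\<dots> = \<zero>" using x by (simp add: minus_eq r_neg)
    finally have "x = \<zero> \<or> x \<ominus> \<one> = \<zero> \<or> x \<oplus> \<one> = \<zero>" using x(1) integral_iff by simp
    then show "x \<in> {\<zero>, \<one>, \<ominus> \<one>}" using x(1) minus_equality by auto
  qed (auto simp: numeral_3_eq_3 mm)
  show "subfield {\<zero>, \<one>, \<ominus> \<one>} R"
  proof (rule subfieldI')
    show "subring {\<zero>, \<one>, \<ominus> \<one>} R"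
      by (rule subringI) (auto simp: mm two mp l_neg r_neg)
    fix k assume "k \<in> {\<zero>, \<one>, \<ominus> \<one>} - {\<zero>}"
    then have "k = \<one> \<or> k = \<ominus> \<one>" by auto
    then show "inv k \<in> {\<zero>, \<one>, \<ominus> \<one>}"
      using mm comm_inv_char[of "\<ominus> \<one>" "\<ominus> \<one>"] by auto
  qed
qed

section \<open>Truncated polynomial algebras\<close>

context
  fixes n l :: nat
  assumes n: "n \<ge> 1" and l: "l \<ge> 1"
begin

interpretation L: Ring.field "GF 3 n" using GF_exists[OF n] by blast

lemma base_field_facts: "base_field 3 n = (GF 3 n)\<lparr>carrier := {\<zero>\<^bsub>GF 3 n\<^esub>, \<one>\<^bsub>GF 3 n\<^esub>, \<ominus>\<^bsub>GF 3 n\<^esub> \<one>\<^bsub>GF 3 n\<^esub>}\<rparr>"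
  "Ring.field (base_field 3 n)" "card (carrier (base_field 3 n)) = 3" "carrier (base_field 3 n) \<subseteq> carrier (GF 3 n)"
proof -
  note pf = L.prime_field[OF L.char_three[of n]]
  have c: "card (carrier (GF 3 n)) = 3 ^ n" using GF_exists[OF n] by blast
  show b: "base_field 3 n = (GF 3 n)\<lparr>carrier := {\<zero>\<^bsub>GF 3 n\<^esub>, \<one>\<^bsub>GF 3 n\<^esub>, \<ominus>\<^bsub>GF 3 n\<^esub> \<one>\<^bsub>GF 3 n\<^esub>}\<rparr>"
    unfolding base_field_def pf(1)[OF c] ..
  show "Ring.field (base_field 3 n)" unfolding b by (rule L.subfield_iff(2)[OF pf(2)[OF c]])
  show "card (carrier (base_field 3 n)) = 3" unfolding b using pf(3)[OF c] by simp
  show "carrier (base_field 3 n) \<subseteq> carrier (GF 3 n)" unfolding b by auto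
qed

abbreviation "PR \<equiv> poly_ring (GF 3 n)"
abbreviation "XX \<equiv> X\<^bsub>GF 3 n\<^esub>"
abbreviation "TA \<equiv> trunc_algebra 3 n l"

interpretation R: cring PR by (rule L.univ_poly_is_cring[OF L.carrier_is_subring])

lemma XX: "XX \<in> carrier PR" by (rule L.var_closed(1)[OF L.carrier_is_subring])

definition J where "J = trunc_ideal 3 n l"

lemma J: "ideal J PR" unfolding J_def trunc_ideal_def by (rule R.cgenideal_ideal) (rule R.nat_pow_closed[OF XX])

lemma J_mem: "p \<in> J \<longleftrightarrow> (\<exists>q\<in>carrier PR. p = q \<otimes>\<^bsub>PR\<^esub> (XX [^]\<^bsub>PR\<^esub> l))"
  unfolding J_def trunc_ideal_def cgenideal_def by auto

definition co where "co p = J +>\<^bsub>PR\<^esub> p"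

lemma TA_def': "TA = algebra_via (PR Quot J) (\<lambda>c. co (ring.poly_of_const (GF 3 n) c))"
  by (simp add: trunc_algebra_def J_def co_def)

lemma cring_TA: "cring TA" unfolding TA_def' by (rule cring_algebra_via[OF ideal.quotient_is_cring[OF J R.cring_axioms]])

lemma co_hom: "co \<in> ring_hom PR TA"
proof -
  have "(+>\<^bsub>PR\<^esub>) J \<in> ring_hom PR (PR Quot J)" by (rule ideal.rcos_ring_hom[OF J])
  then show ?thesis unfolding TA_def' ring_hom_def co_def by (simp add: algebra_via_def)
qed

lemma carrier_TA: "carrier TA = co ` carrier PR"
  unfolding TA_def' by (auto simp: algebra_via_def FactRing_def A_RCOSETS_def' co_def)

lemma co_zero: "p \<in> carrier PR \<Longrightarrow> co p = \<zero>\<^bsub>TA\<^esub> \<longleftrightarrow> p \<in> J"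
proof -
  assume p: "p \<in> carrier PR"
  have z: "\<zero>\<^bsub>TA\<^esub> = J" by (simp add: TA_def' algebra_via_def FactRing_def)
  show "co p = \<zero>\<^bsub>TA\<^esub> \<longleftrightarrow> p \<in> J"
    unfolding z co_def using ideal.Icarr[OF J] abelian_subgroup.a_rcos_self[of J PR p] p
      ideal.rcos_const_imp_mem[OF J p] abelian_subgroup.a_rcos_const[OF abelian_subgroupI3, of J PR p]
    by (metis J R.abelian_group_axioms additive_subgroup.a_subgroup ideal.axioms(1) abelian_subgroupI3)
qed

definition cst where "cst c = ring.poly_of_const (GF 3 n) c"
definition hh where "hh c = co (cst c)"

lemma cst_hom: "cst \<in> ring_hom (GF 3 n) PR"
  using L.canonical_embedding_is_hom[OF L.carrier_is_subring] by (simp add: cst_def[abs_def])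

lemma hh_hom: "hh \<in> ring_hom (GF 3 n) TA"
  using ring_hom_trans[OF cst_hom co_hom] by (simp add: hh_def[abs_def] comp_def)

lemma eval0: "(\<lambda>p. ring.eval (GF 3 n) p \<zero>\<^bsub>GF 3 n\<^esub>) \<in> ring_hom PR (GF 3 n)"
  using L.eval_is_hom[OF L.carrier_is_subring, of "\<zero>\<^bsub>GF 3 n\<^esub>"] by simp

text \<open>Evaluation at 0 kills the left side but not 1.\<close>

lemma X_mult_neq_one: "q \<in> carrier PR \<Longrightarrow> q \<otimes>\<^bsub>PR\<^esub> XX \<noteq> \<one>\<^bsub>PR\<^esub>"
proof
  assume q: "q \<in> carrier PR" and eq: "q \<otimes>\<^bsub>PR\<^esub> XX = \<one>\<^bsub>PR\<^esub>"
  have "ring.eval (GF 3 n) XX \<zero>\<^bsub>GF 3 n\<^esub> = \<zero>\<^bsub>GF 3 n\<^esub>" by (simp add: var_def)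
  moreover have "ring.eval (GF 3 n) q \<zero>\<^bsub>GF 3 n\<^esub> \<in> carrier (GF 3 n)" using ring_hom_closed[OF eval0 q] .
  ultimately have "ring.eval (GF 3 n) (q \<otimes>\<^bsub>PR\<^esub> XX) \<zero>\<^bsub>GF 3 n\<^esub> = \<zero>\<^bsub>GF 3 n\<^esub>"
    using ring_hom_mult[OF eval0 q XX] by simp
  then show False using eq ring_hom_one[OF eval0] by simp
qed

lemma XX_nonzero: "XX \<noteq> \<zero>\<^bsub>PR\<^esub>"
  by (simp add: var_def univ_poly_zero)

lemma X_pow_not_mem: assumes "m < l" shows "XX [^]\<^bsub>PR\<^esub> m \<notin> J"
proof
  interpret D: domain PR by (rule L.univ_poly_is_domain[OF L.carrier_is_subring])
  assume "XX [^]\<^bsub>PR\<^esub> m \<in> J"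
  then obtain q where q: "q \<in> carrier PR" "XX [^]\<^bsub>PR\<^esub> m = q \<otimes>\<^bsub>PR\<^esub> (XX [^]\<^bsub>PR\<^esub> l)" using J_mem by blast
  have pw: "XX [^]\<^bsub>PR\<^esub> j \<in> carrier PR" for j :: nat using XX by simp
  have nz: "XX [^]\<^bsub>PR\<^esub> m \<noteq> \<zero>\<^bsub>PR\<^esub>" for m :: nat
  proof (induction m)
    case (Suc m) then show ?case using XX XX_nonzero pw[of m] D.integral[of "XX [^]\<^bsub>PR\<^esub> m" XX] by auto
  qed simp
  have "XX [^]\<^bsub>PR\<^esub> l = (XX [^]\<^bsub>PR\<^esub> (l - m - 1) \<otimes>\<^bsub>PR\<^esub> XX) \<otimes>\<^bsub>PR\<^esub> (XX [^]\<^bsub>PR\<^esub> m)"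
  proof -
    have "l = Suc (l - m - 1) + m" using assms by simp
    then have "XX [^]\<^bsub>PR\<^esub> l = XX [^]\<^bsub>PR\<^esub> Suc (l - m - 1) \<otimes>\<^bsub>PR\<^esub> XX [^]\<^bsub>PR\<^esub> m" using R.nat_pow_mult[OF XX] by metis
    then show ?thesis by simp
  qed
  then have "\<one>\<^bsub>PR\<^esub> \<otimes>\<^bsub>PR\<^esub> (XX [^]\<^bsub>PR\<^esub> m) = ((q \<otimes>\<^bsub>PR\<^esub> XX [^]\<^bsub>PR\<^esub> (l - m - 1)) \<otimes>\<^bsub>PR\<^esub> XX) \<otimes>\<^bsub>PR\<^esub> (XX [^]\<^bsub>PR\<^esub> m)"
    using q pw XX by (simp add: R.m_assoc)
  then have "\<one>\<^bsub>PR\<^esub> = (q \<otimes>\<^bsub>PR\<^esub> XX [^]\<^bsub>PR\<^esub> (l - m - 1)) \<otimes>\<^bsub>PR\<^esub> XX"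
    using D.m_rcancel[OF nz[of m] pw[of m], of "\<one>\<^bsub>PR\<^esub>" "(q \<otimes>\<^bsub>PR\<^esub> XX [^]\<^bsub>PR\<^esub> (l - m - 1)) \<otimes>\<^bsub>PR\<^esub> XX"] q(1) pw XX by simp
  then show False using X_mult_neq_one q pw by (metis R.m_closed)
qed

lemma one_neq_zero_TA: "\<one>\<^bsub>TA\<^esub> \<noteq> \<zero>\<^bsub>TA\<^esub>"
  using X_pow_not_mem[of 0] l co_zero[of "\<one>\<^bsub>PR\<^esub>"] ring_hom_one[OF co_hom] by simp

text \<open>Division with remainder by X, whose degree forces a constant remainder.\<close>

lemma poly_decomp:
  assumes p: "p \<in> carrier PR"
  obtains q c where "q \<in> carrier PR" "c \<in> carrier (GF 3 n)" "p = (XX \<otimes>\<^bsub>PR\<^esub> q) \<oplus>\<^bsub>PR\<^esub> cst c"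
proof -
  obtain q r where qr: "q \<in> carrier PR" "r \<in> carrier PR" "p = (XX \<otimes>\<^bsub>PR\<^esub> q) \<oplus>\<^bsub>PR\<^esub> r"
    "r = \<zero>\<^bsub>PR\<^esub> \<or> length r - 1 < length XX - 1"
    using L.field_long_division_theorem_shell[OF L.carrier_is_subfield p XX XX_nonzero] by blast
  have "length XX - 1 = 1" by (simp add: var_def)
  then have "length r - 1 = 0" using qr(4) by (auto simp: univ_poly_zero)
  then have "r \<in> cst ` carrier (GF 3 n)"
    using L.poly_of_const_over_carrier qr(2) by (simp add: cst_def[abs_def])
  then show ?thesis using that qr by blast
qed

lemma scalar_algebra_TA: "scalar_algebra (base_field 3 n) TA hh"
proof (intro scalar_algebra.intro scalar_algebra_axioms.intro)
  show "cring TA" by (rule cring_TA)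
  show "hh \<in> ring_hom (base_field 3 n) TA"
  proof -
    have ops: "monoid.mult (base_field 3 n) = monoid.mult (GF 3 n)" "add (base_field 3 n) = add (GF 3 n)" "\<one>\<^bsub>base_field 3 n\<^esub> = \<one>\<^bsub>GF 3 n\<^esub>"
      by (simp_all add: base_field_def)
    show ?thesis
      using ring_hom_closed[OF hh_hom] ring_hom_mult[OF hh_hom] ring_hom_add[OF hh_hom] ring_hom_one[OF hh_hom]
        subsetD[OF base_field_facts(4)]
      by (intro ring_hom_memI) (simp_all add: ops)
  qed
  show "r \<odot>\<^bsub>TA\<^esub> x = hh r \<otimes>\<^bsub>TA\<^esub> x" for r x by (simp add: TA_def' algebra_via_def hh_def cst_def)
qed (use base_field_facts one_neq_zero_TA in auto)

text \<open>Modulo X every polynomial is congruent to its constant term, so the quotient is a copy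
  of \<open>GF 3 n\<close>.\<close>

lemma field_TA:
  assumes l1: "l = 1" shows "Ring.field TA" "card (carrier TA) = 3 ^ n"
proof -
  have sur: "carrier TA = hh ` carrier (GF 3 n)"
  proof (intro equalityI subsetI)
    fix z assume "z \<in> carrier TA"
    then obtain p where p: "p \<in> carrier PR" "z = co p" using carrier_TA by blast
    obtain q c where qc: "q \<in> carrier PR" "c \<in> carrier (GF 3 n)" "p = (XX \<otimes>\<^bsub>PR\<^esub> q) \<oplus>\<^bsub>PR\<^esub> cst c" by (rule poly_decomp[OF p(1)])
    have "XX \<otimes>\<^bsub>PR\<^esub> q \<in> J" unfolding J_mem unfolding l1 using qc XX by (intro bexI[of _ q]) (simp_all add: R.m_comm)
    then have "co (XX \<otimes>\<^bsub>PR\<^esub> q) = \<zero>\<^bsub>TA\<^esub>" using co_zero XX qc by simp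
    then have "z = \<zero>\<^bsub>TA\<^esub> \<oplus>\<^bsub>TA\<^esub> hh c"
      using p qc ring_hom_add[OF co_hom, of "XX \<otimes>\<^bsub>PR\<^esub> q" "cst c"] XX ring_hom_closed[OF cst_hom] by (simp add: hh_def)
    then have "z = hh c" using cring_TA ring_hom_closed[OF hh_hom qc(2)] by (simp add: cring.cring_simprules)
    then show "z \<in> hh ` carrier (GF 3 n)" using qc by blast
  qed (use ring_hom_closed[OF hh_hom] in auto)
  interpret T: cring TA by (rule cring_TA)
  interpret H: ring_hom_ring "GF 3 n" TA hh
    by (rule ring_hom_ringI2[OF L.ring_axioms T.ring_axioms hh_hom])
  have "inj_on hh (carrier (GF 3 n))" using H.img_is_subfield(1)[OF L.carrier_is_subfield one_neq_zero_TA] .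
  then show "card (carrier TA) = 3 ^ n" unfolding sur using GF_exists[OF n] by (simp add: card_image)
  show "Ring.field TA"
  proof (rule T.cring_fieldI2)
    show "\<zero>\<^bsub>TA\<^esub> \<noteq> \<one>\<^bsub>TA\<^esub>" using one_neq_zero_TA by metis
    fix a assume a: "a \<in> carrier TA" "a \<noteq> \<zero>\<^bsub>TA\<^esub>"
    then obtain c where c: "c \<in> carrier (GF 3 n)" "a = hh c" using sur by blast
    then have "c \<noteq> \<zero>\<^bsub>GF 3 n\<^esub>" using a H.hom_zero by auto
    then have u: "c \<in> Units (GF 3 n)" using c L.field_Units by simp
    have "a \<otimes>\<^bsub>TA\<^esub> hh (inv\<^bsub>GF 3 n\<^esub> c) = \<one>\<^bsub>TA\<^esub>"
      unfolding c(2) using u c by (simp flip: H.hom_mult)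
    then show "\<exists>b\<in>carrier TA. a \<otimes>\<^bsub>TA\<^esub> b = \<one>\<^bsub>TA\<^esub>" using u by (intro bexI[of _ "hh (inv\<^bsub>GF 3 n\<^esub> c)"]) (simp_all add: H.hom_closed)
  qed
qed

text \<open>For \<open>n = 1\<close> the coefficient field is the base field itself, so the constant
  term from \<open>poly_decomp\<close> is a scalar, as \<open>nilpotent_algorithm\<close> asks;
  \<open>t\<close> is the class of X.\<close>

lemma nilpotent_TA:
  assumes l3: "l = 3" and n1: "n = 1"
  shows "\<exists>\<phi> w. sym_mult_algorithm (base_field 3 n) TA {..<5::nat} \<phi> w"
proof -
  interpret S: scalar_algebra "base_field 3 n" TA hh by (rule scalar_algebra_TA)
  have KL: "S.K = hh ` carrier (GF 3 n)"
  proof -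
    have c: "card (carrier (GF 3 n)) = 3" using GF_exists[OF n] n1 by simp
    then have "finite (carrier (GF 3 n))" using card.infinite by fastforce
    then have "carrier (base_field 3 n) = carrier (GF 3 n)"
      using base_field_facts(3,4) c by (intro card_subset_eq) auto
    then show ?thesis by (simp add: S.K_def)
  qed
  define t where "t = co XX"
  have t: "t \<in> carrier TA" using XX by (simp add: t_def carrier_TA)
  have m: "co p \<otimes>\<^bsub>TA\<^esub> co q = co (p \<otimes>\<^bsub>PR\<^esub> q)" "co p \<oplus>\<^bsub>TA\<^esub> co q = co (p \<oplus>\<^bsub>PR\<^esub> q)" if "p \<in> carrier PR" "q \<in> carrier PR" for p q
    using ring_hom_mult[OF co_hom that] ring_hom_add[OF co_hom that] by simp_all
  have cstc: "cst c \<in> carrier PR" if "c \<in> carrier (GF 3 n)" for c using ring_hom_closed[OF cst_hom that] .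
  have l3': "l = Suc (Suc (Suc 0))" using l3 by simp
  have p3: "XX [^]\<^bsub>PR\<^esub> l = XX \<otimes>\<^bsub>PR\<^esub> (XX \<otimes>\<^bsub>PR\<^esub> XX)" unfolding l3' using XX by (simp add: R.m_assoc)
  have p2: "XX [^]\<^bsub>PR\<^esub> Suc (Suc 0) = XX \<otimes>\<^bsub>PR\<^esub> XX" using XX by simp
  have "XX \<otimes>\<^bsub>PR\<^esub> (XX \<otimes>\<^bsub>PR\<^esub> XX) \<in> J" unfolding J_mem p3 using XX by (intro bexI[of _ "\<one>\<^bsub>PR\<^esub>"]) simp_all
  then have t3: "t \<otimes>\<^bsub>TA\<^esub> (t \<otimes>\<^bsub>TA\<^esub> t) = \<zero>\<^bsub>TA\<^esub>" using XX co_zero by (simp add: t_def m)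
  have "XX \<otimes>\<^bsub>PR\<^esub> XX \<notin> J" using X_pow_not_mem[of "Suc (Suc 0)"] l3 p2 by simp
  then have t2: "t \<otimes>\<^bsub>TA\<^esub> t \<noteq> \<zero>\<^bsub>TA\<^esub>" using XX co_zero by (simp add: t_def m)
  have step: "\<exists>y\<in>carrier TA. \<exists>c\<in>S.K. x = t \<otimes>\<^bsub>TA\<^esub> y \<oplus>\<^bsub>TA\<^esub> c" if x: "x \<in> carrier TA" for x
  proof -
    obtain p where p: "p \<in> carrier PR" "x = co p" using x carrier_TA by blast
    obtain q c where qc: "q \<in> carrier PR" "c \<in> carrier (GF 3 n)" "p = (XX \<otimes>\<^bsub>PR\<^esub> q) \<oplus>\<^bsub>PR\<^esub> cst c" by (rule poly_decomp[OF p(1)])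
    have "x = t \<otimes>\<^bsub>TA\<^esub> co q \<oplus>\<^bsub>TA\<^esub> hh c" unfolding p(2) qc(3) t_def hh_def using XX qc cstc by (simp add: m)
    then show ?thesis using qc carrier_TA KL by blast
  qed
  then show ?thesis using S.nilpotent_algorithm[OF t t3 t2] by blast
qed

end

lemma mu_sym_le: "\<exists>\<phi> w. sym_mult_algorithm k A {..<m} \<phi> w \<Longrightarrow> mu_sym k A \<le> enat m"
  unfolding mu_sym_def by (rule Inf_lower) blast

lemma mu_sym_q_bounds:
  "mu_sym_q 3 1 3 \<le> 5" "mu_sym_q 3 2 1 \<le> 3" "mu_sym_q 3 3 1 \<le> 6" "mu_sym_q 3 4 1 \<le> 9"
proof -
  note f = scalar_algebra.field_algorithm[OF scalar_algebra_TA field_TA(1)]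
  show "mu_sym_q 3 1 3 \<le> 5"
    unfolding mu_sym_q_def using mu_sym_le[OF nilpotent_TA[of 1 3]] by (simp add: numeral_eq_enat)
  show "mu_sym_q 3 2 1 \<le> 3"
    unfolding mu_sym_q_def using mu_sym_le[OF f(1)[of 2 1]] field_TA(2)[of 2 1] by (simp add: numeral_eq_enat)
  show "mu_sym_q 3 3 1 \<le> 6"
    unfolding mu_sym_q_def using mu_sym_le[OF f(2)[of 3 1]] field_TA(2)[of 3 1] by (simp add: numeral_eq_enat)
  show "mu_sym_q 3 4 1 \<le> 9"
    unfolding mu_sym_q_def using mu_sym_le[OF f(3)[of 4 1]] field_TA(2)[of 4 1] by (simp add: numeral_eq_enat)
qed

section \<open>Algorithms at the points of the support\<close>

lemma field_KK: "Ring.field (FF\<lparr>carrier := KK\<rparr>)"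
  by (rule ring.subfield_iff(2)[OF FF.ring_axioms subfield_KK])

lemma scalar_algebra_LA:
  assumes P: "P \<in> closed_points KK FF" and u: "u \<ge> 1"
  shows "scalar_algebra (FF\<lparr>carrier := KK\<rparr>) (local_algebra FF P u) (cls P u)"
  using cring_LA[OF P] field_KK card_KK hom_KK_LA[OF P] one_neq_zero_LA[OF P u] smult_LA[OF P]
  by (intro scalar_algebra.intro scalar_algebra_axioms.intro) simp_all

lemma field_LA:
  assumes P: "P \<in> closed_points KK FF"
  shows "Ring.field (local_algebra FF P 1)"
proof (rule cring.cring_fieldI2[OF cring_LA[OF P]])
  note dvr = dvr_P[OF P]
  show "\<zero>\<^bsub>local_algebra FF P 1\<^esub> \<noteq> \<one>\<^bsub>local_algebra FF P 1\<^esub>" using one_neq_zero_LA[OF P, of 1] by simp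
  fix a assume a: "a \<in> carrier (local_algebra FF P 1)" "a \<noteq> \<zero>\<^bsub>local_algebra FF P 1\<^esub>"
  then obtain x where x: "x \<in> P" "a = cls P 1 x" using carrier_LA[OF P] by blast
  have "fr x \<notin> mpow (fr ` P) 1" using a(2) x cls_hom(4)[OF P, of 1] cls_eq_iff[OF P, of 1 x "\<zero>\<^bsub>FF\<^esub>"] by auto
  then have v: "fr x \<noteq> 0" "val (fr ` P) (fr x) \<le> 0" by (auto simp: mpow_def simp del: fr_zero_iff)
  have "fr x * inverse (fr x) - 1 \<in> mpow (fr ` P) 1" using v(1) by (simp add: mpow_def)
  then have "cls P 1 (x \<otimes>\<^bsub>FF\<^esub> cd (inverse (fr x))) = cls P 1 \<one>\<^bsub>FF\<^esub>" by (simp add: cls_eq_iff[OF P])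
  moreover have inv: "cd (inverse (fr x)) \<in> P"
    unfolding mem_P[OF P] fr_cd mpow_def mem_Collect_eq val_inverse[OF dvr v(1)] using v(2) by linarith
  ultimately show "\<exists>b\<in>carrier (local_algebra FF P 1). a \<otimes>\<^bsub>local_algebra FF P 1\<^esub> b = \<one>\<^bsub>local_algebra FF P 1\<^esub>"
    unfolding x(2)
    by (intro bexI[of _ "cls P 1 (cd (inverse (fr x)))"] cls_in_LA[OF P inv])
      (simp only: cls_hom(2)[OF P x(1) inv] cls_hom(3)[OF P])
qed

text \<open>The three constants are distinct modulo the maximal ideal, and there are only three
  classes.\<close>

lemma rational_residue:
  assumes Q: "dvr Q" "rcard Q = 3" and z: "z \<in> Q"
  shows "\<exists>c. z - to_fract (pol [:c:]) \<in> mpow Q 1"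
proof -
  let ?k = "\<lambda>c. translate (mpow Q 1) (to_fract (pol [:c:]))"
  note sub = add_subgroup_mpow[OF Q(1), of 1]
  have "inj ?k"
  proof (rule injI, rule ccontr)
    fix c d assume eq: "?k c = ?k d" and ne: "c \<noteq> d"
    have "to_fract (pol [:c - d:]) \<in> mpow Q 1"
      using eq unfolding translate_eq_iff[OF sub] by (simp flip: to_fract_diff pol_simps)
    moreover have "to_fract (pol [:inverse (c - d):]) \<in> mpow Q 0"
      using const_in_dvr[OF Q(1)] by (simp add: mpow_0[OF Q(1)])
    ultimately have "to_fract (pol [:inverse (c - d):]) * to_fract (pol [:c - d:]) \<in> mpow Q (0 + 1)"
      by (intro mpow_mult[OF Q(1)])
    then show False using ne dvr_mpow_one_proper[OF Q(1)] by (simp add: const_pol_simps one_pCons[symmetric])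
  qed
  then have "card (range ?k) = 3" by (simp add: card_image card_f3)
  moreover have "range ?k \<subseteq> cosets Q (mpow Q 1)" using const_in_dvr[OF Q(1)] by (auto simp: cosets_def)
  moreover have "finite (cosets Q (mpow Q 1))" "card (cosets Q (mpow Q 1)) = 3"
    using Q(2) card.infinite by (fastforce simp: rcard_def)+
  ultimately have "range ?k = cosets Q (mpow Q 1)" by (intro card_subset_eq) simp_all
  then have "translate (mpow Q 1) z \<in> range ?k" using z by (simp add: cosets_def)
  then show ?thesis using translate_eq_iff[OF sub] by auto
qed

text \<open>The class of a uniformizer plays the role of \<open>t\<close>: its cube has valuation 3
  and vanishes in the quotient, its square has valuation 2 and does not.\<close>

lemma nilpotent_LA:
  assumes P: "P \<in> closed_points KK FF" and r: "rcard (fr ` P) = 3"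
  shows "\<exists>\<phi> w. sym_mult_algorithm (FF\<lparr>carrier := KK\<rparr>) (local_algebra FF P 3) {..<5::nat} \<phi> w"
proof -
  interpret S: scalar_algebra "FF\<lparr>carrier := KK\<rparr>" "local_algebra FF P 3" "cls P 3"
    by (rule scalar_algebra_LA[OF P]) simp
  note dvr = dvr_P[OF P]
  obtain \<tau> where \<tau>: "unif (fr ` P) \<tau>" by (rule dvr_obtain_unif[OF dvr])
  then have \<tau>0: "\<tau> \<noteq> 0" "val (fr ` P) \<tau> = 1" using unif_iff[OF dvr] by simp_all
  have vp: "val (fr ` P) (\<tau> ^ n) = int n" for n using val_power[OF dvr \<tau>0(1)] \<tau>0(2) by simp
  define t where "t = cls P 3 (cd \<tau>)"
  have tP: "cd \<tau> \<in> P" unfolding mem_P[OF P] fr_cd mpow_def mem_Collect_eq using \<tau>0 by simp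
  note hom = cls_hom[OF P, where u = 3] and cl = P_closed[OF P]
  have t: "t \<in> carrier (local_algebra FF P 3)" unfolding t_def by (rule cls_in_LA[OF P tP])
  note t2P = cl(2)[OF tP tP]
  have t2: "t \<otimes>\<^bsub>local_algebra FF P 3\<^esub> t = cls P 3 (cd \<tau> \<otimes>\<^bsub>FF\<^esub> cd \<tau>)"
    unfolding t_def by (rule hom(2)[OF tP tP])
  have t3: "t \<otimes>\<^bsub>local_algebra FF P 3\<^esub> (t \<otimes>\<^bsub>local_algebra FF P 3\<^esub> t) = cls P 3 (cd \<tau> \<otimes>\<^bsub>FF\<^esub> (cd \<tau> \<otimes>\<^bsub>FF\<^esub> cd \<tau>))"
    unfolding t2 unfolding t_def by (rule hom(2)[OF tP t2P])
  have "t \<otimes>\<^bsub>local_algebra FF P 3\<^esub> (t \<otimes>\<^bsub>local_algebra FF P 3\<^esub> t) = \<zero>\<^bsub>local_algebra FF P 3\<^esub>"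
    unfolding t3 hom(4) cls_eq_iff[OF P] using vp[of 3] by (simp add: mpow_def power3_eq_cube mult.assoc)
  moreover have "t \<otimes>\<^bsub>local_algebra FF P 3\<^esub> t \<noteq> \<zero>\<^bsub>local_algebra FF P 3\<^esub>"
    unfolding t2 hom(4) cls_eq_iff[OF P] using vp[of 2] \<tau>0(1) by (simp add: mpow_def power2_eq_square)
  moreover have "\<exists>y\<in>carrier (local_algebra FF P 3). \<exists>c\<in>S.K.
      x = t \<otimes>\<^bsub>local_algebra FF P 3\<^esub> y \<oplus>\<^bsub>local_algebra FF P 3\<^esub> c" if x: "x \<in> carrier (local_algebra FF P 3)" for x
  proof -
    obtain z where z: "z \<in> P" "x = cls P 3 z" using x carrier_LA[OF P] by blast
    obtain c where c: "fr z - to_fract (pol [:c:]) \<in> mpow (fr ` P) 1"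
      using rational_residue[OF dvr r, of "fr z"] z by auto
    define k where "k = cd (to_fract (pol [:c:]))"
    have k: "k \<in> KK" by (auto simp: mem_KK_iff k_def)
    define y where "y = cd ((fr z - fr k) / \<tau>)"
    have "inverse \<tau> \<in> mpow (fr ` P) (-1)" using \<tau>0 val_inverse[OF dvr] by (simp add: mpow_def)
    then have "(fr z - fr k) * inverse \<tau> \<in> mpow (fr ` P) (1 + -1)" using c by (intro mpow_mult[OF dvr]) (simp_all add: k_def)
    then have y: "y \<in> P" unfolding mem_P[OF P] y_def fr_cd divide_inverse by simp
    have "cls P 3 z = cls P 3 (cd \<tau> \<otimes>\<^bsub>FF\<^esub> y \<oplus>\<^bsub>FF\<^esub> k)"
      using \<tau>0 by (intro arg_cong[of _ _ "cls P 3"] FF_eqI) (simp add: y_def)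
    also have "\<dots> = t \<otimes>\<^bsub>local_algebra FF P 3\<^esub> cls P 3 y \<oplus>\<^bsub>local_algebra FF P 3\<^esub> cls P 3 k"
      unfolding t_def by (simp only: hom(2)[OF tP y] hom(1)[OF cl(2)[OF tP y] subsetD[OF cl(6) k]])
    finally show ?thesis using z y k cls_in_LA[OF P y, of 3] by (auto simp: S.K_def)
  qed
  ultimately show ?thesis by (rule S.nilpotent_algorithm[OF t])
qed

text \<open>Two bounds by the same number: one for the local algebra itself, from which the explicit
  algorithm is built, and one for the truncated polynomial algebra that enters
  \<open>data_length\<close>.\<close>

lemma local_algorithms:
  assumes G: "Gdiv P \<noteq> 0"
  shows "\<exists>\<phi> w. sym_mult_algorithm (FF\<lparr>carrier := KK\<rparr>) (local_algebra FF (pt P) (nat (Gdiv P))) {..<cost P} \<phi> w"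
    "mu_sym_q 3 (pt_degree KK FF (pt P)) (nat (Gdiv P)) \<le> enat (cost P)"
proof -
  note dvr = Gdiv_supp_dvr[OF G]
  then have P: "pt P \<in> closed_points KK FF" by simp
  note field = scalar_algebra.field_algorithm[OF scalar_algebra_LA[OF P] field_LA[OF P]]
  have deg: "pt_degree KK FF (pt P) = n" if "rcard P = 3 ^ n" for n by (rule pt_degree_eqI[OF dvr that])
  have card: "card (carrier (local_algebra FF (pt P) 1)) = rcard P" using card_LA(1)[OF P, of 1] by simp
  consider "Gdiv P = 3" "rcard P = 3" | "Gdiv P = 1" "rcard P = 3 ^ 2" | "Gdiv P = 1" "rcard P = 3 ^ 3"
    | "Gdiv P = 1" "rcard P = 3 ^ 4"
    using known_types[OF G] unfolding known_type_def by blast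
  then have "(\<exists>\<phi> w. sym_mult_algorithm (FF\<lparr>carrier := KK\<rparr>) (local_algebra FF (pt P) (nat (Gdiv P))) {..<cost P} \<phi> w)
    \<and> mu_sym_q 3 (pt_degree KK FF (pt P)) (nat (Gdiv P)) \<le> enat (cost P)"
  proof cases
    case 1 then show ?thesis using nilpotent_LA[OF P] deg[of 1] mu_sym_q_bounds(1) by (simp add: cost_def numeral_eq_enat)
  next
    case 2 then show ?thesis using field(1) card deg[of 2] mu_sym_q_bounds(2) by (simp add: cost_def numeral_eq_enat)
  next
    case 3 then show ?thesis using field(2) card deg[of 3] mu_sym_q_bounds(3) by (simp add: cost_def numeral_eq_enat)
  next
    case 4 then show ?thesis using field(3) card deg[of 4] mu_sym_q_bounds(4) by (simp add: cost_def numeral_eq_enat)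
  qed
  then show "\<exists>\<phi> w. sym_mult_algorithm (FF\<lparr>carrier := KK\<rparr>) (local_algebra FF (pt P) (nat (Gdiv P))) {..<cost P} \<phi> w"
    "mu_sym_q 3 (pt_degree KK FF (pt P)) (nat (Gdiv P)) \<le> enat (cost P)" by blast+
qed

section \<open>A point of degree 57\<close>

text \<open>The embedding of F_3 into a field of characteristic three, where \<open>ev x\<close> is
  the induced evaluation at x; the homomorphism laws hold once 3 = 0
  (\<open>em_hom\<close>).\<close>

definition em :: "f3 \<Rightarrow> 'a::field" where "em c = (if c = 0 then 0 else if c = 1 then 1 else - 1)"

definition ev :: "'a::field \<Rightarrow> f3 poly \<Rightarrow> 'a" where "ev x q = poly (map_poly em q) x"

lemma ev_simps [simp]: "ev x 0 = 0" "ev x [:c:] = em c" "ev x (pCons c q) = em c + x * ev x q"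
  by (simp_all add: ev_def em_def map_poly_pCons)

context
  fixes ty :: "'a::finite_field itself"
  assumes card: "card (UNIV :: 'a set) = 3 ^ 57" and three: "(3::'a) = 0"
begin

lemma two: "(2::'a) = - 1" "(1::'a) + 1 = - 1" "(- 1 :: 'a) - 1 = 1"
proof -
  have "(2::'a) + 1 = 0" using three by simp
  then show t: "(2::'a) = - 1" by (simp only: eq_neg_iff_add_eq_0)
  then show "(1::'a) + 1 = - 1" by simp
  have "(- 1 :: 'a) - 1 = - 2" by simp
  then show "(- 1 :: 'a) - 1 = 1" unfolding t by simp
qed

lemma em_hom: "em (c + d) = em c + (em d :: 'a)" "em (c * d) = em c * (em d :: 'a)" "em (- c) = - (em c :: 'a)"
  by (cases c rule: f3_cases; cases d rule: f3_cases; simp add: em_def two f3_two)+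

lemma ev_hom: "ev (x::'a) (p + q) = ev x p + ev x q" "ev x (p * q) = ev x p * ev x q" "ev x (- p) = - ev x p"
  "ev x (p - q) = ev x p - ev x q" "ev x 1 = 1"
proof -
  show add: "ev x (p + q) = ev x p + ev x q" for p q
    by (induction p q rule: poly_induct2) (simp_all add: em_hom algebra_simps)
  have smult: "ev x (smult c q) = em c * ev x q" for c q
    by (induction q) (simp_all add: em_hom algebra_simps)
  show "ev x (p * q) = ev x p * ev x q"
    by (induction p) (simp_all add: add smult em_def[of 0] algebra_simps)
  show minus: "ev x (- p) = - ev x p" for p
    by (induction p) (simp_all add: em_hom algebra_simps)
  show "ev x (p - q) = ev x p - ev x q" using add[of p "- q"] minus[of q] by simp
  show "ev x 1 = 1" by (simp add: one_pCons em_def)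
qed

lemma card_zeros_le:
  assumes "q \<noteq> 0" shows "card {x :: 'a. ev x q = 0} \<le> degree q"
proof -
  have inj: "em c = (0::'a) \<longleftrightarrow> c = 0" for c by (simp add: em_def)
  then have deg: "degree (map_poly em q :: 'a poly) = degree q" by (intro degree_map_poly) simp
  have "map_poly em q \<noteq> (0 :: 'a poly)" using assms by (simp add: map_poly_eq_0_iff inj em_def[of 0])
  then show ?thesis unfolding ev_def using card_poly_roots_bound[of "map_poly em q :: 'a poly"] deg by simp
qed

text \<open>(3^57 - 1) / 2 is odd, so i^2 = -1 would turn i^(3^57) = i into -i = i.\<close>

lemma minus_one_nonsquare: "i * i \<noteq> (- 1 :: 'a)"
proof
  \<comment> \<open>The large factor is (3^57 - 1) / 2; being odd, it makes the power of -1 equal to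
    -1.\<close>
  have pow57: "(3::nat) ^ 57 = 2 * 785021449541040805820267281 + 1" by simp
  assume i: "i * i = - 1"
  have "i ^ (3 ^ 57) = i" using finite_field_power_card_eq_same[of i] card by simp
  moreover have "i ^ (2 * k + 1) = (i * i) ^ k * i" for k :: nat
    by (simp add: power_mult power2_eq_square)
  ultimately have "(i * i) ^ 785021449541040805820267281 * i = i" by (metis pow57)
  then have "- i = i" unfolding i minus_one_power_iff by simp
  then have "2 * i = 0" by (metis add.right_inverse mult_2)
  then have "i = 0" using two by simp
  then show False using i by simp
qed

lemma cube_add: "(a + b) ^ 3 = a ^ 3 + (b::'a) ^ 3"
proof -
  have "(a + b) ^ 3 = a ^ 3 + b ^ 3 + 3 * (a ^ 2 * b + a * b ^ 2)" by (simp add: power3_eq_cube power2_eq_square algebra_simps)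
  then show ?thesis unfolding three by simp
qed

text \<open>In terms of \<open>u = 1 / x\<close> the equation \<open>x\<^sup>3 + x\<^sup>2 = c\<close> becomes \<open>u\<^sup>3 - u / c = 1 / c\<close>, whose left-hand side is
  additive, and injective when \<open>c\<close> is not a square.\<close>

lemma exists_abscissa:
  assumes z: "- (y * y + 1) = z * (z::'a)"
  shows "\<exists>x. y * y = x ^ 3 + x ^ 2 - 1"
proof -
  define c where "c = y * y + 1"
  have z0: "z \<noteq> 0" using z minus_one_nonsquare[of y] by (metis eq_neg_iff_add_eq_0 mult_zero_left neg_equal_0_iff_equal)
  have "c = - (z * z)" unfolding c_def by (metis z minus_minus)
  then have c: "c = - (z * z)" "c \<noteq> 0" using z0 by simp_all
  define L where "L u = u ^ 3 - u / c" for u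
  have "inj L"
  proof (rule injI)
    fix u v assume eq: "L u = L v"
    define w where "w = u - v"
    have "u = w + v" by (simp add: w_def)
    then have "w ^ 3 = w / c" using eq by (simp add: L_def cube_add add_divide_distrib)
    then have "w * (w * w * c - 1) = 0" using c(2) by (simp add: field_simps power3_eq_cube)
    moreover have "w * w * c \<noteq> 1"
    proof
      assume "w * w * c = 1"
      then have "(w * z) * (w * z) = - 1" unfolding c(1) by (simp add: algebra_simps minus_equation_iff)
      then show False using minus_one_nonsquare by blast
    qed
    ultimately show "u = v" by (simp add: w_def)
  qed
  then have "surj L" by (rule finite_UNIV_inj_surj[OF finite])
  then obtain u where u: "L u = 1 / c" by (metis surjE)
  then have u0: "u \<noteq> 0" using c(2) by (auto simp: L_def)
  have "u ^ 3 * c = u + 1" using u c(2) by (simp add: L_def field_simps)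
  then have "(1 / u) ^ 3 + (1 / u) ^ 2 = c" using u0 by (simp add: field_simps power3_eq_cube power2_eq_square)
  then show ?thesis by (intro exI[of _ "1 / u"]) (simp add: c_def)
qed

text \<open>The parametrization of the conic \<open>y\<^sup>2 + z\<^sup>2 = - 1\<close> by the lines through its point \<open>(-1, 1)\<close>.\<close>

lemma conic_parametrization:
  fixes m :: 'a
  defines "y \<equiv> (- m * m + m + 1) / (m * m + 1)"
  shows "\<exists>z. - (y * y + 1) = z * z" "(y + 1) * (m * m) - m + (y - 1) = 0"
proof -
  have n0: "m * m + 1 \<noteq> 0" using minus_one_nonsquare[of m] by (simp add: add_eq_0_iff2)
  \<comment> \<open>Over the integers the two sides differ by a multiple of 3.\<close>
  have 1: "- ((- m * m + m + 1) * (- m * m + m + 1) + (m * m + 1) * (m * m + 1)) = (m * m + m - 1) * (m * m + m - 1)"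
  proof -
    have "- ((- m * m + m + 1) * (- m * m + m + 1) + (m * m + 1) * (m * m + 1))
        = (m * m + m - 1) * (m * m + m - 1) - 3 * (m * m * m * m)  - 3 * 1" by (simp add: algebra_simps)
    then show ?thesis unfolding three by simp
  qed
  let ?z = "(m * m + m - 1) / (m * m + 1)"
  have frac: "(a / d) * (a / d) + 1 = (a * a + d * d) / (d * d)" if "d \<noteq> 0" for a d :: 'a
    using that by (simp add: add_divide_distrib)
  have "- (y * y + 1) = ?z * ?z"
  proof -
    have "y * y + 1 = ((- m * m + m + 1) * (- m * m + m + 1) + (m * m + 1) * (m * m + 1)) / ((m * m + 1) * (m * m + 1))"
      unfolding y_def by (rule frac[OF n0])
    then show ?thesis using 1 by (simp add: minus_divide_left)
  qed
  then show "\<exists>z. - (y * y + 1) = z * z" by blast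
  have "y * (m * m + 1) = - m * m + m + 1" using n0 by (simp add: y_def)
  then show "(y + 1) * (m * m) - m + (y - 1) = 0" by (simp add: algebra_simps)
qed

lemma card_quadratic_le: "a \<noteq> 0 \<or> b \<noteq> 0 \<Longrightarrow> card {m :: 'a. a * (m * m) + b * m + c = 0} \<le> 2"
proof -
  assume "a \<noteq> 0 \<or> b \<noteq> 0"
  then have "[:c, b, a:] \<noteq> 0" "degree [:c, b, a:] \<le> 2" by auto
  then have "card {m. poly [:c, b, a:] m = 0} \<le> 2" using card_poly_roots_bound le_trans by blast
  then show ?thesis by (simp add: algebra_simps)
qed

text \<open>The elements of degree at most 28 over F_3. Half of 57 lies between 28 and 29, so any
  element outside generates the field.\<close>

definition low :: "'a set" where "low = (\<Union>q \<in> {q. q = 0 \<or> degree q < 29} - {0}. {x. ev x q = 0})"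

lemma card_low: "card low \<le> 3 ^ 29 * 28"
proof -
  let ?S = "{q :: f3 poly. q = 0 \<or> degree q < 29}"
  have S: "finite ?S" "card ?S = 3 ^ 29" using card_poly_degree_less[of 29, where ?'a = f3] by (simp_all add: card_f3)
  have "card low \<le> (\<Sum>q\<in>?S - {0}. card {x :: 'a. ev x q = 0})"
    unfolding low_def by (rule card_UN_le) (use S in simp)
  also have "\<dots> \<le> (\<Sum>q\<in>?S - {0}. 28)"
  proof (rule sum_mono)
    fix q assume "q \<in> ?S - {0}"
    then show "card {x :: 'a. ev x q = 0} \<le> 28" using card_zeros_le[of q] by auto
  qed
  also have "\<dots> \<le> 3 ^ 29 * 28" using card_mono[OF S(1), of "?S - {0}"] S(2) by simp
  finally show ?thesis .
qed

text \<open>Each line parameter m gives some y on the conic and hence some x. At most two y belong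
  to each x and at most two m to each y, so if every x were in \<open>low\<close>, then 3^57 would
  be at most 4 * 28 * 3^29.\<close>

lemma exists_point_not_low: "\<exists>x y :: 'a. y * y = x ^ 3 + x ^ 2 - 1 \<and> x \<notin> low"
proof (rule ccontr)
  assume "\<not> ?thesis"
  then have bad: "x \<in> low" if "y * y = x ^ 3 + x ^ 2 - 1" for x y :: 'a using that by blast
  define B :: "'a set" where "B = (\<Union>x\<in>low. {y. 1 * (y * y) + 0 * y + (1 - x ^ 3 - x ^ 2) = 0})"
  have "card {y. 1 * (y * y) + 0 * y + (1 - x ^ 3 - x ^ 2) = 0} \<le> 2" for x :: 'a
    by (rule card_quadratic_le) simp
  then have "(\<Sum>x\<in>low. card {y. 1 * (y * y) + 0 * y + (1 - x ^ 3 - x ^ 2) = (0::'a)}) \<le> (\<Sum>x\<in>low. 2)" by (intro sum_mono)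
  then have cB: "card B \<le> 2 * card low" unfolding B_def using card_UN_le[of low "\<lambda>x. {y. 1 * (y * y) + 0 * y + (1 - x ^ 3 - x ^ 2) = (0::'a)}"] by simp
  have "(UNIV :: 'a set) \<subseteq> (\<Union>y\<in>B. {m. (y + 1) * (m * m) + (- 1) * m + (y - 1) = 0})"
  proof
    fix m :: 'a
    define y where "y = (- m * m + m + 1) / (m * m + 1)"
    obtain z where "- (y * y + 1) = z * z" using conic_parametrization(1)[of m] unfolding y_def by blast
    then obtain x where x: "y * y = x ^ 3 + x ^ 2 - 1" using exists_abscissa by blast
    then have "y \<in> B" using bad[OF x] by (auto simp: B_def intro!: bexI[of _ x])
    moreover have "(y + 1) * (m * m) + (- 1) * m + (y - 1) = 0" using conic_parametrization(2)[of m] by (simp add: y_def)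
    ultimately show "m \<in> (\<Union>y\<in>B. {m. (y + 1) * (m * m) + (- 1) * m + (y - 1) = 0})" by blast
  qed
  then have "card (UNIV :: 'a set) \<le> card (\<Union>y\<in>B. {m. (y + 1) * (m * m) + (- 1) * m + (y - 1) = 0})" by (intro card_mono) simp_all
  also have "\<dots> \<le> (\<Sum>y\<in>B. card {m. (y + 1) * (m * m) + (- 1) * m + (y - 1) = 0})" by (rule card_UN_le) simp
  also have "\<dots> \<le> (\<Sum>y\<in>B. 2)" by (intro sum_mono card_quadratic_le) simp
  finally have "(3::nat) ^ 57 \<le> 2 * (2 * (3 ^ 29 * 28))" using cB card_low card by simp
  then show False by simp
qed

text \<open>An element of degree at least 29 generates the field: a proper subfield \<open>S\<close> satisfies \<open>|S|\<^sup>2 \<le> 3\<^bsup>57\<^esup>\<close>.\<close>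

lemma min_poly_degree:
  fixes x :: 'a
  assumes x: "x \<notin> low"
  obtains \<pi> where "\<pi> \<noteq> 0" "degree \<pi> = 57" "\<And>q. ev x q = 0 \<longleftrightarrow> \<pi> dvd q" "\<And>z. \<exists>q. ev x q = z"
proof -
  define V where "V n = {q :: f3 poly. q = 0 \<or> degree q < n}" for n
  have V: "card (V n) = 3 ^ n" "finite (V n)" for n using card_poly_degree_less[of n, where ?'a = f3] by (simp_all add: V_def card_f3)
  have "\<exists>q. q \<noteq> 0 \<and> ev x q = 0"
  proof -
    \<comment> \<open>There are 3^58 such polynomials and only 3^57 values.\<close>
    have "\<not> inj_on (ev x) (V 58)"
    proof
      assume "inj_on (ev x) (V 58)"
      then have "card (V 58) \<le> card (UNIV :: 'a set)" by (intro card_inj_on_le) simp_all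
      then show False using V card by simp
    qed
    then obtain p q where "p \<noteq> q" "ev x p = ev x q" by (auto simp: inj_on_def)
    then show ?thesis by (intro exI[of _ "p - q"]) (simp add: ev_hom)
  qed
  then obtain \<pi> where \<pi>: "\<pi> \<noteq> 0" "ev x \<pi> = 0" and min: "\<And>q. q \<noteq> 0 \<Longrightarrow> ev x q = 0 \<Longrightarrow> degree \<pi> \<le> degree q"
    using exists_least_iff[of "\<lambda>d. \<exists>q. q \<noteq> 0 \<and> ev x q = 0 \<and> degree q = d"] by (metis not_le_imp_less)
  define d where "d = degree \<pi>"
  have dvd: "ev x q = 0 \<longleftrightarrow> \<pi> dvd q" for q
  proof
    assume "ev x q = 0"
    moreover have "ev x q = ev x \<pi> * ev x (q div \<pi>) + ev x (q mod \<pi>)" by (metis ev_hom(1,2) mult_div_mod_eq)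
    ultimately have "ev x (q mod \<pi>) = 0" using \<pi> by simp
    then have "q mod \<pi> = 0" using min[of "q mod \<pi>"] degree_mod_less[OF \<pi>(1), of q] by fastforce
    then show "\<pi> dvd q" by (simp add: dvd_eq_mod_eq_0)
  qed (auto simp: ev_hom \<pi>)
  define S where "S = range (ev x)"
  have inj: "inj_on (ev x) (V d)"
  proof (rule inj_onI, rule ccontr)
    fix p q assume pq: "p \<in> V d" "q \<in> V d" "ev x p = ev x q" "p \<noteq> q"
    then have "d \<le> degree (p - q)" using min[of "p - q"] by (simp add: ev_hom d_def)
    moreover have "degree (p - q) < d"
      using pq by (auto simp: V_def intro: degree_diff_less)
    ultimately show False by simp
  qed
  have "S = ev x ` V d"
  proof -
    have "ev x q \<in> ev x ` V d" for q
    proof (rule image_eqI)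
      have "\<pi> dvd q - q mod \<pi>" by (simp add: minus_mod_eq_mult_div)
      then have "ev x (q - q mod \<pi>) = 0" using dvd by blast
      then show "ev x q = ev x (q mod \<pi>)" by (simp add: ev_hom(4))
      show "q mod \<pi> \<in> V d" using degree_mod_less[OF \<pi>(1), of q] by (auto simp: V_def d_def)
    qed
    then show ?thesis by (auto simp: S_def)
  qed
  then have cS: "card S = 3 ^ d" using inj V by (simp add: card_image)
  have d29: "29 \<le> d"
  proof (rule ccontr)
    assume "\<not> 29 \<le> d"
    then have "x \<in> low" unfolding low_def using \<pi> by (auto simp: d_def)
    then show False using x by blast
  qed
  have cl: "a \<in> S \<Longrightarrow> b \<in> S \<Longrightarrow> a * b \<in> S" "a \<in> S \<Longrightarrow> b \<in> S \<Longrightarrow> a - b \<in> S" for a b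
    using ev_hom(2)[of x, symmetric] ev_hom(4)[of x, symmetric] by (auto simp: S_def)
  have "1 \<in> S" unfolding S_def using ev_hom(5) by (metis rangeI)
  \<comment> \<open>Multiplication by \<open>s\<close> is injective on the finite set
    \<open>S\<close>, hence onto, and reaches 1.\<close>
  have inv: "inverse s \<in> S" if s: "s \<in> S" "s \<noteq> 0" for s
  proof -
    have "inj_on ((*) s) S" using s by (auto simp: inj_on_def)
    moreover have "(*) s ` S \<subseteq> S" using cl s by blast
    ultimately have "(*) s ` S = S" by (intro endo_inj_surj) simp_all
    then obtain b where "b \<in> S" "s * b = 1" using \<open>1 \<in> S\<close> by (metis imageE)
    then show ?thesis using inverse_unique by metis
  qed
  have "S = UNIV"
  proof (rule ccontr)
    assume "S \<noteq> UNIV"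
    then obtain a where a: "a \<notin> S" by blast
    \<comment> \<open>1 and \<open>a\<close> are independent over \<open>S\<close>, so the field has
      at least 3^(2d) elements, which is too many for \<open>d \<ge> 29\<close>.\<close>
    have "inj_on (\<lambda>(s, b). s + a * b) (S \<times> S)"
    proof (rule inj_onI, clarify)
      fix s b s' b' assume st: "s \<in> S" "b \<in> S" "s' \<in> S" "b' \<in> S" "s + a * b = s' + a * b'"
      then have eq: "a * (b - b') = s' - s" by (simp add: algebra_simps)
      have "b = b'"
      proof (rule ccontr)
        assume "b \<noteq> b'"
        then have "a = (s' - s) * inverse (b - b')" using eq by (metis mult.assoc mult.right_neutral right_inverse right_minus_eq)
        then show False using a cl inv st \<open>b \<noteq> b'\<close> by (metis right_minus_eq)
      qed
      then show "s = s' \<and> b = b'" using st by simp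
    qed
    then have "card (S \<times> S) \<le> card (UNIV :: 'a set)" by (intro card_inj_on_le) simp_all
    then have "(3::nat) ^ (d + d) \<le> 3 ^ 57" using cS card by (simp add: card_cartesian_product power_add)
    then have "d + d \<le> 57" by (subst (asm) power_increasing_iff) simp_all
    then show False using d29 by simp
  qed
  then have "(3::nat) ^ d = 3 ^ 57" using cS card by simp
  then have "d = 57" by (subst (asm) power_inject_exp) simp_all
  then show ?thesis using that[of \<pi>] \<pi> dvd \<open>S = UNIV\<close> unfolding d_def S_def by (metis surjE)
qed

text \<open>\<open>\<pi>\<close> is a minimal polynomial of x, and \<open>g\<close> a polynomial
  whose value at x is y. The last two properties serve to identify the residue field at
  \<open>Q\<close> with \<open>GF 3 57\<close>.\<close>

lemma exists_degree_57_point: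
  obtains \<pi> g and x :: 'a where "irreducible \<pi>" "degree \<pi> = 57" "\<pi> dvd g * g - cubic"
    "\<And>q. ev x q = 0 \<longleftrightarrow> \<pi> dvd q" "\<And>z. \<exists>q. ev x q = z"
proof -
  obtain x y :: 'a where xy: "y * y = x ^ 3 + x ^ 2 - 1" "x \<notin> low" using exists_point_not_low by blast
  obtain \<pi> where \<pi>: "\<pi> \<noteq> 0" "degree \<pi> = 57" and dvd: "\<And>q. ev x q = 0 \<longleftrightarrow> \<pi> dvd q"
    and sur: "\<And>z. \<exists>q. ev x q = z" by (rule min_poly_degree[OF xy(2)]) blast
  obtain g where g: "ev x g = y" using sur by blast
  have "ev x cubic = x ^ 3 + x ^ 2 - 1"
    by (simp add: cubic_def em_def f3_two power3_eq_cube power2_eq_square algebra_simps)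
  then have "\<pi> dvd g * g - cubic" unfolding dvd[symmetric] using g xy by (simp add: ev_hom)
  moreover have "irreducible \<pi>"
  proof (rule Factorial_Ring.irreducibleI)
    show "\<not> is_unit \<pi>" using \<pi> by (auto simp: is_unit_iff_degree)
    fix a b assume ab: "\<pi> = a * b"
    then have "ev x a * ev x b = 0" using dvd[of \<pi>] by (simp add: ev_hom)
    then have "\<pi> dvd a \<or> \<pi> dvd b" using dvd by auto
    then show "is_unit a \<or> is_unit b" using \<pi>(1) ab by (auto simp: dvd_def)
  qed (use \<pi> in simp)
  ultimately show ?thesis using that \<pi> dvd sur by blast
qed

end

section \<open>The local algebras and sums of classes\<close>

definition Cls :: "aff fract set \<Rightarrow> nat \<Rightarrow> aff fract \<Rightarrow> nat set" where
  "Cls Q u z = cls (pt Q) u (cd z)"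

abbreviation LA :: "aff fract set \<Rightarrow> nat \<Rightarrow> (nat, nat set) module" where
  "LA Q u \<equiv> local_algebra FF (pt Q) u"

lemma mem_pt: "a \<in> pt Q \<longleftrightarrow> fr a \<in> Q" by (simp add: pt_def)

lemma cls_Cls: "cls (pt Q) u a = Cls Q u (fr a)" by (simp add: Cls_def)

context
  fixes Q :: "aff fract set" assumes Q: "dvr Q"
begin

lemma pt_Q: "pt Q \<in> closed_points KK FF" using Q by simp

lemma cring_LA': "cring (LA Q u)" by (rule cring_LA[OF pt_Q])

lemma Cls_eq_iff: "Cls Q u z = Cls Q u z' \<longleftrightarrow> z - z' \<in> mpow Q (int u)"
  unfolding Cls_def cls_eq_iff[OF pt_Q] by simp

lemma Cls_closed: "z \<in> Q \<Longrightarrow> Cls Q u z \<in> carrier (LA Q u)"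
  unfolding Cls_def by (rule cls_in_LA[OF pt_Q]) (simp add: mem_pt)

lemma Cls_cases:
  assumes "a \<in> carrier (LA Q u)" obtains z where "z \<in> Q" "a = Cls Q u z"
  using assms unfolding carrier_LA[OF pt_Q] by (auto simp: mem_pt cls_Cls)

lemma Cls_add: "z \<in> Q \<Longrightarrow> z' \<in> Q \<Longrightarrow> Cls Q u z \<oplus>\<^bsub>LA Q u\<^esub> Cls Q u z' = Cls Q u (z + z')"
  unfolding Cls_def by (subst cls_hom(1)[OF pt_Q]) (auto simp: mem_pt intro!: arg_cong[of _ _ "cls (pt Q) u"] FF_eqI)

lemma Cls_mult: "z \<in> Q \<Longrightarrow> z' \<in> Q \<Longrightarrow> Cls Q u z \<otimes>\<^bsub>LA Q u\<^esub> Cls Q u z' = Cls Q u (z * z')"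
  unfolding Cls_def by (subst cls_hom(2)[OF pt_Q]) (auto simp: mem_pt intro!: arg_cong[of _ _ "cls (pt Q) u"] FF_eqI)

lemma Cls_one: "\<one>\<^bsub>LA Q u\<^esub> = Cls Q u 1"
  unfolding Cls_def cls_hom(3)[OF pt_Q] by (auto intro!: arg_cong[of _ _ "cls (pt Q) u"] FF_eqI)

lemma Cls_zero: "\<zero>\<^bsub>LA Q u\<^esub> = Cls Q u 0"
  unfolding Cls_def cls_hom(4)[OF pt_Q] by (auto intro!: arg_cong[of _ _ "cls (pt Q) u"] FF_eqI)

lemma KK_mem: "c \<in> KK \<Longrightarrow> fr c \<in> Q"
  using P_closed(6)[OF pt_Q] by (auto simp: mem_pt[symmetric])

lemma Cls_smult: "c \<in> KK \<Longrightarrow> z \<in> Q \<Longrightarrow> c \<odot>\<^bsub>LA Q u\<^esub> Cls Q u z = Cls Q u (fr c * z)"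
  unfolding smult_LA[OF pt_Q] cls_Cls by (rule Cls_mult[OF KK_mem])

lemma Cls_sum:
  assumes "finite I" "\<And>i. i \<in> I \<Longrightarrow> z i \<in> Q"
  shows "(\<Oplus>\<^bsub>LA Q u\<^esub>i\<in>I. Cls Q u (z i)) = Cls Q u (\<Sum>i\<in>I. z i)"
  using assms
proof (induction I rule: finite_induct)
  interpret R: cring "LA Q u" by (rule cring_LA')
  case empty then show ?case using Cls_zero by (simp add: R.finsum_empty)
next
  interpret R: cring "LA Q u" by (rule cring_LA')
  case (insert i I)
  have "(\<Sum>i\<in>I. z i) \<in> Q" using dvr_add_subgroup[OF Q] insert.prems by (intro add_subgroup_sum) auto
  moreover have "(\<Oplus>\<^bsub>LA Q u\<^esub>i\<in>insert i I. Cls Q u (z i)) = Cls Q u (z i) \<oplus>\<^bsub>LA Q u\<^esub> (\<Oplus>\<^bsub>LA Q u\<^esub>i\<in>I. Cls Q u (z i))"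
    by (rule R.finsum_insert[OF insert.hyps]) (use insert.prems Cls_closed in auto)
  ultimately show ?case using insert Cls_add by simp
qed

lemma const_mult_mpow: "c \<in> KK \<Longrightarrow> z \<in> mpow Q n \<Longrightarrow> fr c * z \<in> mpow Q n"
  using mpow_mult[OF Q, of "fr c" 0 z n] KK_mem mpow_0[OF Q] by simp

end

lemma const_mult_sections: "c \<in> KK \<Longrightarrow> f \<in> sections D \<Longrightarrow> fr c * f \<in> sections D"
  unfolding sections_def using const_mult_mpow by blast

section \<open>Surjectivity of evaluation by counting\<close>

text \<open>The map to the product of the quotients is injective by \<open>ker\<close>, and its
  target is no larger than \<open>V\<close>, so it is onto.\<close>

lemma surj_by_counting:
  fixes V :: "'a::ab_group_add set"
  assumes V: "add_subgroup V" "finite V" and S: "finite S"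
    and W: "\<And>P. P \<in> S \<Longrightarrow> add_subgroup (W P)" "\<And>P. P \<in> S \<Longrightarrow> V \<subseteq> U P" "\<And>P. P \<in> S \<Longrightarrow> finite (cosets (U P) (W P))"
    and ker: "\<And>f. f \<in> V \<Longrightarrow> (\<And>P. P \<in> S \<Longrightarrow> f \<in> W P) \<Longrightarrow> f = 0"
    and le: "(\<Prod>P\<in>S. card (cosets (U P) (W P))) \<le> card V" and z: "\<And>P. P \<in> S \<Longrightarrow> z P \<in> U P"
  obtains f where "f \<in> V" "\<And>P. P \<in> S \<Longrightarrow> f - z P \<in> W P"
proof -
  define \<Phi> where "\<Phi> f = (\<lambda>P\<in>S. translate (W P) f)" for f
  let ?T = "PiE S (\<lambda>P. cosets (U P) (W P))"
  have "inj_on \<Phi> V"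
  proof (rule inj_onI)
    fix f h assume fh: "f \<in> V" "h \<in> V" "\<Phi> f = \<Phi> h"
    have "f - h \<in> W P" if "P \<in> S" for P
      using fun_cong[OF fh(3), of P] that translate_eq_iff[OF W(1)[OF that]] by (simp add: \<Phi>_def)
    then have "f - h = 0" using ker add_subgroup_diff[OF V(1) fh(1,2)] by blast
    then show "f = h" by simp
  qed
  then have "card (\<Phi> ` V) = card V" by (rule card_image)
  moreover have "\<Phi> ` V \<subseteq> ?T" by (auto simp: \<Phi>_def cosets_def intro!: imageI intro: subsetD[OF W(2)])
  moreover have "finite ?T" using S W(3) by (rule finite_PiE)
  moreover have "card ?T = (\<Prod>P\<in>S. card (cosets (U P) (W P)))" by (rule card_PiE[OF S])
  ultimately have "\<Phi> ` V = ?T" using le by (intro card_seteq) simp_all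
  moreover have "(\<lambda>P\<in>S. translate (W P) (z P)) \<in> ?T" using z by (simp add: cosets_def)
  ultimately obtain f where f: "f \<in> V" "(\<lambda>P\<in>S. translate (W P) (z P)) = \<Phi> f" by blast
  have "f - z P \<in> W P" if "P \<in> S" for P
    using fun_cong[OF f(2)[symmetric], of P] that translate_eq_iff[OF W(1)[OF that]] by (simp add: \<Phi>_def)
  then show ?thesis using f that by blast
qed

lemma cosets_mpow_shift:
  assumes P: "dvr P" and fin: "finite (cosets P (mpow P 1))"
  shows "finite (cosets (mpow P a) (mpow P (int n + a)))" "card (cosets (mpow P a) (mpow P (int n + a))) = rcard P ^ n"
  using cosets_mpow[OF P fin, of a n] by (simp_all add: rcard_def add.commute)

section \<open>The symmetric Chudnovsky data\<close>

abbreviation kk :: "nat ring" where "kk \<equiv> FF\<lparr>carrier := KK\<rparr>"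

text \<open>The point \<open>Q\<close> together with a sign for which L(D - Q) vanishes, as
  \<open>exists_good_sign\<close> provides.\<close>

locale degree_57_point =
  fixes \<pi> g :: "f3 poly" and e :: f3
  assumes \<pi>: "irreducible \<pi>" "degree \<pi> = 57" and g: "\<pi> dvd g * g - cubic"
    and e: "sgn3 e" and van: "sections_at_Q \<pi> g e = {0}"
begin

abbreviation "QQ \<equiv> loc (Qp \<pi> g)"
abbreviation "D \<equiv> Ddiv e"

definition DD :: "nat divisor" where "DD N = D (fr ` N)"
definition GG :: "nat divisor" where "GG N = Gdiv (fr ` N)"

lemma dvr_Q: "dvr QQ" by (rule loc_dvr[OF Qp_prime[OF \<pi> g]])

lemma rcard_Q: "rcard QQ = 3 ^ 57"
  using rcard_split[OF \<pi>(1) g] \<pi>(2) by (simp add: Qp_def[OF \<pi> g])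

lemma D_at_Q: "D QQ = 0"
  using Ddiv_loc[OF Qp_prime[OF \<pi> g] e] Qp_neq_rat[OF \<pi> g] by simp

lemma supp_scaled:
  assumes "k \<noteq> 0" shows "{P. k * D P \<noteq> 0} = {inf_ring, loc (rat_prime e)}"
  using Ddiv_supp[OF e] assms by simp

text \<open>Stated for multiples so that \<open>k = 1\<close> and \<open>k = 2\<close> cover D and
  2D.\<close>

lemma scaled_divisor:
  assumes k: "k \<noteq> 0"
  shows "(\<lambda>N. k * DD N) \<in> divisors KK FF" "div_degree KK FF (\<lambda>N. k * DD N) = 57 * k"
proof -
  have "N \<in> pt ` {inf_ring, loc (rat_prime e)}" if "k * DD N \<noteq> 0" for N
  proof -
    have "fr ` N \<in> {P. k * D P \<noteq> 0}" using that unfolding DD_def by (rule CollectI)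
    then have "fr ` N \<in> {inf_ring, loc (rat_prime e)}" unfolding supp_scaled[OF k] .
    then show ?thesis by (metis image_eqI pt_fr_image)
  qed
  then have sub: "supp (\<lambda>N. k * DD N) \<subseteq> pt ` {inf_ring, loc (rat_prime e)}" unfolding supp_def by blast
  then show div: "(\<lambda>N. k * DD N) \<in> divisors KK FF"
  proof -
    have "pt ` {inf_ring, loc (rat_prime e)} \<subseteq> closed_points KK FF" using inf_dvr loc_dvr[OF aff_prime_rat[OF e]] by simp
    then show ?thesis unfolding divisors_def using subset_trans[OF sub] finite_subset[OF sub] by simp
  qed
  have "rcard (loc (rat_prime e)) = 3 ^ 1"
    unfolding rat_prime_def rcard_split[OF irreducible_xm1 rat_dvd[OF e]] by (simp add: xm1_def)
  then have "pt_degree KK FF (pt (loc (rat_prime e))) = 1" by (rule pt_degree_eqI[OF loc_dvr[OF aff_prime_rat[OF e]]])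
  moreover have "loc (rat_prime e) \<noteq> inf_ring" using loc_neq_inf_ring aff_prime_rat[OF e] by blast
  ultimately show "div_degree KK FF (\<lambda>N. k * DD N) = 57 * k"
    unfolding div_degree_FF[OF div] unfolding DD_def fr_image_pt supp_scaled[OF k]
    using Ddiv_inf[of e] Ddiv_loc[OF aff_prime_rat[OF e] e] pt_degree_inf by (simp add: algebra_simps)
qed

lemma card_scaled_sections:
  assumes k: "k > 0"
  shows "finite (sections (\<lambda>P. k * D P))" "3 ^ nat (57 * k) \<le> card (sections (\<lambda>P. k * D P))"
proof -
  note 1 = finite_card_sections[OF scaled_divisor(1)[of k]]
  show "finite (sections (\<lambda>P. k * D P))" "3 ^ nat (57 * k) \<le> card (sections (\<lambda>P. k * D P))"
    using 1 scaled_divisor(2)[of k] k by (simp_all add: DD_def)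
qed

lemma GG_divisor: "GG \<in> divisors KK FF" and supp_GG: "supp GG = pt ` {P. Gdiv P \<noteq> 0}"
proof -
  show eq: "supp GG = pt ` {P. Gdiv P \<noteq> 0}"
  proof (intro Set.set_eqI iffI)
    fix N assume "N \<in> supp GG"
    then show "N \<in> pt ` {P. Gdiv P \<noteq> 0}" unfolding supp_def GG_def by (intro image_eqI[of _ _ "fr ` N"]) simp_all
  qed (auto simp: supp_def GG_def)
  show "GG \<in> divisors KK FF" using finite_Gdiv_supp Gdiv_supp_dvr by (auto simp: divisors_def eq)
qed

lemma sections_mem: "f \<in> sections E \<Longrightarrow> dvr P \<Longrightarrow> f \<in> mpow P (- E P)" by (simp add: sections_def)

text \<open>L(D) has at least 3^57 elements, the size of the residue field at \<open>Q\<close>, and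
  the kernel L(D - Q) is zero.\<close>

lemma evaluation_at_Q_surj:
  assumes z: "z \<in> QQ" obtains f where "f \<in> sections D" "f - z \<in> mpow QQ 1"
proof -
  note fin = finite_residue[OF dvr_Q]
  note sec = card_scaled_sections[of 1]
  have "\<exists>f. f \<in> sections D \<and> (\<forall>P\<in>{QQ}. f - (\<lambda>_. z) P \<in> mpow P 1)"
  proof (rule surj_by_counting[of "sections D" "{QQ}" "\<lambda>P. mpow P 1" "\<lambda>P. mpow P 0" "\<lambda>_. z"])
    show "add_subgroup (sections D)" by (rule add_subgroup_sections)
    show "add_subgroup (mpow P 1)" if "P \<in> {QQ}" for P using that add_subgroup_mpow[OF dvr_Q] by simp
    show "sections D \<subseteq> mpow P 0" if "P \<in> {QQ}" for P using that sections_mem[OF _ dvr_Q, of _ D] D_at_Q by auto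
    show "finite (cosets (mpow P 0) (mpow P 1))" if "P \<in> {QQ}" for P using that fin mpow_0[OF dvr_Q] by simp
    show "f = 0" if "f \<in> sections D" "\<And>P. P \<in> {QQ} \<Longrightarrow> f \<in> mpow P 1" for f
      using van that by (auto simp: sections_at_Q_def[OF \<pi> g])
    show "(\<Prod>P\<in>{QQ}. card (cosets (mpow P 0) (mpow P 1))) \<le> card (sections D)"
      using sec(2) rcard_Q mpow_0[OF dvr_Q] by (simp add: rcard_def)
  qed (use sec(1) z mpow_0[OF dvr_Q] in auto)
  then show ?thesis using that by blast
qed

text \<open>The hypotheses place \<open>f\<close> in L(2D - G).\<close>

lemma evaluation_at_G_inj:
  assumes f: "f \<in> sections (\<lambda>P. 2 * D P)" and v: "\<And>P. Gdiv P \<noteq> 0 \<Longrightarrow> f \<in> mpow P (Gdiv P - 2 * D P)"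
  shows "f = 0"
proof (rule sections_twice_minus_G[OF e])
  show "f \<in> sections (\<lambda>P. 2 * D P - Gdiv P)"
    unfolding sections_def
  proof (intro CollectI allI impI)
    fix P :: "aff fract set" assume "dvr P"
    then show "f \<in> mpow P (- (2 * D P - Gdiv P))"
      using v[of P] sections_mem[OF f, of P] by (cases "Gdiv P = 0") (simp_all add: algebra_simps)
  qed
qed

text \<open>L(2D) has at least 3^114 elements, which matches the bound for the target. This lets the
  algorithm prescribe values at the points of \<open>G\<close>.\<close>

lemma evaluation_at_G_surj:
  assumes z: "\<And>P. Gdiv P \<noteq> 0 \<Longrightarrow> z P \<in> mpow P (- (2 * D P))"
  obtains f where "f \<in> sections (\<lambda>P. 2 * D P)" "\<And>P. Gdiv P \<noteq> 0 \<Longrightarrow> f - z P \<in> mpow P (Gdiv P - 2 * D P)"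
proof -
  let ?S = "{P. Gdiv P \<noteq> 0}"
  have sh: "Gdiv P - 2 * D P = int (nat (Gdiv P)) + - (2 * D P)" for P using Gdiv_nonneg[of P] by simp
  note co = cosets_mpow_shift[OF Gdiv_supp_dvr finite_residue[OF Gdiv_supp_dvr]]
  have "\<exists>f. f \<in> sections (\<lambda>P. 2 * D P) \<and> (\<forall>P\<in>?S. f - z P \<in> mpow P (Gdiv P - 2 * D P))"
  proof (rule surj_by_counting[of "sections (\<lambda>P. 2 * D P)" ?S "\<lambda>P. mpow P (Gdiv P - 2 * D P)" "\<lambda>P. mpow P (- (2 * D P))" z])
    show "add_subgroup (sections (\<lambda>P. 2 * D P))" by (rule add_subgroup_sections)
    show "finite (sections (\<lambda>P. 2 * D P))" using card_scaled_sections(1)[of 2] by simp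
    show "finite ?S" by (rule finite_Gdiv_supp)
    show "add_subgroup (mpow P (Gdiv P - 2 * D P))" if "P \<in> ?S" for P using that by (intro add_subgroup_mpow Gdiv_supp_dvr) simp
    show "sections (\<lambda>P. 2 * D P) \<subseteq> mpow P (- (2 * D P))" if "P \<in> ?S" for P
      using sections_mem[of _ "\<lambda>P. 2 * D P" P] that Gdiv_supp_dvr[of P] by auto
    show "finite (cosets (mpow P (- (2 * D P))) (mpow P (Gdiv P - 2 * D P)))" if "P \<in> ?S" for P
      unfolding sh by (rule co(1)) (use that in simp_all)
    show "f = 0" if "f \<in> sections (\<lambda>P. 2 * D P)" "\<And>P. P \<in> ?S \<Longrightarrow> f \<in> mpow P (Gdiv P - 2 * D P)" for f
      by (rule evaluation_at_G_inj[OF that(1)]) (rule that(2), simp)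
    have "(\<Prod>P\<in>?S. card (cosets (mpow P (- (2 * D P))) (mpow P (Gdiv P - 2 * D P)))) = (\<Prod>P\<in>?S. rcard P ^ nat (Gdiv P))"
      unfolding sh by (intro prod.cong refl co(2)) simp_all
    then show "(\<Prod>P\<in>?S. card (cosets (mpow P (- (2 * D P))) (mpow P (Gdiv P - 2 * D P)))) \<le> card (sections (\<lambda>P. 2 * D P))"
      using rcard_interp card_scaled_sections(2)[of 2] by simp
    show "z P \<in> mpow P (- (2 * D P))" if "P \<in> ?S" for P using z that by simp
  qed blast
  then show ?thesis using that by blast
qed

lemma global_sections_scaled: "global_sections KK FF (\<lambda>N. k * DD N) = fr -` sections (\<lambda>P. k * D P)"
  by (simp add: global_sections_FF DD_def)

lemma global_sections_DD: "global_sections KK FF DD = fr -` sections D"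
  by (simp add: global_sections_FF DD_def)

lemma evaluation_FF: "evaluation FF E N u f = fr -` translate (mpow (fr ` N) (int u - E N)) (fr f)"
  by (simp add: evaluation_def max_ideal_pow_FF coset_FF)

theorem chudnovsky_data: "sym_chudnovsky_data KK FF 57 1 (pt QQ) DD GG"
proof -
  have "DD \<in> divisors KK FF" using scaled_divisor(1)[of 1] by simp
  moreover have "pt_degree KK FF (pt QQ) = 57" by (rule pt_degree_eqI[OF dvr_Q rcard_Q])
  moreover have "inj_on (\<lambda>f. \<lambda>P\<in>supp GG. evaluation FF (\<lambda>P. 2 * DD P) P (nat (GG P)) f) (global_sections KK FF (\<lambda>P. 2 * DD P))"
  proof (rule inj_onI)
    fix a b assume ab: "a \<in> global_sections KK FF (\<lambda>P. 2 * DD P)" "b \<in> global_sections KK FF (\<lambda>P. 2 * DD P)"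
      "(\<lambda>P\<in>supp GG. evaluation FF (\<lambda>P. 2 * DD P) P (nat (GG P)) a) = (\<lambda>P\<in>supp GG. evaluation FF (\<lambda>P. 2 * DD P) P (nat (GG P)) b)"
    have "fr a - fr b \<in> sections (\<lambda>P. 2 * D P)"
      using ab(1,2) unfolding global_sections_scaled by (simp add: add_subgroup_diff[OF add_subgroup_sections])
    moreover have "fr a - fr b \<in> mpow P (Gdiv P - 2 * D P)" if P: "Gdiv P \<noteq> 0" for P
    proof -
      have "pt P \<in> supp GG" using P by (simp add: supp_GG)
      then have "evaluation FF (\<lambda>P. 2 * DD P) (pt P) (nat (GG (pt P))) a = evaluation FF (\<lambda>P. 2 * DD P) (pt P) (nat (GG (pt P))) b"
        using fun_cong[OF ab(3), of "pt P"] by simp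
      then have "translate (mpow P (Gdiv P - 2 * D P)) (fr a) = translate (mpow P (Gdiv P - 2 * D P)) (fr b)"
        using Gdiv_nonneg[of P] by (simp add: evaluation_FF DD_def GG_def)
      then show ?thesis using translate_eq_iff[OF add_subgroup_mpow[OF Gdiv_supp_dvr[OF P]]] by blast
    qed
    ultimately have "fr a - fr b = 0" by (rule evaluation_at_G_inj)
    then show "a = b" by simp
  qed
  moreover have "evaluation FF DD (pt QQ) 1 ` global_sections KK FF DD = fibre FF DD (pt QQ) 1"
  proof -
    have m: "max_ideal_pow FF (pt QQ) (- DD (pt QQ)) = pt QQ"
      unfolding max_ideal_pow_FF DD_def fr_image_pt D_at_Q by (simp add: mpow_0[OF dvr_Q] pt_def)
    have sub: "fr a \<in> QQ" if "a \<in> global_sections KK FF DD" for a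
      using that sections_mem[OF _ dvr_Q, of "fr a" D] D_at_Q mpow_0[OF dvr_Q] by (simp add: global_sections_DD)
    have ev: "evaluation FF DD (pt QQ) 1 a = fr -` translate (mpow QQ 1) (fr a)" for a
      using D_at_Q by (simp add: evaluation_FF DD_def)
    have "evaluation FF DD (pt QQ) 1 a \<in> evaluation FF DD (pt QQ) 1 ` global_sections KK FF DD" if "a \<in> pt QQ" for a
    proof -
      obtain f where f: "f \<in> sections D" "f - fr a \<in> mpow QQ 1" using evaluation_at_Q_surj[of "fr a"] \<open>a \<in> pt QQ\<close> by (auto simp: mem_pt)
      then have "translate (mpow QQ 1) f = translate (mpow QQ 1) (fr a)"
        using translate_eq_iff[OF add_subgroup_mpow[OF dvr_Q]] by blast
      then show ?thesis using f(1) by (intro image_eqI[of _ _ "cd f"]) (simp_all only: ev fr_cd global_sections_DD vimage_eq)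
    qed
    then show ?thesis unfolding fibre_def m using sub by (auto simp: mem_pt)
  qed
  ultimately show ?thesis
    unfolding sym_chudnovsky_data_def using dvr_Q GG_divisor Gdiv_nonneg by (simp add: GG_def)
qed

lemma data_length_le: "data_length KK FF GG \<le> 234"
proof -
  have inj: "inj_on pt A" for A by (auto simp: inj_on_def)
  have "data_length KK FF GG = (\<Sum>P | Gdiv P \<noteq> 0. mu_sym_q 3 (pt_degree KK FF (pt P)) (nat (Gdiv P)))"
    unfolding data_length_def supp_GG card_KK sum.reindex[OF inj] by (simp add: GG_def)
  also have "\<dots> \<le> (\<Sum>P | Gdiv P \<noteq> 0. enat (cost P))" by (intro sum_mono local_algorithms(2)) simp
  also have "\<dots> = enat (\<Sum>P | Gdiv P \<noteq> 0. cost P)" by (induction rule: infinite_finite_induct) (simp_all add: zero_enat_def)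
  also have "\<dots> \<le> 234" using sum_cost by (simp add: numeral_eq_enat)
  finally show ?thesis .
qed

lemma sum_cost_nat: "(\<Sum>N\<in>supp GG. cost (fr ` N)) \<le> 234"
proof -
  have inj: "inj_on pt A" for A by (auto simp: inj_on_def)
  show ?thesis unfolding supp_GG sum.reindex[OF inj] using sum_cost by simp
qed

end

section \<open>The algorithm attached to the data\<close>

context degree_57_point
begin

text \<open>Choosing 1 at \<open>Q\<close>, where \<open>D\<close> vanishes, lets classes at
  \<open>Q\<close> be read off sections without division.\<close>

definition loc_gen :: "aff fract set \<Rightarrow> aff fract" where
  "loc_gen P = (if P = QQ then 1 else SOME c. c \<noteq> 0 \<and> val P c = - D P)"

lemma loc_gen: assumes "dvr P" shows "loc_gen P \<noteq> 0" "val P (loc_gen P) = - D P"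
proof -
  have "loc_gen P \<noteq> 0 \<and> val P (loc_gen P) = - D P"
  proof (cases "P = QQ")
    case True then show ?thesis using D_at_Q val_one[OF dvr_Q] by (simp add: loc_gen_def)
  next
    case False then show ?thesis using someI_ex[OF exists_val[OF assms, of "- D P"]] by (simp add: loc_gen_def)
  qed
  then show "loc_gen P \<noteq> 0" "val P (loc_gen P) = - D P" by blast+
qed

lemma loc_gen_mpow:
  assumes P: "dvr P"
  shows "f / loc_gen P \<in> mpow P n \<longleftrightarrow> f \<in> mpow P (n - D P)"
    "f / (loc_gen P * loc_gen P) \<in> mpow P n \<longleftrightarrow> f \<in> mpow P (n - 2 * D P)"
  using loc_gen[OF P] val_divide[OF P, of f "loc_gen P"] val_divide[OF P, of f "loc_gen P * loc_gen P"]
    val_mult[OF P, of "loc_gen P" "loc_gen P"]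
  by (cases "f = 0"; simp add: mpow_def; linarith)+

definition lift :: "nat set \<Rightarrow> aff fract" where
  "lift x = (SOME f. f \<in> sections D \<and> Cls QQ 1 f = x)"

lemma sections_in_Q: "f \<in> sections D \<Longrightarrow> f \<in> QQ"
  using sections_mem[OF _ dvr_Q, of f D] D_at_Q mpow_0[OF dvr_Q] by simp

lemma lift_props:
  assumes x: "x \<in> carrier (LA QQ 1)"
  shows "lift x \<in> sections D" "Cls QQ 1 (lift x) = x"
proof -
  obtain z where z: "z \<in> QQ" "x = Cls QQ 1 z" by (rule Cls_cases[OF dvr_Q x])
  obtain f where "f \<in> sections D" "f - z \<in> mpow QQ 1" by (rule evaluation_at_Q_surj[OF z(1)])
  then have "f \<in> sections D \<and> Cls QQ 1 f = x" unfolding z(2) by (simp add: Cls_eq_iff[OF dvr_Q])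
  then have "lift x \<in> sections D \<and> Cls QQ 1 (lift x) = x" unfolding lift_def by (rule someI)
  then show "lift x \<in> sections D" "Cls QQ 1 (lift x) = x" by blast+
qed

text \<open>Evaluation at \<open>Q\<close> is injective on L(D), so the chosen lift is its inverse
  and inherits linearity.\<close>

lemma lift_unique:
  assumes "f \<in> sections D" shows "lift (Cls QQ 1 f) = f"
proof -
  note 1 = lift_props[OF Cls_closed[OF dvr_Q sections_in_Q[OF assms]]]
  have "lift (Cls QQ 1 f) - f \<in> sections_at_Q \<pi> g e"
    using 1 assms Cls_eq_iff[OF dvr_Q, of 1]
    by (simp add: sections_at_Q_def[OF \<pi> g] add_subgroup_diff[OF add_subgroup_sections])
  then show ?thesis using van by simp
qed

lemma lift_linear:
  assumes x: "x \<in> carrier (LA QQ 1)" and y: "y \<in> carrier (LA QQ 1)"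
  shows "lift (x \<oplus>\<^bsub>LA QQ 1\<^esub> y) = lift x + lift y"
    "c \<in> KK \<Longrightarrow> lift (c \<odot>\<^bsub>LA QQ 1\<^esub> x) = fr c * lift x"
proof -
  note lx = lift_props[OF x] and ly = lift_props[OF y]
  have "x \<oplus>\<^bsub>LA QQ 1\<^esub> y = Cls QQ 1 (lift x + lift y)"
    using Cls_add[OF dvr_Q sections_in_Q[OF lx(1)] sections_in_Q[OF ly(1)], of 1] lx(2) ly(2) by simp
  then show "lift (x \<oplus>\<^bsub>LA QQ 1\<^esub> y) = lift x + lift y"
    using lift_unique[OF add_subgroup_add[OF add_subgroup_sections lx(1) ly(1)]] by simp
  assume c: "c \<in> KK"
  have "c \<odot>\<^bsub>LA QQ 1\<^esub> x = Cls QQ 1 (fr c * lift x)"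
    using Cls_smult[OF dvr_Q c sections_in_Q[OF lx(1)], of 1] lx(2) by simp
  then show "lift (c \<odot>\<^bsub>LA QQ 1\<^esub> x) = fr c * lift x"
    using lift_unique[OF const_mult_sections[OF c lx(1)]] by simp
qed

definition restrict_at :: "aff fract set \<Rightarrow> nat set \<Rightarrow> nat set" where
  "restrict_at P x = Cls P (nat (Gdiv P)) (lift x / loc_gen P)"

lemma lift_over_gen:
  assumes x: "x \<in> carrier (LA QQ 1)" and P: "dvr P" shows "lift x / loc_gen P \<in> P"
  using loc_gen_mpow(1)[OF P, of "lift x" 0] sections_mem[OF lift_props(1)[OF x] P] mpow_0[OF P] by simp

lemma restrict_at_linear:
  assumes P: "dvr P" and x: "x \<in> carrier (LA QQ 1)" and y: "y \<in> carrier (LA QQ 1)"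
  shows "restrict_at P x \<in> carrier (LA P (nat (Gdiv P)))"
    "restrict_at P (x \<oplus>\<^bsub>LA QQ 1\<^esub> y) = restrict_at P x \<oplus>\<^bsub>LA P (nat (Gdiv P))\<^esub> restrict_at P y"
    "c \<in> KK \<Longrightarrow> restrict_at P (c \<odot>\<^bsub>LA QQ 1\<^esub> x) = c \<odot>\<^bsub>LA P (nat (Gdiv P))\<^esub> restrict_at P x"
proof -
  note lx = lift_over_gen[OF x P] and ly = lift_over_gen[OF y P]
  show "restrict_at P x \<in> carrier (LA P (nat (Gdiv P)))" unfolding restrict_at_def by (rule Cls_closed[OF P lx])
  show "restrict_at P (x \<oplus>\<^bsub>LA QQ 1\<^esub> y) = restrict_at P x \<oplus>\<^bsub>LA P (nat (Gdiv P))\<^esub> restrict_at P y"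
    unfolding restrict_at_def lift_linear(1)[OF x y] add_divide_distrib by (rule Cls_add[OF P lx ly, symmetric])
  assume c: "c \<in> KK"
  show "restrict_at P (c \<odot>\<^bsub>LA QQ 1\<^esub> x) = c \<odot>\<^bsub>LA P (nat (Gdiv P))\<^esub> restrict_at P x"
    unfolding restrict_at_def lift_linear(2)[OF x y c] times_divide_eq_right[symmetric]
    by (rule Cls_smult[OF P c lx, symmetric])
qed

text \<open>The product of two lifts lies in L(2D). The local algorithms compute its values along
  \<open>G\<close>; sections \<open>\<theta> P j\<close> that interpolate a local element at one
  point and 0 at the others reassemble it, and evaluation at \<open>Q\<close> turns this into an
  algorithm there.\<close>

lemma exists_chudnovsky_algorithm:
  "\<exists>\<phi> w. chudnovsky_algorithm KK FF 1 (pt QQ) DD GG (\<lambda>N. cost (fr ` N)) \<phi> w"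
proof -
  have "\<forall>P. \<exists>\<psi> v. Gdiv P \<noteq> 0 \<longrightarrow> sym_mult_algorithm kk (LA P (nat (Gdiv P))) {..<cost P} \<psi> v"
    using local_algorithms(1) by blast
  then obtain \<psi> v where alg: "\<And>P. Gdiv P \<noteq> 0 \<Longrightarrow> sym_mult_algorithm kk (LA P (nat (Gdiv P))) {..<cost P} (\<psi> P) (v P)"
    by metis
  have form: "linear_map kk (LA P (nat (Gdiv P))) (algebra_via kk (\<lambda>c. c)) (\<psi> P j)"
    and v: "v P j \<in> carrier (LA P (nat (Gdiv P)))" if "Gdiv P \<noteq> 0" "j < cost P" for P j
    using alg[OF that(1)] that(2) unfolding sym_mult_algorithm_def by blast+
  have mult: "x \<otimes>\<^bsub>LA P (nat (Gdiv P))\<^esub> y = (\<Oplus>\<^bsub>LA P (nat (Gdiv P))\<^esub>j\<in>{..<cost P}.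
      (\<psi> P j x \<otimes>\<^bsub>kk\<^esub> \<psi> P j y) \<odot>\<^bsub>LA P (nat (Gdiv P))\<^esub> v P j)"
    if "Gdiv P \<noteq> 0" "x \<in> carrier (LA P (nat (Gdiv P)))" "y \<in> carrier (LA P (nat (Gdiv P)))" for P x y
    using alg[OF that(1)] that(2,3) unfolding sym_mult_algorithm_def by blast
  have \<psi>K: "\<psi> P j x \<in> KK" if "Gdiv P \<noteq> 0" "j < cost P" "x \<in> carrier (LA P (nat (Gdiv P)))" for P j x
    using form[OF that(1,2)] that(3) unfolding linear_map_def by (auto simp: algebra_via_def)
  have "\<forall>P j. \<exists>z. Gdiv P \<noteq> 0 \<longrightarrow> j < cost P \<longrightarrow> z \<in> P \<and> v P j = Cls P (nat (Gdiv P)) z"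
    using v Cls_cases[OF Gdiv_supp_dvr] by metis
  then obtain r where r: "\<And>P j. Gdiv P \<noteq> 0 \<Longrightarrow> j < cost P \<Longrightarrow> r P j \<in> P"
    "\<And>P j. Gdiv P \<noteq> 0 \<Longrightarrow> j < cost P \<Longrightarrow> v P j = Cls P (nat (Gdiv P)) (r P j)" by metis
  \<comment> \<open>The square of the local generator trivializes 2D at \<open>P\<close>, where
    products of two sections live.\<close>
  define sq where "sq P = loc_gen P * loc_gen P" for P
  define target where "target P j P' = (if P' = P then r P j * sq P else 0)" for P j P'
  have target: "target P j P' \<in> mpow P' (- (2 * D P'))" if "Gdiv P \<noteq> 0" "j < cost P" "Gdiv P' \<noteq> 0" for P j P'
  proof (cases "P' = P")
    case True
    have "r P j * sq P / sq P \<in> mpow P 0" using r(1)[OF that(1,2)] mpow_0[OF Gdiv_supp_dvr[OF that(1)]] loc_gen(1)[OF Gdiv_supp_dvr[OF that(1)]]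
      by (simp add: sq_def)
    then have "r P j * sq P \<in> mpow P (0 - 2 * D P)" unfolding sq_def loc_gen_mpow(2)[OF Gdiv_supp_dvr[OF that(1)]] .
    then show ?thesis using True by (simp add: target_def)
  qed (simp add: target_def mpow_def)
  have "\<exists>f. Gdiv P \<noteq> 0 \<longrightarrow> j < cost P \<longrightarrow> f \<in> sections (\<lambda>P. 2 * D P) \<and>
      (\<forall>P'. Gdiv P' \<noteq> 0 \<longrightarrow> f - target P j P' \<in> mpow P' (Gdiv P' - 2 * D P'))" for P j
  proof (cases "Gdiv P \<noteq> 0 \<and> j < cost P")
    case True
    then obtain f where "f \<in> sections (\<lambda>P. 2 * D P)" "\<And>P'. Gdiv P' \<noteq> 0 \<Longrightarrow> f - target P j P' \<in> mpow P' (Gdiv P' - 2 * D P')"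
      using evaluation_at_G_surj[of "target P j"] target by metis
    then show ?thesis by blast
  qed blast
  then have "\<forall>P j. \<exists>f. Gdiv P \<noteq> 0 \<longrightarrow> j < cost P \<longrightarrow> f \<in> sections (\<lambda>P. 2 * D P) \<and>
      (\<forall>P'. Gdiv P' \<noteq> 0 \<longrightarrow> f - target P j P' \<in> mpow P' (Gdiv P' - 2 * D P'))" by blast
  then obtain \<theta> where \<theta>: "\<And>P j. Gdiv P \<noteq> 0 \<Longrightarrow> j < cost P \<Longrightarrow> \<theta> P j \<in> sections (\<lambda>P. 2 * D P)"
    "\<And>P j P'. Gdiv P \<noteq> 0 \<Longrightarrow> j < cost P \<Longrightarrow> Gdiv P' \<noteq> 0 \<Longrightarrow> \<theta> P j - target P j P' \<in> mpow P' (Gdiv P' - 2 * D P')"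
    by metis
  let ?I = "SIGMA N:supp GG. {..<cost (fr ` N)}"
  let ?S = "{P. Gdiv P \<noteq> 0}"
  define \<phi> where "\<phi> = (\<lambda>(N, j) x. \<psi> (fr ` N) j (restrict_at (fr ` N) x))"
  define w where "w = (\<lambda>(N, j). Cls QQ 1 (\<theta> (fr ` N) j))"
  have supp: "N \<in> supp GG \<longleftrightarrow> Gdiv (fr ` N) \<noteq> 0" for N by (simp add: supp_def GG_def)
  have finI: "finite ?I" using finite_Gdiv_supp by (simp add: supp_GG)
  have index: "Gdiv (fr ` fst i) \<noteq> 0" "snd i < cost (fr ` fst i)" if i: "i \<in> ?I" for i
  proof -
    obtain N j where "N \<in> supp GG" "j \<in> {..<cost (fr ` N)}" "i = (N, j)" using i by (rule SigmaE)
    then show "Gdiv (fr ` fst i) \<noteq> 0" "snd i < cost (fr ` fst i)" using supp[of N] by simp_all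
  qed
  have \<theta>Q: "\<theta> P j \<in> QQ" if "Gdiv P \<noteq> 0" "j < cost P" for P j
    using sections_mem[OF \<theta>(1)[OF that] dvr_Q] D_at_Q mpow_0[OF dvr_Q] by simp
  have alg_Q: "sym_mult_algorithm kk (LA QQ 1) ?I \<phi> w"
    unfolding sym_mult_algorithm_def
  proof (intro conjI ballI)
    show "finite ?I" by (rule finI)
  next
    fix i assume "i \<in> ?I"
    then obtain N j where i: "i = (N, j)" "Gdiv (fr ` N) \<noteq> 0" "j < cost (fr ` N)" using supp by auto
    note dvr = Gdiv_supp_dvr[OF i(2)]
    note R = restrict_at_linear[OF dvr] and F = form[OF i(2,3)]
    show "w i \<in> carrier (LA QQ 1)" using Cls_closed[OF dvr_Q \<theta>Q[OF i(2,3)]] by (simp add: i(1) w_def)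
    show "linear_map kk (LA QQ 1) (algebra_via kk (\<lambda>c. c)) (\<phi> i)"
      unfolding linear_map_def
    proof (intro conjI ballI funcsetI)
      fix x assume x: "x \<in> carrier (LA QQ 1)"
      show "\<phi> i x \<in> carrier (algebra_via kk (\<lambda>c. c))"
        using \<psi>K[OF i(2,3) R(1)[OF x x]] by (simp add: i(1) \<phi>_def algebra_via_def)
      show "\<phi> i (x \<oplus>\<^bsub>LA QQ 1\<^esub> y) = \<phi> i x \<oplus>\<^bsub>algebra_via kk (\<lambda>c. c)\<^esub> \<phi> i y" if y: "y \<in> carrier (LA QQ 1)" for y
        using F R(1)[OF x x] R(1)[OF y y] unfolding linear_map_def i(1) \<phi>_def prod.case R(2)[OF x y] by blast
    next
      fix c x assume c: "c \<in> carrier kk" and x: "x \<in> carrier (LA QQ 1)"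
      then have cK: "c \<in> KK" by simp
      show "\<phi> i (c \<odot>\<^bsub>LA QQ 1\<^esub> x) = c \<odot>\<^bsub>algebra_via kk (\<lambda>c. c)\<^esub> \<phi> i x"
        using F R(1)[OF x x] c unfolding linear_map_def i(1) \<phi>_def prod.case R(3)[OF x x cK] by blast
    qed
  next
    fix x y assume x: "x \<in> carrier (LA QQ 1)" and y: "y \<in> carrier (LA QQ 1)"
    define c where "c P j = \<psi> P j (restrict_at P x) \<otimes>\<^bsub>kk\<^esub> \<psi> P j (restrict_at P y)" for P j
    have cK: "c P j \<in> KK" if "Gdiv P \<noteq> 0" "j < cost P" for P j
      using \<psi>K[OF that restrict_at_linear(1)[OF Gdiv_supp_dvr[OF that(1)] x x]]
        \<psi>K[OF that restrict_at_linear(1)[OF Gdiv_supp_dvr[OF that(1)] y y]]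
        subringE(6)[OF subfieldE(1)[OF subfield_KK]] by (simp add: c_def)
    define h where "h = lift x * lift y"
    \<comment> \<open>The section that the local algorithms prescribe; agreement with
      \<open>h\<close> along \<open>G\<close> will force equality.\<close>
    define h' where "h' = (\<Sum>P\<in>?S. \<Sum>j<cost P. fr (c P j) * \<theta> P j)"
    have sub2: "add_subgroup (sections (\<lambda>P. 2 * D P))" by (rule add_subgroup_sections)
    have "h \<in> sections (\<lambda>P. D P + D P)" unfolding h_def by (rule sections_mult[OF lift_props(1)[OF x] lift_props(1)[OF y]])
    then have hs: "h \<in> sections (\<lambda>P. 2 * D P)" unfolding mult_2 .
    have hs': "h' \<in> sections (\<lambda>P. 2 * D P)"
      unfolding h'_def by (intro add_subgroup_sum[OF sub2] const_mult_sections[OF cK \<theta>(1)]) simp_all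
    have "h - h' \<in> mpow P (Gdiv P - 2 * D P)" if P: "Gdiv P \<noteq> 0" for P
    proof -
      note dvr = Gdiv_supp_dvr[OF P]
      note sub = add_subgroup_mpow[OF dvr, of "Gdiv P - 2 * D P"]
      define A where "A = (\<Sum>j<cost P. fr (c P j) * r P j)"
      have rK: "fr (c P j) * r P j \<in> P" if "j < cost P" for j
        using const_mult_mpow[OF dvr cK[OF P that], of "r P j" 0] r(1)[OF P that] mpow_0[OF dvr] by simp
      have "Cls P (nat (Gdiv P)) (lift x / loc_gen P * (lift y / loc_gen P)) = restrict_at P x \<otimes>\<^bsub>LA P (nat (Gdiv P))\<^esub> restrict_at P y"
        unfolding restrict_at_def by (rule Cls_mult[OF dvr lift_over_gen[OF x dvr] lift_over_gen[OF y dvr], symmetric])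
      also have "\<dots> = (\<Oplus>\<^bsub>LA P (nat (Gdiv P))\<^esub>j\<in>{..<cost P}. c P j \<odot>\<^bsub>LA P (nat (Gdiv P))\<^esub> v P j)"
        unfolding c_def by (rule mult[OF P restrict_at_linear(1)[OF dvr x x] restrict_at_linear(1)[OF dvr y y]])
      also have "\<dots> = (\<Oplus>\<^bsub>LA P (nat (Gdiv P))\<^esub>j\<in>{..<cost P}. Cls P (nat (Gdiv P)) (fr (c P j) * r P j))"
      proof -
        interpret R: cring "LA P (nat (Gdiv P))" by (rule cring_LA'[OF dvr])
        show ?thesis
        proof (rule R.finsum_cong')
          show "(\<lambda>j. Cls P (nat (Gdiv P)) (fr (c P j) * r P j)) \<in> {..<cost P} \<rightarrow> carrier (LA P (nat (Gdiv P)))"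
            using Cls_closed[OF dvr rK] by auto
          show "c P j \<odot>\<^bsub>LA P (nat (Gdiv P))\<^esub> v P j = Cls P (nat (Gdiv P)) (fr (c P j) * r P j)" if "j \<in> {..<cost P}" for j
            using that r[OF P, of j] Cls_smult[OF dvr cK[OF P]] by simp
        qed simp
      qed
      also have "\<dots> = Cls P (nat (Gdiv P)) A" unfolding A_def by (rule Cls_sum[OF dvr]) (use rK in simp_all)
      finally have "lift x / loc_gen P * (lift y / loc_gen P) - A \<in> mpow P (Gdiv P)"
        unfolding Cls_eq_iff[OF dvr] using Gdiv_nonneg[of P] by simp
      moreover have "lift x / loc_gen P * (lift y / loc_gen P) - A = (h - A * sq P) / (loc_gen P * loc_gen P)"
        using loc_gen(1)[OF dvr] by (simp add: h_def sq_def diff_divide_distrib)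
      ultimately have 1: "h - A * sq P \<in> mpow P (Gdiv P - 2 * D P)" using loc_gen_mpow(2)[OF dvr] by metis
      \<comment> \<open>At \<open>P\<close> only the targets belonging to \<open>P\<close> itself
        are nonzero.\<close>
      have "(\<Sum>P'\<in>?S. \<Sum>j<cost P'. fr (c P' j) * target P' j P) = (\<Sum>P'\<in>?S. if P = P' then \<Sum>j<cost P'. fr (c P' j) * (r P' j * sq P') else 0)"
        by (intro sum.cong refl) (simp add: target_def)
      also have "\<dots> = A * sq P" using finite_Gdiv_supp P by (simp add: A_def sum_distrib_right mult.assoc)
      finally have "h' - A * sq P = (\<Sum>P'\<in>?S. \<Sum>j<cost P'. fr (c P' j) * (\<theta> P' j - target P' j P))"
        by (simp add: h'_def right_diff_distrib sum_subtractf)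
      also have "\<dots> \<in> mpow P (Gdiv P - 2 * D P)"
        by (intro add_subgroup_sum[OF sub] const_mult_mpow[OF dvr cK \<theta>(2)]) (use P in simp_all)
      finally have "(h - A * sq P) - (h' - A * sq P) \<in> mpow P (Gdiv P - 2 * D P)" by (rule add_subgroup_diff[OF sub 1])
      then show ?thesis by simp
    qed
    then have "h - h' = 0" by (rule evaluation_at_G_inj[OF add_subgroup_diff[OF sub2 hs hs']])
    then have hh': "h = h'" by simp
    have inj: "inj_on pt A" for A by (auto simp: inj_on_def)
    have "h' = (\<Sum>i\<in>?I. fr (c (fr ` fst i) (snd i)) * \<theta> (fr ` fst i) (snd i))"
    proof -
      have "(\<Sum>i\<in>?I. fr (c (fr ` fst i) (snd i)) * \<theta> (fr ` fst i) (snd i)) =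
          (\<Sum>N\<in>supp GG. \<Sum>j<cost (fr ` N). fr (c (fr ` N) j) * \<theta> (fr ` N) j)"
        by (subst sum.Sigma) (use finite_Gdiv_supp in \<open>simp_all add: supp_GG case_prod_beta\<close>)
      also have "\<dots> = h'" unfolding h'_def supp_GG sum.reindex[OF inj] by simp
      finally show ?thesis ..
    qed
    note h'_eq = this
    have "x \<otimes>\<^bsub>LA QQ 1\<^esub> y = Cls QQ 1 h"
      using Cls_mult[OF dvr_Q sections_in_Q[OF lift_props(1)[OF x]] sections_in_Q[OF lift_props(1)[OF y]], of 1]
        lift_props(2)[OF x] lift_props(2)[OF y] by (simp add: h_def)
    also have "\<dots> = (\<Oplus>\<^bsub>LA QQ 1\<^esub>i\<in>?I. Cls QQ 1 (fr (c (fr ` fst i) (snd i)) * \<theta> (fr ` fst i) (snd i)))"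
      unfolding hh' h'_eq
    proof (rule Cls_sum[OF dvr_Q finI, symmetric])
      fix i assume "i \<in> ?I"
      note i = index[OF this]
      show "fr (c (fr ` fst i) (snd i)) * \<theta> (fr ` fst i) (snd i) \<in> QQ"
        using const_mult_mpow[OF dvr_Q cK[OF i], of _ 0] \<theta>Q[OF i] mpow_0[OF dvr_Q] by simp
    qed
    also have "\<dots> = (\<Oplus>\<^bsub>LA QQ 1\<^esub>i\<in>?I. (\<phi> i x \<otimes>\<^bsub>kk\<^esub> \<phi> i y) \<odot>\<^bsub>LA QQ 1\<^esub> w i)"
    proof -
      interpret R: cring "LA QQ 1" by (rule cring_LA'[OF dvr_Q])
      have eq: "Cls QQ 1 (fr (c (fr ` fst i) (snd i)) * \<theta> (fr ` fst i) (snd i)) = (\<phi> i x \<otimes>\<^bsub>kk\<^esub> \<phi> i y) \<odot>\<^bsub>LA QQ 1\<^esub> w i"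
        and mem: "Cls QQ 1 (fr (c (fr ` fst i) (snd i)) * \<theta> (fr ` fst i) (snd i)) \<in> carrier (LA QQ 1)" if "i \<in> ?I" for i
      proof -
        note i = index[OF \<open>i \<in> ?I\<close>]
        show "Cls QQ 1 (fr (c (fr ` fst i) (snd i)) * \<theta> (fr ` fst i) (snd i)) = (\<phi> i x \<otimes>\<^bsub>kk\<^esub> \<phi> i y) \<odot>\<^bsub>LA QQ 1\<^esub> w i"
          using Cls_smult[OF dvr_Q cK[OF i] \<theta>Q[OF i], of 1] by (simp add: \<phi>_def w_def c_def case_prod_beta)
        show "Cls QQ 1 (fr (c (fr ` fst i) (snd i)) * \<theta> (fr ` fst i) (snd i)) \<in> carrier (LA QQ 1)"
          using const_mult_mpow[OF dvr_Q cK[OF i], of _ 0] \<theta>Q[OF i] mpow_0[OF dvr_Q] by (intro Cls_closed[OF dvr_Q]) simp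
      qed
      show ?thesis by (rule R.finsum_cong') (use eq mem in auto)
    qed
    finally show "x \<otimes>\<^bsub>LA QQ 1\<^esub> y = (\<Oplus>\<^bsub>LA QQ 1\<^esub>i\<in>?I. (\<phi> i x \<otimes>\<^bsub>kk\<^esub> \<phi> i y) \<odot>\<^bsub>LA QQ 1\<^esub> w i)" .
  qed
  define gen where "gen N = cd (loc_gen (fr ` N))" for N
  define s where "s x = cd (lift x)" for x
  have gen_inv: "fr (inv\<^bsub>FF\<^esub> (gen N)) = inverse (loc_gen (fr ` N))" if "dvr (fr ` N)" for N
  proof -
    have "fr (gen N) \<noteq> 0" using loc_gen(1)[OF that] by (simp add: gen_def del: fr_zero_iff)
    then have "gen N \<noteq> \<zero>\<^bsub>FF\<^esub>" by simp
    then show ?thesis by (simp add: gen_def)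
  qed
  have dvr_supp: "dvr (fr ` N)" if "N \<in> insert (pt QQ) (supp GG)" for N
  proof -
    have "N = pt QQ \<or> Gdiv (fr ` N) \<noteq> 0" using that supp by blast
    then show ?thesis using dvr_Q Gdiv_supp_dvr by auto
  qed
  have cls_div: "max_ideal_pow FF N u +>\<^bsub>FF\<^esub> (s x \<otimes>\<^bsub>FF\<^esub> inv\<^bsub>FF\<^esub> gen N) = Cls (fr ` N) (nat u) (lift x / loc_gen (fr ` N))"
    if "dvr (fr ` N)" "0 \<le> u" for N u x
  proof -
    have "s x \<otimes>\<^bsub>FF\<^esub> inv\<^bsub>FF\<^esub> gen N = cd (lift x / loc_gen (fr ` N))"
      by (rule FF_eqI) (simp add: gen_inv[OF that(1)] s_def divide_inverse)
    then show ?thesis using that(2) by (simp add: Cls_def cls_def)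
  qed
  have "chudnovsky_algorithm KK FF 1 (pt QQ) DD GG (\<lambda>N. cost (fr ` N)) \<phi> w"
    unfolding chudnovsky_algorithm_def
  proof (intro conjI exI ballI allI impI)
    show "sym_mult_algorithm kk (LA QQ 1) ?I \<phi> w" by (rule alg_Q)
  next
    fix N assume "N \<in> insert (pt QQ) (supp GG)"
    note dvr = dvr_supp[OF this]
    have "fr (gen N) \<noteq> 0" using loc_gen(1)[OF dvr] by (simp add: gen_def del: fr_zero_iff)
    then show "gen N \<in> carrier FF - {\<zero>\<^bsub>FF\<^esub>}" by simp
    show "valuation FF N (gen N) = - DD N" using loc_gen(2)[OF dvr] by (simp add: valuation_FF gen_def DD_def)
  next
    show "linear_map kk (LA QQ 1) (algebra_via (FF\<lparr>carrier := global_sections KK FF DD\<rparr>) (\<lambda>c. c)) s"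
      unfolding linear_map_def
    proof (intro conjI ballI funcsetI)
      fix x assume x: "x \<in> carrier (LA QQ 1)"
      show "s x \<in> carrier (algebra_via (FF\<lparr>carrier := global_sections KK FF DD\<rparr>) (\<lambda>c. c))"
        using lift_props(1)[OF x] by (simp add: algebra_via_def global_sections_DD s_def)
      show "s (x \<oplus>\<^bsub>LA QQ 1\<^esub> y) = s x \<oplus>\<^bsub>algebra_via (FF\<lparr>carrier := global_sections KK FF DD\<rparr>) (\<lambda>c. c)\<^esub> s y"
        if y: "y \<in> carrier (LA QQ 1)" for y
        unfolding s_def lift_linear(1)[OF x y] by (rule FF_eqI) (simp add: algebra_via_def)
    next
      fix c x assume "c \<in> carrier kk" and x: "x \<in> carrier (LA QQ 1)"
      then have c: "c \<in> KK" by simp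
      show "s (c \<odot>\<^bsub>LA QQ 1\<^esub> x) = c \<odot>\<^bsub>algebra_via (FF\<lparr>carrier := global_sections KK FF DD\<rparr>) (\<lambda>c. c)\<^esub> s x"
        unfolding s_def lift_linear(2)[OF x x c] by (rule FF_eqI) (simp add: algebra_via_def)
    qed
  next
    fix x assume x: "x \<in> carrier (LA QQ 1)"
    have "dvr (fr ` pt QQ)" using dvr_Q by simp
    then have "max_ideal_pow FF (pt QQ) (int 1) +>\<^bsub>FF\<^esub> (s x \<otimes>\<^bsub>FF\<^esub> inv\<^bsub>FF\<^esub> gen (pt QQ)) = Cls QQ 1 (lift x / loc_gen QQ)"
      using cls_div[of "pt QQ" 1 x] by simp
    then show "max_ideal_pow FF (pt QQ) (int 1) +>\<^bsub>FF\<^esub> (s x \<otimes>\<^bsub>FF\<^esub> inv\<^bsub>FF\<^esub> gen (pt QQ)) = x"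
      using lift_props(2)[OF x] by (simp add: loc_gen_def)
  next
    fix N assume "N \<in> supp GG"
    then have "Gdiv (fr ` N) \<noteq> 0" using supp by blast
    then have "sym_mult_algorithm kk (LA (fr ` N) (nat (Gdiv (fr ` N)))) {..<cost (fr ` N)} (\<psi> (fr ` N)) (v (fr ` N))" by (rule alg)
    then show "sym_mult_algorithm kk (local_algebra FF N (nat (GG N))) {..<cost (fr ` N)} ((\<lambda>N. \<psi> (fr ` N)) N) ((\<lambda>N. v (fr ` N)) N)"
      by (simp add: GG_def)
  next
    fix N j x assume N: "N \<in> supp GG"
    show "\<phi> (N, j) x = (\<lambda>N. \<psi> (fr ` N)) N j (max_ideal_pow FF N (GG N) +>\<^bsub>FF\<^esub> (s x \<otimes>\<^bsub>FF\<^esub> inv\<^bsub>FF\<^esub> gen N))"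
      using cls_div[OF dvr_supp, of N "GG N" x] N Gdiv_nonneg[of "fr ` N"] by (simp add: \<phi>_def restrict_at_def GG_def)
  qed
  then show ?thesis by blast
qed

end

section \<open>The residue field\<close>

lemma field_GF57: "Ring.field (GF 3 57)" using GF_exists[of 57] by simp

interpretation GF57: cring "GF 3 57"
  using field_GF57 unfolding Ring.field_def domain_def by blast

text \<open>The point of degree 57 is found in a type-class field. Taking the carrier of the chosen
  record \<open>GF 3 57\<close> as that type lets the residue field be compared with the
  record.\<close>

typedef gf57 = "carrier (GF 3 57)" by (rule exI[of _ "\<zero>\<^bsub>GF 3 57\<^esub>"]) simp

instantiation gf57 :: field
begin

definition "0 = Abs_gf57 \<zero>\<^bsub>GF 3 57\<^esub>"
definition "1 = Abs_gf57 \<one>\<^bsub>GF 3 57\<^esub>"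
definition "x + y = Abs_gf57 (Rep_gf57 x \<oplus>\<^bsub>GF 3 57\<^esub> Rep_gf57 y)"
definition "x * y = Abs_gf57 (Rep_gf57 x \<otimes>\<^bsub>GF 3 57\<^esub> Rep_gf57 y)"
definition "- x = Abs_gf57 (\<ominus>\<^bsub>GF 3 57\<^esub> Rep_gf57 x)"
definition "x - y = Abs_gf57 (Rep_gf57 x \<ominus>\<^bsub>GF 3 57\<^esub> Rep_gf57 y)"
definition "inverse x = (if x = 0 then 0 else Abs_gf57 (inv\<^bsub>GF 3 57\<^esub> Rep_gf57 x))"
definition "x div y = x * inverse (y :: gf57)"

lemma Rep_gf57_simps:
  "Rep_gf57 0 = \<zero>\<^bsub>GF 3 57\<^esub>" "Rep_gf57 1 = \<one>\<^bsub>GF 3 57\<^esub>"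
  "Rep_gf57 (x + y) = Rep_gf57 x \<oplus>\<^bsub>GF 3 57\<^esub> Rep_gf57 y" "Rep_gf57 (x * y) = Rep_gf57 x \<otimes>\<^bsub>GF 3 57\<^esub> Rep_gf57 y"
  "Rep_gf57 (- x) = \<ominus>\<^bsub>GF 3 57\<^esub> Rep_gf57 x" "Rep_gf57 (x - y) = Rep_gf57 x \<ominus>\<^bsub>GF 3 57\<^esub> Rep_gf57 y"
  unfolding zero_gf57_def one_gf57_def plus_gf57_def times_gf57_def uminus_gf57_def minus_gf57_def
  using Rep_gf57[of x] Rep_gf57[of y] by (simp_all add: Abs_gf57_inverse)

instance
proof
  fix a b c :: gf57
  note R = Rep_gf57[of a] Rep_gf57[of b] Rep_gf57[of c] and S = Rep_gf57_inject[symmetric] Rep_gf57_simps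
  show "a * b * c = a * (b * c)" unfolding S using R by (simp add: GF57.m_assoc)
  show "a * b = b * a" unfolding S using R by (simp add: GF57.m_comm)
  show "1 * a = a" unfolding S using R by simp
  show "a + b + c = a + (b + c)" unfolding S using R by (simp add: GF57.a_assoc)
  show "a + b = b + a" unfolding S using R by (simp add: GF57.a_comm)
  show "0 + a = a" unfolding S using R by simp
  show "- a + a = 0" unfolding S using R by (simp add: GF57.l_neg)
  show "a - b = a + - b" unfolding S using R by (simp add: GF57.minus_eq)
  show "(a + b) * c = a * c + b * c" unfolding S using R by (simp add: GF57.l_distr)
  show "(0::gf57) \<noteq> 1" unfolding S using domain.zero_not_one[OF Ring.field.axioms(1)[OF field_GF57]] .
  show "a div b = a * inverse b" by (simp add: divide_gf57_def)
  show "inverse (0::gf57) = 0" by (simp add: inverse_gf57_def)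
  assume "a \<noteq> 0"
  then have "Rep_gf57 a \<noteq> \<zero>\<^bsub>GF 3 57\<^esub>" unfolding S .
  then have u: "Rep_gf57 a \<in> Units (GF 3 57)" using R Ring.field.field_Units[OF field_GF57] by simp
  then have "Rep_gf57 (inverse a) = inv\<^bsub>GF 3 57\<^esub> Rep_gf57 a"
    using \<open>a \<noteq> 0\<close> by (simp add: inverse_gf57_def Abs_gf57_inverse)
  then show "inverse a * a = 1" unfolding S using u by simp
qed

end

lemma card_gf57: "finite (UNIV :: gf57 set)" "card (UNIV :: gf57 set) = 3 ^ 57"
proof -
  have c: "card (carrier (GF 3 57)) = 3 ^ 57" using GF_exists[of 57] by simp
  then show "card (UNIV :: gf57 set) = 3 ^ 57" using card_image[of Rep_gf57 UNIV] type_definition.Rep_range[OF type_definition_gf57] by (simp add: inj_on_def Rep_gf57_inject)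
  then show "finite (UNIV :: gf57 set)" using card.infinite by fastforce
qed

instance gf57 :: finite_field
  by (intro finite_fieldI) (rule card_gf57)

lemma three_gf57: "(3::gf57) = 0"
proof -
  have "\<one>\<^bsub>GF 3 57\<^esub> \<oplus>\<^bsub>GF 3 57\<^esub> \<one>\<^bsub>GF 3 57\<^esub> \<oplus>\<^bsub>GF 3 57\<^esub> \<one>\<^bsub>GF 3 57\<^esub> = \<zero>\<^bsub>GF 3 57\<^esub>"
    by (rule field.char_three[OF field_GF57, of 57]) (use GF_exists[of 57] in simp)
  then have "(1::gf57) + 1 + 1 = 0" unfolding Rep_gf57_inject[symmetric] Rep_gf57_simps .
  then show ?thesis by simp
qed

section \<open>Transport of algorithms\<close>

text \<open>Scalars move along \<open>\<kappa>\<close> and the algebra along the semilinear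
  isomorphism \<open>\<theta>\<close>: forms are pulled back by its inverse and elements pushed
  forward. That \<open>\<kappa>\<close> covers \<open>k'\<close> gives homogeneity over all of
  \<open>k'\<close>.\<close>

lemma algorithm_transport:
  assumes A: "cring A" and B: "cring B" and \<theta>: "\<theta> \<in> ring_iso A B"
    and \<kappa>: "\<kappa> \<in> ring_hom k k'" "carrier k' \<subseteq> \<kappa> ` carrier k"
    and smult: "\<And>c x. c \<in> carrier k \<Longrightarrow> x \<in> carrier A \<Longrightarrow> c \<odot>\<^bsub>A\<^esub> x \<in> carrier A \<and> \<theta> (c \<odot>\<^bsub>A\<^esub> x) = \<kappa> c \<odot>\<^bsub>B\<^esub> \<theta> x"
    and k: "cring k" and alg: "sym_mult_algorithm k A I \<phi> w"
  shows "sym_mult_algorithm k' B I (\<lambda>i y. \<kappa> (\<phi> i (inv_into (carrier A) \<theta> y))) (\<lambda>i. \<theta> (w i))"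
proof -
  interpret A: cring A by (rule A)
  interpret B: cring B by (rule B)
  interpret k: cring k by (rule k)
  let ?t = "inv_into (carrier A) \<theta>"
  have bij: "bij_betw \<theta> (carrier A) (carrier B)" and hom: "\<theta> \<in> ring_hom A B" using \<theta> by (simp_all add: ring_iso_def)
  interpret H: ring_hom_cring A B \<theta> by unfold_locales (rule hom)
  have t: "?t y \<in> carrier A" "\<theta> (?t y) = y" if "y \<in> carrier B" for y
    using that bij by (metis bij_betw_def inv_into_into) (metis that bij bij_betw_inv_into_right)
  have tt: "?t (\<theta> x) = x" if "x \<in> carrier A" for x using that bij by (metis bij_betw_inv_into_left)
  have tadd: "?t (y \<oplus>\<^bsub>B\<^esub> z) = ?t y \<oplus>\<^bsub>A\<^esub> ?t z" if "y \<in> carrier B" "z \<in> carrier B" for y z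
    using tt[of "?t y \<oplus>\<^bsub>A\<^esub> ?t z"] t[OF that(1)] t[OF that(2)] by simp
  have fin: "finite I" and form: "\<And>i. i \<in> I \<Longrightarrow> linear_map k A (algebra_via k (\<lambda>c. c)) (\<phi> i)" "\<And>i. i \<in> I \<Longrightarrow> w i \<in> carrier A"
    and eq: "\<And>x y. x \<in> carrier A \<Longrightarrow> y \<in> carrier A \<Longrightarrow> x \<otimes>\<^bsub>A\<^esub> y = (\<Oplus>\<^bsub>A\<^esub>i\<in>I. (\<phi> i x \<otimes>\<^bsub>k\<^esub> \<phi> i y) \<odot>\<^bsub>A\<^esub> w i)"
    using alg unfolding sym_mult_algorithm_def by blast+
  have \<phi>: "\<phi> i x \<in> carrier k" "\<phi> i (x \<oplus>\<^bsub>A\<^esub> y) = \<phi> i x \<oplus>\<^bsub>k\<^esub> \<phi> i y"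
    "c \<in> carrier k \<Longrightarrow> \<phi> i (c \<odot>\<^bsub>A\<^esub> x) = c \<otimes>\<^bsub>k\<^esub> \<phi> i x"
    if "i \<in> I" "x \<in> carrier A" "y \<in> carrier A" for i x y c
    using form(1)[OF that(1)] that(2,3) unfolding linear_map_def by (auto simp: algebra_via_def)
  show ?thesis
    unfolding sym_mult_algorithm_def
  proof (intro conjI ballI)
    show "finite I" by (rule fin)
  next
    fix i assume i: "i \<in> I"
    show "\<theta> (w i) \<in> carrier B" using form(2)[OF i] by simp
    show "linear_map k' B (algebra_via k' (\<lambda>c. c)) (\<lambda>y. \<kappa> (\<phi> i (?t y)))"
      unfolding linear_map_def
    proof (intro conjI ballI funcsetI)
      fix y assume y: "y \<in> carrier B"
      show "\<kappa> (\<phi> i (?t y)) \<in> carrier (algebra_via k' (\<lambda>c. c))"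
        using ring_hom_closed[OF \<kappa>(1) \<phi>(1)[OF i t(1)[OF y] t(1)[OF y]]] by (simp add: algebra_via_def)
      show "\<kappa> (\<phi> i (?t (y \<oplus>\<^bsub>B\<^esub> z))) = \<kappa> (\<phi> i (?t y)) \<oplus>\<^bsub>algebra_via k' (\<lambda>c. c)\<^esub> \<kappa> (\<phi> i (?t z))" if z: "z \<in> carrier B" for z
        unfolding tadd[OF y z] \<phi>(2)[OF i t(1)[OF y] t(1)[OF z]]
        using ring_hom_add[OF \<kappa>(1) \<phi>(1)[OF i t(1)[OF y] t(1)[OF y]] \<phi>(1)[OF i t(1)[OF z] t(1)[OF z]]]
        by (simp add: algebra_via_def)
    next
      fix c' y assume c': "c' \<in> carrier k'" and y: "y \<in> carrier B"
      obtain c where c: "c \<in> carrier k" "c' = \<kappa> c" using c' \<kappa>(2) by blast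
      have "?t (c' \<odot>\<^bsub>B\<^esub> y) = c \<odot>\<^bsub>A\<^esub> ?t y"
        using tt[of "c \<odot>\<^bsub>A\<^esub> ?t y"] smult[OF c(1) t(1)[OF y]] t(2)[OF y] c(2) by simp
      then show "\<kappa> (\<phi> i (?t (c' \<odot>\<^bsub>B\<^esub> y))) = c' \<odot>\<^bsub>algebra_via k' (\<lambda>c. c)\<^esub> \<kappa> (\<phi> i (?t y))"
        using \<phi>(3)[OF i t(1)[OF y] t(1)[OF y] c(1)] ring_hom_mult[OF \<kappa>(1) c(1) \<phi>(1)[OF i t(1)[OF y] t(1)[OF y]]] c(2)
        by (simp add: algebra_via_def)
    qed
  next
    fix x y assume xy: "x \<in> carrier B" "y \<in> carrier B"
    note tx = t[OF xy(1)] and ty = t[OF xy(2)]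
    have cl: "\<phi> i (?t x) \<otimes>\<^bsub>k\<^esub> \<phi> i (?t y) \<in> carrier k" if "i \<in> I" for i
      using \<phi>(1)[OF that tx(1) tx(1)] \<phi>(1)[OF that ty(1) ty(1)] by simp
    have "x \<otimes>\<^bsub>B\<^esub> y = \<theta> (?t x \<otimes>\<^bsub>A\<^esub> ?t y)" using tx ty by simp
    also have "\<dots> = (\<Oplus>\<^bsub>B\<^esub>i\<in>I. \<theta> ((\<phi> i (?t x) \<otimes>\<^bsub>k\<^esub> \<phi> i (?t y)) \<odot>\<^bsub>A\<^esub> w i))"
      unfolding eq[OF tx(1) ty(1)] using smult[OF cl form(2)] by (subst H.hom_finsum) (auto simp: comp_def)
    also have "\<dots> = (\<Oplus>\<^bsub>B\<^esub>i\<in>I. (\<kappa> (\<phi> i (?t x)) \<otimes>\<^bsub>k'\<^esub> \<kappa> (\<phi> i (?t y))) \<odot>\<^bsub>B\<^esub> \<theta> (w i))"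
    proof (rule B.finsum_cong')
      have e: "(\<kappa> (\<phi> i (?t x)) \<otimes>\<^bsub>k'\<^esub> \<kappa> (\<phi> i (?t y))) \<odot>\<^bsub>B\<^esub> \<theta> (w i) = \<theta> ((\<phi> i (?t x) \<otimes>\<^bsub>k\<^esub> \<phi> i (?t y)) \<odot>\<^bsub>A\<^esub> w i)"
        if i: "i \<in> I" for i
        using smult[OF cl[OF i] form(2)[OF i]] ring_hom_mult[OF \<kappa>(1) \<phi>(1)[OF i tx(1) tx(1)] \<phi>(1)[OF i ty(1) ty(1)]] by simp
      then show "\<theta> ((\<phi> i (?t x) \<otimes>\<^bsub>k\<^esub> \<phi> i (?t y)) \<odot>\<^bsub>A\<^esub> w i) = (\<kappa> (\<phi> i (?t x)) \<otimes>\<^bsub>k'\<^esub> \<kappa> (\<phi> i (?t y))) \<odot>\<^bsub>B\<^esub> \<theta> (w i)"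
        if "i \<in> I" for i using that by simp
      show "(\<lambda>i. (\<kappa> (\<phi> i (?t x)) \<otimes>\<^bsub>k'\<^esub> \<kappa> (\<phi> i (?t y))) \<odot>\<^bsub>B\<^esub> \<theta> (w i)) \<in> I \<rightarrow> carrier B"
      proof (rule Pi_I)
        fix i assume i: "i \<in> I"
        show "(\<kappa> (\<phi> i (?t x)) \<otimes>\<^bsub>k'\<^esub> \<kappa> (\<phi> i (?t y))) \<odot>\<^bsub>B\<^esub> \<theta> (w i) \<in> carrier B"
          unfolding e[OF i] by (rule H.hom_closed) (use smult[OF cl[OF i] form(2)[OF i]] in blast)
      qed
    qed simp
    finally show "x \<otimes>\<^bsub>B\<^esub> y = (\<Oplus>\<^bsub>B\<^esub>i\<in>I. (\<kappa> (\<phi> i (?t x)) \<otimes>\<^bsub>k'\<^esub> \<kappa> (\<phi> i (?t y))) \<odot>\<^bsub>B\<^esub> \<theta> (w i))" .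
  qed
qed

text \<open>\<open>chudnovsky_algorithm\<close> is indexed by pairs of a point and a number, whereas
  the length is counted on an initial segment of the naturals.\<close>

lemma algorithm_reindex:
  assumes A: "cring A" and clo: "\<And>i. i \<in> I \<Longrightarrow> (\<And>x y. x \<in> carrier A \<Longrightarrow> y \<in> carrier A \<Longrightarrow> (\<phi> i x \<otimes>\<^bsub>k\<^esub> \<phi> i y) \<odot>\<^bsub>A\<^esub> w i \<in> carrier A)"
    and alg: "sym_mult_algorithm k A I \<phi> w"
  shows "\<exists>\<phi>' w'. sym_mult_algorithm k A {..<card I} \<phi>' w'"
proof -
  interpret A: cring A by (rule A)
  have fin: "finite I" using alg by (simp add: sym_mult_algorithm_def)
  obtain b where b: "bij_betw b {..<card I} I" using ex_bij_betw_nat_finite[OF fin] by (auto simp: atLeast0LessThan)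
  have bI: "b j \<in> I" if "j < card I" for j using b that by (auto simp: bij_betw_def)
  have "sym_mult_algorithm k A {..<card I} (\<phi> \<circ> b) (w \<circ> b)"
    unfolding sym_mult_algorithm_def
  proof (intro conjI ballI)
    fix j assume "j \<in> {..<card I}"
    then have "b j \<in> I" using bI by simp
    then show "linear_map k A (algebra_via k (\<lambda>c. c)) ((\<phi> \<circ> b) j)" "(w \<circ> b) j \<in> carrier A"
      using alg by (simp_all add: sym_mult_algorithm_def)
  next
    fix x y assume xy: "x \<in> carrier A" "y \<in> carrier A"
    have "x \<otimes>\<^bsub>A\<^esub> y = (\<Oplus>\<^bsub>A\<^esub>i\<in>b ` {..<card I}. (\<phi> i x \<otimes>\<^bsub>k\<^esub> \<phi> i y) \<odot>\<^bsub>A\<^esub> w i)"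
      using alg xy b by (simp add: sym_mult_algorithm_def bij_betw_def)
    also have "\<dots> = (\<Oplus>\<^bsub>A\<^esub>j\<in>{..<card I}. ((\<phi> \<circ> b) j x \<otimes>\<^bsub>k\<^esub> (\<phi> \<circ> b) j y) \<odot>\<^bsub>A\<^esub> (w \<circ> b) j)"
      using clo xy b bI by (subst A.finsum_reindex) (auto simp: bij_betw_def)
    finally show "x \<otimes>\<^bsub>A\<^esub> y = (\<Oplus>\<^bsub>A\<^esub>j\<in>{..<card I}. ((\<phi> \<circ> b) j x \<otimes>\<^bsub>k\<^esub> (\<phi> \<circ> b) j y) \<odot>\<^bsub>A\<^esub> (w \<circ> b) j)" .
  qed simp
  then show ?thesis by blast
qed

context degree_57_point
begin

text \<open>Evaluation at x and reduction at \<open>Q\<close> have the same kernel on F_3[x], the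
  multiples of \<open>\<pi>\<close>. The resulting embedding is onto because both fields have 3^57
  elements.\<close>

lemma residue_field_iso:
  assumes kernel: "\<And>q. ev (x :: gf57) q = 0 \<longleftrightarrow> \<pi> dvd q" and sur: "\<And>z. \<exists>q. ev x q = z"
  shows "LA QQ 1 \<simeq> GF 3 57"
proof -
  note ev_hom = ev_hom[OF card_gf57(2) three_gf57]
  \<comment> \<open>A polynomial with the prescribed value at x; any two choices have the same class
    at \<open>Q\<close>.\<close>
  define rep where "rep r = (SOME q. ev x q = Abs_gf57 r)" for r
  have rep: "ev x (rep r) = Abs_gf57 r" for r unfolding rep_def using sur by (rule someI_ex)
  define \<Psi> where "\<Psi> r = Cls QQ 1 (to_fract (pol (rep r)))" for r
  have in_Q: "to_fract (pol q) \<in> QQ" for q by (rule to_fract_in_loc[OF Qp_prime[OF \<pi> g]])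
  have eq_iff: "Cls QQ 1 (to_fract (pol q)) = Cls QQ 1 (to_fract (pol q')) \<longleftrightarrow> ev x q = ev x q'" for q q'
  proof -
    have "to_fract (pol q) - to_fract (pol q') = to_fract (pol (q - q'))" by simp
    then have "Cls QQ 1 (to_fract (pol q)) = Cls QQ 1 (to_fract (pol q')) \<longleftrightarrow> to_fract (pol (q - q')) \<in> mpow QQ 1"
      unfolding Cls_eq_iff[OF dvr_Q] by simp
    also have "\<dots> \<longleftrightarrow> pol (q - q') \<in> Qp \<pi> g" by (rule mem_iff_mpow[OF Qp_prime[OF \<pi> g], symmetric])
    also have "\<dots> \<longleftrightarrow> ev x (q - q') = 0" unfolding kernel Qp_def[OF \<pi> g] split_prime_pol ..
    finally show ?thesis by (simp add: ev_hom)
  qed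
  have Abs: "Abs_gf57 r = z \<longleftrightarrow> r = Rep_gf57 z" if "r \<in> carrier (GF 3 57)" for r z
    using that by (metis Abs_gf57_inverse Rep_gf57_inverse)
  have "\<Psi> \<in> ring_iso (GF 3 57) (LA QQ 1)"
  proof (rule ring_iso_memI)
    fix r assume r: "r \<in> carrier (GF 3 57)"
    show "\<Psi> r \<in> carrier (LA QQ 1)" unfolding \<Psi>_def by (rule Cls_closed[OF dvr_Q in_Q])
    fix s assume s: "s \<in> carrier (GF 3 57)"
    have "\<Psi> r \<otimes>\<^bsub>LA QQ 1\<^esub> \<Psi> s = Cls QQ 1 (to_fract (pol (rep r * rep s)))"
      unfolding \<Psi>_def Cls_mult[OF dvr_Q in_Q in_Q] by simp
    also have "\<dots> = \<Psi> (r \<otimes>\<^bsub>GF 3 57\<^esub> s)"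
      unfolding \<Psi>_def eq_iff ev_hom rep using r s by (simp add: times_gf57_def Abs_gf57_inverse)
    finally show "\<Psi> (r \<otimes>\<^bsub>GF 3 57\<^esub> s) = \<Psi> r \<otimes>\<^bsub>LA QQ 1\<^esub> \<Psi> s" ..
    have "\<Psi> r \<oplus>\<^bsub>LA QQ 1\<^esub> \<Psi> s = Cls QQ 1 (to_fract (pol (rep r + rep s)))"
      unfolding \<Psi>_def Cls_add[OF dvr_Q in_Q in_Q] by simp
    also have "\<dots> = \<Psi> (r \<oplus>\<^bsub>GF 3 57\<^esub> s)"
      unfolding \<Psi>_def eq_iff ev_hom rep using r s by (simp add: plus_gf57_def Abs_gf57_inverse)
    finally show "\<Psi> (r \<oplus>\<^bsub>GF 3 57\<^esub> s) = \<Psi> r \<oplus>\<^bsub>LA QQ 1\<^esub> \<Psi> s" ..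
  next
    have "Cls QQ 1 (to_fract (pol 1)) = \<Psi> \<one>\<^bsub>GF 3 57\<^esub>"
      unfolding \<Psi>_def eq_iff ev_hom rep by (simp add: one_gf57_def)
    then show "\<Psi> \<one>\<^bsub>GF 3 57\<^esub> = \<one>\<^bsub>LA QQ 1\<^esub>" unfolding Cls_one[OF dvr_Q] by simp
  next
    have inj: "inj_on \<Psi> (carrier (GF 3 57))"
    proof (rule inj_onI)
      fix r s assume rs: "r \<in> carrier (GF 3 57)" "s \<in> carrier (GF 3 57)" "\<Psi> r = \<Psi> s"
      then have "Abs_gf57 r = Abs_gf57 s" unfolding \<Psi>_def eq_iff rep by simp
      then show "r = s" using Abs_gf57_inject rs by blast
    qed
    have card: "card (carrier (LA QQ 1)) = 3 ^ 57" "finite (carrier (LA QQ 1))"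
      using card_LA[of "pt QQ" 1] dvr_Q rcard_Q by simp_all
    have "\<Psi> ` carrier (GF 3 57) = carrier (LA QQ 1)"
    proof (rule card_subset_eq[OF card(2)])
      show "\<Psi> ` carrier (GF 3 57) \<subseteq> carrier (LA QQ 1)" unfolding \<Psi>_def using Cls_closed[OF dvr_Q in_Q] by blast
      show "card (\<Psi> ` carrier (GF 3 57)) = card (carrier (LA QQ 1))"
        unfolding card_image[OF inj] card(1) using GF_exists[of 57] by simp
    qed
    then show "bij_betw \<Psi> (carrier (GF 3 57)) (carrier (LA QQ 1))" using inj by (simp add: bij_betw_def)
  qed
  then have "GF 3 57 \<simeq> LA QQ 1" unfolding is_ring_iso_def by blast
  then show ?thesis by (rule ring_iso_sym[OF GF57.ring_axioms])
qed

text \<open>The constants satisfy c^3 = c, so their images lie in the fixed field of cubing; being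
  three in number, they fill \<open>base_field 3 57\<close>.\<close>

lemma GF_algorithm:
  assumes iso: "LA QQ 1 \<simeq> GF 3 57" and alg: "sym_mult_algorithm kk (LA QQ 1) I \<phi> w"
  shows "\<exists>\<phi>' w'. sym_mult_algorithm (base_field 3 57) (GF_algebra 3 57) {..<card I} \<phi>' w'"
proof -
  let ?B = "GF_algebra 3 57"
  obtain \<theta> where \<theta>: "\<theta> \<in> ring_iso (LA QQ 1) (GF 3 57)" using iso unfolding is_ring_iso_def by blast
  then have th: "\<theta> \<in> ring_hom (LA QQ 1) (GF 3 57)" "bij_betw \<theta> (carrier (LA QQ 1)) (carrier (GF 3 57))" by (simp_all add: ring_iso_def)
  have B: "cring ?B" unfolding GF_algebra_def by (rule cring_algebra_via[OF GF57.cring_axioms])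
  have ops: "carrier ?B = carrier (GF 3 57)" "monoid.mult ?B = monoid.mult (GF 3 57)" "add ?B = add (GF 3 57)"
    "\<one>\<^bsub>?B\<^esub> = \<one>\<^bsub>GF 3 57\<^esub>" "c \<odot>\<^bsub>?B\<^esub> x = c \<otimes>\<^bsub>GF 3 57\<^esub> x" for c x by (simp_all add: GF_algebra_def algebra_via_def)
  have \<theta>B: "\<theta> \<in> ring_iso (LA QQ 1) ?B" using \<theta> by (simp add: ring_iso_def ring_hom_def ops)
  have KQ: "c \<in> KK \<Longrightarrow> c \<in> pt QQ" for c using KK_mem[OF dvr_Q] by (simp add: mem_pt)
  define \<kappa> where "\<kappa> c = \<theta> (cls (pt QQ) 1 c)" for c
  have Q: "pt QQ \<in> closed_points KK FF" using dvr_Q by simp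
  have \<kappa>hom: "\<kappa> \<in> ring_hom kk (GF 3 57)"
    using ring_hom_trans[OF hom_KK_LA[OF Q] th(1)] by (simp add: \<kappa>_def[abs_def] comp_def)
  interpret kf: Ring.field kk by (rule field_KK)
  interpret \<kappa>h: ring_hom_ring kk "GF 3 57" \<kappa> by (rule ring_hom_ringI2[OF kf.ring_axioms GF57.ring_axioms \<kappa>hom])
  have \<kappa>fix: "\<kappa> c \<in> carrier (base_field 3 57)" if c: "c \<in> KK" for c
  proof -
    obtain d where d: "fr c = to_fract (pol [:d:])" using c mem_KK_iff by blast
    have "d * d * d = d" by (cases d rule: f3_cases) simp_all
    then have "c \<otimes>\<^bsub>FF\<^esub> c \<otimes>\<^bsub>FF\<^esub> c = c" by (intro FF_eqI) (simp add: d const_pol_simps)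
    then have "\<kappa> c \<otimes>\<^bsub>GF 3 57\<^esub> \<kappa> c \<otimes>\<^bsub>GF 3 57\<^esub> \<kappa> c = \<kappa> c"
      using c \<kappa>h.hom_mult[of c c] \<kappa>h.hom_mult[of "c \<otimes>\<^bsub>FF\<^esub> c" c] kf.m_closed[of c c] by simp
    moreover have "\<kappa> c \<in> carrier (GF 3 57)" using c \<kappa>h.hom_closed by simp
    ultimately have "\<kappa> c [^]\<^bsub>GF 3 57\<^esub> Suc (Suc (Suc 0)) = \<kappa> c" by simp
    then show ?thesis using \<open>\<kappa> c \<in> carrier (GF 3 57)\<close> by (simp only: base_field_def numeral_3_eq_3) simp
  qed
  have n57: "(57::nat) \<ge> 1" by simp
  note bf = base_field_facts[OF n57 order_refl[of 1]]
  have bops: "monoid.mult (base_field 3 57) = monoid.mult (GF 3 57)" "add (base_field 3 57) = add (GF 3 57)"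
    "\<one>\<^bsub>base_field 3 57\<^esub> = \<one>\<^bsub>GF 3 57\<^esub>" by (simp_all add: base_field_def)
  have \<kappa>: "\<kappa> \<in> ring_hom kk (base_field 3 57)"
    using \<kappa>fix \<kappa>h.hom_mult \<kappa>h.hom_add \<kappa>h.hom_one by (intro ring_hom_memI) (simp_all add: bops)
  have sur: "carrier (base_field 3 57) \<subseteq> \<kappa> ` carrier kk"
  proof -
    have "inj_on \<kappa> KK" using \<kappa>h.img_is_subfield(1)[OF kf.carrier_is_subfield] domain.one_not_zero[OF Ring.field.axioms(1)[OF field_GF57]] by simp
    then have "card (\<kappa> ` KK) = 3" by (simp add: card_image card_KK)
    moreover have "\<kappa> ` KK \<subseteq> carrier (base_field 3 57)" using \<kappa>fix by blast
    moreover have "finite (carrier (base_field 3 57))" using bf(3) card.infinite by fastforce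
    ultimately have "\<kappa> ` KK = carrier (base_field 3 57)" using bf(3) by (intro card_subset_eq) simp_all
    then show ?thesis by simp
  qed
  have smult: "c \<odot>\<^bsub>LA QQ 1\<^esub> x \<in> carrier (LA QQ 1) \<and> \<theta> (c \<odot>\<^bsub>LA QQ 1\<^esub> x) = \<kappa> c \<odot>\<^bsub>?B\<^esub> \<theta> x"
    if c: "c \<in> carrier kk" and x: "x \<in> carrier (LA QQ 1)" for c x
  proof -
    interpret R: cring "LA QQ 1" by (rule cring_LA[OF Q])
    have cc: "cls (pt QQ) 1 c \<in> carrier (LA QQ 1)" by (rule cls_in_LA[OF Q KQ]) (use c in simp)
    show ?thesis unfolding smult_LA[OF Q] ops \<kappa>_def using R.m_closed[OF cc x] ring_hom_mult[OF th(1) cc x] by blast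
  qed
  note alg' = algorithm_transport[OF cring_LA[OF Q] B \<theta>B \<kappa> sur smult kf.cring_axioms alg]
  show ?thesis
  proof (rule algorithm_reindex[OF B _ alg'])
    fix i x y assume i: "i \<in> I" and xy: "x \<in> carrier ?B" "y \<in> carrier ?B"
    have "linear_map (base_field 3 57) ?B (algebra_via (base_field 3 57) (\<lambda>c. c)) (\<lambda>y. \<kappa> (\<phi> i (inv_into (carrier (LA QQ 1)) \<theta> y)))"
      and w: "\<theta> (w i) \<in> carrier ?B"
      using alg' i unfolding sym_mult_algorithm_def by blast+
    then have "\<kappa> (\<phi> i (inv_into (carrier (LA QQ 1)) \<theta> z)) \<in> carrier (GF 3 57)" if "z \<in> carrier ?B" for z
      using that bf(4) unfolding linear_map_def by (auto simp: algebra_via_def)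
    then show "(\<kappa> (\<phi> i (inv_into (carrier (LA QQ 1)) \<theta> x)) \<otimes>\<^bsub>base_field 3 57\<^esub> \<kappa> (\<phi> i (inv_into (carrier (LA QQ 1)) \<theta> y))) \<odot>\<^bsub>?B\<^esub> \<theta> (w i) \<in> carrier ?B"
      using xy w by (simp add: ops bops)
  qed
qed

end

theorem mainTheorem5:
  "mu_sym_genus 3 1 57 \<le> 234
    \<and> (\<exists>(F :: nat ring) K Q D G m \<phi> w.
          curve K F \<and> card K = 3 \<and> has_genus K F 1 \<and>
          sym_chudnovsky_data K F 57 1 Q D G \<and>
          local_algebra F Q 1 \<simeq> GF 3 57 \<and>
          chudnovsky_algorithm K F 1 Q D G m \<phi> w \<and>
          (\<Sum>P\<in>supp G. m P) \<le> 234)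
    \<and> (\<exists>m\<le>(234::nat). \<exists>\<phi> w. sym_mult_algorithm (base_field 3 57) (GF_algebra 3 57) {..<m} \<phi> w)"
proof -
  obtain \<pi> g and x :: gf57 where \<pi>: "irreducible \<pi>" "degree \<pi> = 57" and g: "\<pi> dvd g * g - cubic"
    and kernel: "\<And>q. ev x q = 0 \<longleftrightarrow> \<pi> dvd q" and sur: "\<And>z. \<exists>q. ev x q = z"
    by (rule exists_degree_57_point[OF card_gf57(2) three_gf57]) blast
  obtain e where "sgn3 e" "sections_at_Q \<pi> g e = {0}" using exists_good_sign[OF \<pi> g] by blast
  then interpret degree_57_point \<pi> g e using \<pi> g by unfold_locales
  have iso: "LA QQ 1 \<simeq> GF 3 57" by (rule residue_field_iso[OF kernel sur])
  obtain \<phi> w where alg: "chudnovsky_algorithm KK FF 1 (pt QQ) DD GG (\<lambda>N. cost (fr ` N)) \<phi> w"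
    using exists_chudnovsky_algorithm by blast
  let ?I = "SIGMA N:supp GG. {..<cost (fr ` N)}"
  have "sym_mult_algorithm kk (LA QQ 1) ?I \<phi> w" using alg unfolding chudnovsky_algorithm_def by blast
  then have "\<exists>\<phi> w. sym_mult_algorithm (base_field 3 57) (GF_algebra 3 57) {..<card ?I} \<phi> w" by (rule GF_algorithm[OF iso])
  moreover have "card ?I \<le> 234"
  proof -
    have "finite (supp GG)" using GG_divisor by (simp add: divisors_def)
    then show ?thesis using sum_cost_nat by simp
  qed
  moreover have "mu_sym_genus 3 1 57 \<le> 234"
  proof -
    have "mu_sym_genus 3 1 57 \<le> mu_sym_curve KK FF 57"
      unfolding mu_sym_genus_def using curve_FF card_KK genus_one by (intro Inf_lower) blast
    also have "\<dots> \<le> data_length KK FF GG"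
      unfolding mu_sym_curve_def using chudnovsky_data by (intro Inf_lower) blast
    also have "\<dots> \<le> 234" by (rule data_length_le)
    finally show ?thesis .
  qed
  ultimately show ?thesis
    using curve_FF card_KK genus_one chudnovsky_data iso alg sum_cost_nat by blast
qed

end
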